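(* For every $X\in\mathrm{Ind}\text{-}(\mathrm{Vect}^{\mathrm{op}})$, the functor $X\mathbin{\hat\otimes}-:\mathrm{Ind}\text{-}(\mathrm{Vect}^{\mathrm{op}})\to\mathrm{Ind}\text{-}(\mathrm{Vect}^{\mathrm{op}})$ has a right adjoint $\mathrm{Hom}(X,-)$, computed as $$\mathrm{Hom}(X,Y)(V)\cong\mathrm{Ind}\text{-}(\mathrm{Vect}^{\mathrm{op}})(X\mathbin{\hat\otimes}\mathbb{Y}V,Y)\cong\varprojlim_{x\in(\mathbb{Y}\downarrow X)^{\mathrm{op}}}\ \varinjlim_{y\in(\mathbb{Y}\downarrow Y)}\mathrm{Vect}(Py,Px\otimes V)\cong$$ $$\cong\int_{H}\mathrm{Vect}\big(X(H),Y(H\otimes V)\big)\cong\int_{H_0}\mathrm{Vect}\Big(X(H_0),\int^{H_1}Y(H_1)\otimes\mathrm{Vect}(H_1,H_0\otimes V)\Big).$$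
   Context: Fix a field $\mathbf{k}$ and a (non-trivial) Grothendieck universe; sets in it are small. $\mathrm{Vect}$ is the category of small $\mathbf{k}$-vector spaces, $[\mathrm{Vect},\mathrm{Vect}]$ the category of $\mathbf{k}$-additive functors (acting $\mathbf{k}$-linearly on hom-spaces) and natural transformations, $\mathbb{Y}:\mathrm{Vect}^{\mathrm{op}}\to[\mathrm{Vect},\mathrm{Vect}]$, $\mathbb{Y}V:=\mathrm{Vect}(V,-)$. $\mathrm{Ind}\text{-}(\mathrm{Vect}^{\mathrm{op}})$ is the full subcategory of $[\mathrm{Vect},\mathrm{Vect}]$ on the small functors, i.e. those isomorphic to a colimit, over a small directed poset, of representables. For $X\in\mathrm{Ind}\text{-}(\mathrm{Vect}^{\mathrm{op}})$, $(\mathbb{Y}\downarrow X)$ is the category of pairs $(V,x:\mathbb{Y}V\to X)$ and $P:(\mathbb{Y}\downarrow X)\to\mathrm{Vect}^{\mathrm{op}}$, $(V,x)\mapsto V$, is the projection (similarly for $Y$). Ends $\int_H$ and coends $\int^H$ are over $H\in\mathrm{Vect}$ (in the $\mathbf{k}$-linear sense). The tensor product $\hat\otimes$ on $\mathrm{Ind}\text{-}(\mathrm{Vect}^{\mathrm{op}})$ is the functor induced by $\otimes_{\mathbf{k}}$ on $\mathrm{Vect}^{\mathrm{op}}$: $(X\hat\otimes Y)(V)\cong\int^{H_0}\int^{H_1}X(H_0)\otimes Y(H_1)\otimes\mathrm{Vect}(H_0\otimes H_1,V)$; equivalently, if $X\cong\varinjlim_{d}\mathbb{Y}(Fd)$ and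 $Y\cong\varinjlim_b\mathbb{Y}(Gb)$ are small directed colimits of representables, then $X\hat\otimes Y\cong\varinjlim_{d,b}\mathbb{Y}(Fd\otimes Gb)$. *)

theory Defs
  imports "HOL-Algebra.Module" "HOL-Library.FuncSet"
begin

section \<open>Categories, limits and ends\<close>

record ('o, 'm) category =
  Ob :: "'o set"
  Ar :: "'m set"
  Dom :: "'m \<Rightarrow> 'o"
  Cod :: "'m \<Rightarrow> 'o"
  Idn :: "'o \<Rightarrow> 'm"
  Cmp :: "'m \<Rightarrow> 'm \<Rightarrow> 'm"  \<comment> \<open>\<open>Cmp C g f\<close> is \<open>g\<close> after \<open>f\<close>\<close>

record ('o, 'm, 'p, 'n) cfunctor =
  Fo :: "'o \<Rightarrow> 'p"
  Fa :: "'m \<Rightarrow> 'n"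

text \<open>Arrows given by a source, a target and some underlying data.\<close>

record ('o, 'f) arrow =
  src :: 'o
  tgt :: 'o
  fn :: 'f

definition Mor :: "('o, 'm) category \<Rightarrow> 'o \<Rightarrow> 'o \<Rightarrow> 'm set" where
  "Mor C a b = {f \<in> Ar C. Dom C f = a \<and> Cod C f = b}"

definition op_cat :: "('o, 'm) category \<Rightarrow> ('o, 'm) category" where
  "op_cat C = \<lparr>Ob = Ob C, Ar = Ar C, Dom = Cod C, Cod = Dom C, Idn = Idn C,
     Cmp = (\<lambda>g f. Cmp C f g)\<rparr>"

definition prod_cat ::
    "('o, 'm) category \<Rightarrow> ('p, 'n) category \<Rightarrow> ('o \<times> 'p, 'm \<times> 'n) category" where
  "prod_cat C D = \<lparr>Ob = Ob C \<times> Ob D, Ar = Ar C \<times> Ar D,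
     Dom = map_prod (Dom C) (Dom D), Cod = map_prod (Cod C) (Cod D),
     Idn = map_prod (Idn C) (Idn D),
     Cmp = (\<lambda>(g, g') (f, f'). (Cmp C g f, Cmp D g' f'))\<rparr>"

definition full_subcat :: "('o, 'm) category \<Rightarrow> 'o set \<Rightarrow> ('o, 'm) category" where
  "full_subcat C S = C\<lparr>Ob := Ob C \<inter> S, Ar := {f \<in> Ar C. Dom C f \<in> S \<and> Cod C f \<in> S}\<rparr>"

definition poset_cat :: "'a set \<Rightarrow> ('a \<times> 'a) set \<Rightarrow> ('a, 'a \<times> 'a) category" where
  "poset_cat A r = \<lparr>Ob = A, Ar = {p \<in> r. fst p \<in> A \<and> snd p \<in> A}, Dom = fst, Cod = snd,
     Idn = (\<lambda>a. (a, a)), Cmp = (\<lambda>g f. (fst f, snd g))\<rparr>"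

definition is_functor ::
    "('o, 'm) category \<Rightarrow> ('p, 'n) category \<Rightarrow> ('o, 'm, 'p, 'n) cfunctor \<Rightarrow> bool" where
  "is_functor C D F \<longleftrightarrow>
     (\<forall>a\<in>Ob C. Fo F a \<in> Ob D \<and> Fa F (Idn C a) = Idn D (Fo F a)) \<and>
     (\<forall>f\<in>Ar C. Fa F f \<in> Mor D (Fo F (Dom C f)) (Fo F (Cod C f))) \<and>
     (\<forall>f\<in>Ar C. \<forall>g\<in>Ar C. Dom C g = Cod C f \<longrightarrow>
        Fa F (Cmp C g f) = Cmp D (Fa F g) (Fa F f))"

definition fcomp ::
    "('p, 'n, 'q, 'l) cfunctor \<Rightarrow> ('o, 'm, 'p, 'n) cfunctor \<Rightarrow> ('o, 'm, 'q, 'l) cfunctor" where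
  "fcomp G F = \<lparr>Fo = Fo G \<circ> Fo F, Fa = Fa G \<circ> Fa F\<rparr>"

definition is_nat ::
    "('o, 'm) category \<Rightarrow> ('p, 'n) category \<Rightarrow> ('o, 'm, 'p, 'n) cfunctor \<Rightarrow>
     ('o, 'm, 'p, 'n) cfunctor \<Rightarrow> ('o \<Rightarrow> 'n) \<Rightarrow> bool" where
  "is_nat C D F G t \<longleftrightarrow>
     (\<forall>a\<in>Ob C. t a \<in> Mor D (Fo F a) (Fo G a)) \<and>
     (\<forall>f\<in>Ar C. Cmp D (t (Cod C f)) (Fa F f) = Cmp D (Fa G f) (t (Dom C f)))"

definition fun_cat ::
    "('o, 'm) category \<Rightarrow> ('p, 'n) category \<Rightarrow>
     (('o, 'm, 'p, 'n) cfunctor, (('o, 'm, 'p, 'n) cfunctor, 'o \<Rightarrow> 'n) arrow) category" where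
  "fun_cat C D = \<lparr>Ob = {F. is_functor C D F},
     Ar = {t. is_functor C D (src t) \<and> is_functor C D (tgt t) \<and>
              is_nat C D (src t) (tgt t) (fn t) \<and> fn t \<in> extensional (Ob C)},
     Dom = src, Cod = tgt,
     Idn = (\<lambda>F. \<lparr>src = F, tgt = F, fn = (\<lambda>a\<in>Ob C. Idn D (Fo F a))\<rparr>),
     Cmp = (\<lambda>t s. \<lparr>src = src s, tgt = tgt t, fn = (\<lambda>a\<in>Ob C. Cmp D (fn t a) (fn s a))\<rparr>)\<rparr>"

text \<open>The comma category \<open>(F \<down> X)\<close> of a functor \<open>F : C \<rightarrow> D\<close> over an object \<open>X\<close> of \<open>D\<close>,
  and its projection to \<open>C\<close>.\<close>

definition comma_cat ::
    "('o, 'm) category \<Rightarrow> ('p, 'n) category \<Rightarrow> ('o, 'm, 'p, 'n) cfunctor \<Rightarrow> 'p \<Rightarrow>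
     ('o \<times> 'n, ('o \<times> 'n, 'm) arrow) category" where
  "comma_cat C D F X = \<lparr>Ob = {(c, x). c \<in> Ob C \<and> x \<in> Mor D (Fo F c) X},
     Ar = {u. fst (src u) \<in> Ob C \<and> snd (src u) \<in> Mor D (Fo F (fst (src u))) X \<and>
              fst (tgt u) \<in> Ob C \<and> snd (tgt u) \<in> Mor D (Fo F (fst (tgt u))) X \<and>
              fn u \<in> Mor C (fst (src u)) (fst (tgt u)) \<and>
              Cmp D (snd (tgt u)) (Fa F (fn u)) = snd (src u)},
     Dom = src, Cod = tgt,
     Idn = (\<lambda>p. \<lparr>src = p, tgt = p, fn = Idn C (fst p)\<rparr>),
     Cmp = (\<lambda>v u. \<lparr>src = src u, tgt = tgt v, fn = Cmp C (fn v) (fn u)\<rparr>)\<rparr>"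

definition comma_proj :: "('o \<times> 'n, ('o \<times> 'n, 'm) arrow, 'o, 'm) cfunctor" where
  "comma_proj = \<lparr>Fo = fst, Fa = fn\<rparr>"

definition is_cone ::
    "('j, 'i) category \<Rightarrow> ('o, 'm) category \<Rightarrow> ('j, 'i, 'o, 'm) cfunctor \<Rightarrow>
     'o \<Rightarrow> ('j \<Rightarrow> 'm) \<Rightarrow> bool" where
  "is_cone J C F L p \<longleftrightarrow> L \<in> Ob C \<and> (\<forall>j\<in>Ob J. p j \<in> Mor C L (Fo F j)) \<and>
     (\<forall>u\<in>Ar J. Cmp C (Fa F u) (p (Dom J u)) = p (Cod J u))"

definition is_limit ::
    "('j, 'i) category \<Rightarrow> ('o, 'm) category \<Rightarrow> ('j, 'i, 'o, 'm) cfunctor \<Rightarrow>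
     'o \<Rightarrow> ('j \<Rightarrow> 'm) \<Rightarrow> bool" where
  "is_limit J C F L p \<longleftrightarrow> is_cone J C F L p \<and>
     (\<forall>M q. is_cone J C F M q \<longrightarrow>
        (\<exists>!h. h \<in> Mor C M L \<and> (\<forall>j\<in>Ob J. Cmp C (p j) h = q j)))"

definition is_cocone ::
    "('j, 'i) category \<Rightarrow> ('o, 'm) category \<Rightarrow> ('j, 'i, 'o, 'm) cfunctor \<Rightarrow>
     'o \<Rightarrow> ('j \<Rightarrow> 'm) \<Rightarrow> bool" where
  "is_cocone J C F L p \<longleftrightarrow> L \<in> Ob C \<and> (\<forall>j\<in>Ob J. p j \<in> Mor C (Fo F j) L) \<and>
     (\<forall>u\<in>Ar J. Cmp C (p (Cod J u)) (Fa F u) = p (Dom J u))"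

definition is_colimit ::
    "('j, 'i) category \<Rightarrow> ('o, 'm) category \<Rightarrow> ('j, 'i, 'o, 'm) cfunctor \<Rightarrow>
     'o \<Rightarrow> ('j \<Rightarrow> 'm) \<Rightarrow> bool" where
  "is_colimit J C F L p \<longleftrightarrow> is_cocone J C F L p \<and>
     (\<forall>M q. is_cocone J C F M q \<longrightarrow>
        (\<exists>!h. h \<in> Mor C L M \<and> (\<forall>j\<in>Ob J. Cmp C h (p j) = q j)))"

text \<open>Ends and coends of \<open>T : C\<^sup>o\<^sup>p \<times> C \<rightarrow> D\<close>. For \<open>k\<close>-bilinear \<open>T\<close> with values in vector
  spaces, dinaturality is the equality of two linear maps, so the \<open>k\<close>-linear (enriched) notion is
  given by the same universal property.\<close>

definition is_wedge ::
    "('o, 'm) category \<Rightarrow> ('p, 'n) category \<Rightarrow> ('o \<times> 'o, 'm \<times> 'm, 'p, 'n) cfunctor \<Rightarrow>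
     'p \<Rightarrow> ('o \<Rightarrow> 'n) \<Rightarrow> bool" where
  "is_wedge C D T e w \<longleftrightarrow> e \<in> Ob D \<and> (\<forall>a\<in>Ob C. w a \<in> Mor D e (Fo T (a, a))) \<and>
     (\<forall>f\<in>Ar C. Cmp D (Fa T (Idn C (Dom C f), f)) (w (Dom C f)) =
                Cmp D (Fa T (f, Idn C (Cod C f))) (w (Cod C f)))"

definition is_end ::
    "('o, 'm) category \<Rightarrow> ('p, 'n) category \<Rightarrow> ('o \<times> 'o, 'm \<times> 'm, 'p, 'n) cfunctor \<Rightarrow>
     'p \<Rightarrow> ('o \<Rightarrow> 'n) \<Rightarrow> bool" where
  "is_end C D T e w \<longleftrightarrow> is_wedge C D T e w \<and>
     (\<forall>e' w'. is_wedge C D T e' w' \<longrightarrow>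
        (\<exists>!h. h \<in> Mor D e' e \<and> (\<forall>a\<in>Ob C. Cmp D (w a) h = w' a)))"

definition is_cowedge ::
    "('o, 'm) category \<Rightarrow> ('p, 'n) category \<Rightarrow> ('o \<times> 'o, 'm \<times> 'm, 'p, 'n) cfunctor \<Rightarrow>
     'p \<Rightarrow> ('o \<Rightarrow> 'n) \<Rightarrow> bool" where
  "is_cowedge C D T e w \<longleftrightarrow> e \<in> Ob D \<and> (\<forall>a\<in>Ob C. w a \<in> Mor D (Fo T (a, a)) e) \<and>
     (\<forall>f\<in>Ar C. Cmp D (w (Dom C f)) (Fa T (f, Idn C (Dom C f))) =
                Cmp D (w (Cod C f)) (Fa T (Idn C (Cod C f), f)))"

definition is_coend ::
    "('o, 'm) category \<Rightarrow> ('p, 'n) category \<Rightarrow> ('o \<times> 'o, 'm \<times> 'm, 'p, 'n) cfunctor \<Rightarrow>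
     'p \<Rightarrow> ('o \<Rightarrow> 'n) \<Rightarrow> bool" where
  "is_coend C D T e w \<longleftrightarrow> is_cowedge C D T e w \<and>
     (\<forall>e' w'. is_cowedge C D T e' w' \<longrightarrow>
        (\<exists>!h. h \<in> Mor D e e' \<and> (\<forall>a\<in>Ob C. Cmp D h (w a) = w' a)))"

text \<open>Chosen (co)limits and (co)ends, meaningful whenever they exist, and the arrows induced between
  them by a compatible family \<open>t\<close>. For colimits the index category may vary along \<open>k\<close>.\<close>

definition lim :: "('j, 'i) category \<Rightarrow> ('o, 'm) category \<Rightarrow> ('j, 'i, 'o, 'm) cfunctor \<Rightarrow>
    'o \<times> ('j \<Rightarrow> 'm)" where
  "lim J C F = (SOME (L, p). is_limit J C F L p)"

definition colim :: "('j, 'i) category \<Rightarrow> ('o, 'm) category \<Rightarrow> ('j, 'i, 'o, 'm) cfunctor \<Rightarrow>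
    'o \<times> ('j \<Rightarrow> 'm)" where
  "colim J C F = (SOME (L, p). is_colimit J C F L p)"

definition end_of :: "('o, 'm) category \<Rightarrow> ('p, 'n) category \<Rightarrow>
    ('o \<times> 'o, 'm \<times> 'm, 'p, 'n) cfunctor \<Rightarrow> 'p \<times> ('o \<Rightarrow> 'n)" where
  "end_of C D T = (SOME (e, w). is_end C D T e w)"

definition coend_of :: "('o, 'm) category \<Rightarrow> ('p, 'n) category \<Rightarrow>
    ('o \<times> 'o, 'm \<times> 'm, 'p, 'n) cfunctor \<Rightarrow> 'p \<times> ('o \<Rightarrow> 'n)" where
  "coend_of C D T = (SOME (e, w). is_coend C D T e w)"

definition lim_map ::
    "('j, 'i) category \<Rightarrow> ('o, 'm) category \<Rightarrow> ('j, 'i, 'o, 'm) cfunctor \<Rightarrow>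
     ('j, 'i, 'o, 'm) cfunctor \<Rightarrow> ('j \<Rightarrow> 'm) \<Rightarrow> 'm" where
  "lim_map J C F G t = (THE h. h \<in> Mor C (fst (lim J C F)) (fst (lim J C G)) \<and>
     (\<forall>j\<in>Ob J. Cmp C (snd (lim J C G) j) h = Cmp C (t j) (snd (lim J C F) j)))"

definition colim_map ::
    "('j, 'i) category \<Rightarrow> ('l, 'h) category \<Rightarrow> ('o, 'm) category \<Rightarrow> ('j, 'i, 'o, 'm) cfunctor \<Rightarrow>
     ('l, 'h, 'o, 'm) cfunctor \<Rightarrow> ('j \<Rightarrow> 'l) \<Rightarrow> ('j \<Rightarrow> 'm) \<Rightarrow> 'm" where
  "colim_map J J' C F G k t = (THE h. h \<in> Mor C (fst (colim J C F)) (fst (colim J' C G)) \<and>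
     (\<forall>j\<in>Ob J. Cmp C h (snd (colim J C F) j) = Cmp C (snd (colim J' C G) (k j)) (t j)))"

definition end_map ::
    "('o, 'm) category \<Rightarrow> ('p, 'n) category \<Rightarrow> ('o \<times> 'o, 'm \<times> 'm, 'p, 'n) cfunctor \<Rightarrow>
     ('o \<times> 'o, 'm \<times> 'm, 'p, 'n) cfunctor \<Rightarrow> ('o \<Rightarrow> 'n) \<Rightarrow> 'n" where
  "end_map C D T T' t = (THE h. h \<in> Mor D (fst (end_of C D T)) (fst (end_of C D T')) \<and>
     (\<forall>a\<in>Ob C. Cmp D (snd (end_of C D T') a) h = Cmp D (t a) (snd (end_of C D T) a)))"

definition coend_map ::
    "('o, 'm) category \<Rightarrow> ('p, 'n) category \<Rightarrow> ('o \<times> 'o, 'm \<times> 'm, 'p, 'n) cfunctor \<Rightarrow>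
     ('o \<times> 'o, 'm \<times> 'm, 'p, 'n) cfunctor \<Rightarrow> ('o \<Rightarrow> 'n) \<Rightarrow> 'n" where
  "coend_map C D T T' t = (THE h. h \<in> Mor D (fst (coend_of C D T)) (fst (coend_of C D T')) \<and>
     (\<forall>a\<in>Ob C. Cmp D h (snd (coend_of C D T) a) = Cmp D (snd (coend_of C D T') a) (t a)))"

definition is_adjunction ::
    "('o, 'm) category \<Rightarrow> ('p, 'n) category \<Rightarrow> ('o, 'm, 'p, 'n) cfunctor \<Rightarrow>
     ('p, 'n, 'o, 'm) cfunctor \<Rightarrow> bool" where
  "is_adjunction C D L R \<longleftrightarrow> is_functor C D L \<and> is_functor D C R \<and>
     (\<exists>\<phi>. (\<forall>c\<in>Ob C. \<forall>d\<in>Ob D. bij_betw (\<phi> c d) (Mor D (Fo L c) d) (Mor C c (Fo R d))) \<and>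
          (\<forall>f\<in>Ar C. \<forall>g\<in>Ar D. \<forall>h\<in>Mor D (Fo L (Cod C f)) (Dom D g).
             \<phi> (Dom C f) (Cod D g) (Cmp D g (Cmp D h (Fa L f))) =
             Cmp C (Fa R g) (Cmp C (\<phi> (Cod C f) (Dom D g) h) f)))"

section \<open>Linear maps\<close>

definition is_linear :: "'k ring \<Rightarrow> ('k, 'a) module \<Rightarrow> ('k, 'b) module \<Rightarrow> ('a \<Rightarrow> 'b) \<Rightarrow> bool" where
  "is_linear K V W f \<longleftrightarrow> f \<in> carrier V \<rightarrow> carrier W \<and>
     (\<forall>v\<in>carrier V. \<forall>w\<in>carrier V. f (v \<oplus>\<^bsub>V\<^esub> w) = f v \<oplus>\<^bsub>W\<^esub> f w) \<and>
     (\<forall>a\<in>carrier K. \<forall>v\<in>carrier V. f (a \<odot>\<^bsub>V\<^esub> v) = a \<odot>\<^bsub>W\<^esub> f v)"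

definition is_bilinear ::
    "'k ring \<Rightarrow> ('k, 'a) module \<Rightarrow> ('k, 'b) module \<Rightarrow> ('k, 'c) module \<Rightarrow> ('a \<Rightarrow> 'b \<Rightarrow> 'c) \<Rightarrow> bool" where
  "is_bilinear K V W Z \<beta> \<longleftrightarrow> (\<forall>v\<in>carrier V. is_linear K W Z (\<beta> v)) \<and>
     (\<forall>w\<in>carrier W. is_linear K V Z (\<lambda>v. \<beta> v w))"

text \<open>Assignments of vector spaces to the objects of a category, with maps between the underlying
  sets attached to its arrows. The vector spaces need not be small: their elements may be of any
  type.\<close>

record ('o, 'm, 'k, 'a) vs_assign =
  sp :: "'o \<Rightarrow> ('k, 'a) module"
  act :: "'m \<Rightarrow> 'a \<Rightarrow> 'a"

definition nat_lin_iso ::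
    "'k ring \<Rightarrow> ('o, 'm) category \<Rightarrow> ('o, 'm, 'k, 'a) vs_assign \<Rightarrow>
     ('o, 'm, 'k, 'b) vs_assign \<Rightarrow> bool" where
  "nat_lin_iso K P A B \<longleftrightarrow> (\<exists>\<phi>.
     (\<forall>p\<in>Ob P. is_linear K (sp A p) (sp B p) (\<phi> p) \<and>
        bij_betw (\<phi> p) (carrier (sp A p)) (carrier (sp B p))) \<and>
     (\<forall>u\<in>Ar P. \<forall>a\<in>carrier (sp A (Dom P u)).
        \<phi> (Cod P u) (act A u a) = act B u (\<phi> (Dom P u) a)))"

section \<open>The universe\<close>

text \<open>The elements of the universe are the elements of the type \<open>'u\<close>, and \<open>elts x\<close> is the
  set of members of \<open>x\<close>; that these are again of type \<open>'u\<close> is transitivity of the universe. The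
  third axiom says that the power set of an element is an element (which, by transitivity, includes
  that all subsets of an element are elements). The last one excludes the trivial universes, i.e.
  those consisting of hereditarily finite sets only.\<close>

locale grothendieck_universe =
  fixes elts :: "'u \<Rightarrow> 'u set"
  assumes elts_inject: "elts x = elts y \<Longrightarrow> x = y"
    and pairing: "\<exists>z. elts z = {x, y}"
    and power: "(\<forall>A. A \<subseteq> elts x \<longrightarrow> (\<exists>y. elts y = A)) \<and> (\<exists>z. elts z = {y. elts y \<subseteq> elts x})"
    and union: "\<exists>z. elts z = (\<Union>i\<in>elts x. elts (f i))"
    and nontrivial: "\<exists>x. infinite (elts x)"

type_synonym ('k, 'u) lin = "(('k, 'u) module, 'u \<Rightarrow> 'u) arrow"

type_synonym ('k, 'u) vfun =
  "(('k, 'u) module, ('k, 'u) lin, ('k, 'u) module, ('k, 'u) lin) cfunctor"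

type_synonym ('k, 'u) vnat = "(('k, 'u) vfun, ('k, 'u) module \<Rightarrow> ('k, 'u) lin) arrow"

locale small_vect = grothendieck_universe elts + field K
  for elts :: "'u \<Rightarrow> 'u set" and K :: "'k ring"
begin

subsection \<open>Small vector spaces\<close>

definition set_code :: "'u set \<Rightarrow> 'u" where
  "set_code A = (THE x. elts x = A)"

definition pair_code :: "'u \<Rightarrow> 'u \<Rightarrow> 'u" where
  "pair_code x y = set_code {set_code {x}, set_code {x, y}}"

text \<open>Module records also carry the irrelevant fields \<open>mult\<close>, \<open>one\<close> and values of the operations
  outside the carrier, so a vector space may be represented by several (isomorphic) objects.\<close>

definition Vect :: "(('k, 'u) module, ('k, 'u) lin) category" where
  "Vect = \<lparr>Ob = {V. module K V \<and> carrier V \<in> range elts},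
     Ar = {f. module K (src f) \<and> carrier (src f) \<in> range elts \<and>
              module K (tgt f) \<and> carrier (tgt f) \<in> range elts \<and>
              is_linear K (src f) (tgt f) (fn f) \<and> fn f \<in> extensional (carrier (src f))},
     Dom = src, Cod = tgt,
     Idn = (\<lambda>V. \<lparr>src = V, tgt = V, fn = (\<lambda>v\<in>carrier V. v)\<rparr>),
     Cmp = (\<lambda>g f. \<lparr>src = src f, tgt = tgt g, fn = compose (carrier (src f)) (fn g) (fn f)\<rparr>)\<rparr>"

abbreviation "idV \<equiv> Idn Vect"

definition lin_zero :: "('k, 'u) module \<Rightarrow> ('k, 'u) module \<Rightarrow> ('k, 'u) lin" where
  "lin_zero V W = \<lparr>src = V, tgt = W, fn = (\<lambda>v\<in>carrier V. \<zero>\<^bsub>W\<^esub>)\<rparr>"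

definition lin_add :: "('k, 'u) lin \<Rightarrow> ('k, 'u) lin \<Rightarrow> ('k, 'u) lin" where
  "lin_add f g = \<lparr>src = src f, tgt = tgt f,
     fn = (\<lambda>v\<in>carrier (src f). fn f v \<oplus>\<^bsub>tgt f\<^esub> fn g v)\<rparr>"

definition lin_smult :: "'k \<Rightarrow> ('k, 'u) lin \<Rightarrow> ('k, 'u) lin" where
  "lin_smult a f = \<lparr>src = src f, tgt = tgt f,
     fn = (\<lambda>v\<in>carrier (src f). a \<odot>\<^bsub>tgt f\<^esub> fn f v)\<rparr>"

text \<open>The vector space \<open>Vect(V, W)\<close> as an object of \<open>Vect\<close>: a linear map is represented by its
  graph, which is an element of the universe.\<close>

definition graph :: "('k, 'u) lin \<Rightarrow> 'u" where
  "graph f = set_code ((\<lambda>v. pair_code v (fn f v)) ` carrier (src f))"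

definition ungraph :: "('k, 'u) module \<Rightarrow> ('k, 'u) module \<Rightarrow> 'u \<Rightarrow> ('k, 'u) lin" where
  "ungraph V W = inv_into (Mor Vect V W) graph"

definition hom_sp :: "('k, 'u) module \<Rightarrow> ('k, 'u) module \<Rightarrow> ('k, 'u) module" where
  "hom_sp V W = \<lparr>carrier = graph ` Mor Vect V W, mult = undefined, one = undefined,
     zero = graph (lin_zero V W),
     add = (\<lambda>a b. graph (lin_add (ungraph V W a) (ungraph V W b))),
     smult = (\<lambda>c a. graph (lin_smult c (ungraph V W a)))\<rparr>"

definition hom_map :: "('k, 'u) lin \<Rightarrow> ('k, 'u) lin \<Rightarrow> ('k, 'u) lin" where
  "hom_map f g = \<lparr>src = hom_sp (tgt f) (src g), tgt = hom_sp (src f) (tgt g),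
     fn = (\<lambda>a\<in>carrier (hom_sp (tgt f) (src g)).
             graph (Cmp Vect g (Cmp Vect (ungraph (tgt f) (src g) a) f)))\<rparr>"

text \<open>The tensor product \<open>\<otimes>\<^sub>k\<close>, chosen by its universal property.\<close>

definition is_tensor ::
    "('k, 'u) module \<Rightarrow> ('k, 'u) module \<Rightarrow> ('k, 'u) module \<Rightarrow> ('u \<Rightarrow> 'u \<Rightarrow> 'u) \<Rightarrow> bool" where
  "is_tensor V W T t \<longleftrightarrow> T \<in> Ob Vect \<and> is_bilinear K V W T t \<and>
     (\<forall>Z\<in>Ob Vect. \<forall>\<beta>. is_bilinear K V W Z \<beta> \<longrightarrow>
        (\<exists>!h. h \<in> Mor Vect T Z \<and> (\<forall>v\<in>carrier V. \<forall>w\<in>carrier W. fn h (t v w) = \<beta> v w)))"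

definition tensor :: "('k, 'u) module \<Rightarrow> ('k, 'u) module \<Rightarrow> ('k, 'u) module \<times> ('u \<Rightarrow> 'u \<Rightarrow> 'u)" where
  "tensor V W = (SOME (T, t). is_tensor V W T t)"

definition tens :: "('k, 'u) module \<Rightarrow> ('k, 'u) module \<Rightarrow> ('k, 'u) module" where
  "tens V W = fst (tensor V W)"

definition pure_tensor :: "('k, 'u) module \<Rightarrow> ('k, 'u) module \<Rightarrow> 'u \<Rightarrow> 'u \<Rightarrow> 'u" where
  "pure_tensor V W = snd (tensor V W)"

definition tens_map :: "('k, 'u) lin \<Rightarrow> ('k, 'u) lin \<Rightarrow> ('k, 'u) lin" where
  "tens_map f g = (THE h. h \<in> Mor Vect (tens (src f) (src g)) (tens (tgt f) (tgt g)) \<and>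
     (\<forall>v\<in>carrier (src f). \<forall>w\<in>carrier (src g).
        fn h (pure_tensor (src f) (src g) v w) =
        pure_tensor (tgt f) (tgt g) (fn f v) (fn g w)))"

subsection \<open>Linear functors and small functors\<close>

definition linear_functor :: "('k, 'u) vfun \<Rightarrow> bool" where
  "linear_functor F \<longleftrightarrow> is_functor Vect Vect F \<and>
     (\<forall>V\<in>Ob Vect. \<forall>W\<in>Ob Vect. \<forall>f\<in>Mor Vect V W.
        (\<forall>g\<in>Mor Vect V W. Fa F (lin_add f g) = lin_add (Fa F f) (Fa F g)) \<and>
        (\<forall>a\<in>carrier K. Fa F (lin_smult a f) = lin_smult a (Fa F f)))"

definition FunVect :: "(('k, 'u) vfun, ('k, 'u) vnat) category" where
  "FunVect = full_subcat (fun_cat Vect Vect) {F. linear_functor F}"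

text \<open>The contravariant Yoneda embedding, \<open>V \<mapsto> Vect(V, -)\<close>, as a functor on \<open>Vect\<^sup>o\<^sup>p\<close>.\<close>

definition yo :: "('k, 'u) module \<Rightarrow> ('k, 'u) vfun" where
  "yo V = \<lparr>Fo = hom_sp V, Fa = hom_map (idV V)\<rparr>"

definition Yoneda :: "(('k, 'u) module, ('k, 'u) lin, ('k, 'u) vfun, ('k, 'u) vnat) cfunctor" where
  "Yoneda = \<lparr>Fo = yo,
     Fa = (\<lambda>f. \<lparr>src = yo (tgt f), tgt = yo (src f), fn = (\<lambda>W\<in>Ob Vect. hom_map f (idV W))\<rparr>)\<rparr>"

definition small_functor :: "('k, 'u) vfun \<Rightarrow> bool" where
  "small_functor X \<longleftrightarrow> (\<exists>d r F p. partial_order_on (elts d) r \<and> elts d \<noteq> {} \<and>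
     (\<forall>a\<in>elts d. \<forall>b\<in>elts d. \<exists>c\<in>elts d. (a, c) \<in> r \<and> (b, c) \<in> r) \<and>
     is_functor (poset_cat (elts d) r) (op_cat Vect) F \<and>
     is_colimit (poset_cat (elts d) r) FunVect (fcomp Yoneda F) X p)"

definition Ind :: "(('k, 'u) vfun, ('k, 'u) vnat) category" where
  "Ind = full_subcat FunVect {X. small_functor X}"

text \<open>The functor \<open>Y \<mapsto> (W \<mapsto> ob Y W)\<close>, with values in \<open>[Vect, Vect]\<close>, of a functor of two
  arguments \<open>Y\<close> (in \<open>[Vect, Vect]\<close>) and \<open>W\<close> (in \<open>Vect\<close>).\<close>

definition vfun_of ::
    "(('k, 'u) vfun \<Rightarrow> ('k, 'u) module \<Rightarrow> ('k, 'u) module) \<Rightarrow>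
     (('k, 'u) vnat \<Rightarrow> ('k, 'u) lin \<Rightarrow> ('k, 'u) lin) \<Rightarrow> ('k, 'u) vfun \<Rightarrow> ('k, 'u) vfun" where
  "vfun_of ob ar Y = \<lparr>Fo = ob Y, Fa = ar (Idn FunVect Y)\<rparr>"

definition curried ::
    "(('k, 'u) vfun \<Rightarrow> ('k, 'u) module \<Rightarrow> ('k, 'u) module) \<Rightarrow>
     (('k, 'u) vnat \<Rightarrow> ('k, 'u) lin \<Rightarrow> ('k, 'u) lin) \<Rightarrow>
     (('k, 'u) vfun, ('k, 'u) vnat, ('k, 'u) vfun, ('k, 'u) vnat) cfunctor" where
  "curried ob ar = \<lparr>Fo = vfun_of ob ar,
     Fa = (\<lambda>\<eta>. \<lparr>src = vfun_of ob ar (src \<eta>), tgt = vfun_of ob ar (tgt \<eta>),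
                 fn = (\<lambda>W\<in>Ob Vect. ar \<eta> (idV W))\<rparr>)\<rparr>"

subsection \<open>The tensor product of functors\<close>

text \<open>The integrand, in \<open>H\<^sub>1\<close>, of
  \<open>\<integral>\<^sup>H\<^sup>0 \<integral>\<^sup>H\<^sup>1 (X(H\<^sub>0) \<otimes> Y(H\<^sub>1)) \<otimes> Vect(H\<^sub>0 \<otimes> H\<^sub>1, V)\<close>, where
  \<open>A\<close> and \<open>B\<close> are the contravariant and the covariant occurrence of \<open>H\<^sub>0\<close>.\<close>

definition tens_integrand ::
    "('k, 'u) vfun \<Rightarrow> ('k, 'u) vfun \<Rightarrow> ('k, 'u) module \<Rightarrow> ('k, 'u) module \<Rightarrow> ('k, 'u) module \<Rightarrow>
     (('k, 'u) module \<times> ('k, 'u) module, ('k, 'u) lin \<times> ('k, 'u) lin,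
      ('k, 'u) module, ('k, 'u) lin) cfunctor" where
  "tens_integrand X Y V A B = \<lparr>
     Fo = (\<lambda>(A', B'). tens (tens (Fo X B) (Fo Y B')) (hom_sp (tens A A') V)),
     Fa = (\<lambda>(a, b). tens_map (tens_map (idV (Fo X B)) (Fa Y b))
                       (hom_map (tens_map (idV A) a) (idV V)))\<rparr>"

definition tens_inner_map ::
    "('k, 'u) vfun \<Rightarrow> ('k, 'u) vnat \<Rightarrow> ('k, 'u) lin \<Rightarrow> ('k, 'u) lin \<Rightarrow> ('k, 'u) lin \<Rightarrow> ('k, 'u) lin" where
  "tens_inner_map X \<eta> v a b = coend_map Vect Vect
     (tens_integrand X (src \<eta>) (src v) (tgt a) (src b))
     (tens_integrand X (tgt \<eta>) (tgt v) (src a) (tgt b))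
     (\<lambda>H. tens_map (tens_map (Fa X b) (fn \<eta> H)) (hom_map (tens_map a (idV H)) v))"

definition tens_inner ::
    "('k, 'u) vfun \<Rightarrow> ('k, 'u) vfun \<Rightarrow> ('k, 'u) module \<Rightarrow>
     (('k, 'u) module \<times> ('k, 'u) module, ('k, 'u) lin \<times> ('k, 'u) lin,
      ('k, 'u) module, ('k, 'u) lin) cfunctor" where
  "tens_inner X Y V = \<lparr>
     Fo = (\<lambda>(A, B). fst (coend_of Vect Vect (tens_integrand X Y V A B))),
     Fa = (\<lambda>(a, b). tens_inner_map X (Idn FunVect Y) (idV V) a b)\<rparr>"

definition tens_ob :: "('k, 'u) vfun \<Rightarrow> ('k, 'u) vfun \<Rightarrow> ('k, 'u) module \<Rightarrow> ('k, 'u) module" where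
  "tens_ob X Y V = fst (coend_of Vect Vect (tens_inner X Y V))"

definition tens_ar :: "('k, 'u) vfun \<Rightarrow> ('k, 'u) vnat \<Rightarrow> ('k, 'u) lin \<Rightarrow> ('k, 'u) lin" where
  "tens_ar X \<eta> v = coend_map Vect Vect
     (tens_inner X (src \<eta>) (src v)) (tens_inner X (tgt \<eta>) (tgt v))
     (\<lambda>H. tens_inner_map X \<eta> v (idV H) (idV H))"

text \<open>The functor \<open>X \<otimes> -\<close>.\<close>

definition tens_left ::
    "('k, 'u) vfun \<Rightarrow> (('k, 'u) vfun, ('k, 'u) vnat, ('k, 'u) vfun, ('k, 'u) vnat) cfunctor" where
  "tens_left X = curried (tens_ob X) (tens_ar X)"

subsection \<open>The formulas for the internal hom\<close>

text \<open>Each formula is a functor of \<open>(Y, V)\<close>.\<close>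

definition eval_form ::
    "(('k, 'u) vfun, ('k, 'u) vnat, ('k, 'u) vfun, ('k, 'u) vnat) cfunctor \<Rightarrow>
     (('k, 'u) vfun \<times> ('k, 'u) module, ('k, 'u) vnat \<times> ('k, 'u) lin, 'k, 'u) vs_assign" where
  "eval_form R = \<lparr>sp = (\<lambda>(Y, V). Fo (Fo R Y) V),
     act = (\<lambda>(\<eta>, v). fn (Cmp Vect (fn (Fa R \<eta>) (tgt v)) (Fa (Fo R (src \<eta>)) v)))\<rparr>"

text \<open>The vector space of natural transformations \<open>X \<rightarrow> Y\<close>.\<close>

definition nat_sp :: "('k, 'u) vfun \<Rightarrow> ('k, 'u) vfun \<Rightarrow> ('k, ('k, 'u) vnat) module" where
  "nat_sp X Y = \<lparr>carrier = Mor Ind X Y, mult = undefined, one = undefined,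
     zero = \<lparr>src = X, tgt = Y, fn = (\<lambda>V\<in>Ob Vect. lin_zero (Fo X V) (Fo Y V))\<rparr>,
     add = (\<lambda>s t. \<lparr>src = X, tgt = Y, fn = (\<lambda>V\<in>Ob Vect. lin_add (fn s V) (fn t V))\<rparr>),
     smult = (\<lambda>c t. \<lparr>src = X, tgt = Y, fn = (\<lambda>V\<in>Ob Vect. lin_smult c (fn t V))\<rparr>)\<rparr>"

text \<open>\<open>(Y, V) \<mapsto> Ind(X \<otimes> yo V, Y)\<close>\<close>

definition ind_hom_form ::
    "('k, 'u) vfun \<Rightarrow>
     (('k, 'u) vfun \<times> ('k, 'u) module, ('k, 'u) vnat \<times> ('k, 'u) lin, 'k, ('k, 'u) vnat) vs_assign" where
  "ind_hom_form X = \<lparr>sp = (\<lambda>(Y, V). nat_sp (Fo (tens_left X) (yo V)) Y),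
     act = (\<lambda>(\<eta>, v) t. Cmp Ind \<eta> (Cmp Ind t (Fa (tens_left X) (Fa Yoneda v))))\<rparr>"

abbreviation elements ::
    "('k, 'u) vfun \<Rightarrow> (('k, 'u) module \<times> ('k, 'u) vnat,
       (('k, 'u) module \<times> ('k, 'u) vnat, ('k, 'u) lin) arrow) category" where
  "elements X \<equiv> comma_cat (op_cat Vect) FunVect Yoneda X"

text \<open>\<open>(Y, W) \<mapsto> colim Vect(Py, W)\<close>, the colimit being over \<open>y \<in> (yo \<down> Y)\<close>.\<close>

definition hom_to ::
    "('k, 'u) module \<Rightarrow> (('k, 'u) module, ('k, 'u) lin, ('k, 'u) module, ('k, 'u) lin) cfunctor" where
  "hom_to W = \<lparr>Fo = (\<lambda>G. hom_sp G W), Fa = (\<lambda>f. hom_map f (idV W))\<rparr>"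

definition colim_ob :: "('k, 'u) vfun \<Rightarrow> ('k, 'u) module \<Rightarrow> ('k, 'u) module" where
  "colim_ob Y W = fst (colim (elements Y) Vect (fcomp (hom_to W) comma_proj))"

definition colim_ar :: "('k, 'u) vnat \<Rightarrow> ('k, 'u) lin \<Rightarrow> ('k, 'u) lin" where
  "colim_ar \<eta> w = colim_map (elements (src \<eta>)) (elements (tgt \<eta>)) Vect
     (fcomp (hom_to (src w)) comma_proj) (fcomp (hom_to (tgt w)) comma_proj)
     (\<lambda>(G, y). (G, Cmp FunVect \<eta> y)) (\<lambda>(G, y). hom_map (idV G) w)"

definition colim_functor ::
    "(('k, 'u) vfun, ('k, 'u) vnat, ('k, 'u) vfun, ('k, 'u) vnat) cfunctor" where
  "colim_functor = curried colim_ob colim_ar"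

text \<open>\<open>(Y, W) \<mapsto> \<integral>\<^sup>H Y(H) \<otimes> Vect(H, W)\<close>\<close>

definition coend_integrand ::
    "('k, 'u) vfun \<Rightarrow> ('k, 'u) module \<Rightarrow>
     (('k, 'u) module \<times> ('k, 'u) module, ('k, 'u) lin \<times> ('k, 'u) lin,
      ('k, 'u) module, ('k, 'u) lin) cfunctor" where
  "coend_integrand Y W = \<lparr>Fo = (\<lambda>(A, B). tens (Fo Y B) (hom_sp A W)),
     Fa = (\<lambda>(a, b). tens_map (Fa Y b) (hom_map a (idV W)))\<rparr>"

definition coend_ob :: "('k, 'u) vfun \<Rightarrow> ('k, 'u) module \<Rightarrow> ('k, 'u) module" where
  "coend_ob Y W = fst (coend_of Vect Vect (coend_integrand Y W))"

definition coend_ar :: "('k, 'u) vnat \<Rightarrow> ('k, 'u) lin \<Rightarrow> ('k, 'u) lin" where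
  "coend_ar \<eta> w = coend_map Vect Vect
     (coend_integrand (src \<eta>) (src w)) (coend_integrand (tgt \<eta>) (tgt w))
     (\<lambda>H. tens_map (fn \<eta> H) (hom_map (idV H) w))"

definition coend_functor ::
    "(('k, 'u) vfun, ('k, 'u) vnat, ('k, 'u) vfun, ('k, 'u) vnat) cfunctor" where
  "coend_functor = curried coend_ob coend_ar"

definition id_functor ::
    "(('k, 'u) vfun, ('k, 'u) vnat, ('k, 'u) vfun, ('k, 'u) vnat) cfunctor" where
  "id_functor = \<lparr>Fo = (\<lambda>Y. Y), Fa = (\<lambda>\<eta>. \<eta>)\<rparr>"

text \<open>The map \<open>Z(H \<otimes> V) \<rightarrow> Z'(H \<otimes> V')\<close> induced by \<open>\<zeta> : Z \<rightarrow> Z'\<close> and \<open>v : V \<rightarrow> V'\<close>.\<close>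

definition twist_map :: "('k, 'u) vnat \<Rightarrow> ('k, 'u) lin \<Rightarrow> ('k, 'u) module \<Rightarrow> ('k, 'u) lin" where
  "twist_map \<zeta> v H = Cmp Vect (fn \<zeta> (tens H (tgt v))) (Fa (src \<zeta>) (tens_map (idV H) v))"

definition tens_right :: "('k, 'u) module \<Rightarrow> ('k, 'u) vfun" where
  "tens_right V = \<lparr>Fo = (\<lambda>H. tens H V), Fa = (\<lambda>h. tens_map h (idV V))\<rparr>"

text \<open>\<open>(Y, V) \<mapsto> lim \<Phi>(Y)(Px \<otimes> V)\<close>, the limit being over \<open>x \<in> (yo \<down> X)\<^sup>o\<^sup>p\<close>.\<close>

definition lim_diagram ::
    "('k, 'u) vfun \<Rightarrow> ('k, 'u) module \<Rightarrow>
     (('k, 'u) module \<times> ('k, 'u) vnat,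
       (('k, 'u) module \<times> ('k, 'u) vnat, ('k, 'u) lin) arrow,
       ('k, 'u) module, ('k, 'u) lin) cfunctor" where
  "lim_diagram Z V = fcomp Z (fcomp (tens_right V) comma_proj)"

definition lim_form ::
    "('k, 'u) vfun \<Rightarrow> (('k, 'u) vfun, ('k, 'u) vnat, ('k, 'u) vfun, ('k, 'u) vnat) cfunctor \<Rightarrow>
     (('k, 'u) vfun \<times> ('k, 'u) module, ('k, 'u) vnat \<times> ('k, 'u) lin, 'k, 'u) vs_assign" where
  "lim_form X \<Phi> = \<lparr>sp = (\<lambda>(Y, V). fst (lim (op_cat (elements X)) Vect (lim_diagram (Fo \<Phi> Y) V))),
     act = (\<lambda>(\<eta>, v). fn (lim_map (op_cat (elements X)) Vect
              (lim_diagram (Fo \<Phi> (src \<eta>)) (src v)) (lim_diagram (Fo \<Phi> (tgt \<eta>)) (tgt v))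
              (\<lambda>(H, x). twist_map (Fa \<Phi> \<eta>) v H)))\<rparr>"

text \<open>\<open>(Y, V) \<mapsto> \<integral>\<^sub>H Vect(X(H), \<Phi>(Y)(H \<otimes> V))\<close>\<close>

definition end_integrand ::
    "('k, 'u) vfun \<Rightarrow> ('k, 'u) vfun \<Rightarrow> ('k, 'u) module \<Rightarrow>
     (('k, 'u) module \<times> ('k, 'u) module, ('k, 'u) lin \<times> ('k, 'u) lin,
      ('k, 'u) module, ('k, 'u) lin) cfunctor" where
  "end_integrand X Z V = \<lparr>Fo = (\<lambda>(A, B). hom_sp (Fo X A) (Fo Z (tens B V))),
     Fa = (\<lambda>(a, b). hom_map (Fa X a) (Fa Z (tens_map b (idV V))))\<rparr>"

definition end_form ::
    "('k, 'u) vfun \<Rightarrow> (('k, 'u) vfun, ('k, 'u) vnat, ('k, 'u) vfun, ('k, 'u) vnat) cfunctor \<Rightarrow>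
     (('k, 'u) vfun \<times> ('k, 'u) module, ('k, 'u) vnat \<times> ('k, 'u) lin, 'k, 'u) vs_assign" where
  "end_form X \<Phi> = \<lparr>sp = (\<lambda>(Y, V). fst (end_of Vect Vect (end_integrand X (Fo \<Phi> Y) V))),
     act = (\<lambda>(\<eta>, v). fn (end_map Vect Vect
              (end_integrand X (Fo \<Phi> (src \<eta>)) (src v)) (end_integrand X (Fo \<Phi> (tgt \<eta>)) (tgt v))
              (\<lambda>H. hom_map (idV (Fo X H)) (twist_map (Fa \<Phi> \<eta>) v H))))\<rparr>"

end

end

theory Submission
  imports Defs
begin

text \<open>A small functor is generated by its value at one object (and conversely a linear functor generated
  by the value at one object is a small directed colimit of representables, over finite sets of elements
  and subspaces), so a natural family \<open>X(H) \<rightarrow> Z(H)\<close> is determined by a small amount of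
  data. Hence the families \<open>X(H) \<rightarrow> Y(H \<otimes> V)\<close> natural in \<open>H\<close> form a small vector space
  \<open>Hom(X, Y)(V)\<close>, which is at once the end and, by the Yoneda lemma, the limit over the elements of
  \<open>X\<close>; the colimit of \<open>Vect(Py, W)\<close> and the coend of \<open>Y(H) \<otimes> Vect(H, W)\<close> are both
  \<open>Y(W)\<close>. A vector of \<open>Hom(X, Y)(V)\<close> involves only boundedly many vectors of \<open>V\<close>, so
  \<open>Hom(X, Y)\<close> is again small. A morphism out of \<open>X \<otimes> Y\<close> is a trilinear dinatural family on
  \<open>X(A) \<times> Y(B) \<times> Vect(A \<otimes> B, W)\<close>, and is determined by its values at the identity of
  \<open>A \<otimes> B\<close>: that is a family \<open>X(A) \<times> Y(B) \<rightarrow> Z(A \<otimes> B)\<close>, i.e. a morphism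
  \<open>Y \<rightarrow> Hom(X, Z)\<close>. Every comparison is read off from the coordinates
  \<open>X(H) \<rightarrow> Y(H \<otimes> V)\<close>.\<close>

text \<open>The limits, ends and coends of the statement run over all of \<open>Vect\<close> or over
  a comma category, so existence of small limits in \<open>Vect\<close> says nothing about them.
  Each existence is a smallness argument resting on generation by one object (\<open>gens\<close>),
  which after \<open>Ob_Ind\<close> replaces directed systems altogether. The field \<open>K\<close>
  may be larger than the universe, so scalars cannot serve as small indices; this shapes
  \<open>lsum\<close>, \<open>universal\<close> and \<open>free_space\<close>. Chosen objects come
  from \<open>SOME\<close> and are known only by their universal properties. Therefore every formula
  receives coordinates in one common set \<open>fam\<close>, natural in \<open>(Y, V)\<close>
  (\<open>presents\<close>); two formulas with such coordinates are isomorphic by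
  \<open>presents_iso\<close>, so no direct comparison between two formulas is ever built. Linear
  algebra over a field enters as regularity: every \<open>f\<close> has a \<open>g\<close> with
  \<open>f g f = f\<close>. Retractions, supports of elements and factorisations through images are
  read off from it. Naturality alone forces linearity (\<open>auto_linear\<close>), which is why the
  plain limit over elements agrees with the linear end.\<close>

context small_vect
begin

section \<open>Small sets\<close>

lemma elts_set_code: "A : range elts ==> elts (set_code A) = A"
proof -
  assume "A : range elts"
  then obtain x where x: "A = elts x" by blast
  have "(THE y. elts y = A) = x"
    using x elts_inject by (intro the_equality) auto
  with x show ?thesis unfolding set_code_def by simp
qed

lemma subset_range: "A <= elts x ==> A : range elts"
  using power by (metis rangeI)

lemma pair_range: "{x, y} : range elts"
  using pairing by (metis rangeI)

lemma singleton_range: "{x} : range elts"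
  using pair_range[of x x] by simp

lemma union_range: "(\<Union>i\<in>elts x. elts (f i)) : range elts"
  using union by (metis rangeI)

lemma set_code_inj: "A : range elts ==> B : range elts ==> set_code A = set_code B \<longleftrightarrow> A = B"
  by (metis elts_set_code)

lemma pair_code_inj: "pair_code a b = pair_code c d \<longleftrightarrow> a = c & b = d"
  unfolding pair_code_def
  by (simp add: set_code_inj singleton_range pair_range doubleton_eq_iff) auto

text \<open>Smallness for sets over any type, as being covered by an image of a member of the
  universe. Sets of lists, functions, subspaces or families can thus be shown small before anything
  is coded in \<open>'u\<close>.\<close>

definition small :: "'a set => bool" where
  "small A \<longleftrightarrow> (EX x f. A <= f ` elts x)"

lemma small_elts: "small (elts x)"
  unfolding small_def by (metis image_ident order_refl)

lemma small_subset: "small A ==> B <= A ==> small B"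
  unfolding small_def by (meson subset_trans)

lemma small_image: "small A ==> small (f ` A)"
  unfolding small_def by (metis image_comp image_mono)

text \<open>Replacement: the union axiom, applied to the singletons \<open>{f i}\<close>, produces
  the image of a member of the universe, and subsets of members are members.\<close>

lemma small_iff_range: "small (A :: 'u set) \<longleftrightarrow> A : range elts"
proof
  assume "small A"
  then obtain x f where A: "A <= f ` elts x" unfolding small_def by blast
  have "(\<Union>i\<in>elts x. elts (set_code {f i})) : range elts" by (rule union_range)
  then have "f ` elts x : range elts" by (simp add: elts_set_code singleton_range UNION_singleton_eq_range)
  with A show "A : range elts" by (metis imageE subset_range)
qed (auto simp: small_elts)

lemma image_range: "(f :: 'u => 'u) ` elts x : range elts"
  using small_image[OF small_elts, of f x] by (simp add: small_iff_range)

text \<open>Vector spaces in \<open>Vect\<close> have elements in \<open>'u\<close>. A small carrier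
  found over another type is moved there by this injection.\<close>

lemma small_coding:
  assumes "small A"
  obtains g :: "'a => 'u" where "inj_on g A" "g ` A : range elts"
proof -
  obtain x f where A: "A <= f ` elts x" using assms unfolding small_def by blast
  have "inj_on (inv_into (elts x) f) A" using A by (rule inj_on_inv_into)
  moreover have "inv_into (elts x) f ` A <= elts x" using A by (auto intro: inv_into_into)
  ultimately show ?thesis by (intro that[of "inv_into (elts x) f"]) (auto intro: subset_range)
qed

lemma small_UN:
  assumes I: "small I" and A: "!!i. i : I ==> small (A i)"
  shows "small (\<Union>i\<in>I. A i)"
proof -
  obtain x f where f: "I <= f ` elts x" using I unfolding small_def by blast
  have "ALL i:I. EX p. A i <= snd p ` elts (fst p)" using A unfolding small_def by fastforce
  then obtain p where p: "!!i. i : I ==> A i <= snd (p i) ` elts (fst (p i))" by metis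
  \<comment> \<open>The index and the position inside the set that covers \<open>A i\<close> are
    coded as one pair; the union axiom only collects elements of \<open>'u\<close>, and
    \<open>dec\<close> below reads the pair back.\<close>
  define S where "S = (\<Union>a\<in>elts x. elts (set_code (pair_code a ` elts (fst (p (f a))))))"
  have "small S" unfolding S_def small_iff_range by (rule union_range)
  moreover have S: "S = (\<Union>a\<in>elts x. pair_code a ` elts (fst (p (f a))))"
    unfolding S_def
    by (simp add: elts_set_code image_range)
  define dec where "dec = (%z. SOME q. z = pair_code (fst q) (snd q))"
  have dec: "dec (pair_code a b) = (a, b)" for a b
    unfolding dec_def by (rule some_equality) (auto simp: pair_code_inj)
  have "(\<Union>i\<in>I. A i) <= (%z. snd (p (f (fst (dec z)))) (snd (dec z))) ` S"
  proof
    fix y assume "y : (\<Union>i\<in>I. A i)"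
    then obtain i where i: "i : I" "y : A i" by blast
    then obtain a where a: "a : elts x" "i = f a" using f by blast
    obtain b where b: "b : elts (fst (p i))" "y = snd (p i) b" using p[OF i(1)] i(2) by blast
    have "pair_code a b : S" unfolding S using b(1) unfolding a(2) by (intro UN_I[OF a(1)]) (rule imageI)
    then show "y : (%z. snd (p (f (fst (dec z)))) (snd (dec z))) ` S"
      by (rule image_eqI[rotated]) (simp add: dec b(2) a(2))
  qed
  ultimately show ?thesis using small_image small_subset by metis
qed

lemma small_Sigma: "small A ==> (!!a. a : A ==> small (B a)) ==> small (SIGMA a:A. B a)"
proof -
  assume "small A" "!!a. a : A ==> small (B a)"
  then have "small (\<Union>a\<in>A. Pair a ` B a)" by (intro small_UN small_image)
  moreover have "(\<Union>a\<in>A. Pair a ` B a) = (SIGMA a:A. B a)" by auto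
  ultimately show ?thesis by simp
qed

text \<open>Here the nontriviality of the universe enters. It makes lists of generators, and
  sequences of vectors supporting a tensor, range over small sets.\<close>

lemma small_nat: "small (UNIV :: nat set)"
proof -
  obtain x where "infinite (elts x)" using nontrivial by blast
  then obtain f :: "nat => 'u" where f: "inj f" "range f <= elts x"
    using infinite_countable_subset by blast
  then have "UNIV <= inv_into UNIV f ` elts x" by (metis UNIV_I image_eqI image_subset_iff inv_f_f subsetI)
  then show ?thesis unfolding small_def by blast
qed

lemma small_countable: "small (range (f :: nat => 'a))"
  by (intro small_image small_nat)

lemma small_lists: assumes "small A" shows "small (lists A)"
proof -
  have n: "small {l : lists A. length l = n}" for n
  proof (induction n)
    case 0
    have "{l : lists A. length l = 0} <= range (%_::nat. [])" by auto
    then show ?case using small_countable small_subset by blast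
  next
    case (Suc n)
    have "{l : lists A. length l = Suc n} <=
      (%p. fst p # snd p) ` (A \<times> {l : lists A. length l = n})"
      by (force simp: length_Suc_conv)
    then show ?case using small_image[OF small_Sigma[OF assms Suc]] small_subset by blast
  qed
  have "lists A = (\<Union>n. {l : lists A. length l = n})" by auto
  then show ?thesis using small_UN[OF small_nat, of "%n. {l : lists A. length l = n}"] n by simp
qed

lemma small_Pow: assumes "small A" shows "small (Pow A)"
proof -
  obtain x f where A: "A <= f ` elts x" using assms unfolding small_def by blast
  obtain w where w: "elts w = {y. elts y <= elts x}" using power by blast
  have "Pow A <= (%z. f ` elts z) ` elts w"
  proof
    fix B assume B: "B : Pow A"
    define C where "C = {c : elts x. f c : B}"
    have "C <= elts x" unfolding C_def by blast
    then obtain z where z: "elts z = C" using power by metis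
    have "B = f ` C" using A B unfolding C_def by auto
    then show "B : (%z. f ` elts z) ` elts w" using z \<open>C \<subseteq> elts x\<close> w by auto
  qed
  then show ?thesis unfolding small_def by blast
qed

text \<open>A function in the product is recovered from its graph, and the graphs are subsets of a
  small disjoint sum.\<close>

lemma small_PiE:
  assumes A: "small A" and B: "!!a. a : A ==> small (B a)"
  shows "small (PiE A B)"
proof -
  have "PiE A B <= (%R. \<lambda>a\<in>A. THE b. (a, b) : R) ` Pow (SIGMA a:A. B a)"
  proof
    fix f assume f: "f : PiE A B"
    let ?R = "(%a. (a, f a)) ` A"
    have "f = (\<lambda>a\<in>A. THE b. (a, b) : ?R)"
    proof
      fix a show "f a = (\<lambda>a\<in>A. THE b. (a, b) : ?R) a"
      proof (cases "a : A")
        case True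
        then have "(THE b. (a, b) : ?R) = f a" by (intro the_equality) auto
        with True show ?thesis by simp
      qed (use PiE_arb[OF f] in simp)
    qed
    moreover have "?R : Pow (SIGMA a:A. B a)"
      by (auto intro: PiE_mem[OF f])
    ultimately show "f : (%R. \<lambda>a\<in>A. THE b. (a, b) : R) ` Pow (SIGMA a:A. B a)"
      by (rule image_eqI)
  qed
  then show ?thesis
    by (rule small_subset[rotated]) (intro small_image small_Pow small_Sigma A B)
qed

section \<open>Vector spaces\<close>

abbreviation "Obj \<equiv> Ob Vect"
abbreviation "L \<equiv> Mor Vect"
abbreviation compo (infixr "oo" 75) where "g oo f \<equiv> Cmp Vect g f"

lemma Obj_iff: "V : Obj \<longleftrightarrow> module K V & small (carrier V)"
  by (simp add: Vect_def small_iff_range)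

lemma Obj_module: "V : Obj ==> module K V" by (simp add: Obj_iff)

lemma Obj_small: "V : Obj ==> small (carrier V)" by (simp add: Obj_iff)

lemma Obj_group: "V : Obj ==> abelian_group V"
  by (metis Obj_module module.axioms(2))

lemma V_add[simp, intro]: "V : Obj ==> x : carrier V ==> y : carrier V ==> add V x y : carrier V"
  by (meson Obj_group abelian_groupE(1))

lemma V_zero[simp, intro]: "V : Obj ==> zero V : carrier V"
  by (meson Obj_group abelian_groupE(2))

lemma V_smult[simp, intro]: "V : Obj ==> c : carrier K ==> x : carrier V ==> smult V c x : carrier V"
  by (meson Obj_module module.smult_closed)

lemma V_assoc: "V : Obj ==> x : carrier V ==> y : carrier V ==> z : carrier V ==>
    add V (add V x y) z = add V x (add V y z)"
  by (meson Obj_group abelian_groupE(3))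

lemma V_comm: "V : Obj ==> x : carrier V ==> y : carrier V ==> add V x y = add V y x"
  by (meson Obj_group abelian_groupE(4))

lemma V_lcomm: "V : Obj ==> x : carrier V ==> y : carrier V ==> z : carrier V ==>
    add V x (add V y z) = add V y (add V x z)"
  by (metis V_assoc V_comm)

lemma V_l_zero[simp]: "V : Obj ==> x : carrier V ==> add V (zero V) x = x"
  by (meson Obj_group abelian_groupE(5))

lemma V_r_zero[simp]: "V : Obj ==> x : carrier V ==> add V x (zero V) = x"
  by (metis V_comm V_l_zero V_zero)

lemma V_smult_add: "V : Obj ==> c : carrier K ==> x : carrier V ==> y : carrier V ==>
    smult V c (add V x y) = add V (smult V c x) (smult V c y)"
  by (meson Obj_module module.smult_r_distr)

lemma V_add_smult: "V : Obj ==> c : carrier K ==> d : carrier K ==> x : carrier V ==>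
    smult V (add K c d) x = add V (smult V c x) (smult V d x)"
  by (meson Obj_module module.smult_l_distr)

lemma V_smult_smult: "V : Obj ==> c : carrier K ==> d : carrier K ==> x : carrier V ==>
    smult V c (smult V d x) = smult V (mult K c d) x"
  by (metis Obj_module module.smult_assoc1)

lemma V_one[simp]: "V : Obj ==> x : carrier V ==> smult V (one K) x = x"
  by (meson Obj_module module.smult_one)

lemma V_smult_0[simp]: "V : Obj ==> x : carrier V ==> smult V (zero K) x = zero V"
  by (meson Obj_module module.smult_l_null)

lemma V_smult_zero[simp]: "V : Obj ==> c : carrier K ==> smult V c (zero V) = zero V"
  by (meson Obj_module module.smult_r_null)

text \<open>Negation as multiplication by minus one: linear maps and subspaces then respect it by
  their scalar clauses.\<close>

definition neg :: "('k, 'u) module => 'u => 'u" where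
  "neg V x = smult V (a_inv K (one K)) x"

lemma neg_closed[simp, intro]: "V : Obj ==> x : carrier V ==> neg V x : carrier V"
  unfolding neg_def by simp

lemma V_neg[simp]: assumes "V : Obj" "x : carrier V" shows "add V x (neg V x) = zero V"
proof -
  have "add V (smult V (one K) x) (neg V x) = smult V (add K (one K) (a_inv K (one K))) x"
    unfolding neg_def using assms by (subst V_add_smult) auto
  then show ?thesis using assms by (simp add: r_neg)
qed

lemma V_cancel: assumes "V : Obj" "x : carrier V" "y : carrier V" "z : carrier V"
    "add V x y = add V x z" shows "y = z"
proof -
  have "add V (neg V x) (add V x y) = add V (neg V x) (add V x z)" using assms by simp
  then show ?thesis using assms
    by (metis V_assoc V_comm V_l_zero V_neg neg_closed)
qed

lemma V_eq_iff_neg: assumes "V : Obj" "x : carrier V" "y : carrier V"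
  shows "x = y \<longleftrightarrow> add V x (neg V y) = zero V"
  by (metis V_assoc V_comm V_neg V_r_zero assms neg_closed)

lemma V_double_zero: "V : Obj ==> x : carrier V ==> add V x x = x ==> x = zero V"
  by (metis V_cancel V_r_zero V_zero)

lemma V_add4: "V : Obj ==> a : carrier V ==> b : carrier V ==> c : carrier V ==> d : carrier V ==>
  add V (add V a b) (add V c d) = add V (add V a c) (add V b d)"
  by (simp add: V_assoc V_lcomm)

text \<open>The module axioms are equations, so they can be checked after applying linear
  coordinates that jointly separate points. This gives the axioms for subspaces, for spaces of maps
  and for small subspaces of large products.\<close>

lemma module_coords:
  fixes M :: "('k, 'a) module" and E :: "'j => ('k, 'b) module" and e :: "'j => 'a => 'b"
  assumes E: "!!j. j : J ==> module K (E j)"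
    and cl: "!!j x. j : J ==> x : carrier M ==> e j x : carrier (E j)"
    and inj: "!!x y. x : carrier M ==> y : carrier M ==> (!!j. j : J ==> e j x = e j y) ==> x = y"
    and z: "zero M : carrier M" "!!j. j : J ==> e j (zero M) = zero (E j)"
    and a: "!!x y. x : carrier M ==> y : carrier M ==> add M x y : carrier M"
      "!!j x y. j : J ==> x : carrier M ==> y : carrier M ==> e j (add M x y) = add (E j) (e j x) (e j y)"
    and s: "!!c x. c : carrier K ==> x : carrier M ==> smult M c x : carrier M"
      "!!j c x. j : J ==> c : carrier K ==> x : carrier M ==> e j (smult M c x) = smult (E j) c (e j x)"
  shows "module K M"
proof (rule moduleI)
  note ag = abelian_groupE[OF module.axioms(2)[OF E]]
  note [simp] = cl z a s ag(1,2,5)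
  show "cring K" by (rule cring_axioms)
  show "abelian_group M"
  proof (rule abelian_groupI)
    fix x assume x: "x : carrier M"
    \<comment> \<open>Closure under scalars is what is known about \<open>M\<close>, so the additive
      inverse is produced as a scalar multiple.\<close>
    let ?y = "smult M (a_inv K (one K)) x"
    have "add M ?y x = zero M"
    proof (rule inj)
      fix j assume j: "j : J"
      interpret E: module K "E j" using E[OF j] .
      have "add (E j) (smult (E j) (a_inv K (one K)) (e j x)) (e j x) = zero (E j)"
        using cl[OF j x] by (simp add: E.smult_l_minus E.M.l_neg)
      then show "e j (add M ?y x) = e j (zero M)" using x j by simp
    qed (use x in auto)
    then show "EX y:carrier M. add M y x = zero M" using x s(1) by (metis a_inv_closed one_closed)
  next
    show "add M x y = add M y x" if "x : carrier M" "y : carrier M" for x y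
      using that by (intro inj) (auto simp: ag(4))
    show "add M (add M x y) z = add M x (add M y z)"
      if "x : carrier M" "y : carrier M" "z : carrier M" for x y z
      using that by (intro inj) (auto simp: ag(3))
    show "add M (zero M) x = x" if "x : carrier M" for x
      using that by (intro inj) auto
  qed auto
  show "smult M (add K c d) x = add M (smult M c x) (smult M d x)"
    if "c : carrier K" "d : carrier K" "x : carrier M" for c d x
    using that by (intro inj) (auto simp: module.smult_l_distr[OF E])
  show "smult M c (add M x y) = add M (smult M c x) (smult M c y)"
    if "c : carrier K" "x : carrier M" "y : carrier M" for c x y
    using that by (intro inj) (auto simp: module.smult_r_distr[OF E])
  show "smult M (mult K c d) x = smult M c (smult M d x)"
    if "c : carrier K" "d : carrier K" "x : carrier M" for c d x
    using that by (intro inj) (auto simp: module.smult_assoc1[OF E])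
  show "smult M (one K) x = x" if "x : carrier M" for x
    using that by (intro inj) (auto simp: module.smult_one[OF E])
qed (use s in auto)

subsection \<open>Linear maps\<close>

definition mk :: "('k, 'u) module => ('k, 'u) module => ('u => 'u) => ('k, 'u) lin" where
  "mk V W \<phi> = \<lparr>src = V, tgt = W, fn = restrict \<phi> (carrier V)\<rparr>"

lemma is_linearI:
  assumes "!!x. x : carrier V ==> f x : carrier W"
    "!!x y. x : carrier V ==> y : carrier V ==> f (add V x y) = add W (f x) (f y)"
    "!!c x. c : carrier K ==> x : carrier V ==> f (smult V c x) = smult W c (f x)"
  shows "is_linear K V W f"
  using assms unfolding is_linear_def by auto

lemma is_linearD:
  assumes "is_linear K V W f"
  shows "x : carrier V ==> f x : carrier W"
    "x : carrier V ==> y : carrier V ==> f (add V x y) = add W (f x) (f y)"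
    "c : carrier K ==> x : carrier V ==> f (smult V c x) = smult W c (f x)"
  using assms unfolding is_linear_def by auto

lemma L_iff: "f : L V W \<longleftrightarrow> V : Obj & W : Obj & src f = V & tgt f = W &
    is_linear K V W (fn f) & fn f : extensional (carrier V)"
  by (auto simp: Mor_def Vect_def)

lemma Ar_L: "f : Ar Vect \<longleftrightarrow> f : L (src f) (tgt f)"
  by (auto simp: Mor_def Vect_def)

lemma Vect_simps[simp]: "Dom Vect = src" "Cod Vect = tgt"
  by (auto simp: Vect_def)

lemma is_linear_cong:
  assumes "V : Obj" "!!x. x : carrier V ==> f x = g x"
  shows "is_linear K V W f \<longleftrightarrow> is_linear K V W g"
  using assms unfolding is_linear_def by (simp add: Pi_iff)

lemma mk_L: "V : Obj ==> W : Obj ==> is_linear K V W \<phi> ==> mk V W \<phi> : L V W"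
  unfolding L_iff mk_def by (auto simp: is_linear_cong[of V "restrict \<phi> (carrier V)" \<phi>])

lemma mk_app[simp]: "x : carrier V ==> fn (mk V W \<phi>) x = \<phi> x"
  by (simp add: mk_def)

lemma mk_src[simp]: "src (mk V W \<phi>) = V" "tgt (mk V W \<phi>) = W"
  by (auto simp: mk_def)

lemma L_src: "f : L V W ==> src f = V" "f : L V W ==> tgt f = W"
  by (auto simp: L_iff)

lemma L_Ob: "f : L V W ==> V : Obj" "f : L V W ==> W : Obj"
  by (auto simp: L_iff)

lemma L_Ar: "f : L V W ==> f : Ar Vect"
  by (auto simp: Mor_def)

lemma L_linear: "f : L V W ==> is_linear K V W (fn f)"
  by (auto simp: L_iff)

lemma L_app[intro]: "f : L V W ==> x : carrier V ==> fn f x : carrier W"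
  by (auto simp: L_iff is_linear_def)

lemma L_add: "f : L V W ==> x : carrier V ==> y : carrier V ==> fn f (add V x y) = add W (fn f x) (fn f y)"
  by (auto simp: L_iff is_linear_def)

lemma L_smult: "f : L V W ==> c : carrier K ==> x : carrier V ==> fn f (smult V c x) = smult W c (fn f x)"
  by (auto simp: L_iff is_linear_def)

lemma is_linear_zero: "V : Obj ==> W : Obj ==> is_linear K V W f ==> f (zero V) = zero W"
  by (metis V_double_zero V_l_zero V_zero is_linearD(1,2))

lemma L_zero: "f : L V W ==> fn f (zero V) = zero W"
  by (meson L_Ob L_linear is_linear_zero)

lemma L_neg: "f : L V W ==> x : carrier V ==> fn f (neg V x) = neg W (fn f x)"
  unfolding neg_def by (simp add: L_smult)

lemma L_eqI:
  assumes "f : L V W" "g : L V W" "!!x. x : carrier V ==> fn f x = fn g x"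
  shows "f = g"
proof -
  have "fn f = fn g" using assms unfolding L_iff by (intro extensionalityI[of _ "carrier V"]) auto
  then show ?thesis using assms by (simp add: L_iff)
qed

lemma mk_eta: "f : L V W ==> mk V W (fn f) = f"
  by (rule L_eqI[of _ V W]) (auto intro: mk_L L_Ob L_linear)

lemma L_comp[intro]: "g : L V W ==> f : L U V ==> g oo f : L U W"
proof -
  assume g: "g : L V W" and f: "f : L U V"
  note [simp] = L_app[OF f] L_app[OF g] L_add[OF f] L_add[OF g] L_smult[OF f] L_smult[OF g]
  have "mk U W (%x. fn g (fn f x)) : L U W"
    by (intro mk_L is_linearI) (use L_Ob f g in auto)
  also have "mk U W (%x. fn g (fn f x)) = g oo f"
    using L_src[OF f] L_src[OF g] by (simp add: mk_def Vect_def compose_def)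
  finally show ?thesis .
qed

lemma comp_app[simp]: "x : carrier (src f) ==> fn (g oo f) x = fn g (fn f x)"
  by (simp add: Vect_def compose_def)

lemma comp_app': "f : L V W ==> x : carrier V ==> fn (g oo f) x = fn g (fn f x)"
  by (simp add: L_iff)

lemma comp_src[simp]: "src (g oo f) = src f" "tgt (g oo f) = tgt g"
  by (auto simp: Vect_def)

lemma idV_src[simp]: "src (idV V) = V" "tgt (idV V) = V"
  by (auto simp: Vect_def)

lemma idV_app[simp]: "x : carrier V ==> fn (idV V) x = x"
  by (simp add: Vect_def)

lemma idV_L[simp, intro]: "V : Obj ==> idV V : L V V"
  unfolding L_iff by (auto simp: Vect_def is_linear_def module.axioms)

lemma comp_assoc: "h : L W Z ==> g : L V W ==> f : L U V ==> (h oo g) oo f = h oo (g oo f)"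
  by (rule L_eqI[of _ U Z]) (auto simp: comp_app' L_src dest: L_app)

lemma comp_id[simp]: "f : L V W ==> idV W oo f = f" "f : L V W ==> f oo idV V = f"
  by (rule L_eqI[of _ V W]; auto simp: comp_app' L_src dest: L_app L_Ob intro!: L_comp idV_L)+

lemma lin_add_L: "f : L V W ==> g : L V W ==> lin_add f g : L V W"
  and lin_add_app: "f : L V W ==> x : carrier V ==> fn (lin_add f g) x = add W (fn f x) (fn g x)"
proof -
  assume f: "f : L V W" and g: "g : L V W"
  then have 1: "lin_add f g = mk V W (%v. add W (fn f v) (fn g v))"
    by (simp add: lin_add_def mk_def L_src)
  have "V : Obj" "W : Obj" using f L_Ob by auto
  then show "lin_add f g : L V W" unfolding 1 using f g
    by (intro mk_L is_linearI) (auto simp: L_app[OF f] L_app[OF g] L_add[OF f] L_add[OF g]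
      L_smult[OF f] L_smult[OF g] V_smult_add intro: V_add4)
qed (simp add: lin_add_def L_src)

lemma lin_smult_L: "f : L V W ==> c : carrier K ==> lin_smult c f : L V W"
  and lin_smult_app: "f : L V W ==> x : carrier V ==> fn (lin_smult c f) x = smult W c (fn f x)"
proof -
  assume f: "f : L V W" and c: "c : carrier K"
  then have 1: "lin_smult c f = mk V W (%v. smult W c (fn f v))"
    by (simp add: lin_smult_def mk_def L_src)
  have "V : Obj" "W : Obj" using f L_Ob by auto
  then show "lin_smult c f : L V W" unfolding 1 using f c
    by (intro mk_L is_linearI)
       (auto simp: L_app[OF f] L_add[OF f] L_smult[OF f] V_smult_add V_smult_smult m_comm)
qed (simp add: lin_smult_def L_src)

lemma lin_zero_L: "V : Obj ==> W : Obj ==> lin_zero V W : L V W"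
  and lin_zero_app[simp]: "x : carrier V ==> fn (lin_zero V W) x = zero W"
  using mk_L[of V W "%_. zero W"] by (auto simp: lin_zero_def mk_def is_linear_def)

subsection \<open>Subspaces\<close>

definition subsp :: "'u set => ('k, 'u) module => bool" where
  "subsp U V \<longleftrightarrow> U <= carrier V & zero V : U & (ALL x:U. ALL y:U. add V x y : U) &
     (ALL c:carrier K. ALL x:U. smult V c x : U)"

lemma subspI:
  assumes "!!x. x : U ==> x : carrier V" "zero V : U" "!!x y. x : U ==> y : U ==> add V x y : U"
    "!!c x. c : carrier K ==> x : U ==> smult V c x : U"
  shows "subsp U V"
  using assms unfolding subsp_def by auto

definition sub :: "('k, 'u) module => 'u set => ('k, 'u) module" where
  "sub V U = V\<lparr>carrier := U\<rparr>"

definition incl :: "('k, 'u) module => 'u set => ('k, 'u) lin" where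
  "incl V U = mk (sub V U) V (%x. x)"

lemma sub_simps[simp]: "carrier (sub V U) = U" "zero (sub V U) = zero V" "add (sub V U) = add V"
    "smult (sub V U) = smult V"
  by (auto simp: sub_def)

lemma sub_Obj: assumes V: "V : Obj" and U: "subsp U V" shows "sub V U : Obj"
  unfolding Obj_iff
proof
  show "module K (sub V U)"
    by (rule module_coords[of UNIV "%_. V" "sub V U" "%_ x. x"])
       (use Obj_module[OF V] U in \<open>auto simp: subsp_def\<close>)
  show "small (carrier (sub V U))"
    using U Obj_small[OF V] small_subset by (auto simp: subsp_def)
qed

lemma incl_L: "V : Obj ==> subsp U V ==> incl V U : L (sub V U) V"
  unfolding incl_def by (intro mk_L is_linearI sub_Obj) (auto simp: subsp_def)

lemma incl_app[simp]: "x : U ==> fn (incl V U) x = x"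
  by (simp add: incl_def)

lemma corestrict_L:
  assumes "f : L W V" "subsp U V" "!!x. x : carrier W ==> fn f x : U"
  shows "mk W (sub V U) (fn f) : L W (sub V U)"
  using assms L_Ob[OF assms(1)]
  by (intro mk_L sub_Obj is_linearI) (auto simp: L_add L_smult)

lemma subspD:
  assumes "subsp U V"
  shows "x : U ==> x : carrier V" "zero V : U" "x : U ==> y : U ==> add V x y : U"
    "c : carrier K ==> x : U ==> smult V c x : U" "x : U ==> neg V x : U"
  using assms unfolding subsp_def neg_def by auto

text \<open>Complements are where \<open>K\<close> being a field enters.\<close>

lemma complement:
  assumes V[simp]: "V : Obj" and U: "subsp U V"
  obtains C where "subsp C V" "!!x. x : C ==> x : U ==> x = zero V"
    "!!v. v : carrier V ==> EX c:C. EX u:U. v = add V c u"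
proof -
  \<comment> \<open>Candidates for a complement are the subspaces meeting \<open>U\<close> only in
    zero; Zorn's lemma supplies a maximal one, and maximality will give the decomposition.\<close>
  define good where "good C \<longleftrightarrow> subsp C V & (ALL x:C. x : U --> x = zero V)" for C
  have "EX C:Collect good. ALL X:Collect good. C <= X --> X = C"
  proof (rule subset_Zorn_nonempty)
    have "good {zero V}" unfolding good_def subsp_def by auto
    then show "Collect good \<noteq> {}" by blast
    fix \<C> assume ne: "\<C> \<noteq> {}" and ch: "subset.chain (Collect good) \<C>"
    have g: "subsp C V" "x : C ==> x : U ==> x = zero V" if "C : \<C>" for C x
      using ch that unfolding subset.chain_def good_def by blast+
    have add: "add V x y : \<Union>\<C>" if xy: "x : \<Union>\<C>" "y : \<Union>\<C>" for x y
    proof -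
      obtain C where "C : \<C>" "x : C" "y : C" using ch xy unfolding subset_chain_def by blast
      then show ?thesis using subspD(3)[OF g(1)] by blast
    qed
    have "subsp (\<Union>\<C>) V"
    proof (rule subspI[OF _ _ add])
      show "x : carrier V" if "x : \<Union>\<C>" for x using that subspD(1)[OF g(1)] by blast
      show "zero V : \<Union>\<C>" using ne subspD(2)[OF g(1)] by blast
      show "smult V c x : \<Union>\<C>" if "c : carrier K" "x : \<Union>\<C>" for c x using that subspD(4)[OF g(1)] by blast
    qed
    then show "\<Union>\<C> : Collect good" unfolding good_def using g(2) by blast
  qed
  then obtain C where C: "good C" and max: "!!X. good X ==> C <= X ==> X = C" by blast
  have sC: "subsp C V" and CU: "!!x. x : C ==> x : U ==> x = zero V" using C unfolding good_def by blast+
  note c = subspD[OF sC] and u = subspD[OF U]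
  have "EX c:C. EX u:U. v = add V c u" if v: "v : carrier V" for v
  proof (rule ccontr)
    assume no: "\<not> (EX c:C. EX u:U. v = add V c u)"
    \<comment> \<open>This is \<open>C\<close> enlarged by the line through \<open>v\<close>. If
      \<open>v\<close> were not in \<open>C + U\<close>, it would still meet \<open>U\<close>
      trivially and contradict maximality.\<close>
    let ?H = "{add V x (smult V a v) | x a. x : C & a : carrier K}"
    have HI: "add V x (smult V a v) : ?H" if "x : C" "a : carrier K" for x a using that by blast
    have "subsp ?H V"
    proof (rule subspI)
      show "x : carrier V" if "x : ?H" for x using that v c(1) by auto
      show "zero V : ?H" using HI[OF c(2) zero_closed] v by simp
      fix p assume "p : ?H"
      then obtain x a where p: "x : C" "a : carrier K" "p = add V x (smult V a v)" by blast
      show "smult V b p : ?H" if "b : carrier K" for b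
        using HI[OF c(4)[OF that p(1)] m_closed[OF that p(2)]] that p v c(1) by (simp add: V_smult_add V_smult_smult)
      fix q assume "q : ?H"
      then obtain y b where q: "y : C" "b : carrier K" "q = add V y (smult V b v)" by blast
      show "add V p q : ?H"
        using HI[OF c(3)[OF p(1) q(1)] a_closed[OF p(2) q(2)]] p q v c(1) by (simp add: V_add_smult V_add4)
    qed
    moreover have "p = zero V" if pH: "p : ?H" and pU: "p : U" for p
    proof -
      obtain x a where p: "x : C" "a : carrier K" "p = add V x (smult V a v)" using pH by blast
      \<comment> \<open>An invertible \<open>a\<close> would give \<open>v\<close> as
        \<open>inv a p\<close> minus \<open>inv a x\<close>, an element of \<open>U\<close> plus one
        of \<open>C\<close>.\<close>
      have "a = zero K"
      proof (rule ccontr)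
        assume "a \<noteq> zero K"
        then have a: "a : Units K" using p(2) field_Units by auto
        let ?y = "smult V (inv\<^bsub>K\<^esub> a) x"
        have y: "?y : C" using c(4)[OF Units_inv_closed[OF a] p(1)] .
        have "smult V (inv\<^bsub>K\<^esub> a) p = add V ?y v"
          using p v c(1) a by (simp add: V_smult_add V_smult_smult)
        then have "add V (neg V ?y) (smult V (inv\<^bsub>K\<^esub> a) p) = v"
          using c(1)[OF y] v V_lcomm[of V "neg V ?y" ?y v] by (metis V V_assoc V_comm V_l_zero V_neg neg_closed)
        then show False using no c(5)[OF y] u(4)[OF Units_inv_closed[OF a] pU] by metis
      qed
      then show ?thesis using p v c(1) CU pU by simp
    qed
    ultimately have "good ?H" unfolding good_def by blast
    moreover have "C <= ?H"
    proof
      show "x : ?H" if "x : C" for x using HI[OF that zero_closed] c(1)[OF that] v by simp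
    qed
    ultimately have "?H = C" by (rule max)
    moreover have "v : ?H" using HI[OF c(2) one_closed] v by simp
    ultimately have "v : C" by simp
    then show False using no u(2) v V_r_zero[OF V v] by metis
  qed
  with sC CU show ?thesis by (rule that)
qed

text \<open>Choose complements \<open>C\<close> of the kernel and \<open>D\<close> of the image;
  invert \<open>f\<close> on \<open>C\<close> and let \<open>g\<close> vanish on \<open>D\<close>.
  The equation \<open>f g f = f\<close> is the one form of splitting used afterwards: it yields
  retractions, projections onto kernels, and factorisations through images.\<close>

lemma regular:
  assumes f: "f : L V W"
  obtains g where "g : L W V" "f oo (g oo f) = f"
proof -
  note O[simp] = L_Ob[OF f] and F = L_app[OF f] and [simp] = L_add[OF f] L_smult[OF f] L_zero[OF f]
  let ?N = "{v : carrier V. fn f v = zero W}" and ?M = "fn f ` carrier V"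
  have N: "subsp ?N V" by (rule subspI) (auto simp: F)
  have M: "subsp ?M W"
  proof (rule subspI)
    show "zero W : ?M" by (rule image_eqI[of _ _ "zero V"]) auto
    fix x assume "x : ?M"
    then obtain x' where x: "x' : carrier V" "x = fn f x'" by blast
    then show "x : carrier W" by (simp add: F)
    show "smult W c x : ?M" if "c : carrier K" for c
      by (rule image_eqI[of _ _ "smult V c x'"]) (use x that in auto)
    fix y assume "y : ?M"
    then obtain y' where y: "y' : carrier V" "y = fn f y'" by blast
    show "add W x y : ?M" by (rule image_eqI[of _ _ "add V x' y'"]) (use x y in auto)
  qed
  obtain C where C: "subsp C V" "!!x. x : C ==> x : ?N ==> x = zero V" "!!v. v : carrier V ==> EX c:C. EX u:?N. v = add V c u"
    using complement[OF O(1) N] by blast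
  obtain D where D: "subsp D W" "!!x. x : D ==> x : ?M ==> x = zero W" "!!v. v : carrier W ==> EX d:D. EX u:?M. v = add W d u"
    using complement[OF O(2) M] by blast
  note c = subspD[OF C(1)] and d = subspD[OF D(1)]
  have fC: "EX y:C. fn f y = fn f v" if v: "v : carrier V" for v
  proof -
    obtain y n where "y : C" "n : ?N" "v = add V y n" using C(3)[OF v] by blast
    then show ?thesis using c(1) by (intro bexI[of _ y]) (auto simp: F)
  qed
  \<comment> \<open>\<open>y\<close> in \<open>C\<close> is the preimage of the image part of
    \<open>w\<close>. As a relation with a unique solution, it makes linearity of \<open>g\<close> a
    matter of exhibiting the right solution.\<close>
  define rel where "rel w y \<longleftrightarrow> y : C & (EX z:D. w = add W (fn f y) z)" for w y
  have rex: "EX y. rel w y" if w: "w : carrier W" for w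
  proof -
    obtain z v where z: "z : D" "v : carrier V" "w = add W z (fn f v)" using D(3)[OF w] by blast
    obtain y where "y : C" "fn f y = fn f v" using fC[OF z(2)] by blast
    then show ?thesis unfolding rel_def using z d(1)[OF z(1)] F[OF z(2)] by (metis V_comm O(2))
  qed
  have uniq: "y = y'" if r: "rel w y" "rel w y'" for w y y'
  proof -
    obtain z z' where y: "y : C" "z : D" "w = add W (fn f y) z" and y': "y' : C" "z' : D" "w = add W (fn f y') z'"
      using r unfolding rel_def by blast
    note cl = c(1)[OF y(1)] c(1)[OF y'(1)] d(1)[OF y(2)] d(1)[OF y'(2)]
    let ?e = "add V y (neg V y')"
    have e: "?e : C" by (rule c(3)[OF y(1) c(5)[OF y'(1)]])
    note G = F[OF cl(1)] F[OF cl(2)]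
    \<comment> \<open>The image of the difference equals \<open>z' - z\<close>, so it lies both in
      \<open>D\<close> and in the image of \<open>f\<close> and vanishes; the difference itself is
      then in \<open>C\<close> and in the kernel.\<close>
    have "fn f ?e = add W (add W (fn f y) (neg W (fn f y'))) (add W z (neg W z))"
      using cl G by (simp add: L_neg[OF f])
    also have "\<dots> = add W (add W (fn f y) z) (add W (neg W (fn f y')) (neg W z))"
      by (rule V_add4) (simp_all add: cl G)
    also have "\<dots> = add W (add W (fn f y') z') (add W (neg W (fn f y')) (neg W z))"
      unfolding y(3)[symmetric] y'(3) ..
    also have "\<dots> = add W (add W (fn f y') (neg W (fn f y'))) (add W z' (neg W z))"
      by (rule V_add4) (simp_all add: cl G)
    also have "\<dots> = add W z' (neg W z)" using cl G by simp
    finally have "fn f ?e : D" using d(3)[OF y'(2) d(5)[OF y(2)]] by simp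
    then have "fn f ?e = zero W" using D(2) c(1)[OF e] by blast
    then have "?e = zero V" using C(2)[OF e] c(1)[OF e] by blast
    then show ?thesis using V_eq_iff_neg[OF O(1) cl(1,2)] by simp
  qed
  define g where "g w = (SOME y. rel w y)" for w
  have g: "rel w (g w)" if "w : carrier W" for w unfolding g_def by (rule someI_ex[OF rex[OF that]])
  have gL: "mk W V g : L W V"
  proof (rule mk_L[OF O(2,1) is_linearI])
    fix x assume x: "x : carrier W"
    obtain z where z: "g x : C" "z : D" "x = add W (fn f (g x)) z" using g[OF x] unfolding rel_def by blast
    show "g x : carrier V" by (rule c(1)[OF z(1)])
    note cl = c(1)[OF z(1)] d(1)[OF z(2)] F[OF c(1)[OF z(1)]]
    show "g (smult W a x) = smult V a (g x)" if a: "a : carrier K" for a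
    proof (rule uniq[OF g[OF V_smult[OF O(2) a x]]])
      have "smult W a x = add W (fn f (smult V a (g x))) (smult W a z)"
        by (subst z(3)) (simp add: V_smult_add a cl)
      then show "rel (smult W a x) (smult V a (g x))" unfolding rel_def using c(4)[OF a z(1)] d(4)[OF a z(2)] by blast
    qed
    fix y assume y: "y : carrier W"
    obtain z' where z': "g y : C" "z' : D" "y = add W (fn f (g y)) z'" using g[OF y] unfolding rel_def by blast
    note cl' = c(1)[OF z'(1)] d(1)[OF z'(2)] F[OF c(1)[OF z'(1)]]
    show "g (add W x y) = add V (g x) (g y)"
    proof (rule uniq[OF g[OF V_add[OF O(2) x y]]])
      have "add W x y = add W (fn f (add V (g x) (g y))) (add W z z')"
        by (subst z(3), subst z'(3)) (simp add: V_add4 cl cl')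
      then show "rel (add W x y) (add V (g x) (g y))" unfolding rel_def using c(3)[OF z(1) z'(1)] d(3)[OF z(2) z'(2)] by blast
    qed
  qed
  have "f oo (mk W V g oo f) = f"
  proof (rule L_eqI[OF L_comp[OF f L_comp[OF gL f]] f])
    fix x assume x: "x : carrier V"
    obtain y where y: "y : C" "fn f y = fn f x" using fC[OF x] by blast
    then have "rel (fn f x) y" unfolding rel_def using F[OF x] by (intro conjI bexI[OF _ d(2)]) simp_all
    then have "g (fn f x) = y" by (rule uniq[OF g[OF F[OF x]]])
    then show "fn (f oo (mk W V g oo f)) x = fn f x"
      unfolding comp_app'[OF L_comp[OF gL f] x] comp_app'[OF f x] mk_app[OF F[OF x]] using y by simp
  qed
  with gL show ?thesis by (rule that)
qed

text \<open>Regularity of the inclusion: in \<open>incl r incl = incl\<close> the outer inclusion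
  cancels on elements.\<close>

lemma retract_ex:
  assumes V: "V : Obj" and U: "subsp U V"
  obtains r where "r : L V (sub V U)" "!!x. x : U ==> fn r x = x"
proof -
  note i = incl_L[OF assms]
  obtain r where r: "r : L V (sub V U)" "incl V U oo (r oo incl V U) = incl V U"
    using regular[OF i] by blast
  have "fn r x = x" if x: "x : U" for x
  proof -
    have "fn r x : U" using L_app[OF r(1), of x] x U by (auto simp: subsp_def)
    moreover have "fn (incl V U oo (r oo incl V U)) x = fn (incl V U) x" using r by simp
    ultimately show ?thesis using x i by (simp add: L_src incl_def)
  qed
  with r that show ?thesis by blast
qed


section \<open>Constructions of vector spaces\<close>

text \<open>\<open>V\<close> is, via \<open>\<rho>\<close>, the subspace \<open>C\<close> of the (possibly large) product of the \<open>E j\<close>.\<close>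

definition represents ::
    "('k, 'u) module => ('u => 'j => 'u) => 'j set => ('j => ('k, 'u) module) => ('j => 'u) set => bool" where
  "represents V \<rho> J E C \<longleftrightarrow> V : Obj & bij_betw \<rho> (carrier V) C & C <= PiE J (%j. carrier (E j)) &
     (ALL j:J. E j : Obj & is_linear K V (E j) (%v. \<rho> v j))"

text \<open>The full product over a large \<open>J\<close> has no code in the universe. A small set
  \<open>C\<close> of families closed under the operations does, and its linear structure is carried
  along the coding \<open>g\<close>.\<close>

lemma sub_prod:
  fixes E :: "'j => ('k, 'u) module" and C :: "('j => 'u) set"
  assumes E: "!!j. j : J ==> E j : Obj" and C: "C <= PiE J (%j. carrier (E j))"
    and z: "(\<lambda>j\<in>J. zero (E j)) : C"
    and a: "!!x y. x : C ==> y : C ==> (\<lambda>j\<in>J. add (E j) (x j) (y j)) : C"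
    and s: "!!c x. c : carrier K ==> x : C ==> (\<lambda>j\<in>J. smult (E j) c (x j)) : C"
    and sm: "small C"
  obtains V \<rho> where "represents V \<rho> J E C"
proof -
  obtain g :: "('j => 'u) => 'u" where g: "inj_on g C" "g ` C : range elts"
    using small_coding[OF sm] by blast
  define \<delta> where "\<delta> = inv_into C g"
  have \<delta>g: "\<delta> (g x) = x" if "x : C" for x unfolding \<delta>_def using g(1) that by (rule inv_into_f_f)
  have \<delta>C: "\<delta> a : C" if "a : g ` C" for a using that \<delta>g by auto
  define V :: "('k, 'u) module" where "V = \<lparr>carrier = g ` C, mult = undefined, one = undefined,
    zero = g (\<lambda>j\<in>J. zero (E j)), add = (%a b. g (\<lambda>j\<in>J. add (E j) (\<delta> a j) (\<delta> b j))),
    smult = (%c a. g (\<lambda>j\<in>J. smult (E j) c (\<delta> a j)))\<rparr>"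
  have CE: "x j : carrier (E j)" if "x : C" "j : J" for x j using C that by auto
  have ext: "x = y" if "x : C" "y : C" "!!j. j : J ==> x j = y j" for x y
    using C that PiE_ext[of x J "%j. carrier (E j)" y] by blast
  have "module K V"
  proof (rule module_coords[of J E V "%j a. \<delta> a j"])
    show "module K (E j)" if "j : J" for j using E[OF that] by (rule Obj_module)
    show "x = y" if xy: "x : carrier V" "y : carrier V" "!!j. j : J ==> \<delta> x j = \<delta> y j" for x y
    proof -
      obtain x' y' where *: "x = g x'" "y = g y'" "x' : C" "y' : C"
        using xy(1,2) by (auto simp: V_def)
      then show ?thesis using ext[of x' y'] xy(3) by (simp add: \<delta>g)
    qed
  qed (use E z a s CE \<delta>C \<delta>g in \<open>auto simp: V_def\<close>)
  then have VO: "V : Obj" using g(2) by (simp add: Obj_iff small_iff_range V_def)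
  have "bij_betw \<delta> (carrier V) C"
    unfolding bij_betw_def by (auto simp: V_def inj_on_def \<delta>g image_iff)
  moreover have "is_linear K V (E j) (%v. \<delta> v j)" if "j : J" for j
    by (rule is_linearI) (use that CE \<delta>C \<delta>g a s in \<open>auto simp: V_def\<close>)
  ultimately show ?thesis using VO C E that[of V \<delta>] unfolding represents_def by blast
qed

lemma representsD:
  assumes "represents V \<rho> J E C"
  shows "V : Obj" "v : carrier V ==> \<rho> v : C" "j : J ==> is_linear K V (E j) (%v. \<rho> v j)"
    "j : J ==> E j : Obj" "v : carrier V ==> j : J ==> \<rho> v j : carrier (E j)"
    "z : C ==> EX v:carrier V. \<rho> v = z"
  using assms unfolding represents_def bij_betw_def is_linear_def by (auto simp: image_iff)

lemma represents_eqI: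
  assumes r: "represents V \<rho> J E C" and v: "v : carrier V" "w : carrier V"
    and e: "!!j. j : J ==> \<rho> v j = \<rho> w j"
  shows "v = w"
proof -
  have "\<rho> v : PiE J (%j. carrier (E j))" "\<rho> w : PiE J (%j. carrier (E j))"
    using r v representsD(2)[OF r] unfolding represents_def by auto
  then have "\<rho> v = \<rho> w" using e by (rule PiE_ext)
  then show ?thesis using r v unfolding represents_def bij_betw_def inj_on_def by blast
qed

lemma represents_proj:
  assumes r: "represents V \<rho> J E C" and j: "j : J"
  shows "mk V (E j) (%v. \<rho> v j) : L V (E j)"
  by (rule mk_L) (use representsD[OF r] j in auto)

text \<open>Preimages under \<open>\<rho>\<close> are chosen without regard to linearity; the map
  becomes linear because the coordinates are linear and separate points.\<close>

lemma represents_lift: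
  assumes r: "represents V \<rho> J E C" and W: "W : Obj"
    and C: "!!w. w : carrier W ==> \<phi> w : C"
    and l: "!!j. j : J ==> is_linear K W (E j) (%w. \<phi> w j)"
  obtains h where "h : L W V" "!!w. w : carrier W ==> \<rho> (fn h w) = \<phi> w"
proof -
  obtain \<eta> where \<eta>: "!!w. w : carrier W ==> \<eta> w : carrier V & \<rho> (\<eta> w) = \<phi> w"
    using representsD(6)[OF r C] by metis
  note \<eta>c = \<eta>[THEN conjunct1] and \<eta>r = \<eta>[THEN conjunct2]
  note [simp] = representsD(1)[OF r] W
  have "mk W V \<eta> : L W V"
  proof (intro mk_L is_linearI)
    show "\<eta> (add W x y) = add V (\<eta> x) (\<eta> y)" if "x : carrier W" "y : carrier W" for x y
      by (rule represents_eqI[OF r])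
         (use that \<eta>c \<eta>r is_linearD(2)[OF representsD(3)[OF r]] is_linearD(2)[OF l] in auto)
    show "\<eta> (smult W c x) = smult V c (\<eta> x)" if "c : carrier K" "x : carrier W" for c x
      by (rule represents_eqI[OF r])
         (use that \<eta>c \<eta>r is_linearD(3)[OF representsD(3)[OF r]] is_linearD(3)[OF l] in auto)
  qed (use \<eta>c in auto)
  then show ?thesis using \<eta>r by (intro that[of "mk W V \<eta>"]) auto
qed

text \<open>The last clause provides the projections onto the coordinates in a set \<open>I\<close>.
  They will compare different finite sets of elements inside one fixed product in
  \<open>gens_small_functor\<close>.\<close>

lemma product:
  fixes E :: "'j => ('k, 'u) module"
  assumes J: "small J" and E: "!!j. j : J ==> E j : Obj"
  obtains P p i where "P : Obj" "!!j. j : J ==> p j : L P (E j)" "!!j. j : J ==> i j : L (E j) P"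
    "!!j x. j : J ==> x : carrier (E j) ==> fn (p j) (fn (i j) x) = x"
    "!!j k x. j : J ==> k : J ==> j \<noteq> k ==> x : carrier (E j) ==> fn (p k) (fn (i j) x) = zero (E k)"
    "!!x y. x : carrier P ==> y : carrier P ==> ALL j:J. fn (p j) x = fn (p j) y ==> x = y"
    "!!I. EX \<pi>:L P P. ALL x:carrier P. ALL j:J.
       fn (p j) (fn \<pi> x) = (if j : I then fn (p j) x else zero (E j))"
proof -
  let ?C = "PiE J (%j. carrier (E j))"
  obtain P \<rho> where r: "represents P \<rho> J E ?C"
    by (rule sub_prod[of J E ?C]) (use E J in \<open>auto intro!: small_PiE Obj_small\<close>)
  note [simp] = representsD(1)[OF r] E
  define p where "p j = mk P (E j) (%v. \<rho> v j)" for j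
  have p: "p j : L P (E j)" if "j : J" for j unfolding p_def using represents_proj[OF r that] .
  have papp[simp]: "fn (p j) x = \<rho> x j" if "x : carrier P" for x j using that by (simp add: p_def)
  have ex: "ALL j:J. EX i. i : L (E j) P &
    (ALL x:carrier (E j). \<rho> (fn i x) = (\<lambda>k\<in>J. if k = j then x else zero (E k)))"
  proof
    fix j assume j: "j : J"
    show "EX i. i : L (E j) P & (ALL x:carrier (E j). \<rho> (fn i x) = (\<lambda>k\<in>J. if k = j then x else zero (E k)))"
    by (rule represents_lift[OF r, of "E j" "%x. \<lambda>k\<in>J. if k = j then x else zero (E k)"])
       (use j in \<open>auto simp: is_linear_def\<close>)
  qed
  obtain i where "ALL j:J. i j : L (E j) P &
    (ALL x:carrier (E j). \<rho> (fn (i j) x) = (\<lambda>k\<in>J. if k = j then x else zero (E k)))"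
    by (rule exE[OF bchoice[OF ex]])
  then have i: "!!j. j : J ==> i j : L (E j) P"
    "!!j x. j : J ==> x : carrier (E j) ==> \<rho> (fn (i j) x) = (\<lambda>k\<in>J. if k = j then x else zero (E k))"
    by blast+
  have ic: "fn (i j) x : carrier P" if "j : J" "x : carrier (E j)" for j x
    using L_app[OF i(1)] that by blast
  have "EX \<pi>:L P P. ALL x:carrier P. ALL j:J.
       fn (p j) (fn \<pi> x) = (if j : I then fn (p j) x else zero (E j))" for I
  proof -
    obtain h where h: "h : L P P"
      "!!w. w : carrier P ==> \<rho> (fn h w) = (\<lambda>k\<in>J. if k : I then \<rho> w k else zero (E k))"
    proof (rule represents_lift[OF r, of P "%w. \<lambda>k\<in>J. if k : I then \<rho> w k else zero (E k)"])
      fix j assume j: "j : J"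
      show "is_linear K P (E j) (%w. (\<lambda>k\<in>J. if k : I then \<rho> w k else zero (E k)) j)"
        using representsD(3)[OF r j] j by (auto simp: is_linear_def)
    qed (use representsD(5)[OF r] in auto)
    then show ?thesis using L_app[OF h(1)] by (intro bexI[of _ h]) auto
  qed
  then show ?thesis
    using that[of P p i] p i ic represents_eqI[OF r] by simp
qed

lemma biproduct:
  assumes "A : Obj" "B : Obj"
  obtains P p q i j where "P : Obj" "p : L P A" "q : L P B" "i : L A P" "j : L B P"
    "!!x. x : carrier A ==> fn p (fn i x) = x" "!!x. x : carrier A ==> fn q (fn i x) = zero B"
    "!!x. x : carrier B ==> fn q (fn j x) = x" "!!x. x : carrier B ==> fn p (fn j x) = zero A"
proof -
  have s: "small (UNIV :: bool set)"
    using small_countable[of "%n. n = 0"] by (rule small_subset) (auto simp: image_iff)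
  obtain P p i where P: "P : Obj" "!!b. p b : L P (if b then A else B)"
    "!!b. i b : L (if b then A else B) P"
    "!!b x. x : carrier (if b then A else B) ==> fn (p b) (fn (i b) x) = x"
    "!!b k x. b \<noteq> k ==> x : carrier (if b then A else B) ==>
       fn (p k) (fn (i b) x) = zero (if k then A else B)"
    by (rule product[of UNIV "%b. if b then A else B"]) (use s assms in auto)
  show ?thesis
    by (rule that[of P "p True" "p False" "i True" "i False"])
       (use P(2,3)[of True] P(2,3)[of False] P(4)[of _ True] P(4)[of _ False] P(5)[of True False]
        P(5)[of False True] P(1) in simp_all)
qed

subsection \<open>Spanning sets and the universal construction\<close>

text \<open>Stated through subspaces, so that no linear combinations appear: a property stable under
  the operations cuts out a subspace, and \<open>spans_induct\<close> follows at once.\<close>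

definition spans :: "('k, 'u) module => 'u set => bool" where
  "spans T S \<longleftrightarrow> (ALL U. subsp U T & S <= U --> U = carrier T)"

lemma spans_induct:
  assumes "spans T S" "x : carrier T" "T : Obj" "S <= carrier T"
    "!!x. x : S ==> P x" "P (zero T)"
    "!!x y. x : carrier T ==> y : carrier T ==> P x ==> P y ==> P (add T x y)"
    "!!c x. c : carrier K ==> x : carrier T ==> P x ==> P (smult T c x)"
  shows "P x"
proof -
  have "subsp {x : carrier T. P x} T" using assms by (intro subspI) auto
  moreover have "S <= {x : carrier T. P x}" using assms by auto
  ultimately have "{x : carrier T. P x} = carrier T" using assms(1) unfolding spans_def by blast
  then show ?thesis using assms(2) by blast
qed

lemma spans_eqI:
  assumes T: "spans T S" "S <= carrier T" and f: "f : L T Z" "g : L T Z"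
    and e: "!!x. x : S ==> fn f x = fn g x"
  shows "f = g"
proof (rule L_eqI[OF f])
  fix x assume "x : carrier T"
  then show "fn f x = fn g x"
    by (rule spans_induct[OF T(1) _ _ T(2)])
       (use e L_Ob[OF f(1)] in \<open>auto simp: L_add[OF f(1)] L_add[OF f(2)] L_smult[OF f(1)]
         L_smult[OF f(2)] L_zero[OF f(1)] L_zero[OF f(2)]\<close>)
qed

text \<open>A retraction onto a subspace \<open>U\<close> containing \<open>S\<close>, followed by
  the inclusion, agrees with the identity on \<open>S\<close>. If \<open>S\<close> separates
  endomorphisms the two coincide, and \<open>U\<close> is everything.\<close>

lemma spansI:
  assumes T: "T : Obj" and e: "!!f g. f : L T T ==> g : L T T ==> (!!x. x : S ==> fn f x = fn g x) ==> f = g"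
  shows "spans T S"
  unfolding spans_def
proof (intro allI impI, elim conjE)
  fix U assume U: "subsp U T" "S <= U"
  obtain r where r: "r : L T (sub T U)" "!!x. x : U ==> fn r x = x" using retract_ex[OF T U(1)] by blast
  have Uc: "U <= carrier T" using U by (simp add: subsp_def)
  have ru: "fn r x : U" if "x : carrier T" for x using L_app[OF r(1) that] by simp
  have "incl T U oo r = idV T"
  proof (rule e)
    show "incl T U oo r : L T T" using incl_L[OF T U(1)] r(1) by auto
    show "idV T : L T T" using T by simp
    show "fn (incl T U oo r) x = fn (idV T) x" if "x : S" for x
      using that U Uc r by (auto simp: comp_app'[OF r(1)] subset_iff)
  qed
  then have "x : U" if "x : carrier T" for x
    using that ru[OF that] comp_app'[OF r(1) that, of "incl T U"] by simp
  then show "U = carrier T" using Uc by blast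
qed

text \<open>Formal sums without coefficients. The hypothesis \<open>rep\<close> of
  \<open>universal\<close> turns a scalar multiple of a generator into such a sum, so the number of
  sums is bounded by the generators alone, however large \<open>K\<close> is.\<close>

definition lsum :: "('k, 'u) module => ('i => 'u) => 'i list => 'u" where
  "lsum V \<beta> l = foldr (%i s. add V (\<beta> i) s) l (zero V)"

lemma lsum_simps[simp]: "lsum V \<beta> [] = zero V" "lsum V \<beta> (i # l) = add V (\<beta> i) (lsum V \<beta> l)"
  by (auto simp: lsum_def)

lemma lsum_closed: "V : Obj ==> (!!i. i : set l ==> \<beta> i : carrier V) ==> lsum V \<beta> l : carrier V"
  by (induction l) auto

lemma lsum_append: "V : Obj ==> (!!i. i : set l \<union> set m ==> \<beta> i : carrier V) ==>
    lsum V \<beta> (l @ m) = add V (lsum V \<beta> l) (lsum V \<beta> m)"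
  by (induction l) (auto simp: lsum_closed V_assoc)

text \<open>The universal member is the span of the tautological elements in the product of all the \<open>Z\<close>; it
  is small because the values on \<open>I\<close> are combinations, by formulas independent of the family, of the
  values on \<open>G\<close>.\<close>

lemma universal:
  fixes I :: "'i set" and P :: "(('k, 'u) module \<times> ('i => 'u)) set"
  assumes PO: "!!p. p : P ==> fst p : Obj" and Pc: "!!p i. p : P ==> i : I ==> snd p i : carrier (fst p)"
    and G: "small G" "G <= I"
    and rep: "!!c i. c : carrier K ==> i : I ==>
      EX l:lists G. ALL p:P. smult (fst p) c (snd p i) = lsum (fst p) (snd p) l"
  obtains T t H where "T : Obj" "!!i. i : I ==> t i : carrier T"
    "!!p. p : P ==> H p : L T (fst p)" "!!p i. p : P ==> i : I ==> fn (H p) (t i) = snd p i"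
    "!!x y. x : carrier T ==> y : carrier T ==> (!!p. p : P ==> fn (H p) x = fn (H p) y) ==> x = y"
    "spans T (t ` I)"
proof -
  \<comment> \<open>A formal sum over \<open>G\<close>, evaluated in all members of \<open>P\<close>
    at once. These elements of the large product are the universal space; there are as many of them
    as lists over \<open>G\<close>.\<close>
  define ev where "ev l = (\<lambda>p\<in>P. lsum (fst p) (snd p) l)" for l
  have lc: "lsum (fst p) (snd p) l : carrier (fst p)" if "p : P" "l : lists G" for p l
    using that PO Pc G(2) by (intro lsum_closed) (auto simp: in_lists_conv_set)
  have la: "lsum (fst p) (snd p) (l @ m) = add (fst p) (lsum (fst p) (snd p) l) (lsum (fst p) (snd p) m)"
    if "p : P" "l : lists G" "m : lists G" for p l m
    using that PO Pc G(2) by (intro lsum_append) (auto simp: in_lists_conv_set)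
  have ls: "EX m:lists G. ALL p:P. smult (fst p) c (lsum (fst p) (snd p) l) = lsum (fst p) (snd p) m"
    if c: "c : carrier K" and "l : lists G" for c l
    using that(2)
  proof (induction l)
    case Nil
    then show ?case using PO c by (intro bexI[of _ "[]"]) auto
  next
    case (Cons i l)
    then obtain m where m: "m : lists G"
      "ALL p:P. smult (fst p) c (lsum (fst p) (snd p) l) = lsum (fst p) (snd p) m" by auto
    obtain k where k: "k : lists G" "ALL p:P. smult (fst p) c (snd p i) = lsum (fst p) (snd p) k"
      using rep[OF c, of i] Cons G(2) by auto
    have "smult (fst p) c (lsum (fst p) (snd p) (i # l)) = lsum (fst p) (snd p) (k @ m)"
      if p: "p : P" for p
      using m k p la[OF p k(1) m(1)] c PO[OF p] Pc[OF p, of i] Cons G(2) lc[OF p, of l]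
      by (auto simp: V_smult_add)
    then show ?case using m(1) k(1) by (intro bexI[of _ "k @ m"]) auto
  qed
  let ?C = "ev ` lists G"
  obtain T \<rho> where r: "represents T \<rho> P fst ?C"
  proof (rule sub_prod[of P fst ?C])
    show "?C <= PiE P (%p. carrier (fst p))"
      by (intro image_subsetI) (simp add: ev_def restrict_PiE_iff lc)
    show "(\<lambda>p\<in>P. zero (fst p)) : ?C" by (rule image_eqI[of _ _ "[]"]) (auto simp: ev_def)
    show "(\<lambda>p\<in>P. add (fst p) (x p) (y p)) : ?C" if xy: "x : ?C" "y : ?C" for x y
    proof -
      obtain l m where *: "x = ev l" "y = ev m" "l : lists G" "m : lists G" using xy by blast
      have "(\<lambda>p\<in>P. add (fst p) (x p) (y p)) = ev (l @ m)"
        unfolding * ev_def by (rule restrict_ext) (simp add: la *(3,4))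
      then show ?thesis using *(3,4) by (intro image_eqI[of _ _ "l @ m"]) auto
    qed
    show "(\<lambda>p\<in>P. smult (fst p) c (x p)) : ?C" if cx: "c : carrier K" "x : ?C" for c x
    proof -
      obtain l where l: "x = ev l" "l : lists G" using cx by blast
      obtain m where m: "m : lists G" "ALL p:P. smult (fst p) c (lsum (fst p) (snd p) l) = lsum (fst p) (snd p) m"
        using ls[OF cx(1) l(2)] by blast
      have "(\<lambda>p\<in>P. smult (fst p) c (x p)) = ev m"
        unfolding l ev_def by (rule restrict_ext) (simp add: m)
      then show ?thesis using m(1) by (intro image_eqI[of _ _ m]) auto
    qed
    show "small ?C" using G(1) by (intro small_image small_lists)
  qed (use PO in auto)
  note TO = representsD(1)[OF r]
  have "EX t:carrier T. ALL p:P. \<rho> t p = snd p i" if i: "i : I" for i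
  proof -
    \<comment> \<open>With the scalar one, \<open>rep\<close> says that the value at
      \<open>i\<close> itself is a formal sum over \<open>G\<close>.\<close>
    obtain l where l: "l : lists G" "ALL p:P. smult (fst p) (one K) (snd p i) = lsum (fst p) (snd p) l"
      using rep[OF one_closed i] by blast
    obtain t where "t : carrier T" "\<rho> t = ev l" using representsD(6)[OF r] l(1) by blast
    then show ?thesis using l i PO Pc by (intro bexI[of _ t]) (auto simp: ev_def)
  qed
  then obtain t where t: "!!i. i : I ==> t i : carrier T" "!!i p. i : I ==> p : P ==> \<rho> (t i) p = snd p i"
    by metis
  define H where "H p = mk T (fst p) (%x. \<rho> x p)" for p
  have H: "H p : L T (fst p)" if "p : P" for p unfolding H_def using represents_proj[OF r that] .
  have "spans T (t ` I)" unfolding spans_def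
  proof (intro allI impI, elim conjE)
    fix U assume U: "subsp U T" "t ` I <= U"
    have Uc: "U <= carrier T" using U by (simp add: subsp_def)
    \<comment> \<open>Every vector of \<open>T\<close> is some \<open>ev l\<close>, so a subspace
      that contains the tautological elements is shown to reach all of them by induction on
      \<open>l\<close>.\<close>
    have *: "EX u:U. \<rho> u = ev l" if "l : lists G" for l
      using that
    proof (induction l)
      case Nil
      have "\<rho> (zero T) = ev []"
      proof (rule PiE_ext[of _ P "%p. carrier (fst p)"])
        show "\<rho> (zero T) p = ev [] p" if "p : P" for p
          using is_linear_zero[OF TO _ representsD(3)[OF r that]] PO that by (simp add: ev_def)
      qed (use r TO representsD(2)[OF r, of "zero T"] in \<open>auto simp: represents_def ev_def PO\<close>)
      then show ?case using U by (auto simp: subsp_def)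
    next
      case (Cons i l)
      then obtain u where u: "u : U" "\<rho> u = ev l" by auto
      have i: "i : I" "i : G" using Cons G(2) by auto
      have tu: "add T (t i) u : U" using U i u by (auto simp: subsp_def)
      have "\<rho> (add T (t i) u) = ev (i # l)"
      proof (rule PiE_ext[of _ P "%p. carrier (fst p)"])
        show "\<rho> (add T (t i) u) p = ev (i # l) p" if "p : P" for p
          using is_linearD(2)[OF representsD(3)[OF r that], of "t i" u] t i u Uc that
          by (auto simp: ev_def)
        show "\<rho> (add T (t i) u) : PiE P (%p. carrier (fst p))"
          using r representsD(2)[OF r, of "add T (t i) u"] tu Uc by (auto simp: represents_def)
        show "ev (i # l) : PiE P (%p. carrier (fst p))"
          unfolding ev_def using lc[of _ "i # l"] Cons i by auto
      qed
      then show ?case using tu by blast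
    qed
    have "x : U" if x: "x : carrier T" for x
    proof -
      obtain l where l: "l : lists G" "\<rho> x = ev l" using representsD(2)[OF r x] by blast
      obtain u where u: "u : U" "\<rho> u = ev l" using * l by blast
      have "x = u" by (rule represents_eqI[OF r]) (use x u l Uc in auto)
      then show ?thesis using u by simp
    qed
    then show "U = carrier T" using Uc by blast
  qed
  then show ?thesis
    using that[of T t H] TO t H represents_eqI[OF r] by (simp add: H_def)
qed

subsection \<open>Spaces of linear maps\<close>

lemma graph_inj: assumes f: "f : L V W" and g: "g : L V W" and e: "graph f = graph g" shows "f = g"
proof -
  obtain x where x: "carrier V = elts x" using f by (auto simp: L_iff Obj_iff small_iff_range)
  have "(%v. pair_code v (fn f v)) ` carrier V = (%v. pair_code v (fn g v)) ` carrier V"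
    using e f g set_code_inj[OF image_range image_range] by (simp add: graph_def x L_src)
  then have "fn f v = fn g v" if "v : carrier V" for v
    using that by (auto simp: set_eq_iff image_iff pair_code_inj) (metis pair_code_inj)
  then show ?thesis by (rule L_eqI[OF f g])
qed

lemma ungraph_graph[simp]: "f : L V W ==> ungraph V W (graph f) = f"
  unfolding ungraph_def by (rule inv_into_f_f) (auto intro: inj_onI graph_inj)

lemma carrier_hom: "carrier (hom_sp V W) = graph ` L V W"
  by (simp add: hom_sp_def)

lemma graph_in: "f : L V W ==> graph f : carrier (hom_sp V W)"
  by (simp add: carrier_hom)

lemma hom_cases:
  assumes "a : carrier (hom_sp V W)" obtains f where "f : L V W" "a = graph f"
  using assms by (auto simp: carrier_hom)

lemma ungraph_L: "a : carrier (hom_sp V W) ==> ungraph V W a : L V W"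
  "a : carrier (hom_sp V W) ==> graph (ungraph V W a) = a"
  by (auto elim!: hom_cases)

lemma hom_add: "f : L V W ==> g : L V W ==> add (hom_sp V W) (graph f) (graph g) = graph (lin_add f g)"
  and hom_smult: "f : L V W ==> smult (hom_sp V W) c (graph f) = graph (lin_smult c f)"
  and hom_zero: "zero (hom_sp V W) = graph (lin_zero V W)"
  by (simp_all add: hom_sp_def)

lemma L_small: assumes "V : Obj" "W : Obj" shows "small (L V W)"
proof -
  have "L V W <= (%\<phi>. \<lparr>src = V, tgt = W, fn = \<phi>\<rparr>) ` PiE (carrier V) (%_. carrier W)"
  proof
    fix f assume f: "f : L V W"
    then have "f = \<lparr>src = V, tgt = W, fn = fn f\<rparr>" by (simp add: L_iff)
    moreover have "fn f : PiE (carrier V) (%_. carrier W)"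
      using f by (auto simp: L_iff PiE_def is_linear_def)
    ultimately show "f : (%\<phi>. \<lparr>src = V, tgt = W, fn = \<phi>\<rparr>) ` PiE (carrier V) (%_. carrier W)" by blast
  qed
  then show ?thesis
    by (rule small_subset[rotated]) (intro small_image small_PiE Obj_small assms)
qed

text \<open>The coordinates on the space of maps are evaluations at the vectors of \<open>V\<close>;
  \<open>module_coords\<close> does the rest.\<close>

lemma hom_Obj[simp, intro]: assumes V: "V : Obj" and W: "W : Obj" shows "hom_sp V W : Obj"
  unfolding Obj_iff
proof
  show "small (carrier (hom_sp V W))" unfolding carrier_hom by (intro small_image L_small V W)
  show "module K (hom_sp V W)"
  proof (rule module_coords[of "carrier V" "%_. W" _ "%v a. fn (ungraph V W a) v"])
    show "x = y" if "x : carrier (hom_sp V W)" "y : carrier (hom_sp V W)"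
      "!!j. j : carrier V ==> fn (ungraph V W x) j = fn (ungraph V W y) j" for x y
    proof -
      have "ungraph V W x = ungraph V W y"
        by (rule L_eqI[OF ungraph_L(1)[OF that(1)] ungraph_L(1)[OF that(2)] that(3)])
      then have "graph (ungraph V W x) = graph (ungraph V W y)" by (rule arg_cong)
      then show ?thesis unfolding ungraph_L(2)[OF that(1)] ungraph_L(2)[OF that(2)] .
    qed
    fix x y assume xy: "x : carrier (hom_sp V W)" "y : carrier (hom_sp V W)"
    obtain f where f: "f : L V W" "x = graph f" using xy(1) by (rule hom_cases)
    obtain g where g: "g : L V W" "y = graph g" using xy(2) by (rule hom_cases)
    note fg = lin_add_L[OF f(1) g(1)]
    show "add (hom_sp V W) x y : carrier (hom_sp V W)"
      unfolding f(2) g(2) hom_add[OF f(1) g(1)] by (rule graph_in[OF fg])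
    show "fn (ungraph V W (add (hom_sp V W) x y)) v =
        add W (fn (ungraph V W x) v) (fn (ungraph V W y) v)" if "v : carrier V" for v
      unfolding f(2) g(2) hom_add[OF f(1) g(1)] ungraph_graph[OF fg] ungraph_graph[OF f(1)]
        ungraph_graph[OF g(1)] by (rule lin_add_app[OF f(1) that])
  next
    fix c x assume c: "c : carrier K" and x: "x : carrier (hom_sp V W)"
    obtain f where f: "f : L V W" "x = graph f" using x by (rule hom_cases)
    note fg = lin_smult_L[OF f(1) c]
    show "smult (hom_sp V W) c x : carrier (hom_sp V W)"
      unfolding f(2) hom_smult[OF f(1)] by (rule graph_in[OF fg])
    show "fn (ungraph V W (smult (hom_sp V W) c x)) v = smult W c (fn (ungraph V W x) v)"
      if "v : carrier V" for v
      unfolding f(2) hom_smult[OF f(1)] ungraph_graph[OF fg] ungraph_graph[OF f(1)]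
      by (rule lin_smult_app[OF f(1) that])
  next
    show "zero (hom_sp V W) : carrier (hom_sp V W)"
      unfolding hom_zero by (rule graph_in[OF lin_zero_L[OF V W]])
    show "fn (ungraph V W (zero (hom_sp V W))) v = zero W" if "v : carrier V" for v
      unfolding hom_zero ungraph_graph[OF lin_zero_L[OF V W]] using that by (rule lin_zero_app)
    show "fn (ungraph V W x) v : carrier W" if "v : carrier V" "x : carrier (hom_sp V W)" for v x
      by (rule L_app[OF ungraph_L(1)[OF that(2)] that(1)])
  qed (rule Obj_module[OF W])
qed

lemma comp_lin_add:
  assumes "g : L V W" "h : L U V" "h' : L U V" shows "g oo lin_add h h' = lin_add (g oo h) (g oo h')"
  by (rule L_eqI[of _ U W])
     (use assms in \<open>auto simp: lin_add_L lin_add_app comp_app'[of _ U V] L_comp L_app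
        lin_add_app[of "g oo h" U W] L_add[OF assms(1)]\<close>)

lemma comp_lin_smult:
  assumes "g : L V W" "h : L U V" "c : carrier K" shows "g oo lin_smult c h = lin_smult c (g oo h)"
  by (rule L_eqI[of _ U W])
     (use assms in \<open>auto simp: lin_smult_L lin_smult_app comp_app'[of _ U V] L_comp L_app
        lin_smult_app[of "g oo h" U W] L_smult[OF assms(1)]\<close>)

lemma lin_add_comp:
  assumes "f : L U V" "h : L V W" "h' : L V W" shows "lin_add h h' oo f = lin_add (h oo f) (h' oo f)"
  by (rule L_eqI[of _ U W])
     (use assms in \<open>auto simp: lin_add_L lin_add_app[of _ V W] comp_app'[of _ U V] L_comp L_app
        lin_add_app[of "h oo f" U W] L_comp[OF lin_add_L[OF assms(2,3)] assms(1)]\<close>)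

lemma lin_smult_comp:
  assumes "f : L U V" "h : L V W" "c : carrier K" shows "lin_smult c h oo f = lin_smult c (h oo f)"
  by (rule L_eqI[of _ U W])
     (use assms in \<open>auto simp: lin_smult_L lin_smult_app[of _ V W] comp_app'[of _ U V] L_comp L_app
        lin_smult_app[of "h oo f" U W] L_comp[OF lin_smult_L[OF assms(2,3)] assms(1)]\<close>)

lemma hom_map_app:
  assumes "f : L V' V" "g : L W W'" "h : L V W"
  shows "fn (hom_map f g) (graph h) = graph (g oo h oo f)"
  using assms by (simp add: hom_map_def L_src graph_in)

lemma hom_map_L:
  assumes f: "f : L V' V" and g: "g : L W W'"
  shows "hom_map f g : L (hom_sp V W) (hom_sp V' W')"
proof -
  have "hom_map f g = mk (hom_sp V W) (hom_sp V' W') (%a. graph (g oo ungraph V W a oo f))"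
    using f g by (simp add: hom_map_def mk_def L_src)
  moreover have "is_linear K (hom_sp V W) (hom_sp V' W') (%a. graph (g oo ungraph V W a oo f))"
  proof (rule is_linearI)
    fix x y c assume x: "x : carrier (hom_sp V W)" and y: "y : carrier (hom_sp V W)"
    obtain h where h: "h : L V W" "x = graph h" using x by (rule hom_cases)
    obtain k where k: "k : L V W" "y = graph k" using y by (rule hom_cases)
    note hf = L_comp[OF h(1) f] and kf = L_comp[OF k(1) f]
    show "graph (g oo ungraph V W (add (hom_sp V W) x y) oo f) =
      add (hom_sp V' W') (graph (g oo ungraph V W x oo f)) (graph (g oo ungraph V W y oo f))"
      using h k f g by (simp add: hom_add lin_add_L lin_add_comp comp_lin_add[OF g hf kf]
         hom_add[OF L_comp[OF g hf] L_comp[OF g kf]])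
  next
    fix x c assume x: "x : carrier (hom_sp V W)" and c: "c : carrier K"
    obtain h where h: "h : L V W" "x = graph h" using x by (rule hom_cases)
    note hf = L_comp[OF h(1) f]
    show "graph (g oo ungraph V W (smult (hom_sp V W) c x) oo f) =
      smult (hom_sp V' W') c (graph (g oo ungraph V W x oo f))"
      using h c f g by (simp add: hom_smult lin_smult_L lin_smult_comp comp_lin_smult[OF g hf c]
         hom_smult[OF L_comp[OF g hf]])
  qed (auto elim!: hom_cases intro!: graph_in L_comp[OF g L_comp[OF _ f]])
  ultimately show ?thesis using L_Ob[OF f] L_Ob[OF g] by (simp add: mk_L)
qed

lemma linear_into_hom:
  assumes F: "!!w. w : carrier W ==> F w : L V U"
    and a: "!!w w' v. w : carrier W ==> w' : carrier W ==> v : carrier V ==>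
      fn (F (add W w w')) v = add U (fn (F w) v) (fn (F w') v)"
    and s: "!!c w v. c : carrier K ==> w : carrier W ==> v : carrier V ==>
      fn (F (smult W c w)) v = smult U c (fn (F w) v)"
    and W: "W : Obj"
  shows "is_linear K W (hom_sp V U) (%w. graph (F w))"
proof (rule is_linearI)
  show "graph (F (add W x y)) = add (hom_sp V U) (graph (F x)) (graph (F y))"
    if xy: "x : carrier W" "y : carrier W" for x y
    unfolding hom_add[OF F[OF xy(1)] F[OF xy(2)]]
    by (rule arg_cong[of _ _ graph], rule L_eqI[of _ V U])
       (use xy W F a in \<open>auto simp: lin_add_L lin_add_app[OF F]\<close>)
  show "graph (F (smult W c x)) = smult (hom_sp V U) c (graph (F x))"
    if cx: "c : carrier K" "x : carrier W" for c x
    unfolding hom_smult[OF F[OF cx(2)]]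
    by (rule arg_cong[of _ _ graph], rule L_eqI[of _ V U])
       (use cx W F s in \<open>auto simp: lin_smult_L lin_smult_app[OF F]\<close>)
qed (use F graph_in in auto)

subsection \<open>Tensor products\<close>

lemma bilinearI:
  assumes "!!v w. v : carrier V ==> w : carrier W ==> \<beta> v w : carrier Z"
    "!!v v' w. v : carrier V ==> v' : carrier V ==> w : carrier W ==> \<beta> (add V v v') w = add Z (\<beta> v w) (\<beta> v' w)"
    "!!v w w'. v : carrier V ==> w : carrier W ==> w' : carrier W ==> \<beta> v (add W w w') = add Z (\<beta> v w) (\<beta> v w')"
    "!!c v w. c : carrier K ==> v : carrier V ==> w : carrier W ==> \<beta> (smult V c v) w = smult Z c (\<beta> v w)"
    "!!c v w. c : carrier K ==> v : carrier V ==> w : carrier W ==> \<beta> v (smult W c w) = smult Z c (\<beta> v w)"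
  shows "is_bilinear K V W Z \<beta>"
  using assms unfolding is_bilinear_def is_linear_def by auto

lemma bilinearD:
  assumes "is_bilinear K V W Z \<beta>"
  shows "v : carrier V ==> w : carrier W ==> \<beta> v w : carrier Z"
    "v : carrier V ==> v' : carrier V ==> w : carrier W ==> \<beta> (add V v v') w = add Z (\<beta> v w) (\<beta> v' w)"
    "v : carrier V ==> w : carrier W ==> w' : carrier W ==> \<beta> v (add W w w') = add Z (\<beta> v w) (\<beta> v w')"
    "c : carrier K ==> v : carrier V ==> w : carrier W ==> \<beta> (smult V c v) w = smult Z c (\<beta> v w)"
    "c : carrier K ==> v : carrier V ==> w : carrier W ==> \<beta> v (smult W c w) = smult Z c (\<beta> v w)"
  using assms unfolding is_bilinear_def is_linear_def by auto

text \<open>Instance of \<open>universal\<close> for the class of all bilinear maps on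
  \<open>V\<close> and \<open>W\<close>. A scalar multiple of the value at \<open>(v, w)\<close> is
  the value at \<open>(c v, w)\<close>, so one-element lists suffice.\<close>

lemma tensor_exists:
  assumes V: "V : Obj" and W: "W : Obj"
  shows "EX T t. is_tensor V W T t"
proof -
  define P where "P = {(Z, \<beta>). Z : Obj & is_bilinear K V W Z (%v w. \<beta> (v, w))}"
  let ?I = "carrier V \<times> carrier W"
  have PD: "fst p : Obj" "is_bilinear K V W (fst p) (%v w. snd p (v, w))" if "p : P" for p
    using that by (auto simp: P_def)
  note bil = bilinearD[OF PD(2)]
  obtain T t H where T: "T : Obj" "!!i. i : ?I ==> t i : carrier T"
    "!!p. p : P ==> H p : L T (fst p)" "!!p i. p : P ==> i : ?I ==> fn (H p) (t i) = snd p i"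
    and sep: "!!x y. x : carrier T ==> y : carrier T ==> (!!p. p : P ==> fn (H p) x = fn (H p) y) ==> x = y"
    and sp: "spans T (t ` ?I)"
  proof (rule universal[of P ?I ?I])
    show "small ?I" using V W by (intro small_Sigma Obj_small)
    show "EX l:lists ?I. ALL p:P. smult (fst p) c (snd p i) = lsum (fst p) (snd p) l"
      if "c : carrier K" "i : ?I" for c i
      using that PD(1) V bil(1,4)
      by (intro bexI[of _ "[(smult V c (fst i), snd i)]"]) (auto split: prod.splits)
  qed (use PD bil(1) in auto)
  note HS = L_add[OF T(3)] L_smult[OF T(3)]
  have "is_bilinear K V W T (%v w. t (v, w))"
    by (rule bilinearI; (rule sep)?) (use T V W bil in \<open>auto simp: HS\<close>)
  moreover have "EX! h. h : L T Z & (ALL v:carrier V. ALL w:carrier W. fn h (t (v, w)) = \<beta> v w)"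
    if Z: "Z : Obj" "is_bilinear K V W Z \<beta>" for Z \<beta>
  proof -
    have p: "(Z, %(v, w). \<beta> v w) : P" using Z by (simp add: P_def)
    show ?thesis
    proof (rule ex1I[of _ "H (Z, %(v, w). \<beta> v w)"])
      show "H (Z, %(v, w). \<beta> v w) : L T Z &
          (ALL v:carrier V. ALL w:carrier W. fn (H (Z, %(v, w). \<beta> v w)) (t (v, w)) = \<beta> v w)"
        using T(3)[OF p] T(4)[OF p] by auto
      fix h assume h: "h : L T Z & (ALL v:carrier V. ALL w:carrier W. fn h (t (v, w)) = \<beta> v w)"
      show "h = H (Z, %(v, w). \<beta> v w)"
        by (rule spans_eqI[OF sp]) (use T(2) T(3)[OF p] T(4)[OF p] h in auto)
    qed
  qed
  ultimately have "is_tensor V W T (%v w. t (v, w))" unfolding is_tensor_def using T(1)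
    by (intro conjI ballI allI impI)
  then show ?thesis by blast
qed

abbreviation pt where "pt \<equiv> pure_tensor"

lemma tens_is_tensor:
  assumes V: "V : Obj" and W: "W : Obj"
  shows "is_tensor V W (tens V W) (pt V W)"
proof -
  have "case tensor V W of (T, t) => is_tensor V W T t" unfolding tensor_def
    by (rule someI_ex) (use tensor_exists[OF V W] in auto)
  then show ?thesis by (simp add: tens_def pure_tensor_def split_beta)
qed

lemma tens_Obj[simp, intro]: "V : Obj ==> W : Obj ==> tens V W : Obj"
  using tens_is_tensor unfolding is_tensor_def by blast

lemma pt_bilinear: "V : Obj ==> W : Obj ==> is_bilinear K V W (tens V W) (pt V W)"
  using tens_is_tensor unfolding is_tensor_def by blast

lemmas pt_closed[simp, intro] = bilinearD(1)[OF pt_bilinear]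
lemmas pt_add1 = bilinearD(2)[OF pt_bilinear]
lemmas pt_add2 = bilinearD(3)[OF pt_bilinear]
lemmas pt_smult1 = bilinearD(4)[OF pt_bilinear]
lemmas pt_smult2 = bilinearD(5)[OF pt_bilinear]

lemma tens_ex1:
  assumes "V : Obj" "W : Obj" "Z : Obj" "is_bilinear K V W Z \<beta>"
  shows "EX! h. h : L (tens V W) Z & (ALL v:carrier V. ALL w:carrier W. fn h (pt V W v w) = \<beta> v w)"
proof -
  have "ALL Z:Obj. ALL \<beta>. is_bilinear K V W Z \<beta> -->
    (EX! h. h : L (tens V W) Z & (ALL v:carrier V. ALL w:carrier W. fn h (pt V W v w) = \<beta> v w))"
    using tens_is_tensor[OF assms(1,2)] unfolding is_tensor_def by (elim conjE)
  then show ?thesis using assms(3,4) by simp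
qed

lemma tens_lift:
  assumes "V : Obj" "W : Obj" "Z : Obj" "is_bilinear K V W Z \<beta>"
  obtains h where "h : L (tens V W) Z" "!!v w. v : carrier V ==> w : carrier W ==> fn h (pt V W v w) = \<beta> v w"
  using ex1_implies_ex[OF tens_ex1[OF assms]] that by (elim exE conjE) simp

lemma tens_eqI:
  assumes V: "V : Obj" "W : Obj" and f: "f : L (tens V W) Z" and g: "g : L (tens V W) Z"
    and e: "!!v w. v : carrier V ==> w : carrier W ==> fn f (pt V W v w) = fn g (pt V W v w)"
  shows "f = g"
proof -
  have "is_bilinear K V W Z (%v w. fn f (pt V W v w))"
    by (rule bilinearI)
       (use V in \<open>auto simp: pt_add1 pt_add2 pt_smult1 pt_smult2 L_add[OF f] L_smult[OF f] intro!: L_app[OF f]\<close>)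
  then have "EX! h. h : L (tens V W) Z & (ALL v:carrier V. ALL w:carrier W. fn h (pt V W v w) = fn f (pt V W v w))"
    by (rule tens_ex1[OF V L_Ob(2)[OF f]])
  then obtain h where h: "ALL h'. h' : L (tens V W) Z &
      (ALL v:carrier V. ALL w:carrier W. fn h' (pt V W v w) = fn f (pt V W v w)) --> h' = h"
    by (elim ex1E) (rule that)
  show ?thesis using h[THEN spec, of f] h[THEN spec, of g] f g e by simp
qed

text \<open>Uniqueness in the universal property says that pure tensors separate maps, and
  \<open>spansI\<close> converts separation into spanning.\<close>

lemma tens_spans:
  assumes "V : Obj" "W : Obj"
  shows "spans (tens V W) {pt V W v w | v w. v : carrier V & w : carrier W}"
  by (rule spansI) (use assms in \<open>auto intro!: tens_eqI[OF assms]\<close>)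

lemma tens_induct:
  assumes V: "V : Obj" "W : Obj" "x : carrier (tens V W)"
    and P: "!!v w. v : carrier V ==> w : carrier W ==> P (pt V W v w)"
    "P (zero (tens V W))"
    "!!x y. x : carrier (tens V W) ==> y : carrier (tens V W) ==> P x ==> P y ==> P (add (tens V W) x y)"
    "!!c x. c : carrier K ==> x : carrier (tens V W) ==> P x ==> P (smult (tens V W) c x)"
  shows "P x"
  by (rule spans_induct[OF tens_spans[OF V(1,2)] V(3)]) (use V P in auto)

lemma tens_map_unique:
  assumes f: "f : L V V'" and g: "g : L W W'"
  shows "tens_map f g : L (tens V W) (tens V' W') &
    (ALL v:carrier V. ALL w:carrier W. fn (tens_map f g) (pt V W v w) = pt V' W' (fn f v) (fn g w))"
proof -
  note O = L_Ob[OF f] L_Ob[OF g]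
  have b: "is_bilinear K V W (tens V' W') (%v w. pt V' W' (fn f v) (fn g w))"
    by (rule bilinearI)
       (use O in \<open>auto simp: pt_add1 pt_add2 pt_smult1 pt_smult2 L_add[OF f] L_smult[OF f] L_add[OF g] L_smult[OF g]
         L_app[OF f] L_app[OF g]\<close>)
  then have "EX! h. h : L (tens V W) (tens V' W') &
      (ALL v:carrier V. ALL w:carrier W. fn h (pt V W v w) = pt V' W' (fn f v) (fn g w))"
    by (intro tens_ex1 tens_Obj O)
  from theI'[OF this] show ?thesis using f g by (simp add: tens_map_def L_src)
qed

lemma tens_map_L[intro]: "f : L V V' ==> g : L W W' ==> tens_map f g : L (tens V W) (tens V' W')"
  using tens_map_unique by blast

lemma tens_map_pt: "f : L V V' ==> g : L W W' ==> v : carrier V ==> w : carrier W ==>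
    fn (tens_map f g) (pt V W v w) = pt V' W' (fn f v) (fn g w)"
  using tens_map_unique by blast

lemma tens_map_id[simp]: "V : Obj ==> W : Obj ==> tens_map (idV V) (idV W) = idV (tens V W)"
  by (rule tens_eqI[of V W _ "tens V W"]) (auto simp: tens_map_pt[of _ V V _ W W])

lemma tens_map_comp:
  assumes f: "f : L V V'" and g: "g : L W W'" and f': "f' : L V' V''" and g': "g' : L W' W''"
  shows "tens_map f' g' oo tens_map f g = tens_map (f' oo f) (g' oo g)"
proof (rule tens_eqI[of V W _ "tens V'' W''"])
  note t = tens_map_L[OF f g] tens_map_L[OF f' g']
  show "fn (tens_map f' g' oo tens_map f g) (pt V W v w) = fn (tens_map (f' oo f) (g' oo g)) (pt V W v w)"
    if "v : carrier V" "w : carrier W" for v w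
    using that L_Ob[OF f] L_Ob[OF g]
    by (simp add: comp_app'[OF t(1)] tens_map_pt[OF f g] tens_map_pt[OF f' g'] L_app[OF f] L_app[OF g]
      tens_map_pt[OF L_comp[OF f' f] L_comp[OF g' g]] comp_app'[OF f] comp_app'[OF g])
  show "tens_map f' g' oo tens_map f g : L (tens V W) (tens V'' W'')" by (rule L_comp[OF t(2,1)])
  show "tens_map (f' oo f) (g' oo g) : L (tens V W) (tens V'' W'')"
    by (intro tens_map_L L_comp[OF f' f] L_comp[OF g' g])
qed (use L_Ob[OF f] L_Ob[OF g] in auto)

lemma tens_map_add2:
  assumes f: "f : L V V'" and g: "g : L W W'" and h: "h : L W W'"
  shows "tens_map f (lin_add g h) = lin_add (tens_map f g) (tens_map f h)"
proof (rule tens_eqI[of V W _ "tens V' W'"])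
  note t = tens_map_L[OF f g] tens_map_L[OF f h] lin_add_L[OF g h]
  show "fn (tens_map f (lin_add g h)) (pt V W v w) = fn (lin_add (tens_map f g) (tens_map f h)) (pt V W v w)"
    if "v : carrier V" "w : carrier W" for v w
    using that L_Ob[OF f] L_Ob[OF g]
    by (simp add: tens_map_pt[OF f t(3)] lin_add_app[OF g] lin_add_app[OF t(1)] tens_map_pt[OF f g]
      tens_map_pt[OF f h] pt_add2 L_app[OF f] L_app[OF g] L_app[OF h])
qed (use L_Ob[OF f] L_Ob[OF g] f g h in \<open>auto intro!: tens_map_L lin_add_L\<close>)

lemma tens_map_smult2:
  assumes f: "f : L V V'" and g: "g : L W W'" and c: "c : carrier K"
  shows "tens_map f (lin_smult c g) = lin_smult c (tens_map f g)"
proof (rule tens_eqI[of V W _ "tens V' W'"])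
  note t = tens_map_L[OF f g] lin_smult_L[OF g c]
  show "fn (tens_map f (lin_smult c g)) (pt V W v w) = fn (lin_smult c (tens_map f g)) (pt V W v w)"
    if "v : carrier V" "w : carrier W" for v w
    using that L_Ob[OF f] L_Ob[OF g] c
    by (simp add: tens_map_pt[OF f t(2)] lin_smult_app[OF g] lin_smult_app[OF t(1)] tens_map_pt[OF f g]
      pt_smult2 L_app[OF f] L_app[OF g])
qed (use L_Ob[OF f] L_Ob[OF g] f g c in \<open>auto intro!: tens_map_L lin_smult_L\<close>)


section \<open>Linear functors and natural transformations\<close>

abbreviation "lf \<equiv> linear_functor"
abbreviation "el F V \<equiv> carrier (Fo F V)"
abbreviation "ap X f x \<equiv> fn (Fa X f) x"

lemma lf_Ob: "lf X ==> V : Obj ==> Fo X V : Obj"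
  unfolding linear_functor_def is_functor_def by blast

lemma lf_L: assumes "lf X" "f : L V W" shows "Fa X f : L (Fo X V) (Fo X W)"
proof -
  have "ALL f:Ar Vect. Fa X f : L (Fo X (src f)) (Fo X (tgt f))"
    using assms(1) unfolding linear_functor_def is_functor_def by simp
  then show ?thesis using assms(2) L_Ar[OF assms(2)] L_src[OF assms(2)] by fastforce
qed

lemma lf_id: "lf X ==> V : Obj ==> Fa X (idV V) = idV (Fo X V)"
  unfolding linear_functor_def is_functor_def by blast

lemma lf_comp: assumes "lf X" "g : L V W" "f : L U V" shows "Fa X (g oo f) = Fa X g oo Fa X f"
proof -
  have "ALL f:Ar Vect. ALL g:Ar Vect. src g = tgt f --> Fa X (g oo f) = Fa X g oo Fa X f"
    using assms(1) unfolding linear_functor_def is_functor_def by simp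
  then show ?thesis using assms(2,3) by (simp add: L_Ar L_src)
qed

lemma lf_add: "lf X ==> f : L V W ==> g : L V W ==> Fa X (lin_add f g) = lin_add (Fa X f) (Fa X g)"
  unfolding linear_functor_def using L_Ob by blast

lemma lf_smult: "lf X ==> f : L V W ==> c : carrier K ==> Fa X (lin_smult c f) = lin_smult c (Fa X f)"
  unfolding linear_functor_def using L_Ob by blast

lemma lfI:
  assumes "!!V. V : Obj ==> Fo X V : Obj"
    and L: "!!f V W. f : L V W ==> Fa X f : L (Fo X V) (Fo X W)"
    and id: "!!V x. V : Obj ==> x : el X V ==> ap X (idV V) x = x"
    and comp: "!!f g U V W x. g : L V W ==> f : L U V ==> x : el X U ==>
      ap X (g oo f) x = ap X g (ap X f x)"
    and add: "!!f g V W x. f : L V W ==> g : L V W ==> x : el X V ==>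
      ap X (lin_add f g) x = add (Fo X W) (ap X f x) (ap X g x)"
    and smult: "!!f c V W x. f : L V W ==> c : carrier K ==> x : el X V ==>
      ap X (lin_smult c f) x = smult (Fo X W) c (ap X f x)"
  shows "lf X"
  unfolding linear_functor_def is_functor_def
proof (intro conjI ballI impI)
  show "Fa X (idV V) = idV (Fo X V)" if V: "V : Obj" for V
    by (rule L_eqI[OF L[OF idV_L[OF V]] idV_L]) (use V assms(1) id in auto)
  show "Fa X f : L (Fo X (Dom Vect f)) (Fo X (Cod Vect f))" if "f : Ar Vect" for f
    using that L unfolding Ar_L by simp
  show "Fa X (g oo f) = Fa X g oo Fa X f" if "f : Ar Vect" "g : Ar Vect" "Dom Vect g = Cod Vect f" for f g
  proof -
    have f: "f : L (src f) (tgt f)" and g: "g : L (tgt f) (tgt g)" using that by (simp_all add: Ar_L)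
    show ?thesis
      by (rule L_eqI[OF L[OF L_comp[OF g f]] L_comp[OF L[OF g] L[OF f]]])
         (simp add: comp[OF g f] comp_app'[OF L[OF f]])
  qed
  show "Fa X (lin_add f g) = lin_add (Fa X f) (Fa X g)" if f: "f : L V W" and g: "g : L V W" for f g V W
    by (rule L_eqI[OF L[OF lin_add_L[OF f g]] lin_add_L[OF L[OF f] L[OF g]]])
       (simp add: add[OF f g] lin_add_app[OF L[OF f]])
  show "Fa X (lin_smult c f) = lin_smult c (Fa X f)" if f: "f : L V W" and c: "c : carrier K" for f c V W
    by (rule L_eqI[OF L[OF lin_smult_L[OF f c]] lin_smult_L[OF L[OF f] c]])
       (simp add: smult[OF f c] lin_smult_app[OF L[OF f]])
qed (use assms(1) in auto)

lemma ap_closed: "lf X ==> f : L V W ==> x : el X V ==> ap X f x : el X W"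
  using L_app[OF lf_L] by blast

lemma ap_id: "lf X ==> V : Obj ==> x : el X V ==> ap X (idV V) x = x"
  by (simp add: lf_id)

lemma ap_comp: "lf X ==> g : L V W ==> f : L U V ==> x : el X U ==>
    ap X (g oo f) x = ap X g (ap X f x)"
  using comp_app'[OF lf_L] by (simp add: lf_comp)

lemma ap_lin_add: "lf X ==> f : L V W ==> g : L V W ==> x : el X V ==>
    ap X (lin_add f g) x = add (Fo X W) (ap X f x) (ap X g x)"
  using lin_add_app[OF lf_L] by (simp add: lf_add)

lemma ap_lin_smult: "lf X ==> f : L V W ==> c : carrier K ==> x : el X V ==>
    ap X (lin_smult c f) x = smult (Fo X W) c (ap X f x)"
  using lin_smult_app[OF lf_L] by (simp add: lf_smult)

lemma ap_add: "lf X ==> f : L V W ==> x : el X V ==> y : el X V ==>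
    ap X f (add (Fo X V) x y) = add (Fo X W) (ap X f x) (ap X f y)"
  using L_add[OF lf_L] by blast

lemma ap_smult: "lf X ==> f : L V W ==> c : carrier K ==> x : el X V ==>
    ap X f (smult (Fo X V) c x) = smult (Fo X W) c (ap X f x)"
  using L_smult[OF lf_L] by blast

lemma ap_zero: "lf X ==> f : L V W ==> ap X f (zero (Fo X V)) = zero (Fo X W)"
  using L_zero[OF lf_L] by blast

section \<open>Preservation of zero, and automatic linearity of natural maps\<close>

lemma lin_zero_alt: "V : Obj ==> W : Obj ==> lin_smult (zero K) (lin_zero V W) = lin_zero V W"
  by (rule L_eqI[of _ V W]) (auto intro!: lin_smult_L lin_zero_L simp: lin_smult_app[OF lin_zero_L])

lemma ap_lin_zero: assumes "lf X" "V : Obj" "W : Obj" "x : el X V"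
  shows "ap X (lin_zero V W) x = zero (Fo X W)"
  using ap_lin_smult[OF assms(1) lin_zero_L[OF assms(2,3)] zero_closed assms(4)]
    ap_closed[OF assms(1) lin_zero_L[OF assms(2,3)] assms(4)] lf_Ob[OF assms(1,3)]
  by (simp add: lin_zero_alt assms)

text \<open>In the biproduct of \<open>A\<close> and \<open>B\<close> the element
  \<open>X(i) x + X(j) y\<close> projects to both given elements, the mixed terms being zero. Any
  two elements thus come from a single one along two arrows.\<close>

lemma merge:
  assumes X: "lf X" and A: "A : Obj" "x : el X A" and B: "B : Obj" "y : el X B"
  obtains P p q z where "P : Obj" "p : L P A" "q : L P B" "z : el X P"
    "ap X p z = x" "ap X q z = y"
proof -
  obtain P p q i j where P: "P : Obj" "p : L P A" "q : L P B" "i : L A P" "j : L B P"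
    "!!x. x : carrier A ==> fn p (fn i x) = x" "!!x. x : carrier A ==> fn q (fn i x) = zero B"
    "!!x. x : carrier B ==> fn q (fn j x) = x" "!!x. x : carrier B ==> fn p (fn j x) = zero A"
    using biproduct[OF A(1) B(1)] by blast
  have e: "p oo i = idV A" "q oo i = lin_zero A B" "q oo j = idV B" "p oo j = lin_zero B A"
    by (rule L_eqI[OF L_comp[OF P(2,4)] idV_L[OF A(1)]], simp add: comp_app'[OF P(4)] P,
        rule L_eqI[OF L_comp[OF P(3,4)] lin_zero_L[OF A(1) B(1)]], simp add: comp_app'[OF P(4)] P,
        rule L_eqI[OF L_comp[OF P(3,5)] idV_L[OF B(1)]], simp add: comp_app'[OF P(5)] P,
        rule L_eqI[OF L_comp[OF P(2,5)] lin_zero_L[OF B(1) A(1)]], simp add: comp_app'[OF P(5)] P)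
  let ?a = "ap X i x" and ?b = "ap X j y"
  note ab = ap_closed[OF X P(4) A(2)] ap_closed[OF X P(5) B(2)]
  let ?z = "add (Fo X P) ?a ?b"
  note O = lf_Ob[OF X A(1)] lf_Ob[OF X B(1)] lf_Ob[OF X P(1)]
  have "ap X p ?a = x" "ap X q ?b = y" "ap X p ?b = zero (Fo X A)" "ap X q ?a = zero (Fo X B)"
    using ap_comp[OF X P(2,4) A(2)] ap_comp[OF X P(3,5) B(2)] ap_comp[OF X P(2,5) B(2)]
      ap_comp[OF X P(3,4) A(2)]
    by (simp_all add: e ap_id[OF X] ap_lin_zero[OF X] A B)
  then have "ap X p ?z = x" "ap X q ?z = y"
    by (simp_all add: ap_add[OF X P(2) ab] ap_add[OF X P(3) ab] O A B)
  then show ?thesis using that P(1-3) ab O by blast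
qed

text \<open>With \<open>x\<close> and \<open>y\<close> merged into \<open>z\<close> along
  \<open>p\<close> and \<open>q\<close>, the sum is \<open>X(p + q) z\<close>. Naturality at
  \<open>p\<close>, \<open>q\<close> and \<open>p + q\<close>, together with additivity of
  \<open>Y\<close>, gives additivity of \<open>g\<close>; scalars are naturality at multiples of the
  identity.\<close>

lemma auto_linear:
  assumes X: "lf X" and Y: "lf Y"
    and cl: "!!H x. H : Obj ==> x : el X H ==> g H x : el Y H"
    and nat: "!!f V W x. f : L V W ==> x : el X V ==> g W (ap X f x) = ap Y f (g V x)"
    and H: "H : Obj"
  shows "is_linear K (Fo X H) (Fo Y H) (g H)"
proof (rule is_linearI)
  fix x y assume x: "x : el X H" and y: "y : el X H"
  obtain P p q z where P: "P : Obj" "p : L P H" "q : L P H" "z : el X P"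
    "ap X p z = x" "ap X q z = y" using merge[OF X H x H y] by blast
  note s = lin_add_L[OF P(2,3)]
  have "g H (add (Fo X H) x y) = g H (ap X (lin_add p q) z)"
    by (simp add: ap_lin_add[OF X P(2,3,4)] P)
  also have "\<dots> = ap Y (lin_add p q) (g P z)" by (rule nat[OF s P(4)])
  also have "\<dots> = add (Fo Y H) (ap Y p (g P z)) (ap Y q (g P z))"
    by (rule ap_lin_add[OF Y P(2,3) cl[OF P(1,4)]])
  also have "\<dots> = add (Fo Y H) (g H x) (g H y)"
    using nat[OF P(2,4)] nat[OF P(3,4)] by (simp add: P)
  finally show "g H (add (Fo X H) x y) = add (Fo Y H) (g H x) (g H y)" .
next
  fix c x assume c: "c : carrier K" and x: "x : el X H"
  note i = idV_L[OF H] and s = lin_smult_L[OF idV_L[OF H] c]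
  show "g H (smult (Fo X H) c x) = smult (Fo Y H) c (g H x)"
    using nat[OF s x] ap_lin_smult[OF X i c x] ap_lin_smult[OF Y i c cl[OF H x]]
    by (simp add: ap_id[OF X H x] ap_id[OF Y H cl[OF H x]])
qed (rule cl[OF H])

subsection \<open>Natural transformations\<close>

lemma FunVect_simps[simp]: "Dom FunVect = src" "Cod FunVect = tgt" "Ob FunVect = {F. lf F}"
  "Cmp FunVect t s = \<lparr>src = src s, tgt = tgt t, fn = (\<lambda>H\<in>Obj. fn t H oo fn s H)\<rparr>"
  "Idn FunVect X = \<lparr>src = X, tgt = X, fn = (\<lambda>H\<in>Obj. idV (Fo X H))\<rparr>"
  by (auto simp: FunVect_def full_subcat_def fun_cat_def linear_functor_def)

lemma Ind_simps[simp]: "Dom Ind = src" "Cod Ind = tgt" "Ob Ind = {F. lf F & small_functor F}"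
  "Cmp Ind = Cmp FunVect" "Idn Ind = Idn FunVect"
  by (auto simp: Ind_def full_subcat_def FunVect_def fun_cat_def linear_functor_def)

abbreviation "NT \<equiv> Mor FunVect"

lemma NT_iff: "t : NT X Y \<longleftrightarrow> lf X & lf Y & src t = X & tgt t = Y & fn t : extensional Obj &
    (ALL H:Obj. fn t H : L (Fo X H) (Fo Y H)) &
    (ALL f:Ar Vect. fn t (tgt f) oo Fa X f = Fa Y f oo fn t (src f))"
  by (auto simp: Mor_def[of FunVect]) (auto simp: FunVect_def full_subcat_def fun_cat_def is_nat_def linear_functor_def)

lemma Ar_FunVect: "t : Ar FunVect \<longleftrightarrow> t : NT (src t) (tgt t)"
  by (simp add: Mor_def)

lemma Mor_Ind: "X : Ob Ind ==> Y : Ob Ind ==> Mor Ind X Y = NT X Y"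
  by (auto simp: Mor_def Ind_def full_subcat_def)

lemma Ar_Ind: "t : Ar Ind \<longleftrightarrow> src t : Ob Ind & tgt t : Ob Ind & t : NT (src t) (tgt t)"
  unfolding Ar_FunVect[symmetric]
  by (auto simp: Ind_def full_subcat_def Ar_FunVect NT_iff)

abbreviation "nt t H x \<equiv> fn (fn t H) x"

lemma NT_src: "t : NT X Y ==> src t = X" "t : NT X Y ==> tgt t = Y" by (auto simp: NT_iff)
lemma NT_lf: "t : NT X Y ==> lf X" "t : NT X Y ==> lf Y" by (auto simp: NT_iff)
lemma NT_L: "t : NT X Y ==> H : Obj ==> fn t H : L (Fo X H) (Fo Y H)" by (auto simp: NT_iff)

lemma nt_closed: "t : NT X Y ==> H : Obj ==> x : el X H ==> nt t H x : el Y H"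
  using L_app[OF NT_L] by blast

lemma nt_nat:
  assumes t: "t : NT X Y" and f: "f : L V W" and x: "x : el X V"
  shows "nt t W (ap X f x) = ap Y f (nt t V x)"
proof -
  have "ALL f:Ar Vect. fn t (tgt f) oo Fa X f = Fa Y f oo fn t (src f)" using t by (simp add: NT_iff)
  then have "fn (fn t W oo Fa X f) x = fn (Fa Y f oo fn t V) x"
    using L_Ar[OF f] L_src[OF f] by fastforce
  then show ?thesis
    using comp_app'[OF lf_L[OF NT_lf(1)[OF t] f] x] comp_app'[OF NT_L[OF t L_Ob(1)[OF f]] x] by simp
qed

lemma NT_eqI:
  assumes t: "t : NT X Y" and s: "s : NT X Y"
    and e: "!!H x. H : Obj ==> x : el X H ==> nt t H x = nt s H x"
  shows "t = s"
proof -
  have "fn t = fn s"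
  proof (rule extensionalityI[of _ Obj])
    show "fn t H = fn s H" if "H : Obj" for H
      by (rule L_eqI[OF NT_L[OF t that] NT_L[OF s that] e[OF that]])
  qed (use t s in \<open>auto simp: NT_iff\<close>)
  then show ?thesis using t s by (simp add: NT_iff)
qed

definition mkN :: "('k, 'u) vfun => ('k, 'u) vfun => (('k, 'u) module => 'u => 'u) => ('k, 'u) vnat" where
  "mkN X Y g = \<lparr>src = X, tgt = Y, fn = (\<lambda>H\<in>Obj. mk (Fo X H) (Fo Y H) (g H))\<rparr>"

lemma nt_mkN[simp]: "H : Obj ==> x : el X H ==> nt (mkN X Y g) H x = g H x"
  by (simp add: mkN_def)

text \<open>Linearity of the components is supplied by \<open>auto_linear\<close>, so a natural
  transformation is built from a natural family of plain functions.\<close>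

lemma mkN_NT:
  assumes X: "lf X" and Y: "lf Y"
    and cl: "!!H x. H : Obj ==> x : el X H ==> g H x : el Y H"
    and nat: "!!f V W x. f : L V W ==> x : el X V ==> g W (ap X f x) = ap Y f (g V x)"
  shows "mkN X Y g : NT X Y"
proof -
  have m: "mk (Fo X H) (Fo Y H) (g H) : L (Fo X H) (Fo Y H)" if "H : Obj" for H
    by (rule mk_L[OF lf_Ob[OF X that] lf_Ob[OF Y that] auto_linear[OF X Y cl nat that]])
  have "mk (Fo X (tgt f)) (Fo Y (tgt f)) (g (tgt f)) oo Fa X f =
    Fa Y f oo mk (Fo X (src f)) (Fo Y (src f)) (g (src f))" if "f : Ar Vect" for f
  proof -
    have f: "f : L (src f) (tgt f)" using that by (simp add: Ar_L)
    note O = L_Ob[OF f]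
    show ?thesis
      by (rule L_eqI[OF L_comp[OF m[OF O(2)] lf_L[OF X f]] L_comp[OF lf_L[OF Y f] m[OF O(1)]]])
         (simp add: comp_app'[OF lf_L[OF X f]] comp_app'[OF m[OF O(1)]] ap_closed[OF X f] nat[OF f])
  qed
  then show ?thesis using m X Y L_Ob unfolding NT_iff by (simp add: mkN_def Ar_L L_Ob)
qed

lemma NT_comp:
  assumes t: "t : NT Y Z" and s: "s : NT X Y"
  shows "Cmp FunVect t s : NT X Z"
    and "H : Obj ==> x : el X H ==> nt (Cmp FunVect t s) H x = nt t H (nt s H x)"
proof -
  have a: "nt (Cmp FunVect t s) H x = nt t H (nt s H x)" if "H : Obj" "x : el X H" for H x
    using that by (simp add: comp_app'[OF NT_L[OF s that(1)]])
  have m: "mkN X Z (%H x. nt t H (nt s H x)) : NT X Z"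
    by (rule mkN_NT)
       (use NT_lf[OF t] NT_lf[OF s] in \<open>auto intro!: nt_closed[OF t] nt_closed[OF s]
         simp: nt_nat[OF s] nt_nat[OF t] nt_closed[OF s L_Ob(1)]\<close>)
  have "Cmp FunVect t s = mkN X Z (%H x. nt t H (nt s H x))"
    unfolding FunVect_simps mkN_def NT_src[OF t] NT_src[OF s]
  proof (rule arg_cong[where f = "%w. \<lparr>src = X, tgt = Z, fn = w\<rparr>"], rule restrict_ext)
    fix H assume H: "H : Obj"
    have "mk (Fo X H) (Fo Z H) (%x. nt t H (nt s H x)) : L (Fo X H) (Fo Z H)"
      using NT_L[OF m H] H by (simp add: mkN_def)
    then show "fn t H oo fn s H = mk (Fo X H) (Fo Z H) (%x. nt t H (nt s H x))"
      by (rule L_eqI[OF L_comp[OF NT_L[OF t H] NT_L[OF s H]]]) (simp add: comp_app'[OF NT_L[OF s H]])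
  qed
  with m show "Cmp FunVect t s : NT X Z" by simp
  show "nt (Cmp FunVect t s) H x = nt t H (nt s H x)" if "H : Obj" "x : el X H"
    using a that .
qed

lemma NT_id: assumes X: "lf X" shows "Idn FunVect X : NT X X"
    "H : Obj ==> x : el X H ==> nt (Idn FunVect X) H x = x"
proof -
  have "fn (Idn FunVect X) (tgt f) oo Fa X f = Fa X f oo fn (Idn FunVect X) (src f)" if "f : Ar Vect" for f
  proof -
    have f: "f : L (src f) (tgt f)" using that by (simp add: Ar_L)
    show ?thesis using L_Ob[OF f] comp_id[OF lf_L[OF X f]] by simp
  qed
  then show "Idn FunVect X : NT X X" using X lf_Ob[OF X] by (simp add: NT_iff)
  show "nt (Idn FunVect X) H x = x" if "H : Obj" "x : el X H" using that by simp
qed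

declare FunVect_simps(4,5)[simp del]

lemma subfunctor:
  assumes X: "lf X" and S: "!!W. W : Obj ==> subsp (S W) (Fo X W)"
    and a: "!!f V W x. f : L V W ==> x : S V ==> ap X f x : S W"
  shows "lf \<lparr>Fo = %W. sub (Fo X W) (S W),
    Fa = %f. mk (sub (Fo X (src f)) (S (src f))) (sub (Fo X (tgt f)) (S (tgt f))) (fn (Fa X f))\<rparr>"
    (is "lf ?Y")
proof -
  have Sc: "x : el X W" if "W : Obj" "x : S W" for x W using S[OF that(1)] that by (auto simp: subsp_def)
  have app: "ap ?Y f x = ap X f x" if "f : L V W" "x : S V" for f V W x
    using that by (simp add: L_src)
  have SO: "sub (Fo X V) (S V) : Obj" if "V : Obj" for V
    by (rule sub_Obj[OF lf_Ob[OF X that] S[OF that]])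
  show ?thesis
  proof (rule lfI)
    show "Fo ?Y V : Obj" if "V : Obj" for V using SO[OF that] by simp
    show "Fa ?Y f : L (Fo ?Y V) (Fo ?Y W)" if f: "f : L V W" for f V W
    proof -
      note O = L_Ob[OF f]
      have "is_linear K (sub (Fo X V) (S V)) (sub (Fo X W) (S W)) (fn (Fa X f))"
        by (rule is_linearI)
           (use a[OF f] ap_add[OF X f Sc[OF O(1)] Sc[OF O(1)]] ap_smult[OF X f _ Sc[OF O(1)]] in auto)
      then show ?thesis using mk_L[OF SO[OF O(1)] SO[OF O(2)]] by (simp add: L_src[OF f])
    qed
  next
    fix V x assume V: "V : Obj" and "x : el ?Y V"
    then have x: "x : S V" by simp
    show "ap ?Y (idV V) x = x" unfolding app[OF idV_L[OF V] x] by (rule ap_id[OF X V Sc[OF V x]])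
  next
    fix f g U V W x assume g: "g : L V W" and f: "f : L U V" and "x : el ?Y U"
    then have x: "x : S U" by simp
    show "ap ?Y (g oo f) x = ap ?Y g (ap ?Y f x)"
      unfolding app[OF L_comp[OF g f] x] app[OF f x] app[OF g a[OF f x]]
      by (rule ap_comp[OF X g f Sc[OF L_Ob(1)[OF f] x]])
  next
    fix f g V W x assume f: "f : L V W" and g: "g : L V W" and "x : el ?Y V"
    then have x: "x : S V" by simp
    show "ap ?Y (lin_add f g) x = add (Fo ?Y W) (ap ?Y f x) (ap ?Y g x)"
      unfolding app[OF lin_add_L[OF f g] x] app[OF f x] app[OF g x]
      using ap_lin_add[OF X f g Sc[OF L_Ob(1)[OF f] x]] by simp
  next
    fix f c V W x assume f: "f : L V W" and c: "c : carrier K" and "x : el ?Y V"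
    then have x: "x : S V" by simp
    show "ap ?Y (lin_smult c f) x = smult (Fo ?Y W) c (ap ?Y f x)"
      unfolding app[OF lin_smult_L[OF f c] x] app[OF f x]
      using ap_lin_smult[OF X f c Sc[OF L_Ob(1)[OF f] x]] by simp
  qed
qed

subsection \<open>The Yoneda lemma\<close>

lemma ap_yo: "f : L W W' ==> h : L V W ==> ap (yo V) f (graph h) = graph (f oo h)"
  using hom_map_app[OF idV_L[OF L_Ob(1)], of h V W f W W'] by (simp add: yo_def hom_map_app[OF idV_L[OF L_Ob(1)]])

lemma Fo_yo[simp]: "Fo (yo V) W = hom_sp V W" by (simp add: yo_def)

lemma lf_yo: assumes V: "V : Obj" shows "lf (yo V)"
proof (rule lfI)
  show "Fa (yo V) f : L (Fo (yo V) W) (Fo (yo V) W')" if "f : L W W'" for f W W'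
    using hom_map_L[OF idV_L[OF V] that] by (simp add: yo_def)
next
  fix W x assume "W : Obj" "x : el (yo V) W"
  then show "ap (yo V) (idV W) x = x" by (auto elim!: hom_cases simp: ap_yo[OF idV_L])
next
  fix f g U W Z x assume g: "g : L W Z" and f: "f : L U W" and "x : el (yo V) U"
  then obtain h where h: "h : L V U" "x = graph h" by (auto elim!: hom_cases)
  show "ap (yo V) (g oo f) x = ap (yo V) g (ap (yo V) f x)"
    unfolding h(2) ap_yo[OF L_comp[OF g f] h(1)] ap_yo[OF f h(1)] ap_yo[OF g L_comp[OF f h(1)]]
    by (simp add: comp_assoc[OF g f h(1)])
next
  fix f g W Z x assume f: "f : L W Z" and g: "g : L W Z" and "x : el (yo V) W"
  then obtain h where h: "h : L V W" "x = graph h" by (auto elim!: hom_cases)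
  show "ap (yo V) (lin_add f g) x = add (Fo (yo V) Z) (ap (yo V) f x) (ap (yo V) g x)"
    unfolding h(2) ap_yo[OF lin_add_L[OF f g] h(1)] ap_yo[OF f h(1)] ap_yo[OF g h(1)] Fo_yo
    by (simp add: hom_add[OF L_comp[OF f h(1)] L_comp[OF g h(1)]] lin_add_comp[OF h(1) f g])
next
  fix f c W Z x assume f: "f : L W Z" and c: "c : carrier K" and "x : el (yo V) W"
  then obtain h where h: "h : L V W" "x = graph h" by (auto elim!: hom_cases)
  show "ap (yo V) (lin_smult c f) x = smult (Fo (yo V) Z) c (ap (yo V) f x)"
    unfolding h(2) ap_yo[OF lin_smult_L[OF f c] h(1)] ap_yo[OF f h(1)] Fo_yo
    by (simp add: hom_smult[OF L_comp[OF f h(1)]] lin_smult_comp[OF h(1) f c])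
qed (use V in auto)

text \<open>With \<open>yev\<close>, evaluation at the identity, this forms the pair of inverse
  bijections of the Yoneda lemma.\<close>

definition yoN :: "('k, 'u) vfun => ('k, 'u) module => 'u => ('k, 'u) vnat" where
  "yoN X V x = mkN (yo V) X (%W a. ap X (ungraph V W a) x)"

definition yev :: "('k, 'u) module => ('k, 'u) vnat => 'u" where
  "yev V t = nt t V (graph (idV V))"

lemma nt_yoN: "h : L V W ==> nt (yoN X V x) W (graph h) = ap X h x"
  unfolding yoN_def by (subst nt_mkN) (auto simp: graph_in L_Ob)

lemma yoN_NT: assumes X: "lf X" and V: "V : Obj" and x: "x : el X V"
  shows "yoN X V x : NT (yo V) X"
  unfolding yoN_def
proof (rule mkN_NT)
  fix W a assume "a : el (yo V) W"
  then show "ap X (ungraph V W a) x : el X W"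
    using ap_closed[OF X ungraph_L(1) x] by simp
next
  fix f W W' a assume f: "f : L W W'" and "a : el (yo V) W"
  then obtain h where h: "h : L V W" "a = graph h" by (auto elim!: hom_cases)
  show "ap X (ungraph V W' (ap (yo V) f a)) x = ap X f (ap X (ungraph V W a) x)"
    unfolding h(2) ap_yo[OF f h(1)] ungraph_graph[OF h(1)] ungraph_graph[OF L_comp[OF f h(1)]]
    by (rule ap_comp[OF X f h(1) x])
qed (use lf_yo[OF V] X in auto)

lemma yev_closed: "t : NT (yo V) X ==> V : Obj ==> yev V t : el X V"
  unfolding yev_def by (rule nt_closed) (auto simp: graph_in)

lemma nt_yev: assumes t: "t : NT (yo V) X" and h: "h : L V W"
  shows "nt t W (graph h) = ap X h (yev V t)"
proof -
  note V = L_Ob(1)[OF h]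
  have "nt t W (ap (yo V) h (graph (idV V))) = ap X h (yev V t)"
    unfolding yev_def by (rule nt_nat[OF t h]) (simp add: graph_in V)
  then show ?thesis using ap_yo[OF h idV_L[OF V]] h by simp
qed

lemma yo_eqI:
  assumes t: "t : NT (yo V) X" and s: "s : NT (yo V) X" and V: "V : Obj" and e: "yev V t = yev V s"
  shows "t = s"
proof (rule NT_eqI[OF t s])
  fix H a assume "H : Obj" "a : el (yo V) H"
  then show "nt t H a = nt s H a" by (auto elim!: hom_cases simp: nt_yev[OF t] nt_yev[OF s] e)
qed

lemma yev_yoN: "lf X ==> V : Obj ==> x : el X V ==> yev V (yoN X V x) = x"
  unfolding yev_def using nt_yoN[OF idV_L] ap_id by simp

lemma yoN_yev: "t : NT (yo V) X ==> V : Obj ==> yoN X V (yev V t) = t"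
  by (rule yo_eqI) (auto intro!: yoN_NT yev_yoN yev_closed dest: NT_lf(2))

lemma Yoneda_Fo[simp]: "Fo Yoneda V = yo V" by (simp add: Yoneda_def)

lemma Yoneda_yoN: assumes f: "f : L V W" shows "Fa Yoneda f = yoN (yo V) W (graph f)"
proof -
  have "hom_map f (idV Z) = mk (hom_sp W Z) (hom_sp V Z) (%a. ap (yo V) (ungraph W Z a) (graph f))"
    if Z: "Z : Obj" for Z
  proof -
    have "hom_map f (idV Z) = mk (hom_sp W Z) (hom_sp V Z) (fn (hom_map f (idV Z)))"
      using mk_eta[OF hom_map_L[OF f idV_L[OF Z]]] by simp
    also have "\<dots> = mk (hom_sp W Z) (hom_sp V Z) (%a. ap (yo V) (ungraph W Z a) (graph f))"
      unfolding mk_def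
    proof (rule arg_cong[where f = "%w. \<lparr>src = _, tgt = _, fn = w\<rparr>"], rule restrict_ext)
      fix a assume "a : carrier (hom_sp W Z)"
      then obtain h where h: "h : L W Z" "a = graph h" by (rule hom_cases)
      show "fn (hom_map f (idV Z)) a = ap (yo V) (ungraph W Z a) (graph f)"
        unfolding h(2) hom_map_app[OF f idV_L[OF Z] h(1)] ungraph_graph[OF h(1)] ap_yo[OF h(1) f]
        by (simp add: comp_id(1)[OF L_comp[OF h(1) f]])
    qed
    finally show ?thesis .
  qed
  then show ?thesis by (simp add: Yoneda_def yoN_def mkN_def L_src[OF f] fun_eq_iff restrict_def)
qed

lemma Yoneda_NT: "f : L V W ==> Fa Yoneda f : NT (yo W) (yo V)"
  unfolding Yoneda_yoN by (intro yoN_NT lf_yo) (auto dest: L_Ob simp: graph_in)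

text \<open>Precomposing with a representable arrow moves the corresponding element along
  \<open>X(f)\<close>. This translates cocones of representables, and arrows of the comma category,
  into equations between elements.\<close>

lemma Yoneda_comp:
  assumes X: "lf X" and f: "f : L V W" and x: "x : el X V"
  shows "Cmp FunVect (yoN X V x) (Fa Yoneda f) = yoN X W (ap X f x)"
proof (rule yo_eqI)
  note O = L_Ob[OF f]
  note y = yoN_NT[OF X O(1) x]
  note F = Yoneda_NT[OF f]
  have i: "graph (idV W) : el (yo W) W" using O by (simp add: graph_in)
  show "Cmp FunVect (yoN X V x) (Fa Yoneda f) : NT (yo W) X" by (rule NT_comp[OF y F])
  show "yoN X W (ap X f x) : NT (yo W) X" by (rule yoN_NT[OF X O(2) ap_closed[OF X f x]])
  have "yev W (Cmp FunVect (yoN X V x) (Fa Yoneda f)) = ap X f x"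
  proof -
    have "nt (Fa Yoneda f) W (graph (idV W)) = graph f"
      unfolding Yoneda_yoN[OF f] nt_yoN[OF idV_L[OF O(2)]] using ap_yo[OF idV_L[OF O(2)] f] f by simp
    then show ?thesis unfolding yev_def NT_comp(2)[OF y F O(2) i] using nt_yoN[OF f] by simp
  qed
  then show "yev W (Cmp FunVect (yoN X V x) (Fa Yoneda f)) = yev W (yoN X W (ap X f x))"
    using yev_yoN[OF X O(2) ap_closed[OF X f x]] by simp
qed (use L_Ob[OF f] in auto)


section \<open>Small functors\<close>

lemma ex1_unique: "EX! x. P x ==> P a ==> P b ==> a = b"
  by blast

definition gset :: "('k, 'u) vfun => ('k, 'u) module => ('k, 'u) module => 'u set" where
  "gset X V W = {ap X \<phi> a | \<phi> a. \<phi> : L V W & a : el X V}"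

definition gens :: "('k, 'u) vfun => ('k, 'u) module => bool" where
  "gens X V \<longleftrightarrow> V : Obj & (ALL W:Obj. spans (Fo X W) (gset X V W))"

text \<open>Generation without passing to spans. Colimits of representables have it, and it is
  inherited by the internal hom (\<open>R_sgen\<close>); for the tensor product only
  \<open>gens\<close> is established.\<close>

definition sgen :: "('k, 'u) vfun => ('k, 'u) module => bool" where
  "sgen X V \<longleftrightarrow> V : Obj & (ALL W:Obj. el X W <= gset X V W)"

lemma gset_sub: "lf X ==> gset X V W <= el X W"
  unfolding gset_def using ap_closed by blast

lemma sgen_gens: "sgen X V ==> gens X V"
  unfolding sgen_def gens_def spans_def subsp_def by blast

lemma gens_induct:
  assumes "gens X V" "lf X" "W : Obj" "x : el X W"
    and P: "!!\<phi> a. \<phi> : L V W ==> a : el X V ==> P (ap X \<phi> a)" "P (zero (Fo X W))"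
    "!!x y. x : el X W ==> y : el X W ==> P x ==> P y ==> P (add (Fo X W) x y)"
    "!!c x. c : carrier K ==> x : el X W ==> P x ==> P (smult (Fo X W) c x)"
  shows "P x"
proof (rule spans_induct[OF _ assms(4) lf_Ob[OF assms(2,3)] gset_sub[OF assms(2)]])
  show "spans (Fo X W) (gset X V W)" using assms(1,3) by (simp add: gens_def)
qed (use P in \<open>auto simp: gset_def\<close>)

text \<open>The subfunctor of those elements that come from some stage of the colimit receives the colimit
  cocone, so it is everything.\<close>

lemma small_functor_sgen:
  assumes X: "lf X" and sm: "small_functor X"
  obtains V where "sgen X V"
proof -
  obtain d r F p where ne: "elts d \<noteq> {}"
    and dir: "ALL a:elts d. ALL b:elts d. EX c:elts d. (a, c) : r & (b, c) : r"
    and F: "is_functor (poset_cat (elts d) r) (op_cat Vect) F"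
    and C: "is_colimit (poset_cat (elts d) r) FunVect (fcomp Yoneda F) X p"
    using sm unfolding small_functor_def by (elim exE conjE) (rule that)
  let ?J = "poset_cat (elts d) r" and ?D = "fcomp Yoneda F"
  have J[simp]: "Ob ?J = elts d" "Ar ?J = {p : r. fst p : elts d & snd p : elts d}"
    "Dom ?J = fst" "Cod ?J = snd" by (simp_all add: poset_cat_def)
  have D[simp]: "Fo ?D j = yo (Fo F j)" "Fa ?D u = Fa Yoneda (Fa F u)" for j u
    by (simp_all add: fcomp_def)
  have FO: "Fo F j : Obj" if "j : elts d" for j
    using F that unfolding is_functor_def by (simp add: op_cat_def)
  have FL: "Fa F (j, k) : L (Fo F k) (Fo F j)" if "(j, k) : r" "j : elts d" "k : elts d" for j k
  proof -
    have "ALL f:Ar ?J. Fa F f : Mor (op_cat Vect) (Fo F (fst f)) (Fo F (snd f))"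
      using F unfolding is_functor_def by simp
    from bspec[OF this, of "(j, k)"] show ?thesis using that by (simp add: Mor_def op_cat_def)
  qed
  have cc: "is_cocone ?J FunVect ?D X p" using C unfolding is_colimit_def by blast
  then have p: "p j : NT (yo (Fo F j)) X" if "j : elts d" for j
    using that unfolding is_cocone_def by simp
  have pc: "Cmp FunVect (p k) (Fa Yoneda (Fa F (j, k))) = p j"
    if "(j, k) : r" "j : elts d" "k : elts d" for j k
  proof -
    have "ALL u:Ar ?J. Cmp FunVect (p (snd u)) (Fa Yoneda (Fa F u)) = p (fst u)"
      using cc unfolding is_cocone_def by simp
    from bspec[OF this, of "(j, k)"] show ?thesis using that by simp
  qed
  have univ: "EX! h. h : NT X M & (ALL j:elts d. Cmp FunVect h (p j) = q j)"
    if "is_cocone ?J FunVect ?D M q" for M q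
    using C that unfolding is_colimit_def by simp
  \<comment> \<open>By the Yoneda lemma the colimit cocone is a compatible system of elements of
    \<open>X\<close>.\<close>
  define x where "x j = yev (Fo F j) (p j)" for j
  have x: "x j : el X (Fo F j)" if "j : elts d" for j
    unfolding x_def by (rule yev_closed[OF p[OF that] FO[OF that]])
  have px: "p j = yoN X (Fo F j) (x j)" if "j : elts d" for j
    unfolding x_def by (rule yoN_yev[OF p[OF that] FO[OF that], symmetric])
  have xc: "x j = ap X (Fa F (j, k)) (x k)" if "(j, k) : r" "j : elts d" "k : elts d" for j k
  proof -
    have "yoN X (Fo F j) (ap X (Fa F (j, k)) (x k)) = yoN X (Fo F j) (x j)"
      using pc[OF that] Yoneda_comp[OF X FL[OF that] x[OF that(3)]] by (simp add: px that)
    then have "yev (Fo F j) (yoN X (Fo F j) (ap X (Fa F (j, k)) (x k))) = yev (Fo F j) (yoN X (Fo F j) (x j))"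
      by simp
    then show ?thesis
      by (simp add: yev_yoN[OF X FO[OF that(2)]] x that ap_closed[OF X FL[OF that]])
  qed
  \<comment> \<open>The elements coming from some stage. Directedness lets two of them be written at
    a common stage, which makes \<open>S W\<close> a subspace.\<close>
  define S where "S W = {ap X \<phi> (x j) | j \<phi>. j : elts d & \<phi> : L (Fo F j) W}" for W
  have SI: "ap X \<phi> (x j) : S W" if "j : elts d" "\<phi> : L (Fo F j) W" for \<phi> j W
    unfolding S_def using that by blast
  have Sc: "y : el X W" if "y : S W" for y W
    using that ap_closed[OF X _ x] unfolding S_def by auto
  have Ssub: "subsp (S W) (Fo X W)" if W: "W : Obj" for W
  proof (rule subspI)
    obtain j where j: "j : elts d" using ne by blast
    show "zero (Fo X W) : S W"
      using SI[OF j lin_zero_L[OF FO[OF j] W]] ap_lin_zero[OF X FO[OF j] W x[OF j]] by simp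
  next
    fix y y' assume "y : S W" "y' : S W"
    then obtain j \<phi> k \<psi> where j: "j : elts d" "\<phi> : L (Fo F j) W" "y = ap X \<phi> (x j)"
      and k: "k : elts d" "\<psi> : L (Fo F k) W" "y' = ap X \<psi> (x k)" unfolding S_def by blast
    obtain l where l: "l : elts d" "(j, l) : r" "(k, l) : r" using dir j(1) k(1) by blast
    note jl = FL[OF l(2) j(1) l(1)] and kl = FL[OF l(3) k(1) l(1)]
    note f = L_comp[OF j(2) jl] and g = L_comp[OF k(2) kl]
    have "y = ap X (\<phi> oo Fa F (j, l)) (x l)" "y' = ap X (\<psi> oo Fa F (k, l)) (x l)"
      unfolding j(3) k(3) xc[OF l(2) j(1) l(1)] xc[OF l(3) k(1) l(1)]
      using ap_comp[OF X j(2) jl x[OF l(1)]] ap_comp[OF X k(2) kl x[OF l(1)]] by simp_all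
    then have "add (Fo X W) y y' = ap X (lin_add (\<phi> oo Fa F (j, l)) (\<psi> oo Fa F (k, l))) (x l)"
      using ap_lin_add[OF X f g x[OF l(1)]] by simp
    then show "add (Fo X W) y y' : S W" using SI[OF l(1) lin_add_L[OF f g]] by simp
  next
    fix c y assume c: "c : carrier K" and "y : S W"
    then obtain j \<phi> where j: "j : elts d" "\<phi> : L (Fo F j) W" "y = ap X \<phi> (x j)" unfolding S_def by blast
    show "smult (Fo X W) c y : S W"
      using SI[OF j(1) lin_smult_L[OF j(2) c]] ap_lin_smult[OF X j(2) c x[OF j(1)]] by (simp add: j(3))
  qed (rule Sc)
  have Sa: "ap X f y : S W" if f: "f : L V W" and "y : S V" for f V W y
  proof -
    obtain j \<phi> where j: "j : elts d" "\<phi> : L (Fo F j) V" "y = ap X \<phi> (x j)"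
      using \<open>y \<in> S V\<close> unfolding S_def by blast
    show ?thesis using SI[OF j(1) L_comp[OF f j(2)]] ap_comp[OF X f j(2) x[OF j(1)]] by (simp add: j(3))
  qed
  define Y :: "('k, 'u) vfun" where "Y = \<lparr>Fo = %W. sub (Fo X W) (S W),
    Fa = %f. mk (sub (Fo X (src f)) (S (src f))) (sub (Fo X (tgt f)) (S (tgt f))) (fn (Fa X f))\<rparr>"
  have Y: "lf Y" unfolding Y_def by (rule subfunctor[OF X Ssub Sa])
  have Yc: "el Y W = S W" for W by (simp add: Y_def)
  have Ya: "ap Y f y = ap X f y" if "f : L V W" "y : S V" for f V W y
    using that by (simp add: Y_def L_src)
  define i where "i = mkN Y X (%H y. y)"
  have i: "i : NT Y X" unfolding i_def by (rule mkN_NT[OF Y X]) (auto simp: Yc Ya dest: Sc)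
  have xS: "x j : S (Fo F j)" if "j : elts d" for j
    using SI[OF that idV_L[OF FO[OF that]]] ap_id[OF X FO[OF that] x[OF that]] by simp
  have qN: "yoN Y (Fo F j) (x j) : NT (yo (Fo F j)) Y" if "j : elts d" for j
    by (rule yoN_NT[OF Y FO[OF that]]) (use xS that Yc in simp)
  have "is_cocone ?J FunVect ?D Y (%j. yoN Y (Fo F j) (x j))"
    unfolding is_cocone_def
  proof (intro conjI ballI)
    fix u assume u: "u : Ar ?J"
    then have u': "(fst u, snd u) : r" "fst u : elts d" "snd u : elts d" by auto
    show "Cmp FunVect (yoN Y (Fo F (Cod ?J u)) (x (Cod ?J u))) (Fa ?D u) = yoN Y (Fo F (Dom ?J u)) (x (Dom ?J u))"
      using Yoneda_comp[OF Y FL[OF u'], of "x (snd u)"] xc[OF u'] Ya[OF FL[OF u'] xS[OF u'(3)]]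
        xS[OF u'(3)] Yc by simp
  qed (use Y qN in auto)
  from ex1_implies_ex[OF univ[OF this]] obtain h where h: "h : NT X Y"
    "!!j. j : elts d ==> Cmp FunVect h (p j) = yoN Y (Fo F j) (x j)" by blast
  \<comment> \<open>\<open>h\<close> is the map induced by the cocone with values in the subfunctor.
    Its composite with the inclusion agrees with the identity on all legs, so the inclusion is
    surjective.\<close>
  have "Cmp FunVect i h = Idn FunVect X"
  proof -
    have ih: "Cmp FunVect i h : NT X X" by (rule NT_comp(1)[OF i h(1)])
    have "Cmp FunVect (Cmp FunVect i h) (p j) = p j" if j: "j : elts d" for j
    proof (rule NT_eqI[OF NT_comp(1)[OF ih p[OF j]] p[OF j]])
      fix H a assume H: "H : Obj" and "a : el (yo (Fo F j)) H"
      then obtain f where f: "f : L (Fo F j) H" "a = graph f" by (auto elim!: hom_cases)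
      then have a: "a : el (yo (Fo F j)) H" by (simp add: graph_in)
      have "nt (Cmp FunVect (Cmp FunVect i h) (p j)) H a = nt i H (nt h H (nt (p j) H a))"
        using NT_comp(2)[OF ih p[OF j] H a] NT_comp(2)[OF i h(1) H nt_closed[OF p[OF j] H a]] by simp
      also have "nt h H (nt (p j) H a) = nt (yoN Y (Fo F j) (x j)) H a"
        using NT_comp(2)[OF h(1) p[OF j] H a] h(2)[OF j] by simp
      also have "\<dots> = ap X f (x j)" unfolding f(2) nt_yoN[OF f(1)] by (rule Ya[OF f(1) xS[OF j]])
      also have "nt i H \<dots> = ap X f (x j)"
        unfolding i_def using H SI[OF j f(1)] Yc by simp
      also have "\<dots> = nt (p j) H a" unfolding px[OF j] f(2) nt_yoN[OF f(1)] ..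
      finally show "nt (Cmp FunVect (Cmp FunVect i h) (p j)) H a = nt (p j) H a" .
    qed
    moreover have "Cmp FunVect (Idn FunVect X) (p j) = p j" if j: "j : elts d" for j
    proof (rule NT_eqI[OF NT_comp(1)[OF NT_id(1)[OF X] p[OF j]] p[OF j]])
      fix H a assume H: "H : Obj" and a: "a : el (yo (Fo F j)) H"
      show "nt (Cmp FunVect (Idn FunVect X) (p j)) H a = nt (p j) H a"
        using NT_comp(2)[OF NT_id(1)[OF X] p[OF j] H a] NT_id(2)[OF X H nt_closed[OF p[OF j] H a]] by simp
    qed
    ultimately show ?thesis using ex1_unique[OF univ[OF cc]] ih NT_id(1)[OF X] by simp
  qed
  then have all: "y : S H" if "H : Obj" "y : el X H" for H y
  proof -
    have "nt i H (nt h H y) = y"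
      using NT_comp(2)[OF i h(1) that] NT_id(2)[OF X that] \<open>Cmp FunVect i h = Idn FunVect X\<close> by simp
    moreover have "nt h H y : S H" using nt_closed[OF h(1) that] Yc by simp
    ultimately show ?thesis unfolding i_def using that Yc by simp
  qed
  \<comment> \<open>One object for all stages: each \<open>F j\<close> is a retract of the product,
    so whatever comes from stage \<open>j\<close> comes from \<open>P\<close>.\<close>
  obtain P \<pi> \<iota> where P: "P : Obj" "!!j. j : elts d ==> \<pi> j : L P (Fo F j)"
    "!!j. j : elts d ==> \<iota> j : L (Fo F j) P"
    "!!j x. j : elts d ==> x : el F j ==> fn (\<pi> j) (fn (\<iota> j) x) = x"
  proof (rule product[of "elts d" "Fo F", OF small_elts FO], assumption)
    fix P \<pi> \<iota>
    assume "P : Obj" "!!j. j : elts d ==> \<pi> j : L P (Fo F j)" "!!j. j : elts d ==> \<iota> j : L (Fo F j) P"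
      "!!j x. j : elts d ==> x : el F j ==> fn (\<pi> j) (fn (\<iota> j) x) = x"
    then show thesis by (rule that)
  qed
  have "sgen X P" unfolding sgen_def
  proof (intro conjI ballI subsetI)
    fix W y assume W: "W : Obj" and "y : el X W"
    then obtain j \<phi> where j: "j : elts d" "\<phi> : L (Fo F j) W" "y = ap X \<phi> (x j)"
      using all unfolding S_def by blast
    note \<pi> = P(2)[OF j(1)] and \<iota> = P(3)[OF j(1)]
    have "\<pi> j oo \<iota> j = idV (Fo F j)"
      by (rule L_eqI[OF L_comp[OF \<pi> \<iota>] idV_L[OF FO[OF j(1)]]]) (simp add: comp_app'[OF \<iota>] P(4) j(1))
    then have "ap X (\<pi> j) (ap X (\<iota> j) (x j)) = x j"
      using ap_comp[OF X \<pi> \<iota> x[OF j(1)]] ap_id[OF X FO[OF j(1)] x[OF j(1)]] by simp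
    then have "y = ap X (\<phi> oo \<pi> j) (ap X (\<iota> j) (x j))"
      using ap_comp[OF X j(2) \<pi> ap_closed[OF X \<iota> x[OF j(1)]]] j(3) by simp
    then show "y : gset X P W" unfolding gset_def
      using L_comp[OF j(2) \<pi>] ap_closed[OF X \<iota> x[OF j(1)]] by blast
  qed (rule P(1))
  then show ?thesis by (rule that)
qed

section \<open>A criterion for small directed colimits of representables\<close>

lemma diff_zero_eq:
  assumes f: "f : L V W" and g: "g : L V W" and h: "h : L U V"
    and e: "lin_add f (lin_smult (a_inv K (one K)) g) oo h = lin_zero U W"
  shows "f oo h = g oo h"
proof (rule L_eqI[OF L_comp[OF f h] L_comp[OF g h]])
  fix u assume u: "u : carrier U"
  note hu = L_app[OF h u]
  have "fn (lin_add f (lin_smult (a_inv K (one K)) g) oo h) u = add W (fn f (fn h u)) (neg W (fn g (fn h u)))"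
    unfolding comp_app'[OF h u] lin_add_app[OF f hu] lin_smult_app[OF g hu] neg_def ..
  then show "fn (f oo h) u = fn (g oo h) u"
    using V_eq_iff_neg[OF L_Ob(2)[OF f] L_app[OF f hu] L_app[OF g hu]] u
    by (simp add: comp_app'[OF h u] e)
qed

lemma ap_diff_zero:
  assumes X: "lf X" and f: "f : L V W" and g: "g : L V W" and x: "x : el X V"
    and e: "ap X f x = ap X g x"
  shows "ap X (lin_add f (lin_smult (a_inv K (one K)) g)) x = zero (Fo X W)"
proof -
  have m: "a_inv K (one K) : carrier K" by simp
  show ?thesis
    unfolding ap_lin_add[OF X f lin_smult_L[OF g m] x] ap_lin_smult[OF X g m x] e
    using V_neg[OF lf_Ob[OF X L_Ob(2)[OF f]] ap_closed[OF X g x]] by (simp add: neg_def)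
qed

text \<open>The elements \<open>a d\<close> define a cocone of representables under
  \<open>X\<close>. At each \<open>W\<close>, \<open>span\<close> and directedness say that the
  colimit surjects onto \<open>X(W)\<close>, while \<open>inj\<close> says that an arrow killing
  \<open>a d\<close> becomes zero at a later stage. Transition maps run from later to earlier stages
  because representables are contravariant.\<close>

lemma small_functorI:
  fixes D :: "'d set" and le :: "'d => 'd => bool"
  assumes X: "lf X" and D: "small D" "D \<noteq> {}"
    and refl: "!!d. d : D ==> le d d"
    and anti: "!!d e. d : D ==> e : D ==> le d e ==> le e d ==> d = e"
    and trans: "!!d e f. d : D ==> e : D ==> f : D ==> le d e ==> le e f ==> le d f"
    and dir: "!!d e. d : D ==> e : D ==> EX f:D. le d f & le e f"
    and v: "!!d. d : D ==> v d : Obj"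
    and tr: "!!d e. d : D ==> e : D ==> le d e ==> tr d e : L (v e) (v d)"
    and tr_id: "!!d. d : D ==> tr d d = idV (v d)"
    and tr_comp: "!!d e f. d : D ==> e : D ==> f : D ==> le d e ==> le e f ==> tr d e oo tr e f = tr d f"
    and a: "!!d. d : D ==> a d : el X (v d)"
    and tr_a: "!!d e. d : D ==> e : D ==> le d e ==> ap X (tr d e) (a e) = a d"
    and span: "!!W. W : Obj ==> spans (Fo X W) {ap X \<phi> (a d) | \<phi> d. d : D & \<phi> : L (v d) W}"
    and inj: "!!d W \<phi>. d : D ==> \<phi> : L (v d) W ==> ap X \<phi> (a d) = zero (Fo X W) ==>
      EX e:D. le d e & \<phi> oo tr d e = lin_zero (v e) W"
  shows "small_functor X"
proof -
  \<comment> \<open>Directedness removes the span: a sum of two values is rewritten as one value at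
    a common later stage.\<close>
  have surj: "EX d:D. EX \<phi>:L (v d) W. b = ap X \<phi> (a d)" if W: "W : Obj" and b: "b : el X W" for W b
  proof (rule spans_induct[OF span[OF W] b lf_Ob[OF X W]])
    show "{ap X \<phi> (a d) | \<phi> d. d : D & \<phi> : L (v d) W} <= el X W"
      using ap_closed[OF X _ a] by blast
    obtain d where d: "d : D" using D(2) by blast
    show "EX d:D. EX \<phi>:L (v d) W. zero (Fo X W) = ap X \<phi> (a d)"
      using d lin_zero_L[OF v[OF d] W] ap_lin_zero[OF X v[OF d] W a[OF d]] by metis
  next
    fix x y assume "EX d:D. EX \<phi>:L (v d) W. x = ap X \<phi> (a d)" "EX d:D. EX \<phi>:L (v d) W. y = ap X \<phi> (a d)"
    then obtain d \<phi> e \<psi> where d: "d : D" "\<phi> : L (v d) W" "x = ap X \<phi> (a d)"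
      and e: "e : D" "\<psi> : L (v e) W" "y = ap X \<psi> (a e)" by blast
    obtain f where f: "f : D" "le d f" "le e f" using dir[OF d(1) e(1)] by blast
    note df = tr[OF d(1) f(1,2)] and ef = tr[OF e(1) f(1,3)]
    note \<phi> = L_comp[OF d(2) df] and \<psi> = L_comp[OF e(2) ef]
    have "x = ap X (\<phi> oo tr d f) (a f)" "y = ap X (\<psi> oo tr e f) (a f)"
      using ap_comp[OF X d(2) df a[OF f(1)]] ap_comp[OF X e(2) ef a[OF f(1)]]
        tr_a[OF d(1) f(1,2)] tr_a[OF e(1) f(1,3)] d(3) e(3) by simp_all
    then have "add (Fo X W) x y = ap X (lin_add (\<phi> oo tr d f) (\<psi> oo tr e f)) (a f)"
      using ap_lin_add[OF X \<phi> \<psi> a[OF f(1)]] by simp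
    then show "EX d:D. EX \<phi>:L (v d) W. add (Fo X W) x y = ap X \<phi> (a d)"
      using f(1) lin_add_L[OF \<phi> \<psi>] by blast
  next
    fix c x assume c: "c : carrier K" and "EX d:D. EX \<phi>:L (v d) W. x = ap X \<phi> (a d)"
    then obtain d \<phi> where d: "d : D" "\<phi> : L (v d) W" "x = ap X \<phi> (a d)" by blast
    show "EX d:D. EX \<phi>:L (v d) W. smult (Fo X W) c x = ap X \<phi> (a d)"
      using d(1) lin_smult_L[OF d(2) c] ap_lin_smult[OF X d(2) c a[OF d(1)]] d(3) by metis
  qed auto
  \<comment> \<open>Two expressions of one element are moved to a common stage and subtracted; by
    \<open>inj\<close> the arrows themselves agree at a still later stage, where any compatible
    system \<open>y\<close> is also defined.\<close>
  have wd: "ap M \<phi> (y d) = ap M \<psi> (y e)"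
    if M: "lf M" and y: "!!d. d : D ==> y d : el M (v d)"
      "!!d e. d : D ==> e : D ==> le d e ==> ap M (tr d e) (y e) = y d"
      and d: "d : D" "\<phi> : L (v d) W" and e: "e : D" "\<psi> : L (v e) W"
      and eq: "ap X \<phi> (a d) = ap X \<psi> (a e)" for M y d \<phi> e \<psi> W
  proof -
    obtain f where f: "f : D" "le d f" "le e f" using dir[OF d(1) e(1)] by blast
    note df = tr[OF d(1) f(1,2)] and ef = tr[OF e(1) f(1,3)]
    note \<phi> = L_comp[OF d(2) df] and \<psi> = L_comp[OF e(2) ef]
    have "ap X (\<phi> oo tr d f) (a f) = ap X (\<psi> oo tr e f) (a f)"
      using ap_comp[OF X d(2) df a[OF f(1)]] ap_comp[OF X e(2) ef a[OF f(1)]]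
        tr_a[OF d(1) f(1,2)] tr_a[OF e(1) f(1,3)] eq by simp
    from inj[OF f(1) lin_add_L[OF \<phi> lin_smult_L[OF \<psi>]] ap_diff_zero[OF X \<phi> \<psi> a[OF f(1)] this]]
    obtain g where g: "g : D" "le f g"
      "lin_add (\<phi> oo tr d f) (lin_smult (a_inv K (one K)) (\<psi> oo tr e f)) oo tr f g = lin_zero (v g) W" by auto
    note fg = tr[OF f(1) g(1,2)]
    have "(\<phi> oo tr d f) oo tr f g = (\<psi> oo tr e f) oo tr f g" by (rule diff_zero_eq[OF \<phi> \<psi> fg g(3)])
    then have "ap M (\<phi> oo tr d f) (y f) = ap M (\<psi> oo tr e f) (y f)"
      using ap_comp[OF M \<phi> fg y(1)[OF g(1)]] ap_comp[OF M \<psi> fg y(1)[OF g(1)]] y(2)[OF f(1) g(1,2)] by simp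
    then show ?thesis
      using ap_comp[OF M d(2) df y(1)[OF f(1)]] ap_comp[OF M e(2) ef y(1)[OF f(1)]]
        y(2)[OF d(1) f(1,2)] y(2)[OF e(1) f(1,3)] by simp
  qed
  \<comment> \<open>The definition of a small functor wants the poset to be a member of the
    universe, so the index set is recoded.\<close>
  obtain \<gamma> :: "'d => 'u" where \<gamma>: "inj_on \<gamma> D" "\<gamma> ` D : range elts" using small_coding[OF D(1)] by blast
  obtain s where s: "elts s = \<gamma> ` D" using \<gamma>(2) by fastforce
  define \<delta> where "\<delta> = inv_into D \<gamma>"
  have \<delta>\<gamma>: "\<delta> (\<gamma> d) = d" if "d : D" for d unfolding \<delta>_def using \<gamma>(1) that by (rule inv_into_f_f)
  have \<delta>: "\<delta> j : D" "\<gamma> (\<delta> j) = j" if "j : elts s" for j using that s \<delta>\<gamma> by auto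
  define r where "r = {(\<gamma> d, \<gamma> e) | d e. d : D & e : D & le d e}"
  have rI: "(\<gamma> d, \<gamma> e) : r" if "d : D" "e : D" "le d e" for d e unfolding r_def using that by blast
  have rD: "\<delta> j : D" "\<delta> k : D" "le (\<delta> j) (\<delta> k)" "j : elts s" "k : elts s" if "(j, k) : r" for j k
    using that \<delta>\<gamma> s unfolding r_def by auto
  have po: "partial_order_on (elts s) r"
    unfolding partial_order_on_def preorder_on_def
  proof (intro conjI)
    show "refl_on (elts s) r" unfolding refl_on_def using rI refl \<delta> s by auto
    show "trans r"
    proof (rule transI)
      fix j k l assume jk: "(j, k) : r" and kl: "(k, l) : r"
      have "(\<gamma> (\<delta> j), \<gamma> (\<delta> l)) : r" using rI trans rD[OF jk] rD[OF kl] by blast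
      then show "(j, l) : r" using \<delta> rD[OF jk] rD[OF kl] by simp
    qed
    show "antisym r"
    proof (rule antisymI)
      fix j k assume jk: "(j, k) : r" and kj: "(k, j) : r"
      have "\<delta> j = \<delta> k" by (rule anti) (use rD[OF jk] rD[OF kj] in auto)
      then show "j = k" using \<delta> rD[OF jk] by metis
    qed
    show "r <= elts s \<times> elts s" using rD by auto
  qed
  define F where "F = \<lparr>Fo = %j. v (\<delta> j), Fa = %u. tr (\<delta> (fst u)) (\<delta> (snd u))\<rparr>"
  let ?J = "poset_cat (elts s) r" and ?D = "fcomp Yoneda F"
  have J[simp]: "Ob ?J = elts s" "Ar ?J = {p : r. fst p : elts s & snd p : elts s}"
    "Dom ?J = fst" "Cod ?J = snd" "Idn ?J = (%a. (a, a))" "Cmp ?J g f = (fst f, snd g)" for g f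
    by (simp_all add: poset_cat_def)
  have Ds[simp]: "Fo ?D j = yo (v (\<delta> j))" "Fa ?D u = Fa Yoneda (tr (\<delta> (fst u)) (\<delta> (snd u)))" for j u
    by (simp_all add: fcomp_def F_def)
  have F: "is_functor ?J (op_cat Vect) F"
    unfolding is_functor_def
  proof (intro conjI ballI impI)
    show "Fo F j : Ob (op_cat Vect)" if "j : Ob ?J" for j
      using v \<delta> that by (simp add: F_def op_cat_def)
    show "Fa F (Idn ?J j) = Idn (op_cat Vect) (Fo F j)" if "j : Ob ?J" for j
      using tr_id \<delta> that by (simp add: F_def op_cat_def)
    show "Fa F u : Mor (op_cat Vect) (Fo F (Dom ?J u)) (Fo F (Cod ?J u))" if u: "u : Ar ?J" for u
    proof -
      have "(fst u, snd u) : r" using u by simp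
      then have "tr (\<delta> (fst u)) (\<delta> (snd u)) : L (v (\<delta> (snd u))) (v (\<delta> (fst u)))"
        using rD by (intro tr) blast+
      then show ?thesis by (simp add: Mor_def F_def op_cat_def)
    qed
    show "Fa F (Cmp ?J g f) = Cmp (op_cat Vect) (Fa F g) (Fa F f)"
      if fg0: "f : Ar ?J" "g : Ar ?J" "Dom ?J g = Cod ?J f" for f g
    proof -
      obtain j k l where fg: "f = (j, k)" "g = (k, l)" using fg0(3) by (cases f; cases g) auto
      then have "(j, k) : r" "(k, l) : r" using fg0 by simp_all
      from rD[OF this(1)] rD[OF this(2)] show ?thesis using tr_comp by (simp add: F_def op_cat_def fg)
    qed
  qed
  define p where "p j = yoN X (v (\<delta> j)) (a (\<delta> j))" for j
  have p: "p j : NT (yo (v (\<delta> j))) X" if "j : elts s" for j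
    unfolding p_def using \<delta>[OF that] by (intro yoN_NT X v a)
  have cc: "is_cocone ?J FunVect ?D X p"
    unfolding is_cocone_def
  proof (intro conjI ballI)
    fix u assume "u : Ar ?J"
    then have "(fst u, snd u) : r" by simp
    note u = rD[OF this]
    show "Cmp FunVect (p (Cod ?J u)) (Fa ?D u) = p (Dom ?J u)"
      unfolding p_def using Yoneda_comp[OF X tr[OF u(1-3)] a[OF u(2)]] tr_a[OF u(1-3)] by simp
  qed (use X p in auto)
  have "EX! h. h : NT X M & (ALL j:elts s. Cmp FunVect h (p j) = q j)" if q: "is_cocone ?J FunVect ?D M q" for M q
  proof -
    have M: "lf M" using q unfolding is_cocone_def by simp
    have qN: "q j : NT (yo (v (\<delta> j))) M" if "j : elts s" for j using q that unfolding is_cocone_def by simp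
    define y where "y d = yev (v d) (q (\<gamma> d))" for d
    have \<gamma>s: "\<gamma> d : elts s" if "d : D" for d using s that by simp
    have qN': "q (\<gamma> d) : NT (yo (v d)) M" if "d : D" for d using qN[OF \<gamma>s[OF that]] \<delta>\<gamma>[OF that] by simp
    have y: "y d : el M (v d)" if "d : D" for d
      unfolding y_def by (rule yev_closed[OF qN'[OF that] v[OF that]])
    have qy: "q (\<gamma> d) = yoN M (v d) (y d)" if "d : D" for d
      unfolding y_def by (rule yoN_yev[OF qN'[OF that] v[OF that], symmetric])
    have yt: "ap M (tr d e) (y e) = y d" if de: "d : D" "e : D" "le d e" for d e
    proof -
      have "ALL u:Ar ?J. Cmp FunVect (q (snd u)) (Fa Yoneda (tr (\<delta> (fst u)) (\<delta> (snd u)))) = q (fst u)"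
        using q unfolding is_cocone_def by simp
      from bspec[OF this, of "(\<gamma> d, \<gamma> e)"]
      have "Cmp FunVect (q (\<gamma> e)) (Fa Yoneda (tr d e)) = q (\<gamma> d)" using rI[OF de] \<gamma>s de by (simp add: \<delta>\<gamma>)
      then have "yoN M (v d) (ap M (tr d e) (y e)) = yoN M (v d) (y d)"
        using Yoneda_comp[OF M tr[OF de] y[OF de(2)]] qy de by simp
      then have "yev (v d) (yoN M (v d) (ap M (tr d e) (y e))) = yev (v d) (yoN M (v d) (y d))" by simp
      then show ?thesis using yev_yoN[OF M v[OF de(1)]] y de ap_closed[OF M tr[OF de] y[OF de(2)]] by simp
    qed
    have wd': "ap M \<phi> (y d) = ap M \<psi> (y e)"
      if "d : D" "\<phi> : L (v d) W" "e : D" "\<psi> : L (v e) W" "ap X \<phi> (a d) = ap X \<psi> (a e)" for d \<phi> e \<psi> W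
      by (rule wd[OF M _ _ that]) (erule y, erule (2) yt)
    \<comment> \<open>The induced map sends \<open>X(\<phi>)(a d)\<close> to
      \<open>M(\<phi>)(y d)\<close>; \<open>wd'\<close> makes the choice of expression
      irrelevant.\<close>
    define H where "H W b = (SOME c. EX d:D. EX \<phi>:L (v d) W. b = ap X \<phi> (a d) & c = ap M \<phi> (y d))" for W b
    have H: "H W (ap X \<phi> (a d)) = ap M \<phi> (y d)" if d: "d : D" "\<phi> : L (v d) W" for W \<phi> d
      unfolding H_def
    proof (rule some_equality)
      show "EX e:D. EX \<psi>:L (v e) W. ap X \<phi> (a d) = ap X \<psi> (a e) & ap M \<phi> (y d) = ap M \<psi> (y e)"
        using d by blast
      fix c assume "EX e:D. EX \<psi>:L (v e) W. ap X \<phi> (a d) = ap X \<psi> (a e) & c = ap M \<psi> (y e)"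
      then obtain e \<psi> where e: "e : D" "\<psi> : L (v e) W" "ap X \<phi> (a d) = ap X \<psi> (a e)" "c = ap M \<psi> (y e)"
        by (elim bexE conjE) (rule that)
      show "c = ap M \<phi> (y d)" unfolding e(4) by (rule wd'[OF d e(1-3), symmetric])
    qed
    have hN: "mkN X M H : NT X M"
    proof (rule mkN_NT[OF X M])
      fix W b assume "W : Obj" "b : el X W"
      then obtain d \<phi> where d: "d : D" "\<phi> : L (v d) W" "b = ap X \<phi> (a d)" using surj by blast
      show "H W b : el M W" unfolding d(3) H[OF d(1,2)] by (rule ap_closed[OF M d(2) y[OF d(1)]])
    next
      fix f V W b assume f: "f : L V W" and b: "b : el X V"
      obtain d \<phi> where d: "d : D" "\<phi> : L (v d) V" "b = ap X \<phi> (a d)" using surj[OF L_Ob(1)[OF f] b] by blast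
      show "H W (ap X f b) = ap M f (H V b)"
        unfolding d(3) H[OF d(1,2)] ap_comp[OF X f d(2) a[OF d(1)], symmetric]
          ap_comp[OF M f d(2) y[OF d(1)], symmetric] by (rule H[OF d(1) L_comp[OF f d(2)]])
    qed
    \<comment> \<open>By the Yoneda lemma the equation at a leg is an equation between elements, so
      a competing map is prescribed exactly on the \<open>a d\<close>.\<close>
    have key: "Cmp FunVect h (p (\<gamma> d)) = q (\<gamma> d) \<longleftrightarrow> nt h (v d) (a d) = y d"
      if h: "h : NT X M" and d: "d : D" for h d
    proof -
      have pd: "p (\<gamma> d) = yoN X (v d) (a d)" unfolding p_def by (simp add: \<delta>\<gamma>[OF d])
      note yN = yoN_NT[OF X v[OF d] a[OF d]]
      note hy = NT_comp[OF h yN]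
      have "yev (v d) (Cmp FunVect h (yoN X (v d) (a d))) = nt h (v d) (a d)"
        unfolding yev_def using hy(2)[of "v d" "graph (idV (v d))"] yev_yoN[OF X v[OF d] a[OF d]]
        by (simp add: yev_def v d graph_in)
      then show ?thesis unfolding pd y_def using yo_eqI[OF hy(1) qN'[OF d] v[OF d]] by metis
    qed
    show ?thesis
    proof (rule ex1I[of _ "mkN X M H"])
      have "Cmp FunVect (mkN X M H) (p (\<gamma> d)) = q (\<gamma> d)" if d: "d : D" for d
        unfolding key[OF hN d] nt_mkN[OF v[OF d] a[OF d]]
        using H[OF d idV_L[OF v[OF d]]] ap_id[OF X v[OF d] a[OF d]] ap_id[OF M v[OF d] y[OF d]] by simp
      then show "mkN X M H : NT X M & (ALL j:elts s. Cmp FunVect (mkN X M H) (p j) = q j)"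
        using hN s by auto
      fix h assume "h : NT X M & (ALL j:elts s. Cmp FunVect h (p j) = q j)"
      then have h: "h : NT X M" "!!d. d : D ==> nt h (v d) (a d) = y d" using key \<gamma>s by auto
      show "h = mkN X M H"
      proof (rule NT_eqI[OF h(1) hN])
        fix W b assume W: "W : Obj" and b: "b : el X W"
        obtain d \<phi> where d: "d : D" "\<phi> : L (v d) W" "b = ap X \<phi> (a d)" using surj[OF W b] by blast
        have "nt h W b = ap M \<phi> (y d)" unfolding d(3) nt_nat[OF h(1) d(2) a[OF d(1)]] h(2)[OF d(1)] ..
        then show "nt h W b = nt (mkN X M H) W b"
          unfolding nt_mkN[OF W b] using H[OF d(1,2)] d(3) by simp
      qed
    qed
  qed
  then have C: "is_colimit ?J FunVect ?D X p" unfolding is_colimit_def using cc by simp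
  have "ALL j:elts s. ALL k:elts s. EX l:elts s. (j, l) : r & (k, l) : r"
  proof (intro ballI)
    fix j k assume j: "j : elts s" and k: "k : elts s"
    obtain f where f: "f : D" "le (\<delta> j) f" "le (\<delta> k) f" using dir \<delta> j k by blast
    show "EX l:elts s. (j, l) : r & (k, l) : r"
      using rI[OF \<delta>(1)[OF j] f(1,2)] rI[OF \<delta>(1)[OF k] f(1,3)] \<delta> j k f(1) s by (intro bexI[of _ "\<gamma> f"]) auto
  qed
  moreover have "elts s \<noteq> {}" using D(2) s by simp
  ultimately show ?thesis unfolding small_functor_def using po F C by blast
qed


text \<open>\<open>supp X P a U\<close> says that \<open>a \<in> X(P)\<close> comes from \<open>X(U)\<close>, for a subspace \<open>U\<close>; the form in
  terms of kernels makes it obvious that this passes to intersections.\<close>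

definition supp :: "('k, 'u) vfun => ('k, 'u) module => 'u => 'u set => bool" where
  "supp X P a U \<longleftrightarrow> (EX Q q. q : L P Q & ap X q a = zero (Fo X Q) &
     (ALL x:carrier P. fn q x = zero Q --> x : U))"

lemma supp_kernel: "q : L P Q ==> ap X q a = zero (Fo X Q) ==> supp X P a {x : carrier P. fn q x = zero Q}"
  unfolding supp_def by blast

lemma supp_mono: "supp X P a U ==> (!!x. x : carrier P ==> x : U ==> x : U') ==> supp X P a U'"
  unfolding supp_def by meson

text \<open>If \<open>q\<close> and \<open>q'\<close> kill \<open>a\<close>, so does the map
  \<open>i q + i' q'\<close> into the biproduct, whose kernel is the intersection of the two
  kernels.\<close>

lemma supp_inter:
  assumes X: "lf X" and a: "a : el X P" and U: "supp X P a U" "supp X P a U'"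
  shows "supp X P a (U \<inter> U')"
proof -
  obtain Q q where q: "q : L P Q" "ap X q a = zero (Fo X Q)" "ALL x:carrier P. fn q x = zero Q --> x : U"
    using U(1) unfolding supp_def by blast
  obtain Q' q' where q': "q' : L P Q'" "ap X q' a = zero (Fo X Q')"
    "ALL x:carrier P. fn q' x = zero Q' --> x : U'"
    using U(2) unfolding supp_def by blast
  obtain R p p' i i' where R: "R : Obj" "p : L R Q" "p' : L R Q'" "i : L Q R" "i' : L Q' R"
    "!!x. x : carrier Q ==> fn p (fn i x) = x" "!!x. x : carrier Q ==> fn p' (fn i x) = zero Q'"
    "!!x. x : carrier Q' ==> fn p' (fn i' x) = x" "!!x. x : carrier Q' ==> fn p (fn i' x) = zero Q"
    using biproduct[OF L_Ob(2)[OF q(1)] L_Ob(2)[OF q'(1)]] by blast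
  note iq = L_comp[OF R(4) q(1)] and iq' = L_comp[OF R(5) q'(1)]
  note O = lf_Ob[OF X R(1)] L_Ob(2)[OF q(1)] L_Ob(2)[OF q'(1)]
  let ?f = "lin_add (i oo q) (i' oo q')"
  have "ap X ?f a = zero (Fo X R)"
    unfolding ap_lin_add[OF X iq iq' a] ap_comp[OF X R(4) q(1) a] ap_comp[OF X R(5) q'(1) a] q(2) q'(2)
      ap_zero[OF X R(4)] ap_zero[OF X R(5)] using O by simp
  moreover have "x : U \<inter> U'" if x: "x : carrier P" and 0: "fn ?f x = zero R" for x
  proof -
    note qx = L_app[OF q(1) x] and qx' = L_app[OF q'(1) x]
    note iqx = L_app[OF R(4) qx] and iqx' = L_app[OF R(5) qx']
    have *: "add R (fn i (fn q x)) (fn i' (fn q' x)) = zero R"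
      using 0 unfolding lin_add_app[OF iq x] comp_app'[OF q(1) x] comp_app'[OF q'(1) x] .
    have "fn q x = zero Q"
      using arg_cong[OF *, of "fn p"] L_add[OF R(2) iqx iqx'] L_zero[OF R(2)] R(6)[OF qx] R(9)[OF qx'] O qx
      by simp
    moreover have "fn q' x = zero Q'"
      using arg_cong[OF *, of "fn p'"] L_add[OF R(3) iqx iqx'] L_zero[OF R(3)] R(7)[OF qx] R(8)[OF qx'] O qx'
      by simp
    ultimately show ?thesis using q(3) q'(3) x by blast
  qed
  ultimately show ?thesis unfolding supp_def using lin_add_L[OF iq iq'] by blast
qed

text \<open>The difference of \<open>f\<close> and the identity kills \<open>a\<close>, and its
  kernel is the fixed space.\<close>

lemma supp_fix:
  assumes X: "lf X" and a: "a : el X P" and f: "f : L P P" "ap X f a = a"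
  shows "supp X P a {x : carrier P. fn f x = x}"
proof -
  have P: "P : Obj" using L_Ob[OF f(1)] by simp
  have m: "a_inv K (one K) : carrier K" by simp
  note i = idV_L[OF P]
  let ?q = "lin_add f (lin_smult (a_inv K (one K)) (idV P))"
  have q: "?q : L P P" by (rule lin_add_L[OF f(1) lin_smult_L[OF i m]])
  have "ap X ?q a = zero (Fo X P)"
    by (rule ap_diff_zero[OF X f(1) i a]) (simp add: f(2) ap_id[OF X P a])
  then have "supp X P a {x : carrier P. fn ?q x = zero P}" by (rule supp_kernel[OF q])
  then show ?thesis
  proof (rule supp_mono)
    fix x assume x: "x : carrier P" "x : {x : carrier P. fn ?q x = zero P}"
    then have "add P (fn f x) (neg P x) = zero P"
      by (simp add: lin_add_app[OF f(1)] lin_smult_app[OF i] neg_def)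
    then show "x : {x : carrier P. fn f x = x}"
      using V_eq_iff_neg[OF P L_app[OF f(1) x(1)] x(1)] x(1) by simp
  qed
qed

lemma supp_vimage:
  assumes X: "lf X" and a: "a : el X P" and f: "f : L P P'" and U: "supp X P' (ap X f a) U"
  shows "supp X P a {x : carrier P. fn f x : U}"
proof -
  obtain Q q where q: "q : L P' Q" "ap X q (ap X f a) = zero (Fo X Q)"
    "ALL x:carrier P'. fn q x = zero Q --> x : U"
    using U unfolding supp_def by blast
  have "supp X P a {x : carrier P. fn (q oo f) x = zero Q}"
    by (rule supp_kernel[OF L_comp[OF q(1) f]]) (simp add: ap_comp[OF X q(1) f a] q(2))
  then show ?thesis
    by (rule supp_mono) (use q(3) L_app[OF f] in \<open>auto simp: comp_app'[OF f]\<close>)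
qed

text \<open>If \<open>q\<close> kills \<open>a\<close> and \<open>q r q = q\<close>, then the
  identity minus \<open>r q\<close> maps into the kernel of \<open>q\<close>, hence into
  \<open>U\<close>, and fixes \<open>a\<close>. So \<open>a\<close> factors through
  \<open>U\<close>.\<close>

lemma supp_lift:
  assumes X: "lf X" and a: "a : el X P" and P: "P : Obj" and U: "supp X P a U" "subsp U P"
  shows "EX b:el X (sub P U). ap X (incl P U) b = a"
proof -
  obtain Q q where q: "q : L P Q" "ap X q a = zero (Fo X Q)" "ALL x:carrier P. fn q x = zero Q --> x : U"
    using U(1) unfolding supp_def by blast
  obtain r where r: "r : L Q P" "q oo (r oo q) = q" using regular[OF q(1)] by blast
  have m: "a_inv K (one K) : carrier K" by simp
  note i = idV_L[OF P] and rq = L_comp[OF r(1) q(1)]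
  let ?e = "lin_add (idV P) (lin_smult (a_inv K (one K)) (r oo q))"
  have e: "?e : L P P" by (rule lin_add_L[OF i lin_smult_L[OF rq m]])
  have eU: "fn ?e x : U" if x: "x : carrier P" for x
  proof -
    have ex: "fn ?e x = add P x (neg P (fn (r oo q) x))"
      unfolding lin_add_app[OF i x] lin_smult_app[OF rq x] neg_def using x by simp
    have "fn q (fn (r oo q) x) = fn q x" using arg_cong[OF r(2), of "%h. fn h x"] comp_app'[OF rq x] by simp
    then have "fn q (fn ?e x) = zero Q"
      unfolding ex L_add[OF q(1) x neg_closed[OF P L_app[OF rq x]]] L_neg[OF q(1) L_app[OF rq x]]
      using V_neg[OF L_Ob(2)[OF q(1)] L_app[OF q(1) x]] by simp
    then show ?thesis using q(3) L_app[OF e x] by blast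
  qed
  have "ap X ?e a = a"
    unfolding ap_lin_add[OF X i lin_smult_L[OF rq m] a] ap_lin_smult[OF X rq m a]
      ap_comp[OF X r(1) q(1) a] q(2) ap_zero[OF X r(1)] ap_id[OF X P a]
    using lf_Ob[OF X P] a m by simp
  let ?e' = "mk P (sub P U) (fn ?e)"
  have e': "?e' : L P (sub P U)" by (rule corestrict_L[OF e U(2) eU])
  have "incl P U oo ?e' = ?e"
    by (rule L_eqI[OF L_comp[OF incl_L[OF P U(2)] e'] e]) (simp add: comp_app'[OF e'] eU)
  then have "ap X (incl P U) (ap X ?e' a) = a"
    using ap_comp[OF X incl_L[OF P U(2)] e' a] \<open>ap X ?e a = a\<close> by simp
  then show ?thesis using ap_closed[OF X e' a] by blast
qed

text \<open>Inclusions of subspaces split, and functors preserve split monomorphisms.\<close>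

lemma ap_incl_inj:
  assumes X: "lf X" and P: "P : Obj" and U: "subsp U P"
    and b: "b : el X (sub P U)" "c : el X (sub P U)"
    and e: "ap X (incl P U) b = ap X (incl P U) c"
  shows "b = c"
proof -
  obtain r where r: "r : L P (sub P U)" "!!x. x : U ==> fn r x = x" using retract_ex[OF P U] by blast
  note i = incl_L[OF P U] and O = sub_Obj[OF P U]
  have "r oo incl P U = idV (sub P U)"
    by (rule L_eqI[OF L_comp[OF r(1) i] idV_L[OF O]]) (simp add: comp_app'[OF i] r(2))
  then show ?thesis
    using ap_comp[OF X r(1) i b(1)] ap_comp[OF X r(1) i b(2)] ap_id[OF X O b(1)] ap_id[OF X O b(2)] e by simp
qed

section \<open>Functors generated by one object as directed colimits\<close>

lemma L_finsum:
  assumes f: "f : L V W" and J: "finite J" and g: "g : J \<rightarrow> carrier V"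
  shows "fn f (finsum V g J) = finsum W (%j. fn f (g j)) J"
  using J g
proof (induction J)
  case empty
  interpret V: abelian_group V by (rule Obj_group[OF L_Ob(1)[OF f]])
  interpret W: abelian_group W by (rule Obj_group[OF L_Ob(2)[OF f]])
  show ?case by (simp add: L_zero[OF f])
next
  case (insert j J)
  interpret V: abelian_group V by (rule Obj_group[OF L_Ob(1)[OF f]])
  interpret W: abelian_group W by (rule Obj_group[OF L_Ob(2)[OF f]])
  have g: "g : J \<rightarrow> carrier V" "g j : carrier V" using insert by auto
  have fg: "(%j. fn f (g j)) : J \<rightarrow> carrier W" "fn f (g j) : carrier W" using g L_app[OF f] by auto
  show ?case using insert g fg by (simp add: L_add[OF f] V.finsum_closed)
qed

lemma spans_mono: assumes "spans T S" "S <= S'" shows "spans T S'"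
  unfolding spans_def
proof (intro allI impI, elim conjE)
  fix U assume U: "subsp U T" "S' <= U"
  then have "subsp U T & S <= U" using assms(2) by simp
  then show "U = carrier T" using assms(1) unfolding spans_def by simp
qed

text \<open>The index poset consists of pairs \<open>(J, U)\<close> with \<open>J\<close> a finite set of elements of \<open>X(V)\<close> and \<open>U\<close>
  a subspace of \<open>V\<^sup>J\<close> such that the tautological element of \<open>X(V\<^sup>J)\<close> comes from \<open>X(U)\<close>.\<close>

lemma gens_small_functor:
  assumes X: "lf X" and g: "gens X V"
  shows "small_functor X"
proof -
  have V: "V : Obj" using g by (simp add: gens_def)
  let ?S = "el X V"
  \<comment> \<open>All the powers of \<open>V\<close> indexed by finite sets are placed inside the
    single power indexed by \<open>X(V)\<close>, as images of the projections
    \<open>\<pi> J\<close>. Intersections and preimages are then taken in one space.\<close>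
  obtain P p i where P: "P : Obj" and p: "!!s. s : ?S ==> p s : L P V"
    and i: "!!s. s : ?S ==> i s : L V P"
    and pi: "!!s x. s : ?S ==> x : carrier V ==> fn (p s) (fn (i s) x) = x"
    and pi0: "!!s t x. s : ?S ==> t : ?S ==> s \<noteq> t ==> x : carrier V ==> fn (p t) (fn (i s) x) = zero V"
    and peq': "!!x y. x : carrier P ==> y : carrier P ==> ALL s:?S. fn (p s) x = fn (p s) y ==> x = y"
    and ex\<pi>: "!!I. EX \<pi>:L P P. ALL x:carrier P. ALL s:?S.
       fn (p s) (fn \<pi> x) = (if s : I then fn (p s) x else zero V)"
    by (rule product[of ?S "%_. V", OF Obj_small[OF lf_Ob[OF X V]] V]) (rule that)
  have peq: "x = y" if "x : carrier P" "y : carrier P" "!!s. s : ?S ==> fn (p s) x = fn (p s) y" for x y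
    using peq' that by blast
  have ex: "ALL I. EX \<pi>. \<pi> : L P P & (ALL x:carrier P. ALL s:?S.
       fn (p s) (fn \<pi> x) = (if s : I then fn (p s) x else zero V))"
    using ex\<pi> unfolding Bex_def by (rule allI)
  obtain \<pi> where \<pi>': "ALL I. \<pi> I : L P P & (ALL x:carrier P. ALL s:?S.
       fn (p s) (fn (\<pi> I) x) = (if s : I then fn (p s) x else zero V))"
    using choice[OF ex] by (elim exE) (rule that)
  have \<pi>: "\<pi> I : L P P" for I using \<pi>' by blast
  have p\<pi>: "fn (p s) (fn (\<pi> I) x) = (if s : I then fn (p s) x else zero V)"
    if "x : carrier P" "s : ?S" for I x s using \<pi>' that by blast
  note \<pi>c = L_app[OF \<pi>]
  have \<pi>\<pi>: "fn (\<pi> I) (fn (\<pi> J) x) = fn (\<pi> (I \<inter> J)) x" if "x : carrier P" for I J x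
    by (rule peq) (simp_all add: that \<pi>c p\<pi>)
  have \<pi>i: "\<pi> I oo i s = (if s : I then i s else lin_zero V P)" if s: "s : ?S" for I s
  proof (rule L_eqI[OF L_comp[OF \<pi> i[OF s]]])
    show "(if s : I then i s else lin_zero V P) : L V P" using i[OF s] lin_zero_L[OF V P] by simp
    fix x assume x: "x : carrier V"
    show "fn (\<pi> I oo i s) x = fn (if s : I then i s else lin_zero V P) x"
    proof (rule peq)
      show "fn (\<pi> I oo i s) x : carrier P" by (rule L_app[OF L_comp[OF \<pi> i[OF s]] x])
      show "fn (if s : I then i s else lin_zero V P) x : carrier P"
        using L_app[OF i[OF s] x] P x by simp
      fix t assume t: "t : ?S"
      show "fn (p t) (fn (\<pi> I oo i s) x) = fn (p t) (fn (if s : I then i s else lin_zero V P) x)"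
        unfolding comp_app'[OF i[OF s] x] p\<pi>[OF L_app[OF i[OF s] x] t]
        using pi[OF s x] pi0[OF s t _ x] x by (cases "s = t") (auto simp: L_zero[OF p[OF t]])
    qed
  qed
  interpret XP: abelian_group "Fo X P" by (rule Obj_group[OF lf_Ob[OF X P]])
  \<comment> \<open>The tautological element for \<open>J\<close>: its coordinate at
    \<open>s\<close> in \<open>J\<close> is \<open>s\<close> itself.\<close>
  define a where "a J = finsum (Fo X P) (%s. ap X (i s) s) J" for J
  have ic: "ap X (i s) s : el X P" if "s : ?S" for s by (rule ap_closed[OF X i[OF that] that])
  have a: "a J : el X P" if "J <= ?S" for J
    unfolding a_def by (rule XP.finsum_closed) (use ic that in auto)
  have \<pi>a: "ap X (\<pi> I) (a J) = a I" if J: "finite J" "J <= ?S" "I <= J" for I J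
  proof -
    have "ap X (\<pi> I) (a J) = finsum (Fo X P) (%s. ap X (\<pi> I) (ap X (i s) s)) J"
      unfolding a_def by (rule L_finsum[OF lf_L[OF X \<pi>] J(1)]) (use ic J in auto)
    also have "\<dots> = finsum (Fo X P) (%s. if s : I then ap X (i s) s else zero (Fo X P)) J"
    proof (rule XP.finsum_cong')
      fix s assume "s : J"
      then have s: "s : ?S" using J by blast
      show "ap X (\<pi> I) (ap X (i s) s) = (if s : I then ap X (i s) s else zero (Fo X P))"
        unfolding ap_comp[OF X \<pi> i[OF s] s, symmetric] \<pi>i[OF s] using ap_lin_zero[OF X V P s] by simp
    qed (use ic J in auto)
    also have "\<dots> = finsum (Fo X P) (%s. ap X (i s) s) I"
      by (rule XP.add.finprod_mono_neutral_cong_right) (use J ic in auto)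
    finally show ?thesis unfolding a_def .
  qed
  \<comment> \<open>Requiring \<open>U\<close> to be fixed by \<open>\<pi> J\<close> places it in
    the power over \<open>J\<close>, and makes the order below antisymmetric.\<close>
  define D where "D = {(J, U). finite J & J <= ?S & subsp U P & (ALL x:U. fn (\<pi> J) x = x) & supp X P (a J) U}"
  have DI: "(J, U) : D" if "finite J" "J <= ?S" "subsp U P" "ALL x:U. fn (\<pi> J) x = x" "supp X P (a J) U" for J U
    unfolding D_def using that by simp
  have DD: "finite J" "J <= ?S" "subsp U P" "ALL x:U. fn (\<pi> J) x = x" "supp X P (a J) U" "U <= carrier P"
    if "(J, U) : D" for J U
    using that unfolding D_def subsp_def by simp_all
  \<comment> \<open>Later means more elements and smaller subspaces; projecting the later subspace
    to the earlier coordinates must land in the earlier one, so that \<open>\<pi>\<close> restricts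
    to a transition map.\<close>
  define le where "le d e \<longleftrightarrow> fst d <= fst e & (ALL x:snd e. fn (\<pi> (fst d)) x : snd d)" for d e :: "'u set \<times> 'u set"
  define v where "v d = sub P (snd d)" for d :: "'u set \<times> 'u set"
  define tr where "tr d e = mk (v e) (v d) (fn (\<pi> (fst d)))" for d e
  have D: "d : D ==> finite (fst d) & fst d <= ?S & subsp (snd d) P & (ALL x:snd d. fn (\<pi> (fst d)) x = x) &
      supp X P (a (fst d)) (snd d) & snd d <= carrier P" for d
    using DD[of "fst d" "snd d"] by simp
  have exb: "ALL d:D. EX b. b : el X (v d) & ap X (incl P (snd d)) b = a (fst d)"
  proof
    fix d assume d: "d : D"
    have "EX b:el X (sub P (snd d)). ap X (incl P (snd d)) b = a (fst d)"
      by (rule supp_lift[OF X a P]) (use D[OF d] in simp_all)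
    then show "EX b. b : el X (v d) & ap X (incl P (snd d)) b = a (fst d)"
      unfolding v_def Bex_def .
  qed
  \<comment> \<open>The element living at stage \<open>d\<close>: the tautological element, lifted
    to the subspace. Lifts are unique because \<open>X\<close> is injective on inclusions, which
    makes them compatible.\<close>
  obtain b where b': "ALL d:D. b d : el X (v d) & ap X (incl P (snd d)) (b d) = a (fst d)"
    by (rule exE[OF bchoice[OF exb]])
  have b: "b d : el X (v d)" "ap X (incl P (snd d)) (b d) = a (fst d)" if "d : D" for d
    using bspec[OF b' that] by simp_all
  have vO: "v d : Obj" if "d : D" for d unfolding v_def using D[OF that] by (intro sub_Obj[OF P]) simp
  have inc: "incl P (snd d) : L (v d) P" if "d : D" for d
    unfolding v_def using D[OF that] by (intro incl_L[OF P]) simp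
  have trL: "tr d e : L (v e) (v d)" if "d : D" "e : D" "le d e" for d e
  proof -
    have U: "snd e <= carrier P" using D that by blast
    have "is_linear K (v e) (v d) (fn (\<pi> (fst d)))"
      by (rule is_linearI)
         (use U that(3) L_add[OF \<pi>] L_smult[OF \<pi>] in \<open>auto simp: v_def le_def subset_iff\<close>)
    then show ?thesis unfolding tr_def using vO that by (intro mk_L)
  qed
  have inctr: "incl P (snd d) oo tr d e = \<pi> (fst d) oo incl P (snd e)" if "d : D" "e : D" "le d e" for d e
    by (rule L_eqI[OF L_comp[OF inc[OF that(1)] trL[OF that]] L_comp[OF \<pi> inc[OF that(2)]]])
       (use that in \<open>simp add: comp_app'[OF trL[OF that]] comp_app'[OF inc[OF that(2)]] tr_def v_def le_def\<close>)
  have incinj: "x = y" if d: "d : D" and "x : el X (v d)" "y : el X (v d)"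
    "ap X (incl P (snd d)) x = ap X (incl P (snd d)) y" for d x y
    using ap_incl_inj[OF X P _ _ _ that(4)] that D[OF d] by (simp add: v_def)
  have sub_fix: "subsp {x : carrier P. fn (\<pi> J) x = x} P" for J
    by (rule subspI) (use P in \<open>auto simp: L_add[OF \<pi>] L_smult[OF \<pi>] L_zero[OF \<pi>]\<close>)
  have sub_ker: "subsp {x : carrier P. fn f x : U} P" if "f : L P Q" "subsp U Q" for f U Q
    by (rule subspI)
       (use P that(2) in \<open>auto simp: subsp_def L_add[OF that(1)] L_smult[OF that(1)] L_zero[OF that(1)]\<close>)
  have sub_int: "subsp (U \<inter> U') P" if "subsp U P" "subsp U' P" for U U'
    using that by (auto simp: subsp_def)
  have fixD: "(J, {x : carrier P. fn (\<pi> J) x = x}) : D" if J: "finite J" "J <= ?S" for J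
    by (rule DI[OF J sub_fix _ supp_fix[OF X a[OF J(2)] \<pi>]]) (use \<pi>a[OF J] in auto)
  show ?thesis
  proof (rule small_functorI[OF X, of D le v tr b])
    have "D <= Pow ?S \<times> Pow (carrier P)" unfolding D_def subsp_def by blast
    then show "small D"
      by (rule small_subset[rotated])
         (intro small_Sigma small_Pow Obj_small lf_Ob[OF X V] P)
    show "D \<noteq> {}" using fixD[of "{}"] by auto
    show "le d d" if "d : D" for d using D[OF that] by (simp add: le_def)
    show "d = e" if "d : D" "e : D" "le d e" "le e d" for d e
    proof -
      have "fst d = fst e" using that by (auto simp: le_def)
      moreover from this have "snd d = snd e" using that D[OF that(1)] D[OF that(2)] unfolding le_def by fastforce
      ultimately show ?thesis by (rule prod_eqI)
    qed
    show "le d f" if "d : D" "e : D" "f : D" "le d e" "le e f" for d e f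
      unfolding le_def
    proof (intro conjI ballI)
      show "fst d <= fst f" using that by (auto simp: le_def)
      fix x assume x: "x : snd f"
      then have xP: "x : carrier P" using D[OF that(3)] by blast
      have "fn (\<pi> (fst d)) (fn (\<pi> (fst e)) x) : snd d" using x that unfolding le_def by blast
      moreover have "fst d \<inter> fst e = fst d" using that by (auto simp: le_def)
      ultimately show "fn (\<pi> (fst d)) x : snd d" by (simp add: \<pi>\<pi>[OF xP])
    qed
    show "EX f:D. le d f & le e f" if d: "d : D" and e: "e : D" for d e
    proof -
      \<comment> \<open>An upper bound takes the union of the finite sets and, inside its power,
        intersects the preimages of the two subspaces. Supports are stable under both
        operations.\<close>
      let ?J = "fst d \<union> fst e"
      let ?U1 = "{x : carrier P. fn (\<pi> ?J) x = x}" and ?U2 = "{x : carrier P. fn (\<pi> (fst d)) x : snd d}"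
        and ?U3 = "{x : carrier P. fn (\<pi> (fst e)) x : snd e}"
      have J: "finite ?J" "?J <= ?S" using D[OF d] D[OF e] by auto
      have s2: "supp X P (a ?J) ?U2"
        by (rule supp_vimage[OF X a[OF J(2)] \<pi>]) (use \<pi>a[OF J] D[OF d] in simp)
      have s3: "supp X P (a ?J) ?U3"
        by (rule supp_vimage[OF X a[OF J(2)] \<pi>]) (use \<pi>a[OF J] D[OF e] in simp)
      have s1: "supp X P (a ?J) ?U1" using DD(5)[OF fixD[OF J]] .
      have "(?J, ?U1 \<inter> (?U2 \<inter> ?U3)) : D"
      proof (rule DI[OF J])
        show "subsp (?U1 \<inter> (?U2 \<inter> ?U3)) P"
          using D[OF d] D[OF e] by (intro sub_int sub_fix sub_ker[OF \<pi>]) auto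
        show "supp X P (a ?J) (?U1 \<inter> (?U2 \<inter> ?U3))"
          by (intro supp_inter[OF X a[OF J(2)]] s1 s2 s3)
      qed auto
      then show ?thesis by (rule bexI[rotated]) (auto simp: le_def)
    qed
    show "tr d d = idV (v d)" if d: "d : D" for d
    proof (rule L_eqI[OF trL[OF d d] idV_L[OF vO[OF d]]])
      show "le d d" using D[OF d] by (simp add: le_def)
      show "fn (tr d d) x = fn (idV (v d)) x" if "x : carrier (v d)" for x
        using that D[OF d] by (simp add: tr_def v_def)
    qed
    show "tr d e oo tr e f = tr d f" if dD: "d : D" "e : D" "f : D" "le d e" "le e f" for d e f
    proof -
      have df: "le d f" by (rule \<open>\<And>d e f. \<lbrakk>d \<in> D; e \<in> D; f \<in> D; le d e; le e f\<rbrakk> \<Longrightarrow> le d f\<close>[OF dD])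
      note de' = trL[OF dD(1,2,4)] and ef' = trL[OF dD(2,3,5)] and df' = trL[OF dD(1,3) df]
      show ?thesis
      proof (rule L_eqI[OF L_comp[OF de' ef'] df'])
        fix x assume x: "x : carrier (v f)"
        then have xf: "x : snd f" by (simp add: v_def)
        then have xP: "x : carrier P" using D[OF dD(3)] by blast
        have "fst d \<inter> fst e = fst d" using dD by (auto simp: le_def)
        moreover have "fn (\<pi> (fst e)) x : carrier (v e)" using xf dD(5) by (simp add: le_def v_def)
        ultimately show "fn (tr d e oo tr e f) x = fn (tr d f) x"
          using x \<pi>\<pi>[OF xP, of "fst d" "fst e"] by (simp add: comp_app'[OF ef' x] tr_def)
      qed
    qed
    show "ap X (tr d e) (b e) = b d" if de: "d : D" "e : D" "le d e" for d e
    proof (rule incinj[OF de(1) ap_closed[OF X trL[OF de] b(1)[OF de(2)]] b(1)[OF de(1)]])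
      have "ap X (incl P (snd d)) (ap X (tr d e) (b e)) = ap X (\<pi> (fst d)) (ap X (incl P (snd e)) (b e))"
        using ap_comp[OF X inc[OF de(1)] trL[OF de] b(1)[OF de(2)]]
          ap_comp[OF X \<pi> inc[OF de(2)] b(1)[OF de(2)]] inctr[OF de] by simp
      then show "ap X (incl P (snd d)) (ap X (tr d e) (b e)) = ap X (incl P (snd d)) (b d)"
        using b(2)[OF de(1)] b(2)[OF de(2)] \<pi>a D[OF de(2)] de(3) by (simp add: le_def)
    qed
    show "spans (Fo X W) {ap X \<phi> (b d) | \<phi> d. d : D & \<phi> : L (v d) W}" if W: "W : Obj" for W
    proof -
      have "gset X V W <= {ap X \<phi> (b d) | \<phi> d. d : D & \<phi> : L (v d) W}"
      proof
        fix y assume "y : gset X V W"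
        then obtain \<psi> s where s: "\<psi> : L V W" "s : ?S" "y = ap X \<psi> s" unfolding gset_def by blast
        \<comment> \<open>At this stage the projection \<open>p s\<close> carries the tautological
          element to \<open>s\<close>, so all elements of \<open>gset X V W\<close> occur among the
          values of the system.\<close>
        define d where "d = ({s}, {x : carrier P. fn (\<pi> {s}) x = x})"
        have d: "d : D" unfolding d_def using fixD[of "{s}"] s by simp
        note psi = p[OF s(2)]
        have as: "a {s} = ap X (i s) s" unfolding a_def using ic[OF s(2)] by simp
        have pis: "p s oo i s = idV V"
          by (rule L_eqI[OF L_comp[OF psi i[OF s(2)]] idV_L[OF V]])
             (simp add: comp_app'[OF i[OF s(2)]] pi[OF s(2)])
        have "ap X (p s) (a {s}) = s"
          unfolding as ap_comp[OF X psi i[OF s(2)] s(2), symmetric] pis by (rule ap_id[OF X V s(2)])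
        then have "ap X (p s) (ap X (incl P (snd d)) (b d)) = s" using b(2)[OF d] by (simp add: d_def)
        then have "y = ap X ((\<psi> oo p s) oo incl P (snd d)) (b d)"
          unfolding s(3) ap_comp[OF X L_comp[OF s(1) psi] inc[OF d] b(1)[OF d]]
            ap_comp[OF X s(1) psi ap_closed[OF X inc[OF d] b(1)[OF d]]] by simp
        then show "y : {ap X \<phi> (b d) | \<phi> d. d : D & \<phi> : L (v d) W}"
          using d L_comp[OF L_comp[OF s(1) psi] inc[OF d]] by blast
      qed
      moreover have "spans (Fo X W) (gset X V W)" using g W by (simp add: gens_def)
      ultimately show ?thesis using spans_mono by simp
    qed
    show "EX e:D. le d e & \<phi> oo tr d e = lin_zero (v e) W"
      if d: "d : D" and \<phi>: "\<phi> : L (v d) W" and z: "ap X \<phi> (b d) = zero (Fo X W)" for d W \<phi>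
    proof -
      have U: "subsp (snd d) P" "fst d <= ?S" "finite (fst d)" "snd d <= carrier P" using D[OF d] by auto
      obtain r where r: "r : L P (v d)" "!!x. x : snd d ==> fn r x = x"
        using retract_ex[OF P U(1)] unfolding v_def by blast
      have rinc: "r oo incl P (snd d) = idV (v d)"
        by (rule L_eqI[OF L_comp[OF r(1) inc[OF d]] idV_L[OF vO[OF d]]])
           (simp add: comp_app'[OF inc[OF d]] r(2) v_def)
      have "ap X r (a (fst d)) = b d"
        using ap_comp[OF X r(1) inc[OF d] b(1)[OF d]] ap_id[OF X vO[OF d] b(1)[OF d]] b(2)[OF d] rinc by simp
      then have "ap X (\<phi> oo r) (a (fst d)) = zero (Fo X W)"
        using ap_comp[OF X \<phi> r(1) a[OF U(2)]] z by simp
      from supp_kernel[OF L_comp[OF \<phi> r(1)] this]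
      have sk: "supp X P (a (fst d)) {x : carrier P. fn (\<phi> oo r) x : {zero W}}" by simp
      \<comment> \<open>Shrinking \<open>U\<close> by the kernel of \<open>\<phi> r\<close> is a
        legitimate later stage, because \<open>\<phi> r\<close> kills the tautological element. On
        it \<open>r\<close> is the identity, so \<open>\<phi>\<close> vanishes.\<close>
      let ?U = "snd d \<inter> {x : carrier P. fn (\<phi> oo r) x : {zero W}}"
      have W: "W : Obj" using L_Ob[OF \<phi>] by simp
      have W0: "subsp {zero W} W" using W by (simp add: subsp_def)
      have e: "(fst d, ?U) : D"
        by (rule DI[OF U(3,2) sub_int[OF U(1) sub_ker[OF L_comp[OF \<phi> r(1)] W0]] _
              supp_inter[OF X a[OF U(2)] _ sk]]) (use D[OF d] in auto)
      have le: "le d (fst d, ?U)" using D[OF d] by (auto simp: le_def)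
      have "\<phi> oo tr d (fst d, ?U) = lin_zero (v (fst d, ?U)) W"
      proof (rule L_eqI[OF L_comp[OF \<phi> trL[OF d e le]] lin_zero_L[OF vO[OF e] W]])
        fix x assume x: "x : carrier (v (fst d, ?U))"
        then have xU: "x : snd d" "x : carrier P" "fn (\<phi> oo r) x = zero W" by (auto simp: v_def)
        have tx: "fn (tr d (fst d, ?U)) x = x" unfolding tr_def using x xU(1) D[OF d] by simp
        then show "fn (\<phi> oo tr d (fst d, ?U)) x = fn (lin_zero (v (fst d, ?U)) W) x"
          unfolding comp_app'[OF trL[OF d e le] x] tx lin_zero_app[OF x]
          using xU by (simp add: comp_app'[OF r(1)] r(2))
      qed
      with e le show ?thesis by blast
    qed
  qed (rule vO trL b(1), assumption+)+
qed

text \<open>From here on, membership in \<open>Ind\<close> is handled as linearity plus generation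
  by the value at one object, up to spans. This form is easy to verify for tensor products and
  internal homs.\<close>

lemma Ob_Ind: "X : Ob Ind \<longleftrightarrow> lf X & (EX V. gens X V)"
  using gens_small_functor small_functor_sgen sgen_gens by (metis (no_types, lifting) Ind_simps(3) mem_Collect_eq)


section \<open>Spaces of natural families\<close>

text \<open>A large index: every element of \<open>X\<close> at every object. Families become plain
  functions on it, hence directly comparable whichever construction they come from.\<close>

definition idx :: "('k, 'u) vfun => (('k, 'u) module \<times> 'u) set" where
  "idx X = (SIGMA H:Obj. el X H)"

definition mkfam :: "('k, 'u) vfun => (('k, 'u) module => 'u => 'u) => ('k, 'u) module \<times> 'u => 'u" where
  "mkfam X g = (\<lambda>j\<in>idx X. g (fst j) (snd j))"

text \<open>Only naturality is imposed; linearity in the element of \<open>X(H)\<close> follows from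
  it by \<open>auto_linear\<close>.\<close>

definition fam :: "('k, 'u) vfun => ('k, 'u) vfun => (('k, 'u) module \<times> 'u => 'u) set" where
  "fam X Z = {z : PiE (idx X) (%j. el Z (fst j)).
     ALL f V W x. f : L V W --> x : el X V --> z (W, ap X f x) = ap Z f (z (V, x))}"

lemma idxI: "H : Obj ==> x : el X H ==> (H, x) : idx X"
  by (simp add: idx_def)

lemma idxE: assumes "j : idx X" obtains H x where "j = (H, x)" "H : Obj" "x : el X H"
  using assms by (auto simp: idx_def)

lemma mkfam_app[simp]: "H : Obj ==> x : el X H ==> mkfam X g (H, x) = g H x"
  by (simp add: mkfam_def idxI)

lemma fam_closed: "z : fam X Z ==> H : Obj ==> x : el X H ==> z (H, x) : el Z H"
  unfolding fam_def using PiE_mem[of z "idx X" "%j. el Z (fst j)" "(H, x)"] idxI by auto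

lemma fam_nat: "z : fam X Z ==> f : L V W ==> x : el X V ==> z (W, ap X f x) = ap Z f (z (V, x))"
  unfolding fam_def by simp

lemma fam_eqI:
  assumes z: "z : fam X Z" and z': "z' : fam X Z'"
    and e: "!!H x. H : Obj ==> x : el X H ==> z (H, x) = z' (H, x)"
  shows "z = z'"
proof
  fix j show "z j = z' j"
  proof (cases "j : idx X")
    case False
    have "z : PiE (idx X) (%j. el Z (fst j))" "z' : PiE (idx X) (%j. el Z' (fst j))"
      using z z' unfolding fam_def by simp_all
    from PiE_arb[OF this(1) False] PiE_arb[OF this(2) False] show ?thesis by simp
  qed (auto elim!: idxE simp: e)
qed

lemma mkfam_fam:
  assumes X: "lf X" and cl: "!!H x. H : Obj ==> x : el X H ==> g H x : el Z H"
    and nat: "!!f V W x. f : L V W ==> x : el X V ==> g W (ap X f x) = ap Z f (g V x)"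
  shows "mkfam X g : fam X Z"
  unfolding fam_def
proof (intro CollectI conjI allI impI)
  show "mkfam X g : PiE (idx X) (%j. el Z (fst j))"
    unfolding mkfam_def by (rule restrict_PiE_iff[THEN iffD2]) (auto elim!: idxE intro: cl)
  show "mkfam X g (W, ap X f x) = ap Z f (mkfam X g (V, x))" if "f : L V W" "x : el X V" for f V W x
    using that L_Ob[OF that(1)] ap_closed[OF X that] nat[OF that] by simp
qed

lemma fam_linear: "lf X ==> lf Z ==> z : fam X Z ==> H : Obj ==>
    is_linear K (Fo X H) (Fo Z H) (%x. z (H, x))"
  by (rule auto_linear[where g = "%H x. z (H, x)"]) (auto intro: fam_closed fam_nat)

text \<open>Both families are natural and linear, so agreement at \<open>V\<close> passes to the
  images of \<open>X(V)\<close> and then to their span.\<close>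

lemma fam_eq_gens:
  assumes X: "lf X" and Z: "lf Z" and g: "gens X V" and z: "z : fam X Z" "z' : fam X Z"
    and e: "!!a. a : el X V ==> z (V, a) = z' (V, a)"
  shows "z = z'"
proof (rule fam_eqI[OF z])
  fix H x assume H: "H : Obj" and x: "x : el X H"
  note l = fam_linear[OF X Z z(1) H] fam_linear[OF X Z z(2) H]
  show "z (H, x) = z' (H, x)"
    by (rule gens_induct[OF g X H x])
       (simp_all add: fam_nat[OF z(1)] fam_nat[OF z(2)] e is_linear_zero[OF lf_Ob[OF X H] lf_Ob[OF Z H] l(1)]
         is_linear_zero[OF lf_Ob[OF X H] lf_Ob[OF Z H] l(2)] is_linearD[OF l(1)] is_linearD[OF l(2)])
qed

lemma small_inj: assumes "inj_on f A" "small (f ` A)" shows "small A"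
proof -
  have "A = inv_into A f ` f ` A" using assms(1) by simp
  then show ?thesis using small_image[OF assms(2), of "inv_into A f"] by simp
qed

text \<open>Restriction to \<open>X(V)\<close> is injective on families, and the functions from
  \<open>X(V)\<close> to \<open>Z(V)\<close> form a small set. This is what lets a limit over all of
  \<open>Vect\<close> live in the universe.\<close>

lemma small_fam:
  assumes X: "lf X" and Z: "lf Z" and g: "gens X V"
  shows "small (fam X Z)"
proof (rule small_inj)
  let ?r = "%z. \<lambda>a\<in>el X V. z (V, a)"
  have V: "V : Obj" using g by (simp add: gens_def)
  show "inj_on ?r (fam X Z)"
  proof (rule inj_onI)
    fix z z' assume z: "z : fam X Z" "z' : fam X Z" and e: "?r z = ?r z'"
    show "z = z'"
    proof (rule fam_eq_gens[OF X Z g z])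
      show "z (V, a) = z' (V, a)" if "a : el X V" for a using fun_cong[OF e, of a] that by simp
    qed
  qed
  have "?r ` fam X Z <= PiE (el X V) (%_. el Z V)"
    using fam_closed[OF _ V] by fastforce
  then show "small (?r ` fam X Z)"
    by (rule small_subset[rotated]) (intro small_PiE Obj_small lf_Ob[OF X V] lf_Ob[OF Z V])
qed

abbreviation frep where
  "frep M \<rho> X Z \<equiv> represents M \<rho> (idx X) (%j. Fo Z (fst j)) (fam X Z)"

lemma fam_represented:
  assumes X: "lf X" and Z: "lf Z" and g: "gens X V"
  obtains M \<rho> where "frep M \<rho> X Z"
proof (rule sub_prod[of "idx X" "%j. Fo Z (fst j)" "fam X Z"])
  show "Fo Z (fst j) : Obj" if "j : idx X" for j using that lf_Ob[OF Z] by (auto elim: idxE)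
  show "fam X Z <= PiE (idx X) (%j. el Z (fst j))" unfolding fam_def by blast
  show "(\<lambda>j\<in>idx X. zero (Fo Z (fst j))) : fam X Z"
    using mkfam_fam[OF X, of "%H x. zero (Fo Z H)" Z] V_zero[OF lf_Ob[OF Z]] ap_zero[OF Z]
    unfolding mkfam_def by simp
  show "(\<lambda>j\<in>idx X. add (Fo Z (fst j)) (x j) (y j)) : fam X Z" if xy: "x : fam X Z" "y : fam X Z" for x y
    using mkfam_fam[OF X, of "%H a. add (Fo Z H) (x (H, a)) (y (H, a))" Z]
      V_add[OF lf_Ob[OF Z] fam_closed[OF xy(1)] fam_closed[OF xy(2)]]
      fam_nat[OF xy(1)] fam_nat[OF xy(2)] ap_add[OF Z _ fam_closed[OF xy(1)] fam_closed[OF xy(2)]] L_Ob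
    unfolding mkfam_def by simp
  show "(\<lambda>j\<in>idx X. smult (Fo Z (fst j)) c (x j)) : fam X Z" if c: "c : carrier K" and x: "x : fam X Z" for c x
    using mkfam_fam[OF X, of "%H a. smult (Fo Z H) c (x (H, a))" Z]
      V_smult[OF lf_Ob[OF Z] c fam_closed[OF x]] fam_nat[OF x] ap_smult[OF Z _ c fam_closed[OF x]] L_Ob
    unfolding mkfam_def by simp
  show "small (fam X Z)" by (rule small_fam[OF X Z g])
qed

lemma represents_lift_ex:
  assumes "represents V \<rho> J E C" "W : Obj" "!!w. w : carrier W ==> \<phi> w : C"
    "!!j. j : J ==> is_linear K W (E j) (%w. \<phi> w j)"
  shows "EX h. h : L W V & (ALL w:carrier W. \<rho> (fn h w) = \<phi> w)"
  by (rule represents_lift[OF assms(1,2), of \<phi>]) (use assms(3,4) in auto)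

text \<open>For an object known only by a universal property. The map \<open>k\<close> from a
  concrete model hits every coordinate family, and \<open>uniq\<close> makes \<open>k\<close> a left
  inverse of the lift of \<open>\<phi>\<close> to the model, so coordinates separate points of
  \<open>e\<close>.\<close>

lemma represents_transfer:
  assumes r: "represents V \<rho> J E C" and e: "e : Obj"
    and \<phi>: "!!x. x : carrier e ==> \<phi> x : C" "!!j. j : J ==> is_linear K e (E j) (%x. \<phi> x j)"
    and k: "k : L V e" "!!v. v : carrier V ==> \<phi> (fn k v) = \<rho> v"
    and uniq: "!!m. m : L e e ==> (!!x. x : carrier e ==> \<phi> (fn m x) = \<phi> x) ==> m = idV e"
  shows "represents e \<phi> J E C"
proof -
  obtain h where h: "h : L e V" "!!x. x : carrier e ==> \<rho> (fn h x) = \<phi> x"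
    using represents_lift_ex[OF r e, of \<phi>] \<phi> by blast
  note hc = L_app[OF h(1)] and kc = L_app[OF k(1)]
  have kh: "fn k (fn h x) = x" if x: "x : carrier e" for x
  proof -
    have "k oo h = idV e"
      by (rule uniq[OF L_comp[OF k(1) h(1)]]) (simp add: comp_app'[OF h(1)] k(2) hc h(2))
    then show ?thesis using comp_app'[OF h(1) x, of k] x by simp
  qed
  have bij: "bij_betw \<phi> (carrier e) C"
  proof (rule bij_betwI')
    show "\<phi> x = \<phi> y \<longleftrightarrow> x = y" if x: "x : carrier e" and y: "y : carrier e" for x y
    proof
      assume "\<phi> x = \<phi> y"
      then have "fn h x = fn h y"
        by (intro represents_eqI[OF r hc[OF x] hc[OF y]]) (simp add: h(2) x y)
      then have "fn k (fn h x) = fn k (fn h y)" by (rule arg_cong)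
      then show "x = y" unfolding kh[OF x] kh[OF y] .
    qed simp
    show "EX x:carrier e. z = \<phi> x" if z: "z : C" for z
    proof -
      obtain v where v: "v : carrier V" "\<rho> v = z" using representsD(6)[OF r z] by blast
      then show ?thesis using k(2)[OF v(1)] kc[OF v(1)] by (intro bexI[of _ "fn k v"]) auto
    qed
  qed (rule \<phi>(1))
  then show ?thesis using r e \<phi>(2) unfolding represents_def by simp
qed

subsection \<open>Arrows between chosen limits, ends and coends\<close>

lemma lim_is_limit: assumes "is_limit J C F l p" shows "is_limit J C F (fst (lim J C F)) (snd (lim J C F))"
proof -
  have "case lim J C F of (l, p) => is_limit J C F l p"
    unfolding lim_def by (rule someI[of _ "(l, p)"]) (simp add: assms)
  then show ?thesis by (simp add: split_beta)
qed

lemma colim_is_colimit: assumes "is_colimit J C F l p"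
  shows "is_colimit J C F (fst (colim J C F)) (snd (colim J C F))"
proof -
  have "case colim J C F of (l, p) => is_colimit J C F l p"
    unfolding colim_def by (rule someI[of _ "(l, p)"]) (simp add: assms)
  then show ?thesis by (simp add: split_beta)
qed

lemma end_is_end: assumes "is_end C D T e w" shows "is_end C D T (fst (end_of C D T)) (snd (end_of C D T))"
proof -
  have "case end_of C D T of (e, w) => is_end C D T e w"
    unfolding end_of_def by (rule someI[of _ "(e, w)"]) (simp add: assms)
  then show ?thesis by (simp add: split_beta)
qed

lemma coend_is_coend: assumes "is_coend C D T e w"
  shows "is_coend C D T (fst (coend_of C D T)) (snd (coend_of C D T))"
proof -
  have "case coend_of C D T of (e, w) => is_coend C D T e w"
    unfolding coend_of_def by (rule someI[of _ "(e, w)"]) (simp add: assms)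
  then show ?thesis by (simp add: split_beta)
qed

lemma lim_map_props:
  assumes "is_limit J C G l p" "is_cone J C G (fst (lim J C F)) (%j. Cmp C (t j) (snd (lim J C F) j))"
  shows "lim_map J C F G t : Mor C (fst (lim J C F)) (fst (lim J C G)) &
    (ALL j:Ob J. Cmp C (snd (lim J C G) j) (lim_map J C F G t) = Cmp C (t j) (snd (lim J C F) j))"
proof -
  have "EX! h. h : Mor C (fst (lim J C F)) (fst (lim J C G)) &
    (ALL j:Ob J. Cmp C (snd (lim J C G) j) h = Cmp C (t j) (snd (lim J C F) j))"
    using lim_is_limit[OF assms(1)] assms(2) unfolding is_limit_def by simp
  from theI'[OF this] show ?thesis unfolding lim_map_def .
qed

lemma colim_map_props:
  assumes "is_colimit J C F l p"
    "is_cocone J C F (fst (colim J' C G)) (%j. Cmp C (snd (colim J' C G) (k j)) (t j))"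
  shows "colim_map J J' C F G k t : Mor C (fst (colim J C F)) (fst (colim J' C G)) &
    (ALL j:Ob J. Cmp C (colim_map J J' C F G k t) (snd (colim J C F) j) = Cmp C (snd (colim J' C G) (k j)) (t j))"
proof -
  have "EX! h. h : Mor C (fst (colim J C F)) (fst (colim J' C G)) &
    (ALL j:Ob J. Cmp C h (snd (colim J C F) j) = Cmp C (snd (colim J' C G) (k j)) (t j))"
    using colim_is_colimit[OF assms(1)] assms(2) unfolding is_colimit_def by simp
  from theI'[OF this] show ?thesis unfolding colim_map_def .
qed

lemma end_map_props:
  assumes "is_end C D T' e w"
    "is_wedge C D T' (fst (end_of C D T)) (%a. Cmp D (t a) (snd (end_of C D T) a))"
  shows "end_map C D T T' t : Mor D (fst (end_of C D T)) (fst (end_of C D T')) &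
    (ALL a:Ob C. Cmp D (snd (end_of C D T') a) (end_map C D T T' t) = Cmp D (t a) (snd (end_of C D T) a))"
proof -
  have "EX! h. h : Mor D (fst (end_of C D T)) (fst (end_of C D T')) &
    (ALL a:Ob C. Cmp D (snd (end_of C D T') a) h = Cmp D (t a) (snd (end_of C D T) a))"
    using end_is_end[OF assms(1)] assms(2) unfolding is_end_def by simp
  from theI'[OF this] show ?thesis unfolding end_map_def .
qed

lemma coend_map_props:
  assumes "is_coend C D T e w"
    "is_cowedge C D T (fst (coend_of C D T')) (%a. Cmp D (snd (coend_of C D T') a) (t a))"
  shows "coend_map C D T T' t : Mor D (fst (coend_of C D T)) (fst (coend_of C D T')) &
    (ALL a:Ob C. Cmp D (coend_map C D T T' t) (snd (coend_of C D T) a) = Cmp D (snd (coend_of C D T') a) (t a))"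
proof -
  have "EX! h. h : Mor D (fst (coend_of C D T)) (fst (coend_of C D T')) &
    (ALL a:Ob C. Cmp D h (snd (coend_of C D T) a) = Cmp D (snd (coend_of C D T') a) (t a))"
    using coend_is_coend[OF assms(1)] assms(2) unfolding is_coend_def by simp
  from theI'[OF this] show ?thesis unfolding coend_map_def .
qed

subsection \<open>Natural families as an end\<close>

text \<open>The integrand for natural families with values in a single functor \<open>Z\<close>. The
  one of the statement is the case \<open>Z(H) = Y(H \<otimes> V)\<close>, see
  \<open>end_integrand_endT\<close>.\<close>

definition endT :: "('k, 'u) vfun => ('k, 'u) vfun => (('k, 'u) module \<times> ('k, 'u) module, ('k, 'u) lin \<times> ('k, 'u) lin,
      ('k, 'u) module, ('k, 'u) lin) cfunctor" where
  "endT X Z = \<lparr>Fo = (%(A, B). hom_sp (Fo X A) (Fo Z B)), Fa = (%(a, b). hom_map (Fa X a) (Fa Z b))\<rparr>"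

text \<open>A vector of the apex of a wedge, decoded from graphs of linear maps and read as a family
  on elements.\<close>

definition endfam :: "('k, 'u) vfun => ('k, 'u) vfun => (('k, 'u) module => ('k, 'u) lin) => 'u => ('k, 'u) module \<times> 'u => 'u" where
  "endfam X Z w \<epsilon> = mkfam X (%H x. fn (ungraph (Fo X H) (Fo Z H) (fn (w H) \<epsilon>)) x)"

lemma eval_linear:
  assumes w: "w : L e (hom_sp A B)" and x: "x : carrier A"
  shows "is_linear K e B (%\<epsilon>. fn (ungraph A B (fn w \<epsilon>)) x)"
proof (rule is_linearI)
  fix a assume a: "a : carrier e"
  obtain f where f: "f : L A B" "fn w a = graph f" using L_app[OF w a] by (rule hom_cases)
  show "fn (ungraph A B (fn w a)) x : carrier B" unfolding f(2) ungraph_graph[OF f(1)] by (rule L_app[OF f(1) x])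
  show "fn (ungraph A B (fn w (add e a b))) x = add B (fn (ungraph A B (fn w a)) x) (fn (ungraph A B (fn w b)) x)"
    if b: "b : carrier e" for b
  proof -
    obtain g where g: "g : L A B" "fn w b = graph g" using L_app[OF w b] by (rule hom_cases)
    show ?thesis
      unfolding L_add[OF w a b] f(2) g(2) hom_add[OF f(1) g(1)] ungraph_graph[OF f(1)] ungraph_graph[OF g(1)]
        ungraph_graph[OF lin_add_L[OF f(1) g(1)]] by (rule lin_add_app[OF f(1) x])
  qed
  show "fn (ungraph A B (fn w (smult e c a))) x = smult B c (fn (ungraph A B (fn w a)) x)"
    if c: "c : carrier K" for c
    unfolding L_smult[OF w c a] f(2) hom_smult[OF f(1)] ungraph_graph[OF f(1)]
        ungraph_graph[OF lin_smult_L[OF f(1) c]] by (rule lin_smult_app[OF f(1) x])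
qed

lemma endfam_app: "H : Obj ==> x : el X H ==>
    endfam X Z w \<epsilon> (H, x) = fn (ungraph (Fo X H) (Fo Z H) (fn (w H) \<epsilon>)) x"
  by (simp add: endfam_def)

lemma wedge_eq_iff:
  assumes X: "lf X" and Z: "lf Z" and f: "f : L V W"
    and w: "w V : L e (hom_sp (Fo X V) (Fo Z V))" "w W : L e (hom_sp (Fo X W) (Fo Z W))"
  shows "hom_map (Fa X (idV V)) (Fa Z f) oo w V = hom_map (Fa X f) (Fa Z (idV W)) oo w W \<longleftrightarrow>
    (ALL \<epsilon>:carrier e. ALL x:el X V. endfam X Z w \<epsilon> (W, ap X f x) = ap Z f (endfam X Z w \<epsilon> (V, x)))"
    (is "?l = ?r \<longleftrightarrow> ?R")
proof -
  note O = L_Ob[OF f]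
  note Xi = lf_L[OF X idV_L[OF O(1)]] and Zi = lf_L[OF Z idV_L[OF O(2)]] and Xf = lf_L[OF X f] and Zf = lf_L[OF Z f]
  note l1 = hom_map_L[OF Xi Zf] and r1 = hom_map_L[OF Xf Zi]
  have l: "?l : L e (hom_sp (Fo X V) (Fo Z W))" by (rule L_comp[OF l1 w(1)])
  have r: "?r : L e (hom_sp (Fo X V) (Fo Z W))" by (rule L_comp[OF r1 w(2)])
  have pt: "fn ?l \<epsilon> = fn ?r \<epsilon> \<longleftrightarrow>
      (ALL x:el X V. endfam X Z w \<epsilon> (W, ap X f x) = ap Z f (endfam X Z w \<epsilon> (V, x)))"
    if \<epsilon>: "\<epsilon> : carrier e" for \<epsilon>
  proof -
    obtain m where m: "m : L (Fo X V) (Fo Z V)" "fn (w V) \<epsilon> = graph m" using L_app[OF w(1) \<epsilon>] by (rule hom_cases)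
    obtain n where n: "n : L (Fo X W) (Fo Z W)" "fn (w W) \<epsilon> = graph n" using L_app[OF w(2) \<epsilon>] by (rule hom_cases)
    note Zm = L_comp[OF Zf m(1)] and nX = L_comp[OF n(1) Xf]
    have "fn ?l \<epsilon> = graph (Fa Z f oo m)"
      unfolding comp_app'[OF w(1) \<epsilon>] m(2) hom_map_app[OF Xi Zf m(1)]
      using comp_id(2)[OF m(1)] by (simp add: lf_id[OF X O(1)])
    moreover have "fn ?r \<epsilon> = graph (n oo Fa X f)"
      unfolding comp_app'[OF w(2) \<epsilon>] n(2) hom_map_app[OF Xf Zi n(1)]
      using comp_id(1)[OF nX] by (simp add: lf_id[OF Z O(2)])
    ultimately have "fn ?l \<epsilon> = fn ?r \<epsilon> \<longleftrightarrow> n oo Fa X f = Fa Z f oo m"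
      using graph_inj[OF Zm nX] by auto
    also have "\<dots> \<longleftrightarrow> (ALL x:el X V. fn n (ap X f x) = ap Z f (fn m x))"
    proof
      assume e: "n oo Fa X f = Fa Z f oo m"
      show "ALL x:el X V. fn n (ap X f x) = ap Z f (fn m x)"
        using arg_cong[OF e, of fn] comp_app'[OF Xf] comp_app'[OF m(1)] by metis
    next
      assume e: "ALL x:el X V. fn n (ap X f x) = ap Z f (fn m x)"
      show "n oo Fa X f = Fa Z f oo m"
        by (rule L_eqI[OF nX Zm]) (use e in \<open>simp add: comp_app'[OF Xf] comp_app'[OF m(1)]\<close>)
    qed
    also have "\<dots> \<longleftrightarrow> (ALL x:el X V. endfam X Z w \<epsilon> (W, ap X f x) = ap Z f (endfam X Z w \<epsilon> (V, x)))"
      using O ap_closed[OF X f] by (simp add: endfam_app m n)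
    finally show ?thesis .
  qed
  show ?thesis
  proof
    assume "?l = ?r" then show ?R using pt by metis
  next
    assume ?R then show "?l = ?r" using pt by (intro L_eqI[OF l r]) simp
  qed
qed

text \<open>Dinaturality at \<open>f\<close>, evaluated at a vector of the apex and an element
  \<open>x\<close>, is naturality at \<open>f\<close> of the family of that vector. A wedge is
  therefore a linear parametrisation of natural families.\<close>

lemma wedge_iff:
  assumes X: "lf X" and Z: "lf Z"
  shows "is_wedge Vect Vect (endT X Z) e w \<longleftrightarrow> e : Obj &
    (ALL H:Obj. w H : L e (hom_sp (Fo X H) (Fo Z H))) & (ALL \<epsilon>:carrier e. endfam X Z w \<epsilon> : fam X Z)"
    (is "_ \<longleftrightarrow> _ & ?w & ?f")
proof -
  have "(ALL f:Ar Vect. hom_map (Fa X (idV (src f))) (Fa Z f) oo w (src f) = hom_map (Fa X f) (Fa Z (idV (tgt f))) oo w (tgt f))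
    \<longleftrightarrow> ?f" if w: "?w"
  proof -
    have "(ALL f:Ar Vect. hom_map (Fa X (idV (src f))) (Fa Z f) oo w (src f) = hom_map (Fa X f) (Fa Z (idV (tgt f))) oo w (tgt f))
      \<longleftrightarrow> (ALL f:Ar Vect. ALL \<epsilon>:carrier e. ALL x:el X (src f).
        endfam X Z w \<epsilon> (tgt f, ap X f x) = ap Z f (endfam X Z w \<epsilon> (src f, x)))"
    proof (rule ball_cong[OF refl])
      fix f assume "f : Ar Vect"
      then have f: "f : L (src f) (tgt f)" by (simp add: Ar_L)
      show "hom_map (Fa X (idV (src f))) (Fa Z f) oo w (src f) = hom_map (Fa X f) (Fa Z (idV (tgt f))) oo w (tgt f) \<longleftrightarrow>
        (ALL \<epsilon>:carrier e. ALL x:el X (src f).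
        endfam X Z w \<epsilon> (tgt f, ap X f x) = ap Z f (endfam X Z w \<epsilon> (src f, x)))"
        by (rule wedge_eq_iff[OF X Z f]) (use w L_Ob[OF f] in auto)
    qed
    also have "\<dots> \<longleftrightarrow> ?f"
    proof
      assume n: "ALL f:Ar Vect. ALL \<epsilon>:carrier e. ALL x:el X (src f).
        endfam X Z w \<epsilon> (tgt f, ap X f x) = ap Z f (endfam X Z w \<epsilon> (src f, x))"
      show ?f
      proof
        fix \<epsilon> assume \<epsilon>: "\<epsilon> : carrier e"
        show "endfam X Z w \<epsilon> : fam X Z"
          unfolding endfam_def
        proof (rule mkfam_fam[OF X])
          fix H x assume H: "H : Obj" and x: "x : el X H"
          have wH: "w H : L e (hom_sp (Fo X H) (Fo Z H))" using w H by blast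
          show "fn (ungraph (Fo X H) (Fo Z H) (fn (w H) \<epsilon>)) x : el Z H"
            by (rule L_app[OF ungraph_L(1)[OF L_app[OF wH \<epsilon>]] x])
        next
          fix f V W x assume f: "f : L V W" and x: "x : el X V"
          show "fn (ungraph (Fo X W) (Fo Z W) (fn (w W) \<epsilon>)) (ap X f x) =
            ap Z f (fn (ungraph (Fo X V) (Fo Z V) (fn (w V) \<epsilon>)) x)"
            using bspec[OF bspec[OF bspec[OF n L_Ar[OF f]] \<epsilon>], of x] x L_src[OF f] L_Ob[OF f] ap_closed[OF X f x]
            by (simp add: endfam_app)
        qed
      qed
    next
      assume F: ?f
      show "ALL f:Ar Vect. ALL \<epsilon>:carrier e. ALL x:el X (src f).
        endfam X Z w \<epsilon> (tgt f, ap X f x) = ap Z f (endfam X Z w \<epsilon> (src f, x))"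
      proof (intro ballI)
        fix f \<epsilon> x assume "f : Ar Vect" "\<epsilon> : carrier e" "x : el X (src f)"
        then show "endfam X Z w \<epsilon> (tgt f, ap X f x) = ap Z f (endfam X Z w \<epsilon> (src f, x))"
          using fam_nat[of "endfam X Z w \<epsilon>" X Z f "src f" "tgt f" x] F by (simp add: Ar_L)
      qed
    qed
    finally show ?thesis .
  qed
  then show ?thesis unfolding is_wedge_def by (auto simp: endT_def)
qed

lemma endfam_linear:
  assumes Z: "lf Z" and w: "!!H. H : Obj ==> w H : L e (hom_sp (Fo X H) (Fo Z H))" and j: "j : idx X"
  shows "is_linear K e (Fo Z (fst j)) (%\<epsilon>. endfam X Z w \<epsilon> j)"
proof -
  obtain H x where j: "j = (H, x)" "H : Obj" "x : el X H" using j by (rule idxE)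
  show ?thesis using eval_linear[OF w[OF j(2)] j(3)] by (simp add: j(1) endfam_app[OF j(2,3)])
qed

lemma end_of_families:
  assumes X: "lf X" and Z: "lf Z" and r: "frep M \<rho> X Z"
  shows "EX w. is_end Vect Vect (endT X Z) M w & (ALL v:carrier M. endfam X Z w v = \<rho> v)"
proof -
  define w where "w H = mk M (hom_sp (Fo X H) (Fo Z H)) (%v. graph (mk (Fo X H) (Fo Z H) (%x. \<rho> v (H, x))))" for H
  have M: "M : Obj" and \<rho>: "\<rho> v : fam X Z" if "v : carrier M" for v using representsD[OF r] that by auto
  have M: "M : Obj" by (rule representsD(1)[OF r])
  have m: "mk (Fo X H) (Fo Z H) (%x. \<rho> v (H, x)) : L (Fo X H) (Fo Z H)" if "H : Obj" "v : carrier M" for H v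
    by (rule mk_L[OF lf_Ob[OF X that(1)] lf_Ob[OF Z that(1)] fam_linear[OF X Z \<rho>[OF that(2)] that(1)]])
  have w: "w H : L M (hom_sp (Fo X H) (Fo Z H))" if H: "H : Obj" for H
    unfolding w_def
  proof (rule mk_L[OF M hom_Obj[OF lf_Ob[OF X H] lf_Ob[OF Z H]]], rule linear_into_hom)
    show "mk (Fo X H) (Fo Z H) (%x. \<rho> v (H, x)) : L (Fo X H) (Fo Z H)" if "v : carrier M" for v
      by (rule m[OF H that])
    show "M : Obj" by (rule M)
  next
    fix a b x assume ab: "a : carrier M" "b : carrier M" and x: "x : el X H"
    note l = representsD(3)[OF r idxI[OF H x]]
    show "fn (mk (Fo X H) (Fo Z H) (%x. \<rho> (add M a b) (H, x))) x =
      add (Fo Z H) (fn (mk (Fo X H) (Fo Z H) (%x. \<rho> a (H, x))) x) (fn (mk (Fo X H) (Fo Z H) (%x. \<rho> b (H, x))) x)"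
      using is_linearD(2)[OF l ab] x by simp
  next
    fix c a x assume c: "c : carrier K" "a : carrier M" and x: "x : el X H"
    note l = representsD(3)[OF r idxI[OF H x]]
    show "fn (mk (Fo X H) (Fo Z H) (%x. \<rho> (smult M c a) (H, x))) x =
      smult (Fo Z H) c (fn (mk (Fo X H) (Fo Z H) (%x. \<rho> a (H, x))) x)"
      using is_linearD(3)[OF l c] x by simp
  qed
  have wapp: "fn (w H) v = graph (mk (Fo X H) (Fo Z H) (%x. \<rho> v (H, x)))" if "v : carrier M" for H v
    using that by (simp add: w_def)
  have ew: "endfam X Z w v = \<rho> v" if v: "v : carrier M" for v
  proof -
    have "endfam X Z w v : fam X Z" unfolding endfam_def
    proof (rule mkfam_fam[OF X])
      fix H x assume "H : Obj" "x : el X H"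
      then show "fn (ungraph (Fo X H) (Fo Z H) (fn (w H) v)) x : el Z H"
        using fam_closed[OF \<rho>[OF v]] by (simp add: wapp[OF v] ungraph_graph[OF m[OF _ v]])
    next
      fix f V W x assume f: "f : L V W" "x : el X V"
      show "fn (ungraph (Fo X W) (Fo Z W) (fn (w W) v)) (ap X f x) =
            ap Z f (fn (ungraph (Fo X V) (Fo Z V) (fn (w V) v)) x)"
        using fam_nat[OF \<rho>[OF v] f] ap_closed[OF X f] L_Ob[OF f(1)] f(2)
        by (simp add: wapp[OF v] ungraph_graph[OF m[OF _ v]])
    qed
    then show ?thesis
      by (rule fam_eqI[OF _ \<rho>[OF v]]) (simp add: endfam_app wapp[OF v] ungraph_graph[OF m[OF _ v]])
  qed
  have wd: "is_wedge Vect Vect (endT X Z) M w" unfolding wedge_iff[OF X Z] using M w ew \<rho> by simp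
  moreover have "EX! h. h : L e' M & (ALL H:Obj. w H oo h = w' H)"
    if w': "is_wedge Vect Vect (endT X Z) e' w'" for e' w'
  proof -
    have e': "e' : Obj" and w'L: "!!H. H : Obj ==> w' H : L e' (hom_sp (Fo X H) (Fo Z H))"
      and w'f: "!!\<epsilon>. \<epsilon> : carrier e' ==> endfam X Z w' \<epsilon> : fam X Z" using w' unfolding wedge_iff[OF X Z] by auto
    have key: "(ALL H:Obj. w H oo h = w' H) \<longleftrightarrow> (ALL \<epsilon>:carrier e'. \<rho> (fn h \<epsilon>) = endfam X Z w' \<epsilon>)" if h: "h : L e' M" for h
    proof
      assume e: "ALL H:Obj. w H oo h = w' H"
      show "ALL \<epsilon>:carrier e'. \<rho> (fn h \<epsilon>) = endfam X Z w' \<epsilon>"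
      proof
        fix \<epsilon> assume \<epsilon>: "\<epsilon> : carrier e'"
        have "endfam X Z w (fn h \<epsilon>) = endfam X Z w' \<epsilon>"
        proof (rule fam_eqI[of _ X Z _ Z])
          show "endfam X Z w (fn h \<epsilon>) : fam X Z" using ew \<rho> L_app[OF h \<epsilon>] by simp
          show "endfam X Z w' \<epsilon> : fam X Z" by (rule w'f[OF \<epsilon>])
          fix H x assume H: "H : Obj" "x : el X H"
          have "fn (w H) (fn h \<epsilon>) = fn (w' H) \<epsilon>" using e H(1) comp_app'[OF h \<epsilon>, of "w H"] by simp
          then show "endfam X Z w (fn h \<epsilon>) (H, x) = endfam X Z w' \<epsilon> (H, x)" by (simp add: endfam_app[OF H])
        qed
        then show "\<rho> (fn h \<epsilon>) = endfam X Z w' \<epsilon>" using ew[OF L_app[OF h \<epsilon>]] by simp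
      qed
    next
      assume e: "ALL \<epsilon>:carrier e'. \<rho> (fn h \<epsilon>) = endfam X Z w' \<epsilon>"
      show "ALL H:Obj. w H oo h = w' H"
      proof
        fix H assume H: "H : Obj"
        show "w H oo h = w' H"
        proof (rule L_eqI[OF L_comp[OF w[OF H] h] w'L[OF H]])
          fix \<epsilon> assume \<epsilon>: "\<epsilon> : carrier e'"
          note h\<epsilon> = L_app[OF h \<epsilon>]
          obtain n where n: "n : L (Fo X H) (Fo Z H)" "fn (w' H) \<epsilon> = graph n" using L_app[OF w'L[OF H] \<epsilon>] by (rule hom_cases)
          have "mk (Fo X H) (Fo Z H) (%x. \<rho> (fn h \<epsilon>) (H, x)) = n"
            by (rule L_eqI[OF m[OF H h\<epsilon>] n(1)])
               (use e \<epsilon> H in \<open>simp add: endfam_app n(2) ungraph_graph[OF n(1)]\<close>)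
          then show "fn (w H oo h) \<epsilon> = fn (w' H) \<epsilon>" unfolding comp_app'[OF h \<epsilon>] wapp[OF h\<epsilon>] n(2) by simp
        qed
      qed
    qed
    obtain h where h: "h : L e' M" "!!\<epsilon>. \<epsilon> : carrier e' ==> \<rho> (fn h \<epsilon>) = endfam X Z w' \<epsilon>"
      using represents_lift_ex[OF r e', of "endfam X Z w'"] w'f endfam_linear[OF Z w'L] by blast
    show ?thesis
    proof (rule ex1I[of _ h])
      show "h : L e' M & (ALL H:Obj. w H oo h = w' H)" using h key[OF h(1)] by blast
      fix k assume k: "k : L e' M & (ALL H:Obj. w H oo k = w' H)"
      then have k\<rho>: "ALL \<epsilon>:carrier e'. \<rho> (fn k \<epsilon>) = endfam X Z w' \<epsilon>" using key by blast
      show "k = h"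
      proof (rule L_eqI[OF conjunct1[OF k] h(1)])
        fix \<epsilon> assume \<epsilon>: "\<epsilon> : carrier e'"
        show "fn k \<epsilon> = fn h \<epsilon>"
          by (rule represents_eqI[OF r L_app[OF conjunct1[OF k] \<epsilon>] L_app[OF h(1) \<epsilon>]]) (simp add: k\<rho> h(2) \<epsilon>)
      qed
    qed
  qed
  ultimately have "is_end Vect Vect (endT X Z) M w" unfolding is_end_def by simp
  then show ?thesis using ew by blast
qed

text \<open>Applies to the end picked by \<open>end_of\<close>. The concrete space of families maps
  to it by the universal property, and an endomorphism that preserves all coordinates commutes with
  the wedge, hence is the identity.\<close>

lemma end_represents:
  assumes X: "lf X" and Z: "lf Z" and g: "gens X V" and e: "is_end Vect Vect (endT X Z) e w"
  shows "frep e (endfam X Z w) X Z"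
proof -
  have we: "is_wedge Vect Vect (endT X Z) e w" using e unfolding is_end_def by simp
  have eO: "e : Obj" and w: "!!H. H : Obj ==> w H : L e (hom_sp (Fo X H) (Fo Z H))"
    and wf: "!!\<epsilon>. \<epsilon> : carrier e ==> endfam X Z w \<epsilon> : fam X Z" using we unfolding wedge_iff[OF X Z] by auto
  obtain M \<rho> where r: "frep M \<rho> X Z" using fam_represented[OF X Z g] by blast
  obtain wM where wM: "is_end Vect Vect (endT X Z) M wM" "!!v. v : carrier M ==> endfam X Z wM v = \<rho> v"
    using end_of_families[OF X Z r] by blast
  have univ: "EX! h. h : L e' e & (ALL H:Obj. w H oo h = w' H)" if "is_wedge Vect Vect (endT X Z) e' w'" for e' w'
    using e that unfolding is_end_def by simp
  have wMw: "is_wedge Vect Vect (endT X Z) M wM" using wM(1) unfolding is_end_def by simp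
  obtain k where k: "k : L M e" "!!H. H : Obj ==> w H oo k = wM H"
    using ex1_implies_ex[OF univ[OF wMw]] by blast
  show ?thesis
  proof (rule represents_transfer[OF r eO _ _ k(1)])
    show "endfam X Z w \<epsilon> : fam X Z" if "\<epsilon> : carrier e" for \<epsilon> by (rule wf[OF that])
    show "is_linear K e (Fo Z (fst j)) (%\<epsilon>. endfam X Z w \<epsilon> j)" if "j : idx X" for j
      by (rule endfam_linear[OF Z w that])
    fix v assume v: "v : carrier M"
    have "endfam X Z w (fn k v) = endfam X Z wM v"
      unfolding endfam_def mkfam_def
    proof (rule restrict_ext)
      fix j assume "j : idx X"
      then have "fst j : Obj" by (auto elim: idxE)
      then show "fn (ungraph (Fo X (fst j)) (Fo Z (fst j)) (fn (w (fst j)) (fn k v))) (snd j) =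
        fn (ungraph (Fo X (fst j)) (Fo Z (fst j)) (fn (wM (fst j)) v)) (snd j)"
        using comp_app'[OF k(1) v, of "w (fst j)"] k(2) by simp
    qed
    then show "endfam X Z w (fn k v) = \<rho> v" using wM(2)[OF v] by simp
  next
    fix m assume m: "m : L e e" and e: "!!x. x : carrier e ==> endfam X Z w (fn m x) = endfam X Z w x"
    have A: "w H oo m = w H" if H: "H : Obj" for H
    proof (rule L_eqI[OF L_comp[OF w[OF H] m] w[OF H]])
      fix x assume x: "x : carrier e"
      obtain a where a: "a : L (Fo X H) (Fo Z H)" "fn (w H) (fn m x) = graph a"
        using L_app[OF w[OF H] L_app[OF m x]] by (rule hom_cases)
      obtain b where b: "b : L (Fo X H) (Fo Z H)" "fn (w H) x = graph b"
        using L_app[OF w[OF H] x] by (rule hom_cases)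
      have "a = b"
      proof (rule L_eqI[OF a(1) b(1)])
        show "fn a y = fn b y" if y: "y : el X H" for y
          using fun_cong[OF e[OF x], of "(H, y)"] H y
          by (simp add: endfam_app a(2) b(2) ungraph_graph[OF a(1)] ungraph_graph[OF b(1)])
      qed
      then show "fn (w H oo m) x = fn (w H) x" unfolding comp_app'[OF m x] a(2) b(2) by simp
    qed
    have B: "w H oo idV e = w H" if "H : Obj" for H using comp_id(2)[OF w[OF that]] .
    show "m = idV e"
      by (rule ex1_unique[OF univ[OF we]]) (intro conjI ballI m A B idV_L eO; assumption)+
  qed
qed

subsection \<open>Natural families as a limit over the category of elements\<close>

lemma elements_simps[simp]: "Ob (elements X) = {(H, t). H : Obj & t : NT (yo H) X}"
  "Dom (elements X) = src" "Cod (elements X) = tgt"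
  by (auto simp: comma_cat_def op_cat_def)

lemma op_simps[simp]: "Ob (op_cat C) = Ob C" "Ar (op_cat C) = Ar C" "Dom (op_cat C) = Cod C" "Cod (op_cat C) = Dom C"
  by (simp_all add: op_cat_def)

text \<open>The Yoneda lemma turns the comma category into the category of elements: objects are
  pairs \<open>(H, x)\<close>, and arrows are linear maps that carry one element to the other, with
  direction reversed.\<close>

lemma elements_ArD:
  assumes X: "lf X" and u: "u : Ar (elements X)"
  obtains H x H' x' where "src u = (H, yoN X H x)" "tgt u = (H', yoN X H' x')" "H : Obj" "H' : Obj"
    "x : el X H" "x' : el X H'" "fn u : L H' H" "x = ap X (fn u) x'"
proof -
  obtain H t where s: "src u = (H, t)" by (cases "src u")
  obtain H' t' where s': "tgt u = (H', t')" by (cases "tgt u")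
  have *: "H : Obj" "t : NT (yo H) X" "H' : Obj" "t' : NT (yo H') X" "fn u : L H' H"
    "Cmp FunVect t' (Fa Yoneda (fn u)) = t"
    using u s s' by (auto simp: comma_cat_def Mor_def op_cat_def)
  let ?x = "yev H t" and ?x' = "yev H' t'"
  note x = yev_closed[OF *(2,1)] and x' = yev_closed[OF *(4,3)]
  have s: "src u = (H, yoN X H ?x)" "tgt u = (H', yoN X H' ?x')"
    using s s' yoN_yev[OF *(2,1)] yoN_yev[OF *(4,3)] by simp_all
  have "yoN X H (ap X (fn u) ?x') = yoN X H ?x"
    using Yoneda_comp[OF X *(5) x'] *(6) yoN_yev[OF *(2,1)] yoN_yev[OF *(4,3)] by simp
  then have "yev H (yoN X H (ap X (fn u) ?x')) = yev H (yoN X H ?x)" by simp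
  then have "?x = ap X (fn u) ?x'"
    using yev_yoN[OF X *(1)] x ap_closed[OF X *(5) x'] by simp
  then show ?thesis by (rule that[OF s *(1,3) x x' *(5)])
qed

lemma elements_ArI:
  assumes X: "lf X" and f: "f : L V W" and x: "x : el X V"
  shows "\<lparr>src = (W, yoN X W (ap X f x)), tgt = (V, yoN X V x), fn = f\<rparr> : Ar (elements X)"
  using Yoneda_comp[OF X f x] yoN_NT[OF X L_Ob(1)[OF f] x] yoN_NT[OF X L_Ob(2)[OF f] ap_closed[OF X f x]] L_Ob[OF f] f
  by (simp add: comma_cat_def op_cat_def Mor_def)

definition elD :: "('k, 'u) vfun => (('k, 'u) module \<times> ('k, 'u) vnat,
       (('k, 'u) module \<times> ('k, 'u) vnat, ('k, 'u) lin) arrow, ('k, 'u) module, ('k, 'u) lin) cfunctor" where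
  "elD Z = fcomp Z comma_proj"

lemma elD_simps[simp]: "Fo (elD Z) j = Fo Z (fst j)" "Fa (elD Z) u = Fa Z (fn u)"
  by (simp_all add: elD_def fcomp_def comma_proj_def)

definition limfam :: "('k, 'u) vfun => (('k, 'u) module \<times> ('k, 'u) vnat => ('k, 'u) lin) => 'u => ('k, 'u) module \<times> 'u => 'u" where
  "limfam X p l = mkfam X (%H x. fn (p (H, yoN X H x)) l)"

lemma limfam_app: "H : Obj ==> x : el X H ==> limfam X p l (H, x) = fn (p (H, yoN X H x)) l"
  by (simp add: limfam_def)

text \<open>A cone consists of one arrow for each element and mentions no addition in
  \<open>X(H)\<close>. Compatibility is naturality of the resulting families, and this already
  entails linearity, so cones describe the same families as wedges do.\<close>

lemma cone_iff:
  assumes X: "lf X" and Z: "lf Z"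
  shows "is_cone (op_cat (elements X)) Vect (elD Z) M p \<longleftrightarrow> M : Obj &
    (ALL H:Obj. ALL x:el X H. p (H, yoN X H x) : L M (Fo Z H)) & (ALL l:carrier M. limfam X p l : fam X Z)"
    (is "?C \<longleftrightarrow> _ & ?w & ?f")
proof
  assume C: ?C
  then have M: "M : Obj" by (simp add: is_cone_def)
  have pL: "p (H, yoN X H x) : L M (Fo Z H)" if "H : Obj" "x : el X H" for H x
    using C that yoN_NT[OF X that] unfolding is_cone_def by simp
  have nat: "Fa Z f oo p (V, yoN X V x) = p (W, yoN X W (ap X f x))" if "f : L V W" "x : el X V" for f V W x
  proof -
    have "ALL u:Ar (elements X). Fa Z (fn u) oo p (tgt u) = p (src u)" using C unfolding is_cone_def by simp
    from bspec[OF this elements_ArI[OF X that]] show ?thesis by simp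
  qed
  have "limfam X p l : fam X Z" if l: "l : carrier M" for l
    unfolding limfam_def
  proof (rule mkfam_fam[OF X])
    show "fn (p (H, yoN X H x)) l : el Z H" if "H : Obj" "x : el X H" for H x
      by (rule L_app[OF pL[OF that] l])
    show "fn (p (W, yoN X W (ap X f x))) l = ap Z f (fn (p (V, yoN X V x)) l)"
      if f: "f : L V W" "x : el X V" for f V W x
      unfolding nat[OF f, symmetric] by (rule comp_app'[OF pL[OF L_Ob(1)[OF f(1)] f(2)] l])
  qed
  then show "M : Obj & ?w & ?f" using M pL by blast
next
  assume "M : Obj & ?w & ?f"
  then have M: "M : Obj" and pL: "!!H x. H : Obj ==> x : el X H ==> p (H, yoN X H x) : L M (Fo Z H)"
    and F: "!!l. l : carrier M ==> limfam X p l : fam X Z" by auto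
  show ?C unfolding is_cone_def
  proof (intro conjI ballI)
    show "p j : L M (Fo (elD Z) j)" if jJ: "j : Ob (op_cat (elements X))" for j
    proof -
      obtain H t where j: "j = (H, t)" "H : Obj" "t : NT (yo H) X" using jJ by auto
      show ?thesis using pL[OF j(2) yev_closed[OF j(3,2)]] yoN_yev[OF j(3,2)] j(1) by simp
    qed
    fix u assume "u : Ar (op_cat (elements X))"
    then have "u : Ar (elements X)" by simp
    from elements_ArD[OF X this] obtain H x H' x' where u: "src u = (H, yoN X H x)" "tgt u = (H', yoN X H' x')"
      "H : Obj" "H' : Obj" "x : el X H" "x' : el X H'" "fn u : L H' H" "x = ap X (fn u) x'" .
    have "Fa Z (fn u) oo p (H', yoN X H' x') = p (H, yoN X H x)"
    proof (rule L_eqI[OF L_comp[OF lf_L[OF Z u(7)] pL[OF u(4,6)]] pL[OF u(3,5)]])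
      fix l assume l: "l : carrier M"
      show "fn (Fa Z (fn u) oo p (H', yoN X H' x')) l = fn (p (H, yoN X H x)) l"
        using fam_nat[OF F[OF l] u(7,6)] u limfam_app[OF u(3,5)] limfam_app[OF u(4,6)]
        by (simp add: comp_app'[OF pL[OF u(4,6)] l])
    qed
    then show "Fa (elD Z) u oo p (Dom (op_cat (elements X)) u) = p (Cod (op_cat (elements X)) u)"
      by (simp add: u)
  qed (rule M)
qed

lemma limfam_linear:
  assumes p: "!!H x. H : Obj ==> x : el X H ==> p (H, yoN X H x) : L M (Fo Z H)" and j: "j : idx X"
  shows "is_linear K M (Fo Z (fst j)) (%l. limfam X p l j)"
proof -
  obtain H x where j: "j = (H, x)" "H : Obj" "x : el X H" using j by (rule idxE)
  show ?thesis using L_linear[OF p[OF j(2,3)]] by (simp add: j(1) limfam_app[OF j(2,3)])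
qed

lemma limit_of_families:
  assumes X: "lf X" and Z: "lf Z" and r: "frep M \<rho> X Z"
  shows "EX p. is_limit (op_cat (elements X)) Vect (elD Z) M p & (ALL v:carrier M. limfam X p v = \<rho> v)"
proof -
  define p where "p j = mk M (Fo Z (fst j)) (%v. \<rho> v (fst j, yev (fst j) (snd j)))" for j
  have M: "M : Obj" by (rule representsD(1)[OF r])
  have \<rho>: "\<rho> v : fam X Z" if "v : carrier M" for v using representsD(2)[OF r that] .
  have p_eq: "p (H, yoN X H x) = mk M (Fo Z H) (%v. \<rho> v (H, x))" if "H : Obj" "x : el X H" for H x
    using yev_yoN[OF X that] by (simp add: p_def)
  have pL: "p (H, yoN X H x) : L M (Fo Z H)" if "H : Obj" "x : el X H" for H x
    unfolding p_eq[OF that] using represents_proj[OF r idxI[OF that]] by simp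
  have ep: "limfam X p v = \<rho> v" if v: "v : carrier M" for v
  proof -
    have "limfam X p v = mkfam X (%H x. \<rho> v (H, x))"
      unfolding limfam_def mkfam_def by (rule restrict_ext) (auto elim!: idxE simp: p_eq v)
    also have "\<dots> = \<rho> v"
      by (rule fam_eqI[of _ X Z _ Z]) (auto intro!: mkfam_fam[OF X] \<rho>[OF v] fam_closed[OF \<rho>[OF v]] fam_nat[OF \<rho>[OF v]])
    finally show ?thesis .
  qed
  have cn: "is_cone (op_cat (elements X)) Vect (elD Z) M p"
    unfolding cone_iff[OF X Z] using M pL ep \<rho> by simp
  have "EX! h. h : L N M & (ALL j:Ob (op_cat (elements X)). p j oo h = q j)"
    if q: "is_cone (op_cat (elements X)) Vect (elD Z) N q" for N q
  proof -
    have N: "N : Obj" and qL: "!!H x. H : Obj ==> x : el X H ==> q (H, yoN X H x) : L N (Fo Z H)"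
      and qf: "!!l. l : carrier N ==> limfam X q l : fam X Z" using q unfolding cone_iff[OF X Z] by auto
    have key: "(ALL j:Ob (op_cat (elements X)). p j oo h = q j) \<longleftrightarrow> (ALL l:carrier N. \<rho> (fn h l) = limfam X q l)"
      if h: "h : L N M" for h
    proof
      assume e: "ALL j:Ob (op_cat (elements X)). p j oo h = q j"
      show "ALL l:carrier N. \<rho> (fn h l) = limfam X q l"
      proof
        fix l assume l: "l : carrier N"
        show "\<rho> (fn h l) = limfam X q l"
        proof (rule fam_eqI[OF \<rho>[OF L_app[OF h l]] qf[OF l]])
          fix H x assume H: "H : Obj" "x : el X H"
          have "p (H, yoN X H x) oo h = q (H, yoN X H x)" using e yoN_NT[OF X H] H by simp
          then have "fn (p (H, yoN X H x)) (fn h l) = fn (q (H, yoN X H x)) l" using comp_app'[OF h l] by metis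
          then show "\<rho> (fn h l) (H, x) = limfam X q l (H, x)"
            by (simp add: limfam_app[OF H] p_eq[OF H] L_app[OF h l])
        qed
      qed
    next
      assume e: "ALL l:carrier N. \<rho> (fn h l) = limfam X q l"
      show "ALL j:Ob (op_cat (elements X)). p j oo h = q j"
      proof
        fix j assume "j : Ob (op_cat (elements X))"
        then obtain H t where j: "j = (H, t)" "H : Obj" "t : NT (yo H) X" by auto
        let ?x = "yev H t"
        note x = yev_closed[OF j(3,2)] and t = yoN_yev[OF j(3,2)]
        have "p (H, yoN X H ?x) oo h = q (H, yoN X H ?x)"
        proof (rule L_eqI[OF L_comp[OF pL[OF j(2) x] h] qL[OF j(2) x]])
          fix l assume l: "l : carrier N"
          show "fn (p (H, yoN X H ?x) oo h) l = fn (q (H, yoN X H ?x)) l"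
            unfolding comp_app'[OF h l] p_eq[OF j(2) x] limfam_app[OF j(2) x, symmetric]
            using e l L_app[OF h l] by simp
        qed
        then show "p j oo h = q j" using t j(1) by simp
      qed
    qed
    obtain h where h: "h : L N M" "!!l. l : carrier N ==> \<rho> (fn h l) = limfam X q l"
      using represents_lift_ex[OF r N, of "limfam X q"] qf limfam_linear[OF qL] by blast
    show ?thesis
    proof (rule ex1I[of _ h])
      show "h : L N M & (ALL j:Ob (op_cat (elements X)). p j oo h = q j)" using h key[OF h(1)] by blast
      fix k assume k: "k : L N M & (ALL j:Ob (op_cat (elements X)). p j oo k = q j)"
      then have k\<rho>: "ALL l:carrier N. \<rho> (fn k l) = limfam X q l" using key by blast
      show "k = h"
      proof (rule L_eqI[OF conjunct1[OF k] h(1)])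
        fix l assume l: "l : carrier N"
        show "fn k l = fn h l"
          by (rule represents_eqI[OF r L_app[OF conjunct1[OF k] l] L_app[OF h(1) l]]) (simp add: k\<rho> h(2) l)
      qed
    qed
  qed
  then have "is_limit (op_cat (elements X)) Vect (elD Z) M p" unfolding is_limit_def using cn by simp
  then show ?thesis using ep by blast
qed

lemma limit_represents:
  assumes X: "lf X" and Z: "lf Z" and g: "gens X V"
    and lm: "is_limit (op_cat (elements X)) Vect (elD Z) N q"
  shows "frep N (limfam X q) X Z"
proof -
  let ?J = "op_cat (elements X)"
  have cN: "is_cone ?J Vect (elD Z) N q" using lm unfolding is_limit_def by simp
  have N: "N : Obj" and q: "!!H x. H : Obj ==> x : el X H ==> q (H, yoN X H x) : L N (Fo Z H)"
    and qf: "!!l. l : carrier N ==> limfam X q l : fam X Z" using cN unfolding cone_iff[OF X Z] by auto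
  obtain M \<rho> where r: "frep M \<rho> X Z" using fam_represented[OF X Z g] by blast
  obtain p where p: "is_limit ?J Vect (elD Z) M p" "!!v. v : carrier M ==> limfam X p v = \<rho> v"
    using limit_of_families[OF X Z r] by blast
  have univ: "EX! h. h : L N' N & (ALL j:Ob ?J. q j oo h = q' j)" if "is_cone ?J Vect (elD Z) N' q'" for N' q'
    using lm that unfolding is_limit_def by simp
  have qj: "q j : L N (Fo Z (fst j))" if "j : Ob ?J" for j
  proof -
    have "ALL j:Ob ?J. q j : L N (Fo Z (fst j))" using cN unfolding is_cone_def by simp
    then show ?thesis using that by (rule bspec)
  qed
  have cM: "is_cone ?J Vect (elD Z) M p" using p(1) unfolding is_limit_def by simp
  obtain k where k: "k : L M N" "!!j. j : Ob ?J ==> q j oo k = p j"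
    using ex1_implies_ex[OF univ[OF cM]] by blast
  show ?thesis
  proof (rule represents_transfer[OF r N _ _ k(1)])
    show "limfam X q l : fam X Z" if "l : carrier N" for l by (rule qf[OF that])
    show "is_linear K N (Fo Z (fst j)) (%l. limfam X q l j)" if "j : idx X" for j
      by (rule limfam_linear[OF q that])
    fix v assume v: "v : carrier M"
    have "limfam X q (fn k v) = limfam X p v"
      unfolding limfam_def mkfam_def
    proof (rule restrict_ext)
      fix j assume "j : idx X"
      then have "(fst j, yoN X (fst j) (snd j)) : Ob ?J" using yoN_NT[OF X] by (auto elim!: idxE)
      from k(2)[OF this] show "fn (q (fst j, yoN X (fst j) (snd j))) (fn k v) = fn (p (fst j, yoN X (fst j) (snd j))) v"
        using comp_app'[OF k(1) v] by metis
    qed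
    then show "limfam X q (fn k v) = \<rho> v" using p(2)[OF v] by simp
  next
    fix m assume m: "m : L N N" and e: "!!x. x : carrier N ==> limfam X q (fn m x) = limfam X q x"
    have A: "q j oo m = q j" if jJ: "j : Ob ?J" for j
    proof (rule L_eqI[OF L_comp[OF qj[OF jJ] m] qj[OF jJ]])
      fix x assume x: "x : carrier N"
      obtain H t where j: "j = (H, t)" "H : Obj" "t : NT (yo H) X" using jJ by auto
      show "fn (q j oo m) x = fn (q j) x"
        using fun_cong[OF e[OF x], of "(H, yev H t)"] yoN_yev[OF j(3,2)] j(1)
        by (simp add: limfam_app[OF j(2) yev_closed[OF j(3,2)]] comp_app'[OF m x])
    qed
    have B: "q j oo idV N = q j" if "j : Ob ?J" for j using comp_id(2)[OF qj[OF that]] .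
    show "m = idV N"
      by (rule ex1_unique[OF univ[OF cN]]) (intro conjI ballI m A B idV_L N; assumption)+
  qed
qed

end

section \<open>Functors of two variables\<close>

text \<open>The laws that make \<open>curried ob ar\<close> a functor with values in linear
  functors. The predicate \<open>S\<close> delimits the \<open>Y\<close> on which the construction
  is controlled: all linear functors for the internal hom, members of \<open>Ind\<close> for the
  tensor product.\<close>

locale two_var = small_vect elts K for elts :: "'u => 'u set" and K :: "'k ring" +
  fixes S :: "('k, 'u) vfun => bool" and ob ar
  assumes S_lf: "S Y ==> lf Y"
    and ar_ob: "S Y ==> W : Obj ==> ob Y W : Obj"
    and ar_L: "S Y ==> S Y' ==> \<eta> : NT Y Y' ==> w : L W W' ==> ar \<eta> w : L (ob Y W) (ob Y' W')"
    and ar_id: "S Y ==> W : Obj ==> z : carrier (ob Y W) ==> fn (ar (Idn FunVect Y) (idV W)) z = z"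
    and ar_comp: "S Y ==> S Y' ==> S Y'' ==> \<eta> : NT Y Y' ==> \<eta>' : NT Y' Y'' ==> w : L W W' ==> w' : L W' W'' ==>
      z : carrier (ob Y W) ==> fn (ar (Cmp FunVect \<eta>' \<eta>) (w' oo w)) z = fn (ar \<eta>' w') (fn (ar \<eta> w) z)"
    and ar_add: "S Y ==> w : L W W' ==> w' : L W W' ==> z : carrier (ob Y W) ==>
      fn (ar (Idn FunVect Y) (lin_add w w')) z =
      add (ob Y W') (fn (ar (Idn FunVect Y) w) z) (fn (ar (Idn FunVect Y) w') z)"
    and ar_smult: "S Y ==> w : L W W' ==> c : carrier K ==> z : carrier (ob Y W) ==>
      fn (ar (Idn FunVect Y) (lin_smult c w)) z = smult (ob Y W') c (fn (ar (Idn FunVect Y) w) z)"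
begin

lemma NT_id_comp: assumes "\<eta> : NT Y Y'"
  shows "Cmp FunVect \<eta> (Idn FunVect Y) = \<eta>" "Cmp FunVect (Idn FunVect Y') \<eta> = \<eta>"
proof -
  note i = NT_id[OF NT_lf(1)[OF assms]] and i' = NT_id[OF NT_lf(2)[OF assms]]
  show "Cmp FunVect \<eta> (Idn FunVect Y) = \<eta>"
    by (rule NT_eqI[OF NT_comp(1)[OF assms i(1)] assms]) (simp add: NT_comp(2)[OF assms i(1)] i(2))
  show "Cmp FunVect (Idn FunVect Y') \<eta> = \<eta>"
    by (rule NT_eqI[OF NT_comp(1)[OF i'(1) assms] assms])
       (simp add: NT_comp(2)[OF i'(1) assms] i'(2) nt_closed[OF assms])
qed

lemma vfun_of_simps[simp]: "Fo (vfun_of ob ar Y) = ob Y" "Fa (vfun_of ob ar Y) w = ar (Idn FunVect Y) w"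
  by (simp_all add: vfun_of_def)

lemma curried_simps: "Fo (curried ob ar) = vfun_of ob ar" "src (Fa (curried ob ar) \<eta>) = vfun_of ob ar (src \<eta>)"
  "tgt (Fa (curried ob ar) \<eta>) = vfun_of ob ar (tgt \<eta>)"
  "W : Obj ==> fn (Fa (curried ob ar) \<eta>) W = ar \<eta> (idV W)"
  by (simp_all add: curried_def)

lemma vfun_of_lf: assumes Y: "S Y" shows "lf (vfun_of ob ar Y)"
proof (rule lfI)
  note i = NT_id(1)[OF S_lf[OF Y]]
  show "Fa (vfun_of ob ar Y) f : L (Fo (vfun_of ob ar Y) V) (Fo (vfun_of ob ar Y) W)" if "f : L V W" for f V W
    using ar_L[OF Y Y i that] by simp
  show "ap (vfun_of ob ar Y) (g oo f) x = ap (vfun_of ob ar Y) g (ap (vfun_of ob ar Y) f x)"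
    if "g : L V W" "f : L U V" "x : el (vfun_of ob ar Y) U" for f g U V W x
    using ar_comp[OF Y Y Y i i that(2,1), of x] that(3) by (simp add: NT_id_comp[OF i])
qed (use ar_ob[OF Y] ar_id[OF Y] ar_add[OF Y] ar_smult[OF Y] in auto)

lemma curried_NT:
  assumes Y: "S Y" and Y': "S Y'" and \<eta>: "\<eta> : NT Y Y'"
  shows "Fa (curried ob ar) \<eta> : NT (vfun_of ob ar Y) (vfun_of ob ar Y')"
proof -
  note i = NT_id(1)[OF S_lf[OF Y]] and i' = NT_id(1)[OF S_lf[OF Y']]
  let ?t = "Fa (curried ob ar) \<eta>"
  have "fn ?t (tgt f) oo Fa (vfun_of ob ar Y) f = Fa (vfun_of ob ar Y') f oo fn ?t (src f)" if "f : Ar Vect" for f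
  proof -
    obtain V W where f: "f : L V W" using \<open>f \<in> Ar Vect\<close> by (auto simp: Ar_L)
    note O = L_Ob[OF f]
    note a = ar_L[OF Y Y i f] and a' = ar_L[OF Y' Y' i' f]
      and b = ar_L[OF Y Y' \<eta> idV_L[OF O(1)]] and b' = ar_L[OF Y Y' \<eta> idV_L[OF O(2)]]
    have "ar \<eta> (idV W) oo ar (Idn FunVect Y) f = ar (Idn FunVect Y') f oo ar \<eta> (idV V)"
    proof (rule L_eqI[OF L_comp[OF b' a] L_comp[OF a' b]])
      fix z assume z: "z : carrier (ob Y V)"
      show "fn (ar \<eta> (idV W) oo ar (Idn FunVect Y) f) z = fn (ar (Idn FunVect Y') f oo ar \<eta> (idV V)) z"
        unfolding comp_app'[OF a z] comp_app'[OF b z]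
        using ar_comp[OF Y Y Y' i \<eta> f idV_L[OF O(2)] z] ar_comp[OF Y Y' Y' \<eta> i' idV_L[OF O(1)] f z] f
        by (simp add: NT_id_comp[OF \<eta>])
    qed
    then show ?thesis using L_src[OF f] O by (simp add: curried_simps)
  qed
  moreover have "fn ?t H : L (ob Y H) (ob Y' H)" if "H : Obj" for H
    using ar_L[OF Y Y' \<eta> idV_L[OF that]] that by (simp add: curried_simps)
  ultimately show ?thesis
    using vfun_of_lf[OF Y] vfun_of_lf[OF Y'] NT_src[OF \<eta>]
    unfolding NT_iff by (simp add: curried_simps) (simp add: curried_def)
qed

lemma nt_curried: "W : Obj ==> nt (Fa (curried ob ar) \<eta>) W z = fn (ar \<eta> (idV W)) z"
  by (simp add: curried_simps)

end

context small_vect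
begin

text \<open>A functor isomorphic to the identity on linear functors. Both the colimit over elements
  and the coend are of this kind by the co-Yoneda lemma, so inserting them into the limit or end
  changes nothing.\<close>

definition nearid ::
    "(('k, 'u) vfun, ('k, 'u) vnat, ('k, 'u) vfun, ('k, 'u) vnat) cfunctor => (('k, 'u) vfun => ('k, 'u) vnat) => bool" where
  "nearid \<Phi> \<theta> \<longleftrightarrow> (ALL Y. lf Y --> \<theta> Y : NT (Fo \<Phi> Y) Y &
      (ALL W:Obj. bij_betw (nt (\<theta> Y) W) (el (Fo \<Phi> Y) W) (el Y W))) &
    (ALL \<eta> Y Y'. \<eta> : NT Y Y' --> Fa \<Phi> \<eta> : NT (Fo \<Phi> Y) (Fo \<Phi> Y') &
      (ALL W:Obj. ALL z:el (Fo \<Phi> Y) W. nt (\<theta> Y') W (nt (Fa \<Phi> \<eta>) W z) = nt \<eta> W (nt (\<theta> Y) W z)))"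

lemma nearid_id: "nearid id_functor (Idn FunVect)"
proof -
  have "bij_betw (nt (Idn FunVect Y) W) (el Y W) (el Y W)" if "lf Y" "W : Obj" for Y W
    by (rule bij_betwI'[of _ _ "el Y W"]) (auto simp: NT_id(2)[OF that])
  moreover have "nt (Idn FunVect Y') W (nt \<eta> W z) = nt \<eta> W (nt (Idn FunVect Y) W z)"
    if "\<eta> : NT Y Y'" "W : Obj" "z : el Y W" for \<eta> Y Y' W z
    using NT_id(2)[OF NT_lf(1)[OF that(1)] that(2,3)] NT_id(2)[OF NT_lf(2)[OF that(1)] that(2) nt_closed[OF that]] by simp
  ultimately show ?thesis unfolding nearid_def id_functor_def using NT_id(1) by simp
qed

text \<open>The functor laws for the chosen objects hold after applying \<open>\<tau>\<close>, by
  those of \<open>Y\<close>; as \<open>\<tau>\<close> is injective they hold before.\<close>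

lemma nearidI:
  fixes \<tau> :: "('k, 'u) vfun => ('k, 'u) module => ('k, 'u) lin"
  assumes \<tau>: "!!Y W. lf Y ==> W : Obj ==> \<tau> Y W : L (ob Y W) (Fo Y W)"
    and bij: "!!Y W. lf Y ==> W : Obj ==> bij_betw (fn (\<tau> Y W)) (carrier (ob Y W)) (el Y W)"
    and ar: "!!Y Y' \<eta> W W' w. \<eta> : NT Y Y' ==> w : L W W' ==> ar \<eta> w : L (ob Y W) (ob Y' W')"
    and nat: "!!Y Y' \<eta> W W' w z. \<eta> : NT Y Y' ==> w : L W W' ==> z : carrier (ob Y W) ==>
      fn (\<tau> Y' W') (fn (ar \<eta> w) z) = nt \<eta> W' (ap Y w (fn (\<tau> Y W) z))"
  shows "EX \<theta>. nearid (curried ob ar) \<theta>"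
proof -
  have inj: "z = z'" if "lf Y" "W : Obj" "z : carrier (ob Y W)" "z' : carrier (ob Y W)"
    "fn (\<tau> Y W) z = fn (\<tau> Y W) z'" for Y W z z'
    using bij[OF that(1,2)] that(3-5) unfolding bij_betw_def inj_on_def by blast
  have nat_id: "fn (\<tau> Y W') (fn (ar (Idn FunVect Y) w) z) = ap Y w (fn (\<tau> Y W) z)"
    if Y: "lf Y" and w: "w : L W W'" and z: "z : carrier (ob Y W)" for Y W W' w z
    using nat[OF NT_id(1)[OF Y] w z] NT_id(2)[OF Y L_Ob(2)[OF w] ap_closed[OF Y w L_app[OF \<tau>[OF Y L_Ob(1)[OF w]] z]]]
    by simp
  interpret two_var elts K lf ob ar
  proof (unfold_locales)
    fix Y W assume Y: "lf Y" and W: "W : Obj"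
    show "ob Y W : Obj" using L_Ob[OF \<tau>[OF Y W]] by simp
    note i = NT_id(1)[OF Y] and iW = idV_L[OF W]
    show "fn (ar (Idn FunVect Y) (idV W)) z = z" if z: "z : carrier (ob Y W)" for z
      by (rule inj[OF Y W L_app[OF ar[OF i iW] z] z])
         (simp add: nat_id[OF Y iW z] ap_id[OF Y W L_app[OF \<tau>[OF Y W] z]])
  next
    fix Y W W' w w' z assume Y: "lf Y" and w: "w : L W W'" "w' : L W W'" and z: "z : carrier (ob Y W)"
    note i = NT_id(1)[OF Y] and O = L_Ob[OF w(1)]
    note a = L_app[OF ar[OF i w(1)] z] L_app[OF ar[OF i w(2)] z]
    note \<tau>' = \<tau>[OF Y O(2)] and \<tau>z = L_app[OF \<tau>[OF Y O(1)] z]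
    show "fn (ar (Idn FunVect Y) (lin_add w w')) z =
      add (ob Y W') (fn (ar (Idn FunVect Y) w) z) (fn (ar (Idn FunVect Y) w') z)"
      by (rule inj[OF Y O(2) L_app[OF ar[OF i lin_add_L[OF w]] z] V_add[OF L_Ob(1)[OF \<tau>'] a]])
         (simp add: nat_id[OF Y _ z] lin_add_L[OF w] w L_add[OF \<tau>' a] ap_lin_add[OF Y w \<tau>z])
  next
    fix Y W W' w c z assume Y: "lf Y" and w: "w : L W W'" and c: "c : carrier K" and z: "z : carrier (ob Y W)"
    note i = NT_id(1)[OF Y] and O = L_Ob[OF w]
    note a = L_app[OF ar[OF i w] z]
    note \<tau>' = \<tau>[OF Y O(2)] and \<tau>z = L_app[OF \<tau>[OF Y O(1)] z]
    show "fn (ar (Idn FunVect Y) (lin_smult c w)) z = smult (ob Y W') c (fn (ar (Idn FunVect Y) w) z)"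
      by (rule inj[OF Y O(2) L_app[OF ar[OF i lin_smult_L[OF w c]] z] V_smult[OF L_Ob(1)[OF \<tau>'] c a]])
         (simp add: nat_id[OF Y _ z] lin_smult_L[OF w c] w L_smult[OF \<tau>' c a] ap_lin_smult[OF Y w c \<tau>z])
  next
    fix Y Y' Y'' \<eta> \<eta>' W W' W'' w w' z
    assume "lf Y" "lf Y'" "lf Y''" and \<eta>: "\<eta> : NT Y Y'" "\<eta>' : NT Y' Y''" and w: "w : L W W'" "w' : L W' W''"
      and z: "z : carrier (ob Y W)"
    note Y = NT_lf(1)[OF \<eta>(1)] NT_lf(2)[OF \<eta>(1)] NT_lf(2)[OF \<eta>(2)]
    note c = NT_comp[OF \<eta>(2,1)] and wc = L_comp[OF w(2,1)]
    note a = L_app[OF ar[OF \<eta>(1) w(1)] z]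
    note \<tau>z = L_app[OF \<tau>[OF Y(1) L_Ob(1)[OF w(1)]] z]
    note wz = ap_closed[OF Y(1) w(1) \<tau>z]
    show "fn (ar (Cmp FunVect \<eta>' \<eta>) (w' oo w)) z = fn (ar \<eta>' w') (fn (ar \<eta> w) z)"
      by (rule inj[OF Y(3) L_Ob(2)[OF w(2)] L_app[OF ar[OF c(1) wc] z] L_app[OF ar[OF \<eta>(2) w(2)] a]])
         (simp add: nat[OF c(1) wc z] nat[OF \<eta>(2) w(2) a] nat[OF \<eta>(1) w(1) z] ap_comp[OF Y(1) w(2,1) \<tau>z]
            c(2)[OF L_Ob(2)[OF w(2)] ap_closed[OF Y(1) w(2) wz]] nt_nat[OF \<eta>(1) w(2) wz])
  qed (use ar in auto)
  define \<theta> where "\<theta> Y = mkN (vfun_of ob ar Y) Y (%W. fn (\<tau> Y W))" for Y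
  have \<theta>: "\<theta> Y : NT (vfun_of ob ar Y) Y" if Y: "lf Y" for Y
    unfolding \<theta>_def
    by (rule mkN_NT[OF vfun_of_lf[OF Y] Y]) (use L_app[OF \<tau>[OF Y]] nat_id[OF Y] in auto)
  have nt: "nt (\<theta> Y) W z = fn (\<tau> Y W) z" if "W : Obj" "z : carrier (ob Y W)" for Y W z
    using that by (simp add: \<theta>_def)
  have "nearid (curried ob ar) \<theta>"
    unfolding nearid_def curried_simps
  proof (intro conjI allI impI ballI)
    show "\<theta> Y : NT (vfun_of ob ar Y) Y" if "lf Y" for Y by (rule \<theta>[OF that])
    show "bij_betw (nt (\<theta> Y) W) (el (vfun_of ob ar Y) W) (el Y W)"
      if "lf Y" "W : Obj" for Y W
      using bij[OF that] bij_betw_cong[of "carrier (ob Y W)" "nt (\<theta> Y) W" "fn (\<tau> Y W)"] nt that by simp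
    fix \<eta> Y Y' assume \<eta>: "\<eta> : NT Y Y'"
    note Y = NT_lf[OF \<eta>]
    show "Fa (curried ob ar) \<eta> : NT (vfun_of ob ar Y) (vfun_of ob ar Y')" by (rule curried_NT[OF Y \<eta>])
    fix W z assume W: "W : Obj" and "z : el (vfun_of ob ar Y) W"
    then have z: "z : carrier (ob Y W)" by simp
    note i = idV_L[OF W]
    show "nt (\<theta> Y') W (nt (Fa (curried ob ar) \<eta>) W z) = nt \<eta> W (nt (\<theta> Y) W z)"
      unfolding nt_curried[OF W] nt[OF W z] nt[OF W L_app[OF ar[OF \<eta> i] z]] nat[OF \<eta> i z]
      using ap_id[OF Y(1) W L_app[OF \<tau>[OF Y(1) W] z]] by simp
  qed
  then show ?thesis by blast
qed

subsection \<open>The colimit of representables over the category of elements\<close>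

abbreviation "colD W \<equiv> fcomp (hom_to W) comma_proj"

lemma colD_simps[simp]: "Fo (colD W) j = hom_sp (fst j) W" "Fa (colD W) u = hom_map (fn u) (idV W)"
  by (simp_all add: fcomp_def hom_to_def comma_proj_def)

lemma colD_arrow:
  assumes Y: "lf Y" and q: "is_cocone (elements Y) Vect (colD W) M q" and f: "f : L G W" and x: "x : el Y G"
  shows "fn (q (W, yoN Y W (ap Y f x))) (graph (idV W)) = fn (q (G, yoN Y G x)) (graph f)"
proof -
  have "ALL u:Ar (elements Y). q (tgt u) oo hom_map (fn u) (idV W) = q (src u)" using q unfolding is_cocone_def by simp
  from bspec[OF this elements_ArI[OF Y f x]]
  have e: "q (G, yoN Y G x) oo hom_map f (idV W) = q (W, yoN Y W (ap Y f x))" by simp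
  note O = L_Ob[OF f]
  note i = idV_L[OF O(2)]
  note h = hom_map_L[OF f i]
  have "fn (hom_map f (idV W)) (graph (idV W)) = graph f"
    unfolding hom_map_app[OF f i i] using f by simp
  then show ?thesis unfolding e[symmetric] comp_app'[OF h graph_in[OF i]] by simp
qed

text \<open>Density of representables: an arrow \<open>f\<close> at \<open>(G, x)\<close> is
  identified with the identity at \<open>(W, Y(f) x)\<close>. So a cocone amounts to a function on
  \<open>Y(W)\<close>, and the colimit over a large index exists explicitly.\<close>

lemma colimit_elements:
  assumes Y: "lf Y" and W: "W : Obj"
  shows "is_colimit (elements Y) Vect (colD W) (Fo Y W) (%j. fn (snd j) W)"
proof -
  note i = idV_L[OF W]
  have cc: "is_cocone (elements Y) Vect (colD W) (Fo Y W) (%j. fn (snd j) W)"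
    unfolding is_cocone_def
  proof (intro conjI ballI)
    show "fn (snd j) W : L (Fo (colD W) j) (Fo Y W)" if "j : Ob (elements Y)" for j
      using that NT_L[OF _ W] by fastforce
    fix u assume "u : Ar (elements Y)"
    from elements_ArD[OF Y this] obtain G x G' x' where u: "src u = (G, yoN Y G x)" "tgt u = (G', yoN Y G' x')"
      "G : Obj" "G' : Obj" "x : el Y G" "x' : el Y G'" "fn u : L G' G" "x = ap Y (fn u) x'" .
    note h = hom_map_L[OF u(7) i]
    have t: "fn (yoN Y G' x') W : L (hom_sp G' W) (Fo Y W)" "fn (yoN Y G x) W : L (hom_sp G W) (Fo Y W)"
      using NT_L[OF yoN_NT[OF Y u(4,6)] W] NT_L[OF yoN_NT[OF Y u(3,5)] W] by simp_all
    have "fn (yoN Y G' x') W oo hom_map (fn u) (idV W) = fn (yoN Y G x) W"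
    proof (rule L_eqI[OF L_comp[OF t(1) h] t(2)])
      fix a assume "a : carrier (hom_sp G W)"
      then obtain f where f: "f : L G W" "a = graph f" by (rule hom_cases)
      note fu = L_comp[OF f(1) u(7)]
      have "fn (hom_map (fn u) (idV W)) a = graph (f oo fn u)"
        unfolding f(2) hom_map_app[OF u(7) i f(1)] using comp_id(1)[OF fu] by simp
      then show "fn (fn (yoN Y G' x') W oo hom_map (fn u) (idV W)) a = fn (fn (yoN Y G x) W) a"
        unfolding f(2) nt_yoN[OF f(1)] comp_app'[OF h graph_in[OF f(1)]]
        using nt_yoN[OF fu] ap_comp[OF Y f(1) u(7,6)] u(8) by simp
    qed
    then show "fn (snd (Cod (elements Y) u)) W oo Fa (colD W) u = fn (snd (Dom (elements Y) u)) W"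
      by (simp add: u(1,2))
  qed (rule lf_Ob[OF Y W])
  have "EX! h. h : L (Fo Y W) M & (ALL j:Ob (elements Y). h oo fn (snd j) W = q j)"
    if q: "is_cocone (elements Y) Vect (colD W) M q" for M q
  proof -
    have M: "M : Obj" using q unfolding is_cocone_def by simp
    have qL': "ALL j:Ob (elements Y). q j : L (hom_sp (fst j) W) M" using q unfolding is_cocone_def by simp
    have qL: "q (G, t) : L (hom_sp G W) M" if "G : Obj" "t : NT (yo G) Y" for G t
      using bspec[OF qL', of "(G, t)"] that by simp
    have qx: "q (G, yoN Y G x) : L (hom_sp G W) M" if "G : Obj" "x : el Y G" for G x
      by (rule qL[OF that(1) yoN_NT[OF Y that]])
    note arr = colD_arrow[OF Y q]
    \<comment> \<open>The forced value: every element of the diagram is identified with an identity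
      arrow at an element of \<open>Y(W)\<close>.\<close>
    define g where "g b = fn (q (W, yoN Y W b)) (graph (idV W))" for b
    have gf: "g (ap Y f x) = fn (q (G, yoN Y G x)) (graph f)" if "f : L G W" "x : el Y G" for f G x
      unfolding g_def by (rule arr[OF that])
    have "is_linear K (Fo Y W) M g"
    proof (rule is_linearI)
      show "g b : carrier M" if "b : el Y W" for b
        unfolding g_def by (rule L_app[OF qx[OF W that] graph_in[OF i]])
    next
      fix b b' assume b: "b : el Y W" "b' : el Y W"
      \<comment> \<open>Additivity of the induced map: after merging, \<open>b + b'\<close> is
        \<open>Y(p + r) z\<close>, and the leg at \<open>(P, z)\<close> is linear in the
        arrow.\<close>
      obtain P p r z where P: "P : Obj" "p : L P W" "r : L P W" "z : el Y P" "ap Y p z = b" "ap Y r z = b'"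
        using merge[OF Y W b(1) W b(2)] by blast
      have "g (add (Fo Y W) b b') = g (ap Y (lin_add p r) z)" by (simp add: ap_lin_add[OF Y P(2,3,4)] P(5,6))
      also have "\<dots> = fn (q (P, yoN Y P z)) (add (hom_sp P W) (graph p) (graph r))"
        unfolding gf[OF lin_add_L[OF P(2,3)] P(4)] hom_add[OF P(2,3)] ..
      also have "\<dots> = add M (g b) (g b')"
        unfolding L_add[OF qx[OF P(1,4)] graph_in[OF P(2)] graph_in[OF P(3)]]
          gf[OF P(2,4), symmetric] gf[OF P(3,4), symmetric] P(5,6) ..
      finally show "g (add (Fo Y W) b b') = add M (g b) (g b')" .
    next
      fix c b assume c: "c : carrier K" and b: "b : el Y W"
      have "g (smult (Fo Y W) c b) = g (ap Y (lin_smult c (idV W)) b)"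
        by (simp add: ap_lin_smult[OF Y i c b] ap_id[OF Y W b])
      also have "\<dots> = fn (q (W, yoN Y W b)) (smult (hom_sp W W) c (graph (idV W)))"
        unfolding gf[OF lin_smult_L[OF i c] b] hom_smult[OF i] ..
      also have "\<dots> = smult M c (g b)" unfolding L_smult[OF qx[OF W b] c graph_in[OF i]] g_def ..
      finally show "g (smult (Fo Y W) c b) = smult M c (g b)" .
    qed
    then have gL: "mk (Fo Y W) M g : L (Fo Y W) M" by (rule mk_L[OF lf_Ob[OF Y W] M])
    show ?thesis
    proof (rule ex1I[of _ "mk (Fo Y W) M g"])
      show "mk (Fo Y W) M g : L (Fo Y W) M & (ALL j:Ob (elements Y). mk (Fo Y W) M g oo fn (snd j) W = q j)"
      proof (intro conjI ballI gL)
        fix j assume "j : Ob (elements Y)"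
        then obtain G t where j: "j = (G, t)" "G : Obj" "t : NT (yo G) Y" by auto
        have tW: "fn t W : L (hom_sp G W) (Fo Y W)" using NT_L[OF j(3) W] by simp
        note x = yev_closed[OF j(3,2)]
        have "mk (Fo Y W) M g oo fn t W = q (G, t)"
        proof (rule L_eqI[OF L_comp[OF gL tW] qL[OF j(2,3)]])
          fix a assume a: "a : carrier (hom_sp G W)"
          then obtain f where f: "f : L G W" "a = graph f" by (rule hom_cases)
          show "fn (mk (Fo Y W) M g oo fn t W) a = fn (q (G, t)) a"
            unfolding comp_app'[OF tW a] mk_app[OF L_app[OF tW a]]
            using gf[OF f(1) x] nt_yev[OF j(3) f(1)] yoN_yev[OF j(3,2)] f(2) by simp
        qed
        then show "mk (Fo Y W) M g oo fn (snd j) W = q j" by (simp add: j(1))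
      qed
      fix h assume h: "h : L (Fo Y W) M & (ALL j:Ob (elements Y). h oo fn (snd j) W = q j)"
      show "h = mk (Fo Y W) M g"
      proof (rule L_eqI[OF conjunct1[OF h] gL])
        fix b assume b: "b : el Y W"
        note yN = yoN_NT[OF Y W b]
        have tW: "fn (yoN Y W b) W : L (hom_sp W W) (Fo Y W)" using NT_L[OF yN W] by simp
        have "h oo fn (yoN Y W b) W = q (W, yoN Y W b)"
          using bspec[OF conjunct2[OF h], of "(W, yoN Y W b)"] W yN by simp
        then have "fn h (nt (yoN Y W b) W (graph (idV W))) = g b"
          unfolding g_def using comp_app'[OF tW graph_in[OF i], of h] by simp
        then show "fn h b = fn (mk (Fo Y W) M g) b"
          using nt_yoN[OF i] ap_id[OF Y W b] b by simp
      qed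
    qed
  qed
  then show ?thesis unfolding is_colimit_def using cc by simp
qed

section \<open>Uniqueness of colimits, and comparison with the chosen one\<close>

lemma cocone_comp:
  assumes c: "is_cocone J Vect F l p" and f: "f : L l m"
    and FL: "!!u. u : Ar J ==> Dom J u : Ob J & Cod J u : Ob J & Fa F u : L (Fo F (Dom J u)) (Fo F (Cod J u))"
  shows "is_cocone J Vect F m (%j. f oo p j)"
  unfolding is_cocone_def
proof (intro conjI ballI)
  have pL: "p j : L (Fo F j) l" if "j : Ob J" for j using c that unfolding is_cocone_def by simp
  show "f oo p j : L (Fo F j) m" if "j : Ob J" for j by (rule L_comp[OF f pL[OF that]])
  fix u assume u: "u : Ar J"
  note FL[OF u]
  then show "(f oo p (Cod J u)) oo Fa F u = f oo p (Dom J u)"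
    using comp_assoc[OF f pL, of "Cod J u" "Fa F u" "Fo F (Dom J u)"] c u unfolding is_cocone_def by simp
qed (rule L_Ob(2)[OF f])

lemma colimit_eqI:
  assumes c: "is_colimit J Vect F l p" and f: "f : L l m" "g : L l m"
    and FL: "!!u. u : Ar J ==> Dom J u : Ob J & Cod J u : Ob J & Fa F u : L (Fo F (Dom J u)) (Fo F (Cod J u))"
    and e: "!!j. j : Ob J ==> f oo p j = g oo p j"
  shows "f = g"
proof -
  have cc: "is_cocone J Vect F l p" using c unfolding is_colimit_def by simp
  have "is_cocone J Vect F m (%j. f oo p j)" by (rule cocone_comp[OF cc f(1) FL])
  then have "EX! h. h : L l m & (ALL j:Ob J. h oo p j = f oo p j)" using c unfolding is_colimit_def by simp
  then show ?thesis by (rule ex1_unique) (use f e in auto)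
qed

lemma colimit_iso:
  assumes c: "is_colimit J Vect F l p" and c': "is_colimit J Vect F l' p'"
    and FL: "!!u. u : Ar J ==> Dom J u : Ob J & Cod J u : Ob J & Fa F u : L (Fo F (Dom J u)) (Fo F (Cod J u))"
  shows "EX h. h : L l l' & bij_betw (fn h) (carrier l) (carrier l') & (ALL j:Ob J. h oo p j = p' j)"
proof -
  have cc: "is_cocone J Vect F l p" and cc': "is_cocone J Vect F l' p'"
    using c c' unfolding is_colimit_def by simp_all
  have O: "l : Obj" "l' : Obj" using cc cc' unfolding is_cocone_def by simp_all
  have pL: "p j : L (Fo F j) l" "p' j : L (Fo F j) l'" if "j : Ob J" for j
    using cc cc' that unfolding is_cocone_def by simp_all
  have "EX! h. h : L l l' & (ALL j:Ob J. h oo p j = p' j)" using c cc' unfolding is_colimit_def by simp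
  then obtain h where h: "h : L l l'" "!!j. j : Ob J ==> h oo p j = p' j" by blast
  have "EX! h. h : L l' l & (ALL j:Ob J. h oo p' j = p j)" using c' cc unfolding is_colimit_def by simp
  then obtain k where k: "k : L l' l" "!!j. j : Ob J ==> k oo p' j = p j" by blast
  have kh: "k oo h = idV l"
  proof (rule colimit_eqI[OF c L_comp[OF k(1) h(1)] idV_L[OF O(1)] FL])
    show "(k oo h) oo p j = idV l oo p j" if "j : Ob J" for j
      using comp_assoc[OF k(1) h(1) pL(1)[OF that]] h(2)[OF that] k(2)[OF that] comp_id(1)[OF pL(1)[OF that]] by simp
  qed
  have hk: "h oo k = idV l'"
  proof (rule colimit_eqI[OF c' L_comp[OF h(1) k(1)] idV_L[OF O(2)] FL])
    show "(h oo k) oo p' j = idV l' oo p' j" if "j : Ob J" for j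
      using comp_assoc[OF h(1) k(1) pL(2)[OF that]] h(2)[OF that] k(2)[OF that] comp_id(1)[OF pL(2)[OF that]] by simp
  qed
  have "bij_betw (fn h) (carrier l) (carrier l')"
  proof (rule bij_betw_byWitness[of _ "fn k"])
    show "ALL a:carrier l. fn k (fn h a) = a" using comp_app'[OF h(1), of _ k] kh by simp
    show "ALL a':carrier l'. fn h (fn k a') = a'" using comp_app'[OF k(1), of _ h] hk by simp
  qed (use L_app[OF h(1)] L_app[OF k(1)] in auto)
  then show ?thesis using h by blast
qed

lemma colD_L:
  assumes Y: "lf Y" and W: "W : Obj" and u: "u : Ar (elements Y)"
  shows "Dom (elements Y) u : Ob (elements Y) & Cod (elements Y) u : Ob (elements Y) &
    Fa (colD W) u : L (Fo (colD W) (Dom (elements Y) u)) (Fo (colD W) (Cod (elements Y) u))"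
proof -
  from elements_ArD[OF Y u] obtain G x G' x' where u: "src u = (G, yoN Y G x)" "tgt u = (G', yoN Y G' x')"
    "G : Obj" "G' : Obj" "x : el Y G" "x' : el Y G'" "fn u : L G' G" "x = ap Y (fn u) x'" .
  show ?thesis using u yoN_NT[OF Y u(3,5)] yoN_NT[OF Y u(4,6)] hom_map_L[OF u(7) idV_L[OF W]] by simp
qed

lemma comp_yoN:
  assumes \<eta>: "\<eta> : NT Y Y'" and G: "G : Obj" and x: "x : el Y G"
  shows "Cmp FunVect \<eta> (yoN Y G x) = yoN Y' G (nt \<eta> G x)"
proof (rule yo_eqI)
  note yN = yoN_NT[OF NT_lf(1)[OF \<eta>] G x]
  have i: "graph (idV G) : el (yo G) G" using G by (simp add: graph_in)
  show "Cmp FunVect \<eta> (yoN Y G x) : NT (yo G) Y'" by (rule NT_comp(1)[OF \<eta> yN])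
  show "yoN Y' G (nt \<eta> G x) : NT (yo G) Y'" by (rule yoN_NT[OF NT_lf(2)[OF \<eta>] G nt_closed[OF \<eta> G x]])
  show "yev G (Cmp FunVect \<eta> (yoN Y G x)) = yev G (yoN Y' G (nt \<eta> G x))"
    unfolding yev_yoN[OF NT_lf(2)[OF \<eta>] G nt_closed[OF \<eta> G x]]
    using NT_comp(2)[OF \<eta> yN G i] yev_yoN[OF NT_lf(1)[OF \<eta>] G x] unfolding yev_def by simp
qed (rule G)

lemma nearid_colim: "EX \<theta>. nearid colim_functor \<theta>"
proof -
  let ?c = "%Y W. colim (elements Y) Vect (colD W)"
  have c: "is_colimit (elements Y) Vect (colD W) (colim_ob Y W) (snd (?c Y W))" if "lf Y" "W : Obj" for Y W
    unfolding colim_ob_def by (rule colim_is_colimit[OF colimit_elements[OF that]])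
  have cc: "is_cocone (elements Y) Vect (colD W) (colim_ob Y W) (snd (?c Y W))" if "lf Y" "W : Obj" for Y W
    using c[OF that] unfolding is_colimit_def by simp
  have pL: "snd (?c Y W) (G, t) : L (hom_sp G W) (colim_ob Y W)"
    if "lf Y" "W : Obj" "G : Obj" "t : NT (yo G) Y" for Y W G t
  proof -
    have "ALL j:Ob (elements Y). snd (?c Y W) j : L (hom_sp (fst j) W) (colim_ob Y W)"
      using cc[OF that(1,2)] unfolding is_cocone_def by simp
    from bspec[OF this, of "(G, t)"] show ?thesis using that(3,4) by simp
  qed
  \<comment> \<open>The comparison from the chosen colimit to \<open>Y(W)\<close>; its values on the
    legs are what the naturality proof uses.\<close>
  define \<tau> where "\<tau> Y W = (SOME h. h : L (colim_ob Y W) (Fo Y W) &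
    bij_betw (fn h) (carrier (colim_ob Y W)) (el Y W) &
    (ALL j:Ob (elements Y). h oo snd (?c Y W) j = fn (snd j) W))" for Y W
  have \<tau>: "\<tau> Y W : L (colim_ob Y W) (Fo Y W) & bij_betw (fn (\<tau> Y W)) (carrier (colim_ob Y W)) (el Y W) &
    (ALL j:Ob (elements Y). \<tau> Y W oo snd (?c Y W) j = fn (snd j) W)" if Y: "lf Y" and W: "W : Obj" for Y W
    unfolding \<tau>_def by (rule someI_ex) (rule colimit_iso[OF c[OF Y W] colimit_elements[OF Y W] colD_L[OF Y W]])
  have \<tau>1: "\<tau> Y W : L (colim_ob Y W) (Fo Y W)" if "lf Y" "W : Obj" for Y W using \<tau>[OF that] by blast
  have \<tau>2: "\<tau> Y W oo snd (?c Y W) (G, t) = fn t W" if "lf Y" "W : Obj" "G : Obj" "t : NT (yo G) Y" for Y W G t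
    using \<tau>[OF that(1,2)] that(3,4) by simp
  have ar: "colim_ar \<eta> w : L (colim_ob Y W) (colim_ob Y' W') &
    (ALL G:Obj. ALL t:NT (yo G) Y. colim_ar \<eta> w oo snd (?c Y W) (G, t) = snd (?c Y' W') (G, Cmp FunVect \<eta> t) oo hom_map (idV G) w)"
    if \<eta>: "\<eta> : NT Y Y'" and w: "w : L W W'" for Y Y' \<eta> W W' w
  proof -
    note Y = NT_lf[OF \<eta>] and O = L_Ob[OF w]
    let ?k = "%(G, y). (G, Cmp FunVect \<eta> y)" and ?t = "%(G, y). hom_map (idV G) w"
    have e: "is_cocone (elements Y) Vect (colD W) (colim_ob Y' W') (%j. snd (?c Y' W') (?k j) oo ?t j)"
      unfolding is_cocone_def
    proof (intro conjI ballI)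
      show "colim_ob Y' W' : Obj" using L_Ob(1)[OF \<tau>1[OF Y(2) O(2)]] .
      show "snd (?c Y' W') (?k j) oo ?t j : L (Fo (colD W) j) (colim_ob Y' W')" if jJ: "j : Ob (elements Y)" for j
      proof -
        obtain G t where j: "j = (G, t)" "G : Obj" "t : NT (yo G) Y" using jJ by auto
        show ?thesis
          using L_comp[OF pL[OF Y(2) O(2) j(2) NT_comp(1)[OF \<eta> j(3)]] hom_map_L[OF idV_L[OF j(2)] w]] by (simp add: j(1))
      qed
      fix u assume "u : Ar (elements Y)"
      from elements_ArD[OF Y(1) this] obtain G x G' x' where u: "src u = (G, yoN Y G x)" "tgt u = (G', yoN Y G' x')"
        "G : Obj" "G' : Obj" "x : el Y G" "x' : el Y G'" "fn u : L G' G" "x = ap Y (fn u) x'" .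
      note x = nt_closed[OF \<eta> u(3,5)] and x' = nt_closed[OF \<eta> u(4,6)]
      have xx: "nt \<eta> G x = ap Y' (fn u) (nt \<eta> G' x')" using nt_nat[OF \<eta> u(7,6)] u(8) by simp
      let ?p = "snd (?c Y' W')"
      have "ALL u:Ar (elements Y'). ?p (tgt u) oo hom_map (fn u) (idV W') = ?p (src u)"
        using cc[OF Y(2) O(2)] unfolding is_cocone_def by simp
      from bspec[OF this elements_ArI[OF Y(2) u(7) x']]
      have pe: "?p (G', yoN Y' G' (nt \<eta> G' x')) oo hom_map (fn u) (idV W') = ?p (G, yoN Y' G (nt \<eta> G x))"
        unfolding xx by simp
      note pG' = pL[OF Y(2) O(2) u(4) yoN_NT[OF Y(2) u(4) x']]
      note hw = hom_map_L[OF idV_L[OF u(3)] w] and hw' = hom_map_L[OF idV_L[OF u(4)] w]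
      note hu = hom_map_L[OF u(7) idV_L[OF O(1)]] and hu' = hom_map_L[OF u(7) idV_L[OF O(2)]]
      have hh: "hom_map (idV G') w oo hom_map (fn u) (idV W) = hom_map (fn u) (idV W') oo hom_map (idV G) w"
      proof (rule L_eqI[OF L_comp[OF hw' hu] L_comp[OF hu' hw]])
        fix a assume a: "a : carrier (hom_sp G W)"
        then obtain f where f: "f : L G W" "a = graph f" by (rule hom_cases)
        note fu = L_comp[OF f(1) u(7)] and wf = L_comp[OF w f(1)]
        note wfu = L_comp[OF w fu]
        have "fn (hom_map (fn u) (idV W)) a = graph (f oo fn u)"
          unfolding f(2) hom_map_app[OF u(7) idV_L[OF O(1)] f(1)] using comp_id(1)[OF fu] by simp
        moreover have "fn (hom_map (idV G') w) (graph (f oo fn u)) = graph (w oo f oo fn u)"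
          unfolding hom_map_app[OF idV_L[OF u(4)] w fu] using comp_id(2)[OF fu] by simp
        moreover have "fn (hom_map (idV G) w) a = graph (w oo f)"
          unfolding f(2) hom_map_app[OF idV_L[OF u(3)] w f(1)] using comp_id(2)[OF f(1)] by simp
        moreover have "fn (hom_map (fn u) (idV W')) (graph (w oo f)) = graph (w oo f oo fn u)"
          unfolding hom_map_app[OF u(7) idV_L[OF O(2)] wf] comp_assoc[OF w f(1) u(7)] using comp_id(1)[OF wfu] by simp
        ultimately show "fn (hom_map (idV G') w oo hom_map (fn u) (idV W)) a = fn (hom_map (fn u) (idV W') oo hom_map (idV G) w) a"
          by (simp add: comp_app'[OF hu a] comp_app'[OF hw a])
      qed
      have "(?p (G', yoN Y' G' (nt \<eta> G' x')) oo hom_map (idV G') w) oo hom_map (fn u) (idV W) =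
        ?p (G, yoN Y' G (nt \<eta> G x)) oo hom_map (idV G) w"
        unfolding comp_assoc[OF pG' hw' hu] hh comp_assoc[OF pG' hu' hw, symmetric] pe ..
      then show "(?p (?k (Cod (elements Y) u)) oo ?t (Cod (elements Y) u)) oo Fa (colD W) u =
        ?p (?k (Dom (elements Y) u)) oo ?t (Dom (elements Y) u)"
        by (simp add: u(1,2) comp_yoN[OF \<eta> u(3,5)] comp_yoN[OF \<eta> u(4,6)])
    qed
    have "colim_map (elements Y) (elements Y') Vect (colD W) (colD W') ?k ?t : L (fst (?c Y W)) (fst (?c Y' W')) &
      (ALL j:Ob (elements Y). colim_map (elements Y) (elements Y') Vect (colD W) (colD W') ?k ?t oo snd (?c Y W) j =
         snd (?c Y' W') (?k j) oo ?t j)"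
      by (rule colim_map_props[OF colimit_elements[OF Y(1) O(1)] e[unfolded colim_ob_def]])
    then show ?thesis unfolding colim_ar_def colim_ob_def NT_src[OF \<eta>] L_src[OF w] by auto
  qed
  have nat: "fn (\<tau> Y' W') (fn (colim_ar \<eta> w) z) = nt \<eta> W' (ap Y w (fn (\<tau> Y W) z))"
    if \<eta>: "\<eta> : NT Y Y'" and w: "w : L W W'" and z: "z : carrier (colim_ob Y W)" for Y Y' \<eta> W W' w z
  proof -
    note Y = NT_lf[OF \<eta>] and O = L_Ob[OF w]
    note a = conjunct1[OF ar[OF \<eta> w]] and \<eta>L = NT_L[OF \<eta> O(2)] and Yw = lf_L[OF Y(1) w]
    note \<tau>Y = \<tau>1[OF Y(1) O(1)] and \<tau>Y' = \<tau>1[OF Y(2) O(2)]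
    note l = L_comp[OF \<tau>Y' a] and r = L_comp[OF \<eta>L L_comp[OF Yw \<tau>Y]]
    have "\<tau> Y' W' oo colim_ar \<eta> w = fn \<eta> W' oo Fa Y w oo \<tau> Y W"
    proof (rule colimit_eqI[OF c[OF Y(1) O(1)] l r colD_L[OF Y(1) O(1)]])
      fix j assume "j : Ob (elements Y)"
      then obtain G t where j: "j = (G, t)" "G : Obj" "t : NT (yo G) Y" by auto
      note p = pL[OF Y(1) O(1) j(2,3)]
      note \<eta>t = NT_comp[OF \<eta> j(3)]
      note p' = pL[OF Y(2) O(2) j(2) \<eta>t(1)]
      note hw = hom_map_L[OF idV_L[OF j(2)] w]
      have tW: "fn t W : L (hom_sp G W) (Fo Y W)" using NT_L[OF j(3) O(1)] by simp
      have \<eta>tW: "fn (Cmp FunVect \<eta> t) W' : L (hom_sp G W') (Fo Y' W')" using NT_L[OF \<eta>t(1) O(2)] by simp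
      have "(\<tau> Y' W' oo colim_ar \<eta> w) oo snd (?c Y W) (G, t) = fn (Cmp FunVect \<eta> t) W' oo hom_map (idV G) w"
        unfolding comp_assoc[OF \<tau>Y' a p] using ar[OF \<eta> w] j(2,3)
        by (simp add: comp_assoc[OF \<tau>Y' p' hw, symmetric] \<tau>2[OF Y(2) O(2) j(2) \<eta>t(1)])
      also have "\<dots> = fn \<eta> W' oo Fa Y w oo fn t W"
      proof (rule L_eqI[OF L_comp[OF \<eta>tW hw] L_comp[OF \<eta>L L_comp[OF Yw tW]]])
        fix b assume b: "b : carrier (hom_sp G W)"
        then obtain f where f: "f : L G W" "b = graph f" by (rule hom_cases)
        note wf = L_comp[OF w f(1)]
        have "fn (hom_map (idV G) w) b = graph (w oo f)"
          unfolding f(2) hom_map_app[OF idV_L[OF j(2)] w f(1)] using comp_id(2)[OF f(1)] by simp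
        moreover have "nt (Cmp FunVect \<eta> t) W' (graph (w oo f)) = nt \<eta> W' (nt t W' (graph (w oo f)))"
          by (rule \<eta>t(2)[OF O(2)]) (simp add: graph_in[OF wf])
        moreover have "nt t W' (graph (w oo f)) = ap Y w (nt t W (graph f))"
          unfolding nt_yev[OF j(3) wf] nt_yev[OF j(3) f(1)] by (rule ap_comp[OF Y(1) w f(1) yev_closed[OF j(3,2)]])
        ultimately show "fn (fn (Cmp FunVect \<eta> t) W' oo hom_map (idV G) w) b = fn (fn \<eta> W' oo Fa Y w oo fn t W) b"
          unfolding comp_app'[OF hw b] comp_app'[OF L_comp[OF Yw tW] b] comp_app'[OF tW b] by (simp add: f(2))
      qed
      also have "\<dots> = (fn \<eta> W' oo Fa Y w oo \<tau> Y W) oo snd (?c Y W) (G, t)"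
        unfolding comp_assoc[OF \<eta>L L_comp[OF Yw \<tau>Y] p] comp_assoc[OF Yw \<tau>Y p] \<tau>2[OF Y(1) O(1) j(2,3)] ..
      finally show "(\<tau> Y' W' oo colim_ar \<eta> w) oo snd (?c Y W) j = (fn \<eta> W' oo Fa Y w oo \<tau> Y W) oo snd (?c Y W) j"
        by (simp add: j(1))
    qed
    then show ?thesis
      using comp_app'[OF a z, of "\<tau> Y' W'"] comp_app'[OF L_comp[OF Yw \<tau>Y] z, of "fn \<eta> W'"] comp_app'[OF \<tau>Y z, of "Fa Y w"]
      by simp
  qed
  show ?thesis unfolding colim_functor_def
  proof (rule nearidI[of \<tau>])
    show "\<tau> Y W : L (colim_ob Y W) (Fo Y W)" if "lf Y" "W : Obj" for Y W by (rule \<tau>1[OF that])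
    show "bij_betw (fn (\<tau> Y W)) (carrier (colim_ob Y W)) (el Y W)" if "lf Y" "W : Obj" for Y W
      by (rule \<tau>[OF that, THEN conjunct2, THEN conjunct1])
    show "colim_ar \<eta> w : L (colim_ob Y W) (colim_ob Y' W')" if "\<eta> : NT Y Y'" "w : L W W'" for Y Y' \<eta> W W' w
      by (rule ar[OF that, THEN conjunct1])
  qed (rule nat)
qed

subsection \<open>Coends\<close>

text \<open>That the two arrows of each dinaturality square have the right source and target, as
  composing a cowedge with a map requires.\<close>

definition typedT :: "(('k, 'u) module \<times> ('k, 'u) module, ('k, 'u) lin \<times> ('k, 'u) lin,
      ('k, 'u) module, ('k, 'u) lin) cfunctor => bool" where
  "typedT T \<longleftrightarrow> (ALL A B f. f : L A B --> Fa T (f, idV A) : L (Fo T (B, A)) (Fo T (A, A)) &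
     Fa T (idV B, f) : L (Fo T (B, A)) (Fo T (B, B)))"

lemma cowedgeI:
  assumes "e : Obj" "!!H. H : Obj ==> w H : L (Fo T (H, H)) e"
    "!!A B f. f : L A B ==> w A oo Fa T (f, idV A) = w B oo Fa T (idV B, f)"
  shows "is_cowedge Vect Vect T e w"
  unfolding is_cowedge_def
proof (intro conjI ballI)
  fix f assume "f : Ar Vect"
  then have "f : L (src f) (tgt f)" by (simp add: Ar_L)
  from assms(3)[OF this] show "w (Dom Vect f) oo Fa T (f, idV (Dom Vect f)) = w (Cod Vect f) oo Fa T (idV (Cod Vect f), f)"
    by simp
qed (use assms in auto)

lemma cowedgeD:
  assumes "is_cowedge Vect Vect T e w"
  shows "e : Obj" "H : Obj ==> w H : L (Fo T (H, H)) e"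
    "f : L A B ==> w A oo Fa T (f, idV A) = w B oo Fa T (idV B, f)"
proof -
  show "e : Obj" "H : Obj ==> w H : L (Fo T (H, H)) e" using assms unfolding is_cowedge_def by simp_all
  have "ALL f:Ar Vect. w (src f) oo Fa T (f, idV (src f)) = w (tgt f) oo Fa T (idV (tgt f), f)"
    using assms unfolding is_cowedge_def by simp
  from bspec[OF this] show "w A oo Fa T (f, idV A) = w B oo Fa T (idV B, f)" if "f : L A B"
    using L_Ar[OF that] L_src[OF that] by auto
qed

lemma cowedge_comp:
  assumes c: "is_cowedge Vect Vect T e w" and T: "typedT T" and h: "h : L e m"
  shows "is_cowedge Vect Vect T m (%H. h oo w H)"
proof (rule cowedgeI[OF L_Ob(2)[OF h]])
  note w = cowedgeD[OF c]
  show "h oo w H : L (Fo T (H, H)) m" if "H : Obj" for H by (rule L_comp[OF h w(2)[OF that]])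
  fix A B f assume f: "f : L A B"
  have Tf: "Fa T (f, idV A) : L (Fo T (B, A)) (Fo T (A, A))" "Fa T (idV B, f) : L (Fo T (B, A)) (Fo T (B, B))"
    using T f unfolding typedT_def by blast+
  show "(h oo w A) oo Fa T (f, idV A) = (h oo w B) oo Fa T (idV B, f)"
    unfolding comp_assoc[OF h w(2)[OF L_Ob(1)[OF f]] Tf(1)] comp_assoc[OF h w(2)[OF L_Ob(2)[OF f]] Tf(2)] w(3)[OF f] ..
qed

lemma coend_cowedge: "is_coend C D T e w ==> is_cowedge C D T e w"
  unfolding is_coend_def by simp

lemma coend_univ: "is_coend Vect Vect T e w ==> is_cowedge Vect Vect T m v ==>
    EX! h. h : L e m & (ALL H:Obj. h oo w H = v H)"
  unfolding is_coend_def by simp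

lemma coend_lift: assumes "is_coend Vect Vect T e w" "is_cowedge Vect Vect T m v"
  obtains h where "h : L e m" "!!H. H : Obj ==> h oo w H = v H"
  using ex1_implies_ex[OF coend_univ[OF assms]] by blast

lemma coend_eqI:
  assumes c: "is_coend Vect Vect T e w" and T: "typedT T" and f: "f : L e m" "g : L e m"
    and e: "!!H. H : Obj ==> f oo w H = g oo w H"
  shows "f = g"
proof -
  have "EX! h. h : L e m & (ALL H:Obj. h oo w H = f oo w H)"
    by (rule coend_univ[OF c cowedge_comp[OF coend_cowedge[OF c] T f(1)]])
  then show ?thesis by (rule ex1_unique) (use f e in auto)
qed

lemma coend_iso:
  assumes c: "is_coend Vect Vect T l p" and c': "is_coend Vect Vect T l' p'" and T: "typedT T"
  shows "EX h. h : L l l' & bij_betw (fn h) (carrier l) (carrier l') & (ALL H:Obj. h oo p H = p' H)"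
proof -
  note w = cowedgeD[OF coend_cowedge[OF c]] and w' = cowedgeD[OF coend_cowedge[OF c']]
  obtain h where h: "h : L l l'" "!!H. H : Obj ==> h oo p H = p' H" using coend_lift[OF c coend_cowedge[OF c']] by blast
  obtain k where k: "k : L l' l" "!!H. H : Obj ==> k oo p' H = p H" using coend_lift[OF c' coend_cowedge[OF c]] by blast
  have kh: "k oo h = idV l"
  proof (rule coend_eqI[OF c T L_comp[OF k(1) h(1)] idV_L[OF w(1)]])
    show "(k oo h) oo p H = idV l oo p H" if "H : Obj" for H
      using comp_assoc[OF k(1) h(1) w(2)[OF that]] h(2)[OF that] k(2)[OF that] comp_id(1)[OF w(2)[OF that]] by simp
  qed
  have hk: "h oo k = idV l'"
  proof (rule coend_eqI[OF c' T L_comp[OF h(1) k(1)] idV_L[OF w'(1)]])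
    show "(h oo k) oo p' H = idV l' oo p' H" if "H : Obj" for H
      using comp_assoc[OF h(1) k(1) w'(2)[OF that]] h(2)[OF that] k(2)[OF that] comp_id(1)[OF w'(2)[OF that]] by simp
  qed
  have "bij_betw (fn h) (carrier l) (carrier l')"
  proof (rule bij_betw_byWitness[of _ "fn k"])
    show "ALL a:carrier l. fn k (fn h a) = a" using comp_app'[OF h(1), of _ k] kh by simp
    show "ALL a':carrier l'. fn h (fn k a') = a'" using comp_app'[OF k(1), of _ h] hk by simp
  qed (use L_app[OF h(1)] L_app[OF k(1)] in auto)
  then show ?thesis using h by blast
qed

lemma coendY_simps[simp]: "Fo (coend_integrand Y W) (A, B) = tens (Fo Y B) (hom_sp A W)"
  "Fa (coend_integrand Y W) (a, b) = tens_map (Fa Y b) (hom_map a (idV W))"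
  by (simp_all add: coend_integrand_def)

abbreviation "ptY Y H W y h \<equiv> pt (Fo Y H) (hom_sp H W) y (graph h)"

text \<open>Pure tensors separate maps, so dinaturality can be tested on them; there it says that
  \<open>f\<close> may be moved from the first factor to the second.\<close>

lemma coendY_cowedge_eq:
  assumes Y: "lf Y" and W: "W : Obj" and f: "f : L A B"
    and w: "w A : L (tens (Fo Y A) (hom_sp A W)) e" "w B : L (tens (Fo Y B) (hom_sp B W)) e"
  shows "w A oo tens_map (Fa Y (idV A)) (hom_map f (idV W)) = w B oo tens_map (Fa Y f) (hom_map (idV B) (idV W)) \<longleftrightarrow>
    (ALL y:el Y A. ALL h:L B W. fn (w A) (ptY Y A W y (h oo f)) = fn (w B) (ptY Y B W (ap Y f y) h))"
    (is "?l = ?r \<longleftrightarrow> ?R")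
proof -
  note O = L_Ob[OF f]
  note i = lf_L[OF Y idV_L[OF O(1)]] and m = hom_map_L[OF f idV_L[OF W]]
    and m' = hom_map_L[OF idV_L[OF O(2)] idV_L[OF W]] and Yf = lf_L[OF Y f]
  note t = tens_map_L[OF i m] and t' = tens_map_L[OF Yf m']
  note TO = lf_Ob[OF Y O(1)] hom_Obj[OF O(2) W]
  have pl: "fn ?l (pt (Fo Y A) (hom_sp B W) y (graph h)) = fn (w A) (ptY Y A W y (h oo f))"
    and pr: "fn ?r (pt (Fo Y A) (hom_sp B W) y (graph h)) = fn (w B) (ptY Y B W (ap Y f y) h)"
    if y: "y : el Y A" and h: "h : L B W" for y h
  proof -
    note p = pt_closed[OF TO y graph_in[OF h]]
    have "fn (hom_map f (idV W)) (graph h) = graph (h oo f)"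
      unfolding hom_map_app[OF f idV_L[OF W] h] using comp_id(1)[OF L_comp[OF h f]] by simp
    then show "fn ?l (pt (Fo Y A) (hom_sp B W) y (graph h)) = fn (w A) (ptY Y A W y (h oo f))"
      unfolding comp_app'[OF t p] tens_map_pt[OF i m y graph_in[OF h]] ap_id[OF Y O(1) y] by simp
    have "fn (hom_map (idV B) (idV W)) (graph h) = graph h"
      unfolding hom_map_app[OF idV_L[OF O(2)] idV_L[OF W] h] using comp_id[OF h] by simp
    then show "fn ?r (pt (Fo Y A) (hom_sp B W) y (graph h)) = fn (w B) (ptY Y B W (ap Y f y) h)"
      unfolding comp_app'[OF t' p] tens_map_pt[OF Yf m' y graph_in[OF h]] by simp
  qed
  show ?thesis
  proof
    assume "?l = ?r"
    then show ?R using pl pr by metis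
  next
    assume R: ?R
    show "?l = ?r"
    proof (rule tens_eqI[OF TO L_comp[OF w(1) t] L_comp[OF w(2) t']])
      fix y a assume y: "y : el Y A" and "a : carrier (hom_sp B W)"
      then obtain h where h: "h : L B W" "a = graph h" by (auto elim: hom_cases)
      show "fn ?l (pt (Fo Y A) (hom_sp B W) y a) = fn ?r (pt (Fo Y A) (hom_sp B W) y a)"
        unfolding h(2) pl[OF y h(1)] pr[OF y h(1)] using R y h(1) by blast
    qed
  qed
qed

lemma typedT_coendY: assumes Y: "lf Y" and W: "W : Obj" shows "typedT (coend_integrand Y W)"
  unfolding typedT_def coendY_simps
  by (intro allI impI conjI tens_map_L hom_map_L lf_L[OF Y] idV_L W; (assumption | erule L_Ob))

text \<open>The evaluation of the co-Yoneda lemma, which sends \<open>y \<otimes> g\<close> to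
  \<open>Y(g)(y)\<close>.\<close>

definition cw :: "('k, 'u) vfun => ('k, 'u) module => ('k, 'u) module => ('k, 'u) lin" where
  "cw Y W H = (SOME h. h : L (tens (Fo Y H) (hom_sp H W)) (Fo Y W) &
     (ALL y:el Y H. ALL g:L H W. fn h (ptY Y H W y g) = ap Y g y))"

lemma cw:
  assumes Y: "lf Y" and W: "W : Obj" and H: "H : Obj"
  shows "cw Y W H : L (tens (Fo Y H) (hom_sp H W)) (Fo Y W) &
     (ALL y:el Y H. ALL g:L H W. fn (cw Y W H) (ptY Y H W y g) = ap Y g y)"
  unfolding cw_def
proof (rule someI_ex)
  have b: "is_bilinear K (Fo Y H) (hom_sp H W) (Fo Y W) (%y a. ap Y (ungraph H W a) y)"
  proof (rule bilinearI)
    fix y a assume y: "y : el Y H" and "a : carrier (hom_sp H W)"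
    then obtain g where g: "g : L H W" "a = graph g" by (auto elim: hom_cases)
    show "ap Y (ungraph H W a) y : el Y W" unfolding g(2) ungraph_graph[OF g(1)] by (rule ap_closed[OF Y g(1) y])
    show "ap Y (ungraph H W a) (add (Fo Y H) y y') = add (Fo Y W) (ap Y (ungraph H W a) y) (ap Y (ungraph H W a) y')"
      if "y' : el Y H" for y' unfolding g(2) ungraph_graph[OF g(1)] by (rule ap_add[OF Y g(1) y that])
    show "ap Y (ungraph H W a) (smult (Fo Y H) c y) = smult (Fo Y W) c (ap Y (ungraph H W a) y)" if "c : carrier K" for c
      unfolding g(2) ungraph_graph[OF g(1)] by (rule ap_smult[OF Y g(1) that y])
    show "ap Y (ungraph H W (smult (hom_sp H W) c a)) y = smult (Fo Y W) c (ap Y (ungraph H W a) y)" if c: "c : carrier K" for c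
      unfolding g(2) hom_smult[OF g(1)] ungraph_graph[OF g(1)] ungraph_graph[OF lin_smult_L[OF g(1) c]]
      by (rule ap_lin_smult[OF Y g(1) c y])
    fix a' assume "a' : carrier (hom_sp H W)"
    then obtain g' where g': "g' : L H W" "a' = graph g'" by (rule hom_cases)
    show "ap Y (ungraph H W (add (hom_sp H W) a a')) y = add (Fo Y W) (ap Y (ungraph H W a) y) (ap Y (ungraph H W a') y)"
      unfolding g(2) g'(2) hom_add[OF g(1) g'(1)] ungraph_graph[OF g(1)] ungraph_graph[OF g'(1)]
        ungraph_graph[OF lin_add_L[OF g(1) g'(1)]]
      by (rule ap_lin_add[OF Y g(1) g'(1) y])
  qed
  obtain h where h: "h : L (tens (Fo Y H) (hom_sp H W)) (Fo Y W)"
    "!!y a. y : el Y H ==> a : carrier (hom_sp H W) ==>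
       fn h (pt (Fo Y H) (hom_sp H W) y a) = ap Y (ungraph H W a) y"
    using tens_lift[OF lf_Ob[OF Y H] hom_Obj[OF H W] lf_Ob[OF Y W] b] by blast
  have "ALL y:el Y H. ALL g:L H W. fn h (ptY Y H W y g) = ap Y g y"
  proof (intro ballI)
    fix y g assume "y : el Y H" "g : L H W"
    then show "fn h (ptY Y H W y g) = ap Y g y" using h(2)[OF _ graph_in, of y g] ungraph_graph[of g H W] by simp
  qed
  then show "EX h. h : L (tens (Fo Y H) (hom_sp H W)) (Fo Y W) &
     (ALL y:el Y H. ALL g:L H W. fn h (ptY Y H W y g) = ap Y g y)" using h(1) by blast
qed

text \<open>Dinaturality moves \<open>f\<close> off the second factor: the value of a cowedge at
  \<open>y \<otimes> f\<close> is its value at \<open>Y(f)(y) \<otimes> id\<close>. A cowedge is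
  thus the same as a linear map out of \<open>Y(W)\<close>.\<close>

lemma coend_coYoneda:
  assumes Y: "lf Y" and W: "W : Obj"
  shows "is_coend Vect Vect (coend_integrand Y W) (Fo Y W) (cw Y W)"
proof -
  note i = idV_L[OF W]
  have cwL: "cw Y W H : L (tens (Fo Y H) (hom_sp H W)) (Fo Y W)" if "H : Obj" for H using cw[OF Y W that] by blast
  have cwp: "fn (cw Y W H) (ptY Y H W y g) = ap Y g y" if "y : el Y H" "g : L H W" for y g H
    using cw[OF Y W L_Ob(1)[OF that(2)]] that by blast
  have c: "is_cowedge Vect Vect (coend_integrand Y W) (Fo Y W) (cw Y W)"
  proof (rule cowedgeI[OF lf_Ob[OF Y W]])
    show "cw Y W H : L (Fo (coend_integrand Y W) (H, H)) (Fo Y W)" if "H : Obj" for H using cwL[OF that] by simp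
    fix A B f assume f: "f : L A B"
    show "cw Y W A oo Fa (coend_integrand Y W) (f, idV A) = cw Y W B oo Fa (coend_integrand Y W) (idV B, f)"
      unfolding coendY_simps
      by (rule coendY_cowedge_eq[OF Y W f cwL[OF L_Ob(1)[OF f]] cwL[OF L_Ob(2)[OF f]], THEN iffD2])
         (simp add: cwp ap_closed[OF Y f] L_comp[OF _ f] ap_comp[OF Y _ f])
  qed
  have "EX! h. h : L (Fo Y W) e & (ALL H:Obj. h oo cw Y W H = w H)"
    if wd: "is_cowedge Vect Vect (coend_integrand Y W) e w" for e w
  proof -
    note e = cowedgeD(1)[OF wd]
    have wL: "w H : L (tens (Fo Y H) (hom_sp H W)) e" if "H : Obj" for H using cowedgeD(2)[OF wd that] by simp
    have wn: "fn (w A) (ptY Y A W y (h oo f)) = fn (w B) (ptY Y B W (ap Y f y) h)"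
      if f: "f : L A B" and y: "y : el Y A" and h: "h : L B W" for A B f y h
    proof -
      have "ALL y:el Y A. ALL h:L B W. fn (w A) (ptY Y A W y (h oo f)) = fn (w B) (ptY Y B W (ap Y f y) h)"
        using cowedgeD(3)[OF wd f] coendY_cowedge_eq[where w = w, OF Y W f wL[OF L_Ob(1)[OF f]] wL[OF L_Ob(2)[OF f]]]
        by simp
      then show ?thesis using y h by blast
    qed
    define g where "g b = fn (w W) (ptY Y W W b (idV W))" for b
    note O = lf_Ob[OF Y W] hom_Obj[OF W W]
    have "is_linear K (Fo Y W) e g"
      unfolding g_def
      by (rule is_linearI)
         (simp_all add: pt_add1[OF O] pt_smult1[OF O] graph_in[OF i] L_add[OF wL[OF W]] L_smult[OF wL[OF W]]
            L_app[OF wL[OF W]] O)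
    then have gL: "mk (Fo Y W) e g : L (Fo Y W) e" by (rule mk_L[OF O(1) e])
    show ?thesis
    proof (rule ex1I[of _ "mk (Fo Y W) e g"])
      show "mk (Fo Y W) e g : L (Fo Y W) e & (ALL H:Obj. mk (Fo Y W) e g oo cw Y W H = w H)"
      proof (intro conjI ballI gL)
        fix H assume H: "H : Obj"
        note HO = lf_Ob[OF Y H] hom_Obj[OF H W]
        show "mk (Fo Y W) e g oo cw Y W H = w H"
        proof (rule tens_eqI[OF HO L_comp[OF gL cwL[OF H]] wL[OF H]])
          fix y a assume y: "y : el Y H" and "a : carrier (hom_sp H W)"
          then obtain f where f: "f : L H W" "a = graph f" by (auto elim: hom_cases)
          note p = pt_closed[OF HO y graph_in[OF f(1)]]
          show "fn (mk (Fo Y W) e g oo cw Y W H) (pt (Fo Y H) (hom_sp H W) y a) = fn (w H) (pt (Fo Y H) (hom_sp H W) y a)"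
            unfolding f(2) comp_app'[OF cwL[OF H] p] cwp[OF y f(1)] mk_app[OF ap_closed[OF Y f(1) y]] g_def
            using wn[OF f(1) y i] comp_id(1)[OF f(1)] by simp
        qed
      qed
      fix h assume h: "h : L (Fo Y W) e & (ALL H:Obj. h oo cw Y W H = w H)"
      show "h = mk (Fo Y W) e g"
      proof (rule L_eqI[OF conjunct1[OF h] gL])
        fix b assume b: "b : el Y W"
        have "fn h (fn (cw Y W W) (ptY Y W W b (idV W))) = g b"
          unfolding g_def using comp_app'[OF cwL[OF W] pt_closed[OF O b graph_in[OF i]], of h] h W by simp
        then show "fn h b = fn (mk (Fo Y W) e g) b" using cwp[OF b i] ap_id[OF Y W b] b by simp
      qed
    qed
  qed
  then show ?thesis unfolding is_coend_def using c by simp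
qed

lemma nearid_coend: "EX \<theta>. nearid coend_functor \<theta>"
proof -
  let ?T = "%Y W. coend_integrand Y W"
  let ?c = "%Y W. coend_of Vect Vect (?T Y W)"
  have c: "is_coend Vect Vect (?T Y W) (coend_ob Y W) (snd (?c Y W))" if "lf Y" "W : Obj" for Y W
    unfolding coend_ob_def by (rule coend_is_coend[OF coend_coYoneda[OF that]])
  have pL: "snd (?c Y W) H : L (tens (Fo Y H) (hom_sp H W)) (coend_ob Y W)"
    if "lf Y" "W : Obj" "H : Obj" for Y W H
    using cowedgeD(2)[OF coend_cowedge[OF c[OF that(1,2)]] that(3)] by simp
  have pn: "fn (snd (?c Y W) A) (ptY Y A W y (h oo f)) = fn (snd (?c Y W) B) (ptY Y B W (ap Y f y) h)"
    if Y: "lf Y" and W: "W : Obj" and f: "f : L A B" and y: "y : el Y A" and h: "h : L B W" for Y W A B f y h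
  proof -
    have "ALL y:el Y A. ALL h:L B W. fn (snd (?c Y W) A) (ptY Y A W y (h oo f)) = fn (snd (?c Y W) B) (ptY Y B W (ap Y f y) h)"
      using cowedgeD(3)[OF coend_cowedge[OF c[OF Y W]] f]
        coendY_cowedge_eq[where w = "snd (?c Y W)", OF Y W f pL[OF Y W L_Ob(1)[OF f]] pL[OF Y W L_Ob(2)[OF f]]]
      by simp
    then show ?thesis using y h by blast
  qed
  define \<tau> where "\<tau> Y W = (SOME h. h : L (coend_ob Y W) (Fo Y W) &
    bij_betw (fn h) (carrier (coend_ob Y W)) (el Y W) &
    (ALL H:Obj. h oo snd (?c Y W) H = cw Y W H))" for Y W
  have \<tau>: "\<tau> Y W : L (coend_ob Y W) (Fo Y W) & bij_betw (fn (\<tau> Y W)) (carrier (coend_ob Y W)) (el Y W) &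
    (ALL H:Obj. \<tau> Y W oo snd (?c Y W) H = cw Y W H)" if Y: "lf Y" and W: "W : Obj" for Y W
    unfolding \<tau>_def by (rule someI_ex) (rule coend_iso[OF c[OF Y W] coend_coYoneda[OF Y W] typedT_coendY[OF Y W]])
  have \<tau>1: "\<tau> Y W : L (coend_ob Y W) (Fo Y W)" if "lf Y" "W : Obj" for Y W using \<tau>[OF that] by blast
  have \<tau>2: "fn (\<tau> Y W) (fn (snd (?c Y W) H) (ptY Y H W y g)) = ap Y g y"
    if Y: "lf Y" and W: "W : Obj" and y: "y : el Y H" and g: "g : L H W" for Y W H y g
  proof -
    note H = L_Ob(1)[OF g]
    have "\<tau> Y W oo snd (?c Y W) H = cw Y W H" using \<tau>[OF Y W] H by blast
    then show ?thesis
      using comp_app'[OF pL[OF Y W H] pt_closed[OF lf_Ob[OF Y H] hom_Obj[OF H W] y graph_in[OF g]], of "\<tau> Y W"]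
        cw[OF Y W H] y g by simp
  qed
  have ar: "coend_ar \<eta> w : L (coend_ob Y W) (coend_ob Y' W') &
    (ALL H:Obj. coend_ar \<eta> w oo snd (?c Y W) H = snd (?c Y' W') H oo tens_map (fn \<eta> H) (hom_map (idV H) w))"
    if \<eta>: "\<eta> : NT Y Y'" and w: "w : L W W'" for Y Y' \<eta> W W' w
  proof -
    note Y = NT_lf[OF \<eta>] and O = L_Ob[OF w]
    let ?t = "%H. tens_map (fn \<eta> H) (hom_map (idV H) w)" and ?p = "snd (?c Y' W')"
    have tL: "?t H : L (tens (Fo Y H) (hom_sp H W)) (tens (Fo Y' H) (hom_sp H W'))" if "H : Obj" for H
      by (rule tens_map_L[OF NT_L[OF \<eta> that] hom_map_L[OF idV_L[OF that] w]])
    have tpt: "fn (?p H oo ?t H) (ptY Y H W y h) = fn (?p H) (ptY Y' H W' (nt \<eta> H y) (w oo h))"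
      if y: "y : el Y H" and h: "h : L H W" for H y h
    proof -
      note H = L_Ob(1)[OF h]
      have "fn (hom_map (idV H) w) (graph h) = graph (w oo h)"
        unfolding hom_map_app[OF idV_L[OF H] w h] using comp_id(2)[OF h] by simp
      then show ?thesis
        unfolding comp_app'[OF tL[OF H] pt_closed[OF lf_Ob[OF Y(1) H] hom_Obj[OF H O(1)] y graph_in[OF h]]]
          tens_map_pt[OF NT_L[OF \<eta> H] hom_map_L[OF idV_L[OF H] w] y graph_in[OF h]] by simp
    qed
    have ptL: "?p H oo ?t H : L (tens (Fo Y H) (hom_sp H W)) (coend_ob Y' W')" if "H : Obj" for H
      by (rule L_comp[OF pL[OF Y(2) O(2) that] tL[OF that]])
    have e: "is_cowedge Vect Vect (?T Y W) (coend_ob Y' W') (%H. ?p H oo ?t H)"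
    proof (rule cowedgeI)
      show "coend_ob Y' W' : Obj" using L_Ob(1)[OF \<tau>1[OF Y(2) O(2)]] .
      show "?p H oo ?t H : L (Fo (?T Y W) (H, H)) (coend_ob Y' W')" if "H : Obj" for H using ptL[OF that] by simp
      fix A B f assume f: "f : L A B"
      note AB = L_Ob[OF f]
      have R: "ALL y:el Y A. ALL h:L B W. fn (?p A oo ?t A) (ptY Y A W y (h oo f)) = fn (?p B oo ?t B) (ptY Y B W (ap Y f y) h)"
      proof (intro ballI)
        fix y h assume y: "y : el Y A" and h: "h : L B W"
        show "fn (?p A oo ?t A) (ptY Y A W y (h oo f)) = fn (?p B oo ?t B) (ptY Y B W (ap Y f y) h)"
          unfolding tpt[OF y L_comp[OF h f]] tpt[OF ap_closed[OF Y(1) f y] h]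
          using pn[OF Y(2) O(2) f nt_closed[OF \<eta> AB(1) y] L_comp[OF w h]] nt_nat[OF \<eta> f y] comp_assoc[OF w h f] by simp
      qed
      show "(?p A oo ?t A) oo Fa (?T Y W) (f, idV A) = (?p B oo ?t B) oo Fa (?T Y W) (idV B, f)"
        unfolding coendY_simps
        using coendY_cowedge_eq[where w = "%H. ?p H oo ?t H", OF Y(1) O(1) f ptL[OF AB(1)] ptL[OF AB(2)]] R by blast
    qed
    have "coend_map Vect Vect (?T Y W) (?T Y' W') ?t : L (fst (?c Y W)) (fst (?c Y' W')) &
      (ALL H:Obj. coend_map Vect Vect (?T Y W) (?T Y' W') ?t oo snd (?c Y W) H = ?p H oo ?t H)"
      by (rule coend_map_props[OF coend_coYoneda[OF Y(1) O(1)] e[unfolded coend_ob_def]])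
    then show ?thesis unfolding coend_ar_def coend_ob_def NT_src[OF \<eta>] L_src[OF w] by simp
  qed
  have nat: "fn (\<tau> Y' W') (fn (coend_ar \<eta> w) z) = nt \<eta> W' (ap Y w (fn (\<tau> Y W) z))"
    if \<eta>: "\<eta> : NT Y Y'" and w: "w : L W W'" and z: "z : carrier (coend_ob Y W)" for Y Y' \<eta> W W' w z
  proof -
    note Y = NT_lf[OF \<eta>] and O = L_Ob[OF w]
    note a = conjunct1[OF ar[OF \<eta> w]] and \<eta>L = NT_L[OF \<eta> O(2)] and Yw = lf_L[OF Y(1) w]
    note \<tau>Y = \<tau>1[OF Y(1) O(1)] and \<tau>Y' = \<tau>1[OF Y(2) O(2)]
    note l = L_comp[OF \<tau>Y' a] and r = L_comp[OF \<eta>L L_comp[OF Yw \<tau>Y]]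
    have "\<tau> Y' W' oo coend_ar \<eta> w = fn \<eta> W' oo Fa Y w oo \<tau> Y W"
    proof (rule coend_eqI[OF c[OF Y(1) O(1)] typedT_coendY[OF Y(1) O(1)] l r])
      fix H assume H: "H : Obj"
      note p = pL[OF Y(1) O(1) H] and p' = pL[OF Y(2) O(2) H]
      note HO = lf_Ob[OF Y(1) H] hom_Obj[OF H O(1)]
      have t: "tens_map (fn \<eta> H) (hom_map (idV H) w) : L (tens (Fo Y H) (hom_sp H W)) (tens (Fo Y' H) (hom_sp H W'))"
        by (rule tens_map_L[OF NT_L[OF \<eta> H] hom_map_L[OF idV_L[OF H] w]])
      show "(\<tau> Y' W' oo coend_ar \<eta> w) oo snd (?c Y W) H = (fn \<eta> W' oo Fa Y w oo \<tau> Y W) oo snd (?c Y W) H"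
      proof (rule tens_eqI[OF HO L_comp[OF l p] L_comp[OF r p]])
        fix y b assume y: "y : el Y H" and "b : carrier (hom_sp H W)"
        then obtain h where h: "h : L H W" "b = graph h" by (auto elim: hom_cases)
        note q = pt_closed[OF HO y graph_in[OF h(1)]]
        have "fn (hom_map (idV H) w) (graph h) = graph (w oo h)"
          unfolding hom_map_app[OF idV_L[OF H] w h(1)] using comp_id(2)[OF h(1)] by simp
        then have tq: "fn (tens_map (fn \<eta> H) (hom_map (idV H) w)) (ptY Y H W y h) = ptY Y' H W' (nt \<eta> H y) (w oo h)"
          using tens_map_pt[OF NT_L[OF \<eta> H] hom_map_L[OF idV_L[OF H] w] y graph_in[OF h(1)]] by simp
        have "coend_ar \<eta> w oo snd (?c Y W) H = snd (?c Y' W') H oo tens_map (fn \<eta> H) (hom_map (idV H) w)"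
          using ar[OF \<eta> w] H by blast
        then have "fn (coend_ar \<eta> w) (fn (snd (?c Y W) H) (ptY Y H W y h)) =
          fn (snd (?c Y' W') H) (ptY Y' H W' (nt \<eta> H y) (w oo h))"
          using comp_app'[OF p q, of "coend_ar \<eta> w"] comp_app'[OF t q, of "snd (?c Y' W') H"] tq by simp
        then have "fn ((\<tau> Y' W' oo coend_ar \<eta> w) oo snd (?c Y W) H) (ptY Y H W y h) = ap Y' (w oo h) (nt \<eta> H y)"
          unfolding comp_app'[OF p q] comp_app'[OF a L_app[OF p q]]
          using \<tau>2[OF Y(2) O(2) nt_closed[OF \<eta> H y] L_comp[OF w h(1)]] by simp
        moreover have "fn ((fn \<eta> W' oo Fa Y w oo \<tau> Y W) oo snd (?c Y W) H) (ptY Y H W y h) = nt \<eta> W' (ap Y w (ap Y h y))"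
          unfolding comp_app'[OF p q] comp_app'[OF L_comp[OF Yw \<tau>Y] L_app[OF p q]] comp_app'[OF \<tau>Y L_app[OF p q]]
            \<tau>2[OF Y(1) O(1) y h(1)] ..
        ultimately show "fn ((\<tau> Y' W' oo coend_ar \<eta> w) oo snd (?c Y W) H) (pt (Fo Y H) (hom_sp H W) y b) =
          fn ((fn \<eta> W' oo Fa Y w oo \<tau> Y W) oo snd (?c Y W) H) (pt (Fo Y H) (hom_sp H W) y b)"
          using nt_nat[OF \<eta> L_comp[OF w h(1)] y] ap_comp[OF Y(1) w h(1) y] h(2) by simp
      qed
    qed
    then show ?thesis
      using comp_app'[OF a z, of "\<tau> Y' W'"] comp_app'[OF L_comp[OF Yw \<tau>Y] z, of "fn \<eta> W'"] comp_app'[OF \<tau>Y z, of "Fa Y w"]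
      by simp
  qed
  show ?thesis unfolding coend_functor_def
  proof (rule nearidI[of \<tau>])
    show "\<tau> Y W : L (coend_ob Y W) (Fo Y W)" if "lf Y" "W : Obj" for Y W by (rule \<tau>1[OF that])
    show "bij_betw (fn (\<tau> Y W)) (carrier (coend_ob Y W)) (el Y W)" if "lf Y" "W : Obj" for Y W
      by (rule \<tau>[OF that, THEN conjunct2, THEN conjunct1])
    show "coend_ar \<eta> w : L (coend_ob Y W) (coend_ob Y' W')" if "\<eta> : NT Y Y'" "w : L W W'" for Y Y' \<eta> W W' w
      by (rule ar[OF that, THEN conjunct1])
  qed (rule nat)
qed


section \<open>The internal hom\<close>

lemma tens_map_add1:
  assumes f: "f : L V V'" and g: "g : L V V'" and h: "h : L W W'"
  shows "tens_map (lin_add f g) h = lin_add (tens_map f h) (tens_map g h)"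
proof (rule tens_eqI[of V W _ "tens V' W'"])
  note t = tens_map_L[OF f h] tens_map_L[OF g h] lin_add_L[OF f g]
  show "fn (tens_map (lin_add f g) h) (pt V W v w) = fn (lin_add (tens_map f h) (tens_map g h)) (pt V W v w)"
    if "v : carrier V" "w : carrier W" for v w
    using that L_Ob[OF f] L_Ob[OF h]
    by (simp add: tens_map_pt[OF t(3) h] lin_add_app[OF f] lin_add_app[OF t(1)] tens_map_pt[OF f h]
      tens_map_pt[OF g h] pt_add1 L_app[OF f] L_app[OF g] L_app[OF h])
qed (use L_Ob[OF f] L_Ob[OF h] f g h in \<open>auto intro!: tens_map_L lin_add_L\<close>)

lemma tens_map_smult1:
  assumes f: "f : L V V'" and h: "h : L W W'" and c: "c : carrier K"
  shows "tens_map (lin_smult c f) h = lin_smult c (tens_map f h)"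
proof (rule tens_eqI[of V W _ "tens V' W'"])
  note t = tens_map_L[OF f h] lin_smult_L[OF f c]
  show "fn (tens_map (lin_smult c f) h) (pt V W v w) = fn (lin_smult c (tens_map f h)) (pt V W v w)"
    if "v : carrier V" "w : carrier W" for v w
    using that L_Ob[OF f] L_Ob[OF h] c
    by (simp add: tens_map_pt[OF t(2) h] lin_smult_app[OF f] lin_smult_app[OF t(1)] tens_map_pt[OF f h]
      pt_smult1 L_app[OF f] L_app[OF h])
qed (use L_Ob[OF f] L_Ob[OF h] f c h in \<open>auto intro!: tens_map_L lin_smult_L\<close>)

text \<open>Absorbs the parameter \<open>V\<close> into the functor, so that the internal hom at
  \<open>V\<close> is a space of natural families from \<open>X\<close> to
  \<open>sh Y V\<close>.\<close>

definition sh :: "('k, 'u) vfun => ('k, 'u) module => ('k, 'u) vfun" where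
  "sh Y V = \<lparr>Fo = %H. Fo Y (tens H V), Fa = %h. Fa Y (tens_map h (idV V))\<rparr>"

lemma sh_simps[simp]: "Fo (sh Y V) H = Fo Y (tens H V)" "Fa (sh Y V) h = Fa Y (tens_map h (idV V))"
  by (simp_all add: sh_def)

lemma lf_sh: assumes Y: "lf Y" and V: "V : Obj" shows "lf (sh Y V)"
proof (rule lfI)
  note i = idV_L[OF V]
  fix f A B assume f: "f : L A B"
  note fi = tens_map_L[OF f i]
  show "Fa (sh Y V) f : L (Fo (sh Y V) A) (Fo (sh Y V) B)" using lf_L[OF Y fi] by simp
  show "ap (sh Y V) (g oo f) x = ap (sh Y V) g (ap (sh Y V) f x)"
    if g: "g : L B C" and x: "x : el (sh Y V) A" for g C x
    using ap_comp[OF Y tens_map_L[OF g i] fi, of x] x tens_map_comp[OF f i g i] comp_id(1)[OF i] by simp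
  show "ap (sh Y V) (lin_add f g) x = add (Fo (sh Y V) B) (ap (sh Y V) f x) (ap (sh Y V) g x)"
    if g: "g : L A B" and x: "x : el (sh Y V) A" for g x
    using ap_lin_add[OF Y fi tens_map_L[OF g i], of x] x tens_map_add1[OF f g i] by simp
  show "ap (sh Y V) (lin_smult c f) x = smult (Fo (sh Y V) B) c (ap (sh Y V) f x)"
    if c: "c : carrier K" and x: "x : el (sh Y V) A" for c x
    using ap_lin_smult[OF Y fi c, of x] x tens_map_smult1[OF f i c] by simp
qed (use V Y in \<open>auto simp: lf_Ob ap_id\<close>)

lemma twist_L:
  assumes \<eta>: "\<eta> : NT Y Y'" and v: "v : L V V'" and H: "H : Obj"
  shows "twist_map \<eta> v H : L (Fo Y (tens H V)) (Fo Y' (tens H V'))"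
    and "z : el Y (tens H V) ==>
      fn (twist_map \<eta> v H) z = nt \<eta> (tens H V') (ap Y (tens_map (idV H) v) z)"
proof -
  note Y = NT_lf[OF \<eta>] and O = L_Ob[OF v]
  note a = lf_L[OF Y(1) tens_map_L[OF idV_L[OF H] v]]
  have e: "twist_map \<eta> v H = fn \<eta> (tens H V') oo Fa Y (tens_map (idV H) v)"
    by (simp add: twist_map_def NT_src[OF \<eta>] L_src[OF v])
  show "twist_map \<eta> v H : L (Fo Y (tens H V)) (Fo Y' (tens H V'))"
    unfolding e by (rule L_comp[OF NT_L[OF \<eta> tens_Obj[OF H O(2)]] a])
  show "fn (twist_map \<eta> v H) z = nt \<eta> (tens H V') (ap Y (tens_map (idV H) v) z)"
    if "z : el Y (tens H V)" unfolding e by (rule comp_app'[OF a that])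
qed

lemma twist_nat:
  assumes \<eta>: "\<eta> : NT Y Y'" and v: "v : L V V'" and f: "f : L G H" and z: "z : el (sh Y V) G"
  shows "fn (twist_map \<eta> v H) (ap (sh Y V) f z) = ap (sh Y' V') f (fn (twist_map \<eta> v G) z)"
proof -
  note Y = NT_lf[OF \<eta>] and O = L_Ob[OF v] and G = L_Ob[OF f]
  note i = idV_L[OF O(1)] and i' = idV_L[OF O(2)] and iG = idV_L[OF G(1)] and iH = idV_L[OF G(2)]
  note fi = tens_map_L[OF f i] and fi' = tens_map_L[OF f i'] and Hv = tens_map_L[OF iH v] and Gv = tens_map_L[OF iG v]
  have z: "z : el Y (tens G V)" using z by simp
  have e: "tens_map (idV H) v oo tens_map f (idV V) = tens_map f (idV V') oo tens_map (idV G) v"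
    unfolding tens_map_comp[OF f i iH v] tens_map_comp[OF iG v f i'] using f v by simp
  have "fn (twist_map \<eta> v H) (ap (sh Y V) f z) = nt \<eta> (tens H V') (ap Y (tens_map (idV H) v oo tens_map f (idV V)) z)"
    unfolding sh_simps twist_L(2)[OF \<eta> v G(2) ap_closed[OF Y(1) fi z]] ap_comp[OF Y(1) Hv fi z] ..
  also have "\<dots> = ap Y' (tens_map f (idV V')) (nt \<eta> (tens G V') (ap Y (tens_map (idV G) v) z))"
    unfolding e ap_comp[OF Y(1) fi' Gv z] by (rule nt_nat[OF \<eta> fi' ap_closed[OF Y(1) Gv z]])
  finally show ?thesis unfolding sh_simps twist_L(2)[OF \<eta> v G(1) z] .
qed

lemma twist_id:
  assumes Y: "lf Y" and v: "v : L V V'" and H: "H : Obj" and z: "z : el Y (tens H V)"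
  shows "fn (twist_map (Idn FunVect Y) v H) z = ap Y (tens_map (idV H) v) z"
  unfolding twist_L(2)[OF NT_id(1)[OF Y] v H z]
  by (rule NT_id(2)[OF Y tens_Obj[OF H L_Ob(2)[OF v]] ap_closed[OF Y tens_map_L[OF idV_L[OF H] v] z]])

lemma twist_comp:
  assumes \<eta>: "\<eta> : NT Y Y'" and \<eta>': "\<eta>' : NT Y' Y''" and v: "v : L V V'" and v': "v' : L V' V''"
    and H: "H : Obj" and z: "z : el Y (tens H V)"
  shows "fn (twist_map (Cmp FunVect \<eta>' \<eta>) (v' oo v) H) z = fn (twist_map \<eta>' v' H) (fn (twist_map \<eta> v H) z)"
proof -
  note Y = NT_lf[OF \<eta>] and iH = idV_L[OF H]
  note a = tens_map_L[OF iH v] and a' = tens_map_L[OF iH v']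
  note az = ap_closed[OF Y(1) a z]
  note T' = tens_Obj[OF H L_Ob(2)[OF v']]
  have "tens_map (idV H) (v' oo v) = tens_map (idV H) v' oo tens_map (idV H) v"
    unfolding tens_map_comp[OF iH v iH v'] using comp_id(1)[OF iH] by simp
  then have "fn (twist_map (Cmp FunVect \<eta>' \<eta>) (v' oo v) H) z =
    nt \<eta>' (tens H V'') (nt \<eta> (tens H V'') (ap Y (tens_map (idV H) v') (ap Y (tens_map (idV H) v) z)))"
    unfolding twist_L(2)[OF NT_comp(1)[OF \<eta>' \<eta>] L_comp[OF v' v] H z]
    using NT_comp(2)[OF \<eta>' \<eta> T'] ap_comp[OF Y(1) a' a z] ap_closed[OF Y(1) a' az] by simp
  then show ?thesis
    unfolding twist_L(2)[OF \<eta> v H z]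
      twist_L(2)[OF \<eta>' v' H nt_closed[OF \<eta> tens_Obj[OF H L_Ob(2)[OF v]] az]] nt_nat[OF \<eta> a' az, symmetric] .
qed

text \<open>For small \<open>K\<close> the space \<open>F\<close> is free on \<open>Q\<close>. Its
  purpose is uniformity: one space has maps to every \<open>V\<close> whose images contain any
  prescribed \<open>Q\<close>-indexed family of vectors.\<close>

lemma free_space:
  assumes Q: "small (Q :: 'q set)" and V0: "V0 : Obj"
  shows "EX F:Obj. ALL V:Obj. ALL q. q ` Q <= carrier V --> (EX i:L F V. q ` Q <= fn i ` carrier F)"
proof (cases "small (carrier K)")
  case True
  let ?I = "carrier K \<times> Q"
  \<comment> \<open>The generators are pairs of a scalar and an index, so a scalar multiple of a
    generator is again a generator, as \<open>universal\<close> demands.\<close>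
  define P where "P = {(Z, \<beta>). Z : Obj & (EX q. q ` Q <= carrier Z & \<beta> = (%(c, s). smult Z c (q s)))}"
  have PD: "fst p : Obj & (EX q. q ` Q <= carrier (fst p) & snd p = (%(c, s). smult (fst p) c (q s)))" if pP: "p : P" for p
  proof -
    obtain Z q where "p = (Z, %(c, s). smult Z c (q s))" "Z : Obj" "q ` Q <= carrier Z"
      using pP unfolding P_def by blast
    then show ?thesis by (intro conjI exI[of _ q]) simp_all
  qed
  have Pc: "snd p i : carrier (fst p)" if p: "p : P" and i: "i : ?I" for p i
  proof -
    obtain q where "q ` Q <= carrier (fst p)" "snd p = (%(c, s). smult (fst p) c (q s))" using PD[OF p] by blast
    then show ?thesis using PD[OF p] i by auto
  qed
  have Ps: "smult (fst p) c (snd p (d, s)) = snd p (mult K c d, s)"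
    if p: "p : P" and c: "c : carrier K" and i: "(d, s) : ?I" for p c d s
  proof -
    obtain q where "q ` Q <= carrier (fst p)" "snd p = (%(c, s). smult (fst p) c (q s))" using PD[OF p] by blast
    then show ?thesis using PD[OF p] i c by (auto simp: V_smult_smult)
  qed
  obtain T t H where T: "T : Obj" "!!i. i : ?I ==> t i : carrier T"
    "!!p. p : P ==> H p : L T (fst p)" "!!p i. p : P ==> i : ?I ==> fn (H p) (t i) = snd p i"
  proof (rule universal[of P ?I ?I])
    show "fst p : Obj" if "p : P" for p using PD[OF that] by blast
    show "snd p i : carrier (fst p)" if "p : P" "i : ?I" for p i by (rule Pc[OF that])
    show "small ?I" using True Q by (intro small_Sigma)
    show "EX l:lists ?I. ALL p:P. smult (fst p) c (snd p i) = lsum (fst p) (snd p) l" if c: "c : carrier K" and i: "i : ?I" for c i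
    proof -
      obtain d s where i: "i = (d, s)" "(d, s) : ?I" using i by (cases i) auto
      have m: "(mult K c d, s) : ?I" using i c by simp
      have "smult (fst p) c (snd p i) = lsum (fst p) (snd p) [(mult K c d, s)]" if p: "p : P" for p
        using Ps[OF p c i(2)] Pc[OF p m] PD[OF p] by (simp add: i(1))
      then show ?thesis using m by (intro bexI[of _ "[(mult K c d, s)]"]) auto
    qed
  next
    show "?I <= ?I" by (rule order_refl)
  next
    fix T t H
    assume "T : Obj" "!!i. i : ?I ==> t i : carrier T"
      "!!p. p : P ==> H p : L T (fst p)" "!!p i. p : P ==> i : ?I ==> fn (H p) (t i) = snd p i"
    then show thesis by (rule that)
  qed
  have "EX i:L T V. q ` Q <= fn i ` carrier T" if V: "V : Obj" and q: "q ` Q <= carrier V" for V and q :: "'q => 'u"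
  proof -
    let ?p = "(V, %(c, s). smult V c (q s))"
    have p: "?p : P" unfolding P_def using V q by auto
    have "q ` Q <= fn (H ?p) ` carrier T"
    proof
      fix y assume "y : q ` Q"
      then obtain s where s: "s : Q" "y = q s" by blast
      have si: "(one K, s) : ?I" using s by simp
      have "y = fn (H ?p) (t (one K, s))" using T(4)[OF p si] s q V by auto
      then show "y : fn (H ?p) ` carrier T" using T(2)[OF si] by blast
    qed
    then show ?thesis using T(3)[OF p] by auto
  qed
  then show ?thesis using T(1) by blast
next
  case False
  \<comment> \<open>Multiplication of a nonzero vector by scalars is injective. A large field would
    embed into a small set, so all small spaces are zero and any space will do as
    \<open>F\<close>.\<close>
  have z: "v = zero V" if V: "V : Obj" and v: "v : carrier V" for V v
  proof (rule ccontr)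
    assume nz: "v \<noteq> zero V"
    have "inj_on (%c. smult V c v) (carrier K)"
    proof (rule inj_onI, rule ccontr)
      fix c d assume c: "c : carrier K" and d: "d : carrier K" and e: "smult V c v = smult V d v" and ne: "c \<noteq> d"
      let ?e = "add K c (a_inv K d)"
      have ec: "?e : carrier K" using c d by simp
      have "smult V ?e v = add V (smult V d v) (smult V (a_inv K d) v)"
        using c d v V e by (simp add: V_add_smult)
      also have "\<dots> = zero V" using d v V by (simp add: V_add_smult[symmetric] r_neg)
      finally have ez: "smult V ?e v = zero V" .
      have "?e \<noteq> zero K"
      proof
        assume e0: "?e = zero K"
        have "c = add K ?e d" using c d by (simp add: a_assoc l_neg)
        then show False using ne e0 d by simp
      qed
      then have u: "?e : Units K" using ec field_Units by auto
      have "v = smult V (inv\<^bsub>K\<^esub> ?e) (smult V ?e v)" using u v V ec by (simp add: V_smult_smult)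
      then show False using nz ez u V by simp
    qed
    moreover have "small ((%c. smult V c v) ` carrier K)"
      by (rule small_subset[OF Obj_small[OF V]]) (use V v in auto)
    ultimately show False using False small_inj by blast
  qed
  have "EX i:L V0 V. q ` Q <= fn i ` carrier V0" if V: "V : Obj" and q: "q ` Q <= carrier V" for V and q :: "'q => 'u"
  proof -
    have "q ` Q <= fn (lin_zero V0 V) ` carrier V0"
    proof
      fix y assume "y : q ` Q"
      then have "y = fn (lin_zero V0 V) (zero V0)" using z[OF V] q V0 by auto
      then show "y : fn (lin_zero V0 V) ` carrier V0" using V0 by blast
    qed
    then show ?thesis using lin_zero_L[OF V0 V] by blast
  qed
  then show ?thesis using V0 by blast
qed

text \<open>A tensor is a finite combination of pure tensors, so a map \<open>i\<close> whose image
  contains their second factors lifts it. The factors are recorded in a sequence, possibly with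
  repetitions, rather than in a finite set.\<close>

lemma tens_finite_support:
  assumes A: "A : Obj" and V: "V : Obj" and w: "w : carrier (tens A V)"
  shows "EX q. range q <= carrier V & (ALL F i. i : L F V --> range (q :: nat => 'u) <= fn i ` carrier F -->
    w : fn (tens_map (idV A) i) ` carrier (tens A F))"
proof -
  define good where "good w q \<longleftrightarrow> range q <= carrier V & (ALL F i. i : L F V --> range q <= fn i ` carrier F -->
    w : fn (tens_map (idV A) i) ` carrier (tens A F))" for w and q :: "nat => 'u"
  have goodI: "good w q" if "range q <= carrier V"
    "!!F i. i : L F V ==> range q <= fn i ` carrier F ==> w : fn (tens_map (idV A) i) ` carrier (tens A F)" for w q
    unfolding good_def using that by simp
  have goodD: "range q <= carrier V" "i : L F V ==> range q <= fn i ` carrier F ==>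
      EX x. x : carrier (tens A F) & w = fn (tens_map (idV A) i) x" if "good w q" for w q F i
    using that unfolding good_def by (simp, metis imageE)
  note iA = idV_L[OF A]
  have "EX q. good w q"
  proof (rule tens_induct[OF A V w])
    fix a v assume a: "a : carrier A" and v: "v : carrier V"
    have "good (pt A V a v) (%_. v)"
    proof (rule goodI)
      fix F i assume i: "i : L F V" and r: "range (%_::nat. v) <= fn i ` carrier F"
      obtain f where f: "f : carrier F" "v = fn i f" using r by auto
      have "pt A V a v = fn (tens_map (idV A) i) (pt A F a f)"
        using tens_map_pt[OF iA i a f(1)] a f(2) by simp
      then show "pt A V a v : fn (tens_map (idV A) i) ` carrier (tens A F)"
        using pt_closed[OF A L_Ob(1)[OF i] a f(1)] by (rule image_eqI)
    qed (use v in simp)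
    then show "EX q. good (pt A V a v) q" by blast
  next
    have "good (zero (tens A V)) (%_. zero V)"
    proof (rule goodI)
      fix F i assume i: "i : L F V"
      show "zero (tens A V) : fn (tens_map (idV A) i) ` carrier (tens A F)"
        unfolding L_zero[OF tens_map_L[OF iA i], symmetric]
        by (rule imageI) (rule V_zero[OF tens_Obj[OF A L_Ob(1)[OF i]]])
    qed (use V in simp)
    then show "EX q. good (zero (tens A V)) q" by blast
  next
    fix x y assume "EX q. good x q" "EX q. good y q"
    then obtain q r where q: "good x q" and r: "good y r" by (elim exE)
    \<comment> \<open>Interleaving the two sequences covers the vectors of both summands.\<close>
    define s where "s n = (if even n then q (n div 2) else r (n div 2))" for n
    have qs: "q n = s (2 * n)" "r n = s (2 * n + 1)" for n by (simp_all add: s_def)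
    have "good (add (tens A V) x y) s"
    proof (rule goodI)
      show "range s <= carrier V" using goodD(1)[OF q] goodD(1)[OF r] by (auto simp: s_def)
      fix F i assume i: "i : L F V" and rs: "range s <= fn i ` carrier F"
      have "range q <= fn i ` carrier F" "range r <= fn i ` carrier F" using rs qs by auto
      then obtain x' y' where x': "x' : carrier (tens A F)" "x = fn (tens_map (idV A) i) x'"
        and y': "y' : carrier (tens A F)" "y = fn (tens_map (idV A) i) y'"
        using goodD(2)[OF q i] goodD(2)[OF r i] by auto
      show "add (tens A V) x y : fn (tens_map (idV A) i) ` carrier (tens A F)"
        unfolding x'(2) y'(2) L_add[OF tens_map_L[OF iA i] x'(1) y'(1), symmetric]
        by (rule imageI) (rule V_add[OF tens_Obj[OF A L_Ob(1)[OF i]] x'(1) y'(1)])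
    qed
    then show "EX q. good (add (tens A V) x y) q" by blast
  next
    fix c x assume c: "c : carrier K" and "EX q. good x q"
    then obtain q where q: "good x q" by (elim exE)
    have "good (smult (tens A V) c x) q"
    proof (rule goodI[OF goodD(1)[OF q]])
      fix F i assume i: "i : L F V" and rs: "range q <= fn i ` carrier F"
      obtain x' where x': "x' : carrier (tens A F)" "x = fn (tens_map (idV A) i) x'" using goodD(2)[OF q i rs] by auto
      show "smult (tens A V) c x : fn (tens_map (idV A) i) ` carrier (tens A F)"
        unfolding x'(2) L_smult[OF tens_map_L[OF iA i] c x'(1), symmetric]
        by (rule imageI) (rule V_smult[OF tens_Obj[OF A L_Ob(1)[OF i]] c x'(1)])
    qed
    then show "EX q. good (smult (tens A V) c x) q" by blast
  qed
  then show ?thesis unfolding good_def .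
qed

end

locale ind_obj = small_vect elts K for elts :: "'u => 'u set" and K :: "'k ring" +
  fixes X :: "('k, 'u) vfun" and V0 :: "('k, 'u) module"
  assumes X: "lf X" and gX: "gens X V0"
begin

section \<open>The chosen ends and limits as spaces of families\<close>

lemma V0: "V0 : Obj" using gX by (simp add: gens_def)

abbreviation "EO Z \<equiv> fst (end_of Vect Vect (endT X Z))"
abbreviation "E\<rho> Z \<equiv> endfam X Z (snd (end_of Vect Vect (endT X Z)))"
abbreviation "LO Z \<equiv> fst (lim (op_cat (elements X)) Vect (elD Z))"
abbreviation "L\<rho> Z \<equiv> limfam X (snd (lim (op_cat (elements X)) Vect (elD Z)))"

lemma end_exists: "lf Z ==> EX e w. is_end Vect Vect (endT X Z) e w"
  using fam_represented[OF X _ gX] end_of_families[OF X] by metis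

lemma lim_exists: "lf Z ==> EX l p. is_limit (op_cat (elements X)) Vect (elD Z) l p"
  using fam_represented[OF X _ gX] limit_of_families[OF X] by metis

lemma end_frep: "lf Z ==> frep (EO Z) (E\<rho> Z) X Z"
  using end_exists end_is_end end_represents[OF X _ gX] by metis

lemma lim_frep: "lf Z ==> frep (LO Z) (L\<rho> Z) X Z"
  using lim_exists lim_is_limit limit_represents[OF X _ gX] by metis

lemma fam_map:
  assumes z: "z : fam X Z" and \<tau>: "!!H. H : Obj ==> \<tau> H : L (Fo Z H) (Fo Z' H)"
    and nat: "!!f V W z. f : L V W ==> z : el Z V ==> fn (\<tau> W) (ap Z f z) = ap Z' f (fn (\<tau> V) z)"
  shows "mkfam X (%H x. fn (\<tau> H) (z (H, x))) : fam X Z'"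
proof (rule mkfam_fam[OF X])
  show "fn (\<tau> H) (z (H, x)) : el Z' H" if "H : Obj" "x : el X H" for H x
    by (rule L_app[OF \<tau>[OF that(1)] fam_closed[OF z that]])
  show "fn (\<tau> W) (z (W, ap X f x)) = ap Z' f (fn (\<tau> V) (z (V, x)))" if "f : L V W" "x : el X V" for f V W x
    unfolding fam_nat[OF z that] by (rule nat[OF that(1) fam_closed[OF z L_Ob(1)[OF that(1)] that(2)]])
qed

text \<open>Identifies in coordinates the arrow that \<open>end_map\<close> picks by description:
  its equations with the legs, evaluated at an element of \<open>X\<close>, say that each coordinate
  is transformed by \<open>\<tau>\<close>.\<close>

lemma end_map_frep:
  assumes Z: "lf Z" and Z': "lf Z'" and \<tau>: "!!H. H : Obj ==> \<tau> H : L (Fo Z H) (Fo Z' H)"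
    and nat: "!!f V W z. f : L V W ==> z : el Z V ==> fn (\<tau> W) (ap Z f z) = ap Z' f (fn (\<tau> V) z)"
  defines "m \<equiv> end_map Vect Vect (endT X Z) (endT X Z') (%H. hom_map (idV (Fo X H)) (\<tau> H))"
  shows "m : L (EO Z) (EO Z')"
    and "\<epsilon> : carrier (EO Z) ==> H : Obj ==> x : el X H ==> E\<rho> Z' (fn m \<epsilon>) (H, x) = fn (\<tau> H) (E\<rho> Z \<epsilon> (H, x))"
proof -
  let ?w = "snd (end_of Vect Vect (endT X Z))" and ?w' = "snd (end_of Vect Vect (endT X Z'))"
  let ?t = "%H. hom_map (idV (Fo X H)) (\<tau> H)"
  obtain e0 w0 where ew0: "is_end Vect Vect (endT X Z) e0 w0" using end_exists[OF Z] by blast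
  obtain e1 w1 where ew1: "is_end Vect Vect (endT X Z') e1 w1" using end_exists[OF Z'] by blast
  have wd: "is_wedge Vect Vect (endT X Z) (EO Z) ?w" using end_is_end[OF ew0] unfolding is_end_def by simp
  have eO: "EO Z : Obj" and w: "!!H. H : Obj ==> ?w H : L (EO Z) (hom_sp (Fo X H) (Fo Z H))"
    and wf: "!!\<epsilon>. \<epsilon> : carrier (EO Z) ==> E\<rho> Z \<epsilon> : fam X Z" using wd unfolding wedge_iff[OF X Z] by auto
  have t: "?t H : L (hom_sp (Fo X H) (Fo Z H)) (hom_sp (Fo X H) (Fo Z' H))" if "H : Obj" for H
    by (rule hom_map_L[OF idV_L[OF lf_Ob[OF X that]] \<tau>[OF that]])
  have tw: "endfam X Z' (%H. ?t H oo ?w H) \<epsilon> = mkfam X (%H x. fn (\<tau> H) (E\<rho> Z \<epsilon> (H, x)))"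
    if \<epsilon>: "\<epsilon> : carrier (EO Z)" for \<epsilon>
    unfolding endfam_def[of X Z'] mkfam_def
  proof (rule restrict_ext)
    fix j assume "j : idx X"
    then obtain H x where j: "j = (H, x)" "H : Obj" "x : el X H" by (rule idxE)
    obtain f where f: "f : L (Fo X H) (Fo Z H)" "fn (?w H) \<epsilon> = graph f" using L_app[OF w[OF j(2)] \<epsilon>] by (rule hom_cases)
    note \<tau>f = L_comp[OF \<tau>[OF j(2)] f(1)]
    have "fn (?t H oo ?w H) \<epsilon> = graph (\<tau> H oo f)"
      unfolding comp_app'[OF w[OF j(2)] \<epsilon>] f(2) hom_map_app[OF idV_L[OF lf_Ob[OF X j(2)]] \<tau>[OF j(2)] f(1)]
      using comp_id(2)[OF f(1)] by simp
    then show "fn (ungraph (Fo X (fst j)) (Fo Z' (fst j)) (fn (?t (fst j) oo ?w (fst j)) \<epsilon>)) (snd j) =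
      fn (\<tau> (fst j)) (E\<rho> Z \<epsilon> (fst j, snd j))"
      using comp_app'[OF f(1) j(3)] by (simp add: j(1) endfam_app[OF j(2,3)] f(2) ungraph_graph[OF f(1)] ungraph_graph[OF \<tau>f])
  qed
  have "is_wedge Vect Vect (endT X Z') (EO Z) (%H. ?t H oo ?w H)"
    unfolding wedge_iff[OF X Z']
  proof (intro conjI ballI)
    show "?t H oo ?w H : L (EO Z) (hom_sp (Fo X H) (Fo Z' H))" if "H : Obj" for H
      by (rule L_comp[OF t[OF that] w[OF that]])
    show "endfam X Z' (%H. ?t H oo ?w H) \<epsilon> : fam X Z'" if "\<epsilon> : carrier (EO Z)" for \<epsilon>
      unfolding tw[OF that] by (rule fam_map[OF wf[OF that] \<tau> nat])
  qed (rule eO)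
  from end_map_props[OF ew1 this]
  have m: "m : L (EO Z) (EO Z')" "!!H. H : Obj ==> ?w' H oo m = ?t H oo ?w H" unfolding m_def by blast+
  show "m : L (EO Z) (EO Z')" by (rule m(1))
  assume \<epsilon>: "\<epsilon> : carrier (EO Z)" and H: "H : Obj" and x: "x : el X H"
  have "fn (?w' H) (fn m \<epsilon>) = fn (?t H oo ?w H) \<epsilon>" using m(2)[OF H] comp_app'[OF m(1) \<epsilon>, of "?w' H"] by simp
  then have "E\<rho> Z' (fn m \<epsilon>) (H, x) = endfam X Z' (%H. ?t H oo ?w H) \<epsilon> (H, x)" by (simp add: endfam_app[OF H x])
  then show "E\<rho> Z' (fn m \<epsilon>) (H, x) = fn (\<tau> H) (E\<rho> Z \<epsilon> (H, x))" using tw[OF \<epsilon>] H x by simp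
qed

lemma lim_map_frep:
  assumes Z: "lf Z" and Z': "lf Z'" and \<tau>: "!!H. H : Obj ==> \<tau> H : L (Fo Z H) (Fo Z' H)"
    and nat: "!!f V W z. f : L V W ==> z : el Z V ==> fn (\<tau> W) (ap Z f z) = ap Z' f (fn (\<tau> V) z)"
  defines "m \<equiv> lim_map (op_cat (elements X)) Vect (elD Z) (elD Z') (%(H, x). \<tau> H)"
  shows "m : L (LO Z) (LO Z')"
    and "\<epsilon> : carrier (LO Z) ==> H : Obj ==> x : el X H ==> L\<rho> Z' (fn m \<epsilon>) (H, x) = fn (\<tau> H) (L\<rho> Z \<epsilon> (H, x))"
proof -
  let ?J = "op_cat (elements X)"
  let ?p = "snd (lim ?J Vect (elD Z))" and ?p' = "snd (lim ?J Vect (elD Z'))"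
  let ?t = "%(H, x). \<tau> H"
  obtain e0 w0 where ew0: "is_limit ?J Vect (elD Z) e0 w0" using lim_exists[OF Z] by blast
  obtain e1 w1 where ew1: "is_limit ?J Vect (elD Z') e1 w1" using lim_exists[OF Z'] by blast
  have cn: "is_cone ?J Vect (elD Z) (LO Z) ?p" using lim_is_limit[OF ew0] unfolding is_limit_def by simp
  have lO: "LO Z : Obj" and p: "!!H x. H : Obj ==> x : el X H ==> ?p (H, yoN X H x) : L (LO Z) (Fo Z H)"
    and pf: "!!l. l : carrier (LO Z) ==> L\<rho> Z l : fam X Z" using cn unfolding cone_iff[OF X Z] by auto
  have tp: "limfam X (%j. ?t j oo ?p j) l = mkfam X (%H x. fn (\<tau> H) (L\<rho> Z l (H, x)))"
    if l: "l : carrier (LO Z)" for l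
    unfolding limfam_def[of X "%j. ?t j oo ?p j"] mkfam_def
  proof (rule restrict_ext)
    fix j assume "j : idx X"
    then obtain H x where j: "j = (H, x)" "H : Obj" "x : el X H" by (rule idxE)
    show "fn (?t (fst j, yoN X (fst j) (snd j)) oo ?p (fst j, yoN X (fst j) (snd j))) l = fn (\<tau> (fst j)) (L\<rho> Z l (fst j, snd j))"
      using comp_app'[OF p[OF j(2,3)] l] by (simp add: j(1) limfam_app[OF j(2,3)])
  qed
  have "is_cone ?J Vect (elD Z') (LO Z) (%j. ?t j oo ?p j)"
    unfolding cone_iff[OF X Z']
  proof (intro conjI ballI)
    show "?t (H, yoN X H x) oo ?p (H, yoN X H x) : L (LO Z) (Fo Z' H)" if "H : Obj" "x : el X H" for H x
      using L_comp[OF \<tau>[OF that(1)] p[OF that]] by simp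
    show "limfam X (%j. ?t j oo ?p j) l : fam X Z'" if "l : carrier (LO Z)" for l
      unfolding tp[OF that] by (rule fam_map[OF pf[OF that] \<tau> nat])
  qed (rule lO)
  from lim_map_props[OF ew1 this]
  have m: "m : L (LO Z) (LO Z')" "!!j. j : Ob ?J ==> ?p' j oo m = ?t j oo ?p j" unfolding m_def by blast+
  show "m : L (LO Z) (LO Z')" by (rule m(1))
  assume \<epsilon>: "\<epsilon> : carrier (LO Z)" and H: "H : Obj" and x: "x : el X H"
  let ?j = "(H, yoN X H x)"
  have "?j : Ob ?J" using yoN_NT[OF X H x] H by simp
  then have "fn (?p' ?j) (fn m \<epsilon>) = fn (?t ?j oo ?p ?j) \<epsilon>" using m(2) comp_app'[OF m(1) \<epsilon>, of "?p' ?j"] by metis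
  then have "L\<rho> Z' (fn m \<epsilon>) (H, x) = limfam X (%j. ?t j oo ?p j) \<epsilon> (H, x)" by (simp add: limfam_app[OF H x])
  then show "L\<rho> Z' (fn m \<epsilon>) (H, x) = fn (\<tau> H) (L\<rho> Z \<epsilon> (H, x))" using tp[OF \<epsilon>] H x by simp
qed

subsection \<open>Comparison of the formulas\<close>

text \<open>A form of \<open>represents\<close> for records over any type of elements. It is needed
  for \<open>nat_sp\<close>, whose vectors are natural transformations and not members of the
  universe.\<close>

definition coords :: "('k, 'a) module => ('a => ('k, 'u) module \<times> 'u => 'u) => ('k, 'u) vfun => bool" where
  "coords M \<rho> Z \<longleftrightarrow> bij_betw \<rho> (carrier M) (fam X Z) &
     (ALL j:idx X. is_linear K M (Fo Z (fst j)) (%m. \<rho> m j)) &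
     (ALL a:carrier M. ALL b:carrier M. add M a b : carrier M) & (ALL c:carrier K. ALL a:carrier M. smult M c a : carrier M)"

text \<open>All five formulas are brought to this form, with \<open>twist_map\<close> as the common
  description of their functoriality in \<open>(Y, V)\<close>.\<close>

definition presents :: "(('k, 'u) vfun \<times> ('k, 'u) module, ('k, 'u) vnat \<times> ('k, 'u) lin, 'k, 'a) vs_assign =>
    (('k, 'u) vfun => ('k, 'u) module => 'a => ('k, 'u) module \<times> 'u => 'u) => bool" where
  "presents A \<rho> \<longleftrightarrow> (ALL Y:Ob Ind. ALL V:Obj. coords (sp A (Y, V)) (\<rho> Y V) (sh Y V)) &
    (ALL Y:Ob Ind. ALL Y':Ob Ind. ALL \<eta>:NT Y Y'. ALL V V' v. v : L V V' --> (ALL a:carrier (sp A (Y, V)).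
       act A (\<eta>, v) a : carrier (sp A (Y', V')) &
       (ALL H:Obj. ALL x:el X H. \<rho> Y' V' (act A (\<eta>, v) a) (H, x) = fn (twist_map \<eta> v H) (\<rho> Y V a (H, x)))))"

lemma frep_coords: assumes "frep M \<rho> X Z" shows "coords M \<rho> Z"
proof -
  have M: "M : Obj" by (rule representsD(1)[OF assms])
  then show ?thesis using assms unfolding coords_def represents_def by simp
qed

text \<open>The inverse of a natural bijection is natural, so the families with values in
  \<open>Z\<close> and in \<open>Z'\<close> correspond; linearity of the components comes from
  \<open>auto_linear\<close>.\<close>

lemma coords_transport:
  assumes c: "coords M \<sigma> Z" and Z: "lf Z" and Z': "lf Z'"
    and g: "!!f V W z. f : L V W ==> z : el Z V ==> g W (ap Z f z) = ap Z' f (g V z)"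
    and bij: "!!H. H : Obj ==> bij_betw (g H) (el Z H) (el Z' H)"
  shows "coords M (%a. mkfam X (%H x. g H (\<sigma> a (H, x)))) Z'"
proof -
  have gc: "g H z : el Z' H" if "H : Obj" "z : el Z H" for H z
    using bij[OF that(1)] that(2) by (auto simp: bij_betw_def)
  have ginj: "z = z'" if "H : Obj" "z : el Z H" "z' : el Z H" "g H z = g H z'" for H z z'
    using bij[OF that(1)] that(2-4) by (auto simp: bij_betw_def inj_on_def)
  have gl: "is_linear K (Fo Z H) (Fo Z' H) (g H)" if "H : Obj" for H
    by (rule auto_linear[OF Z Z' gc g that])
  have \<sigma>: "\<sigma> a : fam X Z" if "a : carrier M" for a using c that by (auto simp: coords_def bij_betw_def)
  have f: "mkfam X (%H x. g H (z (H, x))) : fam X Z'" if z: "z : fam X Z" for z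
    by (rule mkfam_fam[OF X gc[OF _ fam_closed[OF z]]]) (simp_all add: fam_nat[OF z] g[OF _ fam_closed[OF z]] L_Ob)
  let ?\<rho> = "%a. mkfam X (%H x. g H (\<sigma> a (H, x)))"
  have "bij_betw ?\<rho> (carrier M) (fam X Z')"
  proof (rule bij_betwI')
    show "?\<rho> a = ?\<rho> b \<longleftrightarrow> a = b" if a: "a : carrier M" and b: "b : carrier M" for a b
    proof
      assume e: "?\<rho> a = ?\<rho> b"
      have "\<sigma> a = \<sigma> b"
      proof (rule fam_eqI[OF \<sigma>[OF a] \<sigma>[OF b]])
        fix H x assume H: "H : Obj" "x : el X H"
        show "\<sigma> a (H, x) = \<sigma> b (H, x)"
          by (rule ginj[OF H(1) fam_closed[OF \<sigma>[OF a] H] fam_closed[OF \<sigma>[OF b] H]])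
             (use fun_cong[OF e, of "(H, x)"] H in simp)
      qed
      then show "a = b" using c a b by (auto simp: coords_def bij_betw_def inj_on_def)
    qed simp
    show "?\<rho> a : fam X Z'" if "a : carrier M" for a by (rule f[OF \<sigma>[OF that]])
    show "EX a:carrier M. z = ?\<rho> a" if z: "z : fam X Z'" for z
    proof -
      let ?h = "%H. inv_into (el Z H) (g H)"
      have gh: "g H (?h H y) = y" "?h H y : el Z H" if "H : Obj" "y : el Z' H" for H y
        using bij[OF that(1)] that(2) by (auto simp: bij_betw_def f_inv_into_f inv_into_into)
      have "mkfam X (%H x. ?h H (z (H, x))) : fam X Z"
      proof (rule mkfam_fam[OF X])
        show "?h H (z (H, x)) : el Z H" if "H : Obj" "x : el X H" for H x
          by (rule gh(2)[OF that(1) fam_closed[OF z that]])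
        fix f V W x assume fx: "f : L V W" "x : el X V"
        note O = L_Ob[OF fx(1)]
        note zc = fam_closed[OF z O(1) fx(2)]
          and zc' = fam_closed[OF z O(2) ap_closed[OF X fx], unfolded fam_nat[OF z fx]]
        show "?h W (z (W, ap X f x)) = ap Z f (?h V (z (V, x)))"
          unfolding fam_nat[OF z fx]
          by (rule ginj[OF O(2) gh(2)[OF O(2) zc'] ap_closed[OF Z fx(1) gh(2)[OF O(1) zc]]])
             (simp add: gh(1)[OF O(2) zc'] g[OF fx(1) gh(2)[OF O(1) zc]] gh(1)[OF O(1) zc])
      qed
      moreover have "fam X Z = \<sigma> ` carrier M" using c by (simp add: coords_def bij_betw_def)
      ultimately have "mkfam X (%H x. ?h H (z (H, x))) : \<sigma> ` carrier M" by simp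
      then obtain a where a': "mkfam X (%H x. ?h H (z (H, x))) = \<sigma> a" "a : carrier M" by (rule imageE)
      note a = a'(2) a'(1)[symmetric]
      have "z = ?\<rho> a"
        by (rule fam_eqI[OF z f[OF \<sigma>[OF a(1)]]]) (simp add: a(2) gh(1) fam_closed[OF z])
      then show ?thesis using a(1) by blast
    qed
  qed
  moreover have "is_linear K M (Fo Z' (fst j)) (%m. ?\<rho> m j)" if jX: "j : idx X" for j
  proof -
    obtain H x where j: "j = (H, x)" "H : Obj" "x : el X H" using jX by (rule idxE)
    have l: "is_linear K M (Fo Z H) (%m. \<sigma> m (H, x))" using c jX unfolding coords_def j(1) by auto
    show ?thesis unfolding j(1) fst_conv mkfam_app[OF j(2,3)]
      by (rule is_linearI) (simp_all add: is_linearD[OF l] is_linearD[OF gl[OF j(2)]])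
  qed
  ultimately show ?thesis using c unfolding coords_def by simp
qed

text \<open>The isomorphism has equal coordinates on both sides. Its linearity and naturality hold
  after taking coordinates, and these separate points.\<close>

lemma presents_iso:
  assumes A: "presents A \<rho>" and B: "presents B \<sigma>"
  shows "nat_lin_iso K (prod_cat Ind Vect) A B"
proof -
  have cA: "coords (sp A (Y, V)) (\<rho> Y V) (sh Y V)" and cB: "coords (sp B (Y, V)) (\<sigma> Y V) (sh Y V)"
    if "Y : Ob Ind" "V : Obj" for Y V using A B that unfolding presents_def by blast+
  define \<phi> where "\<phi> p a = inv_into (carrier (sp B p)) (\<sigma> (fst p) (snd p)) (\<rho> (fst p) (snd p) a)" for p a
  have \<phi>: "\<phi> (Y, V) a : carrier (sp B (Y, V)) & \<sigma> Y V (\<phi> (Y, V) a) = \<rho> Y V a"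
    if "Y : Ob Ind" "V : Obj" "a : carrier (sp A (Y, V))" for Y V a
  proof -
    have "\<rho> Y V a : \<sigma> Y V ` carrier (sp B (Y, V))"
      using cA[OF that(1,2)] cB[OF that(1,2)] that(3) unfolding coords_def bij_betw_def by auto
    then show ?thesis unfolding \<phi>_def by (simp add: f_inv_into_f inv_into_into)
  qed
  have \<sigma>inj: "b = b'" if "Y : Ob Ind" "V : Obj" "b : carrier (sp B (Y, V))" "b' : carrier (sp B (Y, V))"
    "!!H x. H : Obj ==> x : el X H ==> \<sigma> Y V b (H, x) = \<sigma> Y V b' (H, x)" for Y V b b'
  proof -
    have "\<sigma> Y V b : fam X (sh Y V)" "\<sigma> Y V b' : fam X (sh Y V)"
      using cB[OF that(1,2)] that(3,4) unfolding coords_def bij_betw_def by auto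
    then have "\<sigma> Y V b = \<sigma> Y V b'" using that(5) by (rule fam_eqI)
    then show ?thesis using cB[OF that(1,2)] that(3,4) unfolding coords_def bij_betw_def inj_on_def by blast
  qed
  show ?thesis unfolding nat_lin_iso_def
  proof (rule exI[of _ \<phi>], intro conjI ballI)
    fix p assume "p : Ob (prod_cat Ind Vect)"
    then obtain Y V where p: "p = (Y, V)" and Y: "Y : Ob Ind" and V: "V : Obj"
      by (cases p) (auto simp: prod_cat_def simp del: Ind_simps(3))
    let ?A = "sp A (Y, V)" and ?B = "sp B (Y, V)"
    have lA: "is_linear K ?A (Fo (sh Y V) H) (%m. \<rho> Y V m (H, x))" and lB: "is_linear K ?B (Fo (sh Y V) H) (%m. \<sigma> Y V m (H, x))"
      if "H : Obj" "x : el X H" for H x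
      using cA[OF Y V] cB[OF Y V] idxI[OF that] unfolding coords_def by fastforce+
    have clA: "a : carrier ?A ==> b : carrier ?A ==> add ?A a b : carrier ?A"
      "c : carrier K ==> a : carrier ?A ==> smult ?A c a : carrier ?A" for a b c
      using cA[OF Y V] unfolding coords_def by blast+
    have clB: "a : carrier ?B ==> b : carrier ?B ==> add ?B a b : carrier ?B"
      "c : carrier K ==> a : carrier ?B ==> smult ?B c a : carrier ?B" for a b c
      using cB[OF Y V] unfolding coords_def by blast+
    note \<phi>c = \<phi>[OF Y V, THEN conjunct1] and \<phi>r = \<phi>[OF Y V, THEN conjunct2]
    show "is_linear K (sp A p) (sp B p) (\<phi> p)"
      unfolding p
    proof (rule is_linearI)
      show "\<phi> (Y, V) a : carrier ?B" if "a : carrier ?A" for a by (rule \<phi>c[OF that])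
      show "\<phi> (Y, V) (add ?A a b) = add ?B (\<phi> (Y, V) a) (\<phi> (Y, V) b)" if ab: "a : carrier ?A" "b : carrier ?A" for a b
        by (rule \<sigma>inj[OF Y V \<phi>c[OF clA(1)[OF ab]] clB(1)[OF \<phi>c[OF ab(1)] \<phi>c[OF ab(2)]]])
           (simp add: \<phi>r[OF clA(1)[OF ab]] \<phi>r[OF ab(1)] \<phi>r[OF ab(2)] is_linearD(2)[OF lA] is_linearD(2)[OF lB] ab \<phi>c)
      show "\<phi> (Y, V) (smult ?A c a) = smult ?B c (\<phi> (Y, V) a)" if c: "c : carrier K" and a: "a : carrier ?A" for c a
        by (rule \<sigma>inj[OF Y V \<phi>c[OF clA(2)[OF c a]] clB(2)[OF c \<phi>c[OF a]]])
           (simp add: \<phi>r[OF clA(2)[OF c a]] \<phi>r[OF a] is_linearD(3)[OF lA] is_linearD(3)[OF lB] a c \<phi>c)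
    qed
    show "bij_betw (\<phi> p) (carrier (sp A p)) (carrier (sp B p))"
      unfolding p
    proof (rule bij_betwI')
      show "\<phi> (Y, V) a = \<phi> (Y, V) b \<longleftrightarrow> a = b" if a: "a : carrier ?A" and b: "b : carrier ?A" for a b
        using \<phi>r[OF a] \<phi>r[OF b] cA[OF Y V] a b unfolding coords_def bij_betw_def inj_on_def by metis
      show "\<phi> (Y, V) a : carrier ?B" if "a : carrier ?A" for a by (rule \<phi>c[OF that])
      show "EX a:carrier ?A. b = \<phi> (Y, V) a" if b: "b : carrier ?B" for b
      proof -
        have "\<sigma> Y V b : \<rho> Y V ` carrier ?A" using cA[OF Y V] cB[OF Y V] b unfolding coords_def bij_betw_def by auto
        then obtain a where a: "a : carrier ?A" "\<rho> Y V a = \<sigma> Y V b" by auto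
        have "b = \<phi> (Y, V) a" by (rule \<sigma>inj[OF Y V b \<phi>c[OF a(1)]]) (simp add: \<phi>r[OF a(1)] a(2))
        then show ?thesis using a(1) by blast
      qed
    qed
  next
    fix u a assume "u : Ar (prod_cat Ind Vect)" and a: "a : carrier (sp A (Dom (prod_cat Ind Vect) u))"
    then obtain \<eta> v where u: "u = (\<eta>, v)" "\<eta> : Ar Ind" "v : Ar Vect" by (cases u) (auto simp: prod_cat_def)
    have \<eta>: "\<eta> : NT (src \<eta>) (tgt \<eta>)" and Y: "src \<eta> : Ob Ind" "tgt \<eta> : Ob Ind" using u(2) unfolding Ar_Ind by blast+
    have v: "v : L (src v) (tgt v)" using u(3) unfolding Ar_L .
    note O = L_Ob[OF v]
    have D: "Dom (prod_cat Ind Vect) u = (src \<eta>, src v)" "Cod (prod_cat Ind Vect) u = (tgt \<eta>, tgt v)"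
      by (simp_all add: prod_cat_def u(1))
    have a: "a : carrier (sp A (src \<eta>, src v))" using a unfolding D .
    note \<phi>a = \<phi>[OF Y(1) O(1) a]
    have aA: "act A (\<eta>, v) a : carrier (sp A (tgt \<eta>, tgt v))"
      "!!H x. H : Obj ==> x : el X H ==>
        \<rho> (tgt \<eta>) (tgt v) (act A (\<eta>, v) a) (H, x) = fn (twist_map \<eta> v H) (\<rho> (src \<eta>) (src v) a (H, x))"
      using A Y \<eta> v a unfolding presents_def by blast+
    have aB: "act B (\<eta>, v) (\<phi> (src \<eta>, src v) a) : carrier (sp B (tgt \<eta>, tgt v))"
      "!!H x. H : Obj ==> x : el X H ==>
        \<sigma> (tgt \<eta>) (tgt v) (act B (\<eta>, v) (\<phi> (src \<eta>, src v) a)) (H, x) = fn (twist_map \<eta> v H) (\<sigma> (src \<eta>) (src v) (\<phi> (src \<eta>, src v) a) (H, x))"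
      using B Y \<eta> v \<phi>a unfolding presents_def by blast+
    note \<phi>aA = \<phi>[OF Y(2) O(2) aA(1)]
    have "\<phi> (tgt \<eta>, tgt v) (act A (\<eta>, v) a) = act B (\<eta>, v) (\<phi> (src \<eta>, src v) a)"
      by (rule \<sigma>inj[OF Y(2) O(2) conjunct1[OF \<phi>aA] aB(1)])
         (simp add: conjunct2[OF \<phi>aA] aA(2) aB(2) conjunct2[OF \<phi>a])
    then show "\<phi> (Cod (prod_cat Ind Vect) u) (act A u a) = act B u (\<phi> (Dom (prod_cat Ind Vect) u) a)"
      unfolding D unfolding u(1) .
  qed
qed

lemma Ind_lf: "Y : Ob Ind ==> lf Y" by simp

lemma nearid_transport:
  assumes n: "nearid \<Phi> \<theta>" and Y: "lf Y" and V: "V : Obj" and c: "coords M \<sigma> (sh (Fo \<Phi> Y) V)"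
  shows "coords M (%a. mkfam X (%H x. nt (\<theta> Y) (tens H V) (\<sigma> a (H, x)))) (sh Y V)"
proof -
  have \<theta>: "\<theta> Y : NT (Fo \<Phi> Y) Y" and bij: "!!W. W : Obj ==> bij_betw (nt (\<theta> Y) W) (el (Fo \<Phi> Y) W) (el Y W)"
    using n Y unfolding nearid_def by blast+
  note \<Phi>Y = NT_lf(1)[OF \<theta>]
  show ?thesis
  proof (rule coords_transport[OF c lf_sh[OF \<Phi>Y V] lf_sh[OF Y V]])
    show "nt (\<theta> Y) (tens W V) (ap (sh (Fo \<Phi> Y) V) f z) = ap (sh Y V) f (nt (\<theta> Y) (tens U V) z)"
      if "f : L U W" "z : el (sh (Fo \<Phi> Y) V) U" for f U W z
      using nt_nat[OF \<theta> tens_map_L[OF that(1) idV_L[OF V]]] that(2) by simp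
    show "bij_betw (nt (\<theta> Y) (tens H V)) (el (sh (Fo \<Phi> Y) V) H) (el (sh Y V) H)" if "H : Obj" for H
      using bij[OF tens_Obj[OF that V]] by simp
  qed
qed

lemma nearid_twist:
  assumes n: "nearid \<Phi> \<theta>" and \<eta>: "\<eta> : NT Y Y'" and v: "v : L V V'" and H: "H : Obj"
    and z: "z : el (Fo \<Phi> Y) (tens H V)"
  shows "nt (\<theta> Y') (tens H V') (fn (twist_map (Fa \<Phi> \<eta>) v H) z) = fn (twist_map \<eta> v H) (nt (\<theta> Y) (tens H V) z)"
proof -
  note Y = NT_lf[OF \<eta>]
  have \<theta>: "\<theta> Y : NT (Fo \<Phi> Y) Y" using n Y unfolding nearid_def by blast
  have \<Phi>\<eta>: "Fa \<Phi> \<eta> : NT (Fo \<Phi> Y) (Fo \<Phi> Y')"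
    and nat: "!!W z. W : Obj ==> z : el (Fo \<Phi> Y) W ==> nt (\<theta> Y') W (nt (Fa \<Phi> \<eta>) W z) = nt \<eta> W (nt (\<theta> Y) W z)"
    using n \<eta> unfolding nearid_def by blast+
  note t = tens_map_L[OF idV_L[OF H] v] and TV = tens_Obj[OF H L_Ob(1)[OF v]] and TV' = tens_Obj[OF H L_Ob(2)[OF v]]
  show ?thesis
    unfolding twist_L(2)[OF \<Phi>\<eta> v H z] twist_L(2)[OF \<eta> v H nt_closed[OF \<theta> TV z]]
      nat[OF TV' ap_closed[OF NT_lf(1)[OF \<Phi>\<eta>] t z]] nt_nat[OF \<theta> t z] ..
qed

lemma end_integrand_endT: "end_integrand X Z V = endT X (sh Z V)"
  by (simp add: end_integrand_def endT_def)

lemma lim_diagram_elD: "lim_diagram Z V = elD (sh Z V)"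
  by (simp add: lim_diagram_def elD_def fcomp_def sh_def tens_right_def comp_def)

text \<open>The coordinates of the end for \<open>\<Phi>(Y)\<close> are composed with
  \<open>\<theta> Y\<close> at \<open>H \<otimes> V\<close>. This removes \<open>\<Phi>\<close> from
  the target, so that every choice of \<open>\<Phi>\<close> has coordinates in the same
  families.\<close>

lemma end_form_presents:
  assumes n: "nearid \<Phi> \<theta>"
  shows "EX \<rho>. presents (end_form X \<Phi>) \<rho>"
proof (rule exI, unfold presents_def, intro conjI ballI allI impI)
  let ?\<rho> = "%Y V a. mkfam X (%H x. nt (\<theta> Y) (tens H V) (E\<rho> (sh (Fo \<Phi> Y) V) a (H, x)))"
  have \<theta>: "\<theta> Y : NT (Fo \<Phi> Y) Y" if "lf Y" for Y using n that unfolding nearid_def by blast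
  note \<Phi>Y = NT_lf(1)[OF \<theta>]
  show "coords (sp (end_form X \<Phi>) (Y, V)) (?\<rho> Y V) (sh Y V)" if Y: "Y : Ob Ind" and V: "V : Obj" for Y V
    using nearid_transport[OF n Ind_lf[OF Y] V frep_coords[OF end_frep[OF lf_sh[OF \<Phi>Y[OF Ind_lf[OF Y]] V]]]]
    by (simp add: end_form_def end_integrand_endT)
  fix Y Y' \<eta> V V' v a
  assume \<eta>: "\<eta> : NT Y Y'" and v: "v : L V V'" and a: "a : carrier (sp (end_form X \<Phi>) (Y, V))"
  note Y = NT_lf[OF \<eta>] and O = L_Ob[OF v]
  have \<Phi>\<eta>: "Fa \<Phi> \<eta> : NT (Fo \<Phi> Y) (Fo \<Phi> Y')" using n \<eta> unfolding nearid_def by blast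
  have a: "a : carrier (EO (sh (Fo \<Phi> Y) V))" using a by (simp add: end_form_def end_integrand_endT)
  note Z = lf_sh[OF \<Phi>Y[OF Y(1)] O(1)] and Z' = lf_sh[OF \<Phi>Y[OF Y(2)] O(2)]
  have tL: "twist_map (Fa \<Phi> \<eta>) v H : L (Fo (sh (Fo \<Phi> Y) V) H) (Fo (sh (Fo \<Phi> Y') V') H)" if "H : Obj" for H
    using twist_L(1)[OF \<Phi>\<eta> v that] by simp
  let ?m = "end_map Vect Vect (endT X (sh (Fo \<Phi> Y) V)) (endT X (sh (Fo \<Phi> Y') V')) (%H. hom_map (idV (Fo X H)) (twist_map (Fa \<Phi> \<eta>) v H))"
  have m1: "?m : L (EO (sh (Fo \<Phi> Y) V)) (EO (sh (Fo \<Phi> Y') V'))"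
    by (rule end_map_frep(1)[OF Z Z']) (erule tL, erule (1) twist_nat[OF \<Phi>\<eta> v])
  have m2: "E\<rho> (sh (Fo \<Phi> Y') V') (fn ?m a) (H, x) = fn (twist_map (Fa \<Phi> \<eta>) v H) (E\<rho> (sh (Fo \<Phi> Y) V) a (H, x))"
    if "H : Obj" "x : el X H" for H x
    by (rule end_map_frep(2)[OF Z Z' _ _ a that]) (erule tL, erule (1) twist_nat[OF \<Phi>\<eta> v])
  have act: "act (end_form X \<Phi>) (\<eta>, v) a = fn ?m a"
    by (simp add: end_form_def end_integrand_endT NT_src[OF \<eta>] L_src[OF v])
  show "act (end_form X \<Phi>) (\<eta>, v) a : carrier (sp (end_form X \<Phi>) (Y', V'))"
    unfolding act using L_app[OF m1 a] by (simp add: end_form_def end_integrand_endT)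
  fix H x assume H: "H : Obj" and x: "x : el X H"
  have Ec: "E\<rho> (sh (Fo \<Phi> Y) V) a (H, x) : el (Fo \<Phi> Y) (tens H V)"
    using representsD(5)[OF end_frep[OF Z] a idxI[OF H x]] by simp
  show "?\<rho> Y' V' (act (end_form X \<Phi>) (\<eta>, v) a) (H, x) = fn (twist_map \<eta> v H) (?\<rho> Y V a (H, x))"
    unfolding act mkfam_app[OF H x] m2[OF H x] by (rule nearid_twist[OF n \<eta> v H Ec])
qed

lemma lim_form_presents:
  assumes n: "nearid \<Phi> \<theta>"
  shows "EX \<rho>. presents (lim_form X \<Phi>) \<rho>"
proof (rule exI, unfold presents_def, intro conjI ballI allI impI)
  let ?\<rho> = "%Y V a. mkfam X (%H x. nt (\<theta> Y) (tens H V) (L\<rho> (sh (Fo \<Phi> Y) V) a (H, x)))"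
  have \<theta>: "\<theta> Y : NT (Fo \<Phi> Y) Y" if "lf Y" for Y using n that unfolding nearid_def by blast
  note \<Phi>Y = NT_lf(1)[OF \<theta>]
  show "coords (sp (lim_form X \<Phi>) (Y, V)) (?\<rho> Y V) (sh Y V)" if Y: "Y : Ob Ind" and V: "V : Obj" for Y V
    using nearid_transport[OF n Ind_lf[OF Y] V frep_coords[OF lim_frep[OF lf_sh[OF \<Phi>Y[OF Ind_lf[OF Y]] V]]]]
    by (simp add: lim_form_def lim_diagram_elD)
  fix Y Y' \<eta> V V' v a
  assume \<eta>: "\<eta> : NT Y Y'" and v: "v : L V V'" and a: "a : carrier (sp (lim_form X \<Phi>) (Y, V))"
  note Y = NT_lf[OF \<eta>] and O = L_Ob[OF v]
  have \<Phi>\<eta>: "Fa \<Phi> \<eta> : NT (Fo \<Phi> Y) (Fo \<Phi> Y')" using n \<eta> unfolding nearid_def by blast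
  have a: "a : carrier (LO (sh (Fo \<Phi> Y) V))" using a by (simp add: lim_form_def lim_diagram_elD)
  note Z = lf_sh[OF \<Phi>Y[OF Y(1)] O(1)] and Z' = lf_sh[OF \<Phi>Y[OF Y(2)] O(2)]
  have tL: "twist_map (Fa \<Phi> \<eta>) v H : L (Fo (sh (Fo \<Phi> Y) V) H) (Fo (sh (Fo \<Phi> Y') V') H)" if "H : Obj" for H
    using twist_L(1)[OF \<Phi>\<eta> v that] by simp
  let ?m = "lim_map (op_cat (elements X)) Vect (elD (sh (Fo \<Phi> Y) V)) (elD (sh (Fo \<Phi> Y') V')) (%(H, x). twist_map (Fa \<Phi> \<eta>) v H)"
  have m1: "?m : L (LO (sh (Fo \<Phi> Y) V)) (LO (sh (Fo \<Phi> Y') V'))"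
    by (rule lim_map_frep(1)[OF Z Z']) (erule tL, erule (1) twist_nat[OF \<Phi>\<eta> v])
  have m2: "L\<rho> (sh (Fo \<Phi> Y') V') (fn ?m a) (H, x) = fn (twist_map (Fa \<Phi> \<eta>) v H) (L\<rho> (sh (Fo \<Phi> Y) V) a (H, x))"
    if "H : Obj" "x : el X H" for H x
    by (rule lim_map_frep(2)[OF Z Z' _ _ a that]) (erule tL, erule (1) twist_nat[OF \<Phi>\<eta> v])
  have act: "act (lim_form X \<Phi>) (\<eta>, v) a = fn ?m a"
    by (simp add: lim_form_def lim_diagram_elD NT_src[OF \<eta>] L_src[OF v])
  show "act (lim_form X \<Phi>) (\<eta>, v) a : carrier (sp (lim_form X \<Phi>) (Y', V'))"
    unfolding act using L_app[OF m1 a] by (simp add: lim_form_def lim_diagram_elD)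
  fix H x assume H: "H : Obj" and x: "x : el X H"
  have Ec: "L\<rho> (sh (Fo \<Phi> Y) V) a (H, x) : el (Fo \<Phi> Y) (tens H V)"
    using representsD(5)[OF lim_frep[OF Z] a idxI[OF H x]] by simp
  show "?\<rho> Y' V' (act (lim_form X \<Phi>) (\<eta>, v) a) (H, x) = fn (twist_map \<eta> v H) (?\<rho> Y V a (H, x))"
    unfolding act mkfam_app[OF H x] m2[OF H x] by (rule nearid_twist[OF n \<eta> v H Ec])
qed


subsection \<open>The right adjoint\<close>

text \<open>The end itself is taken as the value of the internal hom, so that formula holds by
  construction and the others are compared with it.\<close>

definition Rob :: "('k, 'u) vfun => ('k, 'u) module => ('k, 'u) module" where
  "Rob Y V = EO (sh Y V)"

definition Rar :: "('k, 'u) vnat => ('k, 'u) lin => ('k, 'u) lin" where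
  "Rar \<eta> v = end_map Vect Vect (endT X (sh (src \<eta>) (src v))) (endT X (sh (tgt \<eta>) (tgt v)))
     (%H. hom_map (idV (Fo X H)) (twist_map \<eta> v H))"

definition HomX :: "(('k, 'u) vfun, ('k, 'u) vnat, ('k, 'u) vfun, ('k, 'u) vnat) cfunctor" where
  "HomX = curried Rob Rar"

abbreviation "rr Y V \<equiv> E\<rho> (sh Y V)"

lemma Rob_frep: "lf Y ==> V : Obj ==> frep (Rob Y V) (rr Y V) X (sh Y V)"
  unfolding Rob_def by (rule end_frep[OF lf_sh])

lemma Rob_Obj: "lf Y ==> V : Obj ==> Rob Y V : Obj"
  by (rule representsD(1)[OF Rob_frep])

lemma rr_fam: "lf Y ==> V : Obj ==> n : carrier (Rob Y V) ==> rr Y V n : fam X (sh Y V)"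
  by (rule representsD(2)[OF Rob_frep])

lemma rr_closed: "lf Y ==> V : Obj ==> n : carrier (Rob Y V) ==> H : Obj ==> x : el X H ==>
    rr Y V n (H, x) : el Y (tens H V)"
  using fam_closed[OF rr_fam] by simp

lemma rr_eqI:
  assumes "lf Y" "V : Obj" "n : carrier (Rob Y V)" "m : carrier (Rob Y V)"
    "!!H x. H : Obj ==> x : el X H ==> rr Y V n (H, x) = rr Y V m (H, x)"
  shows "n = m"
  by (rule represents_eqI[OF Rob_frep[OF assms(1,2)] assms(3,4)]) (use assms(5) in \<open>auto elim!: idxE\<close>)

lemma rr_linear: "lf Y ==> V : Obj ==> H : Obj ==> x : el X H ==>
    is_linear K (Rob Y V) (Fo Y (tens H V)) (%n. rr Y V n (H, x))"
  using representsD(3)[OF Rob_frep idxI] by simp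

lemma Rar_L:
  assumes \<eta>: "\<eta> : NT Y Y'" and v: "v : L V V'"
  shows "Rar \<eta> v : L (Rob Y V) (Rob Y' V')"
    and "n : carrier (Rob Y V) ==> H : Obj ==> x : el X H ==>
      rr Y' V' (fn (Rar \<eta> v) n) (H, x) = fn (twist_map \<eta> v H) (rr Y V n (H, x))"
proof -
  note Y = NT_lf[OF \<eta>] and O = L_Ob[OF v]
  have t: "twist_map \<eta> v H : L (Fo (sh Y V) H) (Fo (sh Y' V') H)" if "H : Obj" for H
    using twist_L(1)[OF \<eta> v that] by simp
  show "Rar \<eta> v : L (Rob Y V) (Rob Y' V')"
    unfolding Rar_def Rob_def NT_src[OF \<eta>] L_src[OF v]
    by (rule end_map_frep(1)[OF lf_sh[OF Y(1) O(1)] lf_sh[OF Y(2) O(2)]]) (erule t, erule (1) twist_nat[OF \<eta> v])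
  assume n: "n : carrier (Rob Y V)" and H: "H : Obj" "x : el X H"
  show "rr Y' V' (fn (Rar \<eta> v) n) (H, x) = fn (twist_map \<eta> v H) (rr Y V n (H, x))"
    unfolding Rar_def NT_src[OF \<eta>] L_src[OF v]
    by (rule end_map_frep(2)[OF lf_sh[OF Y(1) O(1)] lf_sh[OF Y(2) O(2)] _ _ n[unfolded Rob_def] H])
       (erule t, erule (1) twist_nat[OF \<eta> v])
qed

lemma rr_Rar_id:
  assumes Y: "lf Y" and v: "v : L V V'" and n: "n : carrier (Rob Y V)" and H: "H : Obj" "x : el X H"
  shows "rr Y V' (fn (Rar (Idn FunVect Y) v) n) (H, x) = ap Y (tens_map (idV H) v) (rr Y V n (H, x))"
  unfolding Rar_L(2)[OF NT_id(1)[OF Y] v n H]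
  by (rule twist_id[OF Y v H(1) rr_closed[OF Y L_Ob(1)[OF v] n H]])

sublocale R: two_var elts K lf Rob Rar
proof (unfold_locales)
  show "Rob Y W : Obj" if "lf Y" "W : Obj" for Y W by (rule Rob_Obj[OF that])
  show "Rar \<eta> w : L (Rob Y W) (Rob Y' W')" if "\<eta> : NT Y Y'" "w : L W W'" for \<eta> Y Y' w W W' by (rule Rar_L(1)[OF that])
next
  fix Y W z assume Y: "lf Y" and W: "W : Obj" and z: "z : carrier (Rob Y W)"
  note i = NT_id(1)[OF Y] and iW = idV_L[OF W]
  show "fn (Rar (Idn FunVect Y) (idV W)) z = z"
  proof (rule rr_eqI[OF Y W L_app[OF Rar_L(1)[OF i iW] z] z])
    fix H x assume H: "H : Obj" "x : el X H"
    show "rr Y W (fn (Rar (Idn FunVect Y) (idV W)) z) (H, x) = rr Y W z (H, x)"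
      unfolding rr_Rar_id[OF Y iW z H] tens_map_id[OF H(1) W]
      by (rule ap_id[OF Y tens_Obj[OF H(1) W] rr_closed[OF Y W z H]])
  qed
next
  fix Y Y' Y'' \<eta> \<eta>' W W' W'' w w' z
  assume \<eta>: "\<eta> : NT Y Y'" "\<eta>' : NT Y' Y''" and w: "w : L W W'" "w' : L W' W''" and z: "z : carrier (Rob Y W)"
  note Y = NT_lf(1)[OF \<eta>(1)] NT_lf(2)[OF \<eta>(1)] NT_lf(2)[OF \<eta>(2)]
  note c = NT_comp(1)[OF \<eta>(2,1)] and wc = L_comp[OF w(2,1)]
  note a = L_app[OF Rar_L(1)[OF \<eta>(1) w(1)] z]
  show "fn (Rar (Cmp FunVect \<eta>' \<eta>) (w' oo w)) z = fn (Rar \<eta>' w') (fn (Rar \<eta> w) z)"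
  proof (rule rr_eqI[OF Y(3) L_Ob(2)[OF w(2)] L_app[OF Rar_L(1)[OF c wc] z] L_app[OF Rar_L(1)[OF \<eta>(2) w(2)] a]])
    fix H x assume H: "H : Obj" "x : el X H"
    show "rr Y'' W'' (fn (Rar (Cmp FunVect \<eta>' \<eta>) (w' oo w)) z) (H, x) = rr Y'' W'' (fn (Rar \<eta>' w') (fn (Rar \<eta> w) z)) (H, x)"
      unfolding Rar_L(2)[OF c wc z H] Rar_L(2)[OF \<eta>(2) w(2) a H] Rar_L(2)[OF \<eta>(1) w(1) z H]
      by (rule twist_comp[OF \<eta> w H(1) rr_closed[OF Y(1) L_Ob(1)[OF w(1)] z H]])
  qed
next
  fix Y W W' w w' z assume Y: "lf Y" and w: "w : L W W'" "w' : L W W'" and z: "z : carrier (Rob Y W)"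
  note i = NT_id(1)[OF Y] and O = L_Ob[OF w(1)]
  note a = L_app[OF Rar_L(1)[OF i w(1)] z] L_app[OF Rar_L(1)[OF i w(2)] z]
  show "fn (Rar (Idn FunVect Y) (lin_add w w')) z =
      add (Rob Y W') (fn (Rar (Idn FunVect Y) w) z) (fn (Rar (Idn FunVect Y) w') z)"
  proof (rule rr_eqI[OF Y O(2) L_app[OF Rar_L(1)[OF i lin_add_L[OF w]] z] V_add[OF Rob_Obj[OF Y O(2)] a]])
    fix H x assume H: "H : Obj" "x : el X H"
    note iH = idV_L[OF H(1)]
    show "rr Y W' (fn (Rar (Idn FunVect Y) (lin_add w w')) z) (H, x) =
      rr Y W' (add (Rob Y W') (fn (Rar (Idn FunVect Y) w) z) (fn (Rar (Idn FunVect Y) w') z)) (H, x)"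
      unfolding is_linearD(2)[OF rr_linear[OF Y O(2) H] a] rr_Rar_id[OF Y w(1) z H] rr_Rar_id[OF Y w(2) z H]
        rr_Rar_id[OF Y lin_add_L[OF w] z H] tens_map_add2[OF iH w]
      by (rule ap_lin_add[OF Y tens_map_L[OF iH w(1)] tens_map_L[OF iH w(2)] rr_closed[OF Y O(1) z H]])
  qed
next
  fix Y W W' w c z assume Y: "lf Y" and w: "w : L W W'" and c: "c : carrier K" and z: "z : carrier (Rob Y W)"
  note i = NT_id(1)[OF Y] and O = L_Ob[OF w]
  note a = L_app[OF Rar_L(1)[OF i w] z]
  show "fn (Rar (Idn FunVect Y) (lin_smult c w)) z = smult (Rob Y W') c (fn (Rar (Idn FunVect Y) w) z)"
  proof (rule rr_eqI[OF Y O(2) L_app[OF Rar_L(1)[OF i lin_smult_L[OF w c]] z] V_smult[OF Rob_Obj[OF Y O(2)] c a]])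
    fix H x assume H: "H : Obj" "x : el X H"
    note iH = idV_L[OF H(1)]
    show "rr Y W' (fn (Rar (Idn FunVect Y) (lin_smult c w)) z) (H, x) =
      rr Y W' (smult (Rob Y W') c (fn (Rar (Idn FunVect Y) w) z)) (H, x)"
      unfolding is_linearD(3)[OF rr_linear[OF Y O(2) H] c a] rr_Rar_id[OF Y w z H]
        rr_Rar_id[OF Y lin_smult_L[OF w c] z H] tens_map_smult2[OF iH w c]
      by (rule ap_lin_smult[OF Y tens_map_L[OF iH w] c rr_closed[OF Y O(1) z H]])
  qed
qed

text \<open>A natural family \<open>X \<rightarrow> Y(- \<otimes> V)\<close> is determined by its values on the generators of \<open>X\<close>, and
  these involve only boundedly many vectors of \<open>V\<close>.\<close>

lemma R_sgen:
  assumes Y: "lf Y" and sg: "sgen Y V1"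
  shows "EX F. sgen (vfun_of Rob Rar Y) F"
proof -
  let ?S = "el X V0"
  have V1: "V1 : Obj" using sg by (simp add: sgen_def)
  \<comment> \<open>One index for each generator of \<open>X\<close>, each vector of the object
    generating \<open>Y\<close>, and each place in the sequence supporting the resulting tensor. The
    bound does not depend on \<open>V\<close>, so one \<open>F\<close> serves for all.\<close>
  define Q where "Q = ?S \<times> (carrier V1 \<times> (UNIV :: nat set))"
  have "small Q" unfolding Q_def
    by (intro small_Sigma Obj_small lf_Ob[OF X V0] V1 small_nat)
  then have "EX F:Obj. ALL V:Obj. ALL q. q ` Q <= carrier V --> (EX i:L F V. q ` Q <= fn i ` carrier F)"
    by (rule free_space[OF _ V1])
  then obtain F where F: "F : Obj" "ALL V:Obj. ALL q. q ` Q <= carrier V --> (EX i:L F V. q ` Q <= fn i ` carrier F)"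
    by (rule bexE)
  let ?R = "vfun_of Rob Rar Y"
  have "n : gset ?R F V" if V: "V : Obj" and n: "n : carrier (Rob Y V)" for V n
  proof -
    let ?t = "rr Y V n"
    note tf = rr_fam[OF Y V n]
    note TV = tens_Obj[OF V0 V]
    \<comment> \<open>Strong generation of \<open>Y\<close> writes the value at a generator as
      \<open>Y(\<phi> a)(b a)\<close>. Only the tensors \<open>\<phi> a u\<close> for
      \<open>u\<close> in \<open>V1\<close> then matter, and there are boundedly many.\<close>
    have ex1: "ALL a:?S. EX p. fst p : L V1 (tens V0 V) & snd p : el Y V1 & ?t (V0, a) = ap Y (fst p) (snd p)"
    proof
      fix a assume a: "a : ?S"
      have "?t (V0, a) : gset Y V1 (tens V0 V)"
        using rr_closed[OF Y V n V0 a] sg TV unfolding sgen_def by blast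
      then show "EX p. fst p : L V1 (tens V0 V) & snd p : el Y V1 & ?t (V0, a) = ap Y (fst p) (snd p)"
        unfolding gset_def by auto
    qed
    obtain p where p0: "ALL a:?S. fst (p a) : L V1 (tens V0 V) & snd (p a) : el Y V1 &
      ?t (V0, a) = ap Y (fst (p a)) (snd (p a))" by (rule exE[OF bchoice[OF ex1]])
    define \<phi> where "\<phi> a = fst (p a)" for a
    define b where "b a = snd (p a)" for a
    have \<phi>: "\<phi> a : L V1 (tens V0 V)" and b: "b a : el Y V1" and t\<phi>: "?t (V0, a) = ap Y (\<phi> a) (b a)"
      if "a : ?S" for a using bspec[OF p0 that] by (simp_all add: \<phi>_def b_def)
    have ex2: "ALL au:?S \<times> carrier V1. EX q. range q <= carrier V & (ALL F i. i : L F V --> range (q :: nat => 'u) <= fn i ` carrier F -->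
      fn (\<phi> (fst au)) (snd au) : fn (tens_map (idV V0) i) ` carrier (tens V0 F))"
    proof
      fix au assume "au : ?S \<times> carrier V1"
      then have "fn (\<phi> (fst au)) (snd au) : carrier (tens V0 V)" using L_app[OF \<phi>, of "fst au" "snd au"] by auto
      then show "EX q. range q <= carrier V & (ALL F i. i : L F V --> range (q :: nat => 'u) <= fn i ` carrier F -->
        fn (\<phi> (fst au)) (snd au) : fn (tens_map (idV V0) i) ` carrier (tens V0 F))"
        by (rule tens_finite_support[OF V0 V])
    qed
    obtain q where q0: "ALL au:?S \<times> carrier V1. range (q au) <= carrier V &
      (ALL F i. i : L F V --> range (q au :: nat => 'u) <= fn i ` carrier F -->
      fn (\<phi> (fst au)) (snd au) : fn (tens_map (idV V0) i) ` carrier (tens V0 F))" by (rule exE[OF bchoice[OF ex2]])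
    let ?q = "%(a, u, k). q (a, u) k"
    have qV: "?q ` Q <= carrier V"
    proof (rule image_subsetI)
      fix x assume "x : Q"
      then obtain a u k where x: "x = (a, u, k)" "(a, u) : ?S \<times> carrier V1" unfolding Q_def by auto
      show "?q x : carrier V" using bspec[OF q0 x(2)] by (auto simp: x(1))
    qed
    \<comment> \<open>The image of \<open>i\<close> contains every vector of \<open>V\<close> that
      occurs in these tensors.\<close>
    obtain i where i: "i : L F V" "?q ` Q <= fn i ` carrier F" 
      using F(2)[THEN bspec, OF V, THEN spec, THEN mp, OF qV] by (rule bexE)
    obtain r where r: "r : L V F" "i oo (r oo i) = i" using regular[OF i(1)] by blast
    note iV0 = idV_L[OF V0]
    note ir = L_comp[OF i(1) r(1)]
    note Ti = tens_map_L[OF iV0 i(1)] and Tir = tens_map_L[OF iV0 ir]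
    \<comment> \<open>The values of \<open>\<phi> a\<close> lie in the image of
      \<open>id \<otimes> i\<close>, and \<open>i r\<close> fixes the image of
      \<open>i\<close>.\<close>
    have fix1: "tens_map (idV V0) (i oo r) oo \<phi> a = \<phi> a" if a: "a : ?S" for a
    proof (rule L_eqI[OF L_comp[OF Tir \<phi>[OF a]] \<phi>[OF a]])
      fix u assume u: "u : carrier V1"
      have au: "(a, u) : ?S \<times> carrier V1" using a u by simp
      have "range (q (a, u)) <= fn i ` carrier F"
      proof (rule image_subsetI)
        fix k
        have "(a, u, k) : Q" unfolding Q_def using a u by simp
        then show "q (a, u) k : fn i ` carrier F" using i(2) by force
      qed
      then have "fn (\<phi> a) u : fn (tens_map (idV V0) i) ` carrier (tens V0 F)"
        using bspec[OF q0 au] i(1) by simp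
      then obtain y where y: "fn (\<phi> a) u = fn (tens_map (idV V0) i) y" "y : carrier (tens V0 F)" by (rule imageE)
      have "tens_map (idV V0) (i oo r) oo tens_map (idV V0) i = tens_map (idV V0) i"
        unfolding tens_map_comp[OF iV0 i(1) iV0 ir] using comp_assoc[OF i(1) r(1) i(1)] r(2) comp_id(1)[OF iV0] by simp
      then show "fn (tens_map (idV V0) (i oo r) oo \<phi> a) u = fn (\<phi> a) u"
        unfolding comp_app'[OF \<phi>[OF a] u] y(1) comp_app'[OF Ti y(2), symmetric] by simp
    qed
    note Id = NT_id(1)[OF Y]
    let ?n = "fn (Rar (Idn FunVect Y) r) n"
    have n': "?n : carrier (Rob Y F)" by (rule L_app[OF Rar_L(1)[OF Id r(1)] n])
    let ?m = "fn (Rar (Idn FunVect Y) (i oo r)) n"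
    have m: "?m : carrier (Rob Y V)" by (rule L_app[OF Rar_L(1)[OF Id ir] n])
    \<comment> \<open>The family is pushed to \<open>F\<close> along \<open>r\<close> and back along
      \<open>i\<close>. The result agrees with it on generators by \<open>fix1\<close>, so it is
      recovered from the value of the internal hom at \<open>F\<close>.\<close>
    have "fn (Rar (Idn FunVect Y) i) ?n = ?m"
      using R.ar_comp[OF Y Y Y Id Id r(1) i(1) n] R.NT_id_comp[OF Id] by simp
    also have "?m = n"
    proof (rule rr_eqI[OF Y V m n])
      have "rr Y V ?m = rr Y V n"
      proof (rule fam_eq_gens[OF X lf_sh[OF Y V] gX rr_fam[OF Y V m] tf])
        fix a assume a: "a : ?S"
        show "rr Y V ?m (V0, a) = ?t (V0, a)"
          unfolding rr_Rar_id[OF Y ir n V0 a] t\<phi>[OF a] ap_comp[OF Y Tir \<phi>[OF a] b[OF a], symmetric] fix1[OF a] ..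
      qed
      then show "rr Y V ?m (H, x) = rr Y V n (H, x)" for H x by simp
    qed
    finally have "n = ap ?R i ?n" by simp
    then show ?thesis unfolding gset_def using i(1) n' by auto
  qed
  then have "sgen ?R F" unfolding sgen_def using F(1) by auto
  then show ?thesis by blast
qed

lemma HomX_Ob: assumes "Y : Ob Ind" shows "vfun_of Rob Rar Y : Ob Ind"
proof -
  have Y: "lf Y" "small_functor Y" using assms by simp_all
  obtain V1 where "sgen Y V1" using small_functor_sgen[OF Y] by blast
  from R_sgen[OF Y(1) this] obtain F where "sgen (vfun_of Rob Rar Y) F" by blast
  then show ?thesis unfolding Ob_Ind using R.vfun_of_lf[OF Y(1)] sgen_gens by blast
qed

end

context two_var
begin

lemma curried_functor:
  assumes S: "!!Y. Y : Ob Ind ==> S Y" and ob: "!!Y. Y : Ob Ind ==> vfun_of ob ar Y : Ob Ind"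
  shows "is_functor Ind Ind (curried ob ar)"
  unfolding is_functor_def
proof (intro conjI ballI impI)
  show "Fo (curried ob ar) Y : Ob Ind" if "Y : Ob Ind" for Y unfolding curried_simps by (rule ob[OF that])
  show "Fa (curried ob ar) (Idn Ind Y) = Idn Ind (Fo (curried ob ar) Y)" if Y: "Y : Ob Ind" for Y
  proof -
    note i = NT_id(1)[OF S_lf[OF S[OF Y]]] and v = vfun_of_lf[OF S[OF Y]]
    have "Fa (curried ob ar) (Idn FunVect Y) = Idn FunVect (vfun_of ob ar Y)"
    proof (rule NT_eqI[OF curried_NT[OF S[OF Y] S[OF Y] i] NT_id(1)[OF v]])
      fix H x assume H: "H : Obj" and x: "x : el (vfun_of ob ar Y) H"
      show "nt (Fa (curried ob ar) (Idn FunVect Y)) H x = nt (Idn FunVect (vfun_of ob ar Y)) H x"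
        unfolding nt_curried[OF H] NT_id(2)[OF v H x] using ar_id[OF S[OF Y] H] x by simp
    qed
    then show ?thesis by (simp add: curried_simps)
  qed
  show "Fa (curried ob ar) t : Mor Ind (Fo (curried ob ar) (Dom Ind t)) (Fo (curried ob ar) (Cod Ind t))"
    if "t : Ar Ind" for t
  proof -
    have t: "src t : Ob Ind" "tgt t : Ob Ind" "t : NT (src t) (tgt t)" using that unfolding Ar_Ind by blast+
    show ?thesis
      using curried_NT[OF S[OF t(1)] S[OF t(2)] t(3)] Mor_Ind[OF ob[OF t(1)] ob[OF t(2)]] by (simp add: curried_simps)
  qed
  show "Fa (curried ob ar) (Cmp Ind t s) = Cmp Ind (Fa (curried ob ar) t) (Fa (curried ob ar) s)"
    if "s : Ar Ind" "t : Ar Ind" "Dom Ind t = Cod Ind s" for s t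
  proof -
    obtain Y Y' Y'' where s: "Y : Ob Ind" "Y' : Ob Ind" "s : NT Y Y'" and t: "Y'' : Ob Ind" "t : NT Y' Y''"
      using \<open>s \<in> Ar Ind\<close> \<open>t \<in> Ar Ind\<close> \<open>Dom Ind t = Cod Ind s\<close> unfolding Ar_Ind by (metis Ind_simps(1,2))
    note Y = S[OF s(1)] and Y' = S[OF s(2)] and Y'' = S[OF t(1)]
    note cs = curried_NT[OF Y Y' s(3)] and ct = curried_NT[OF Y' Y'' t(2)]
    note ts = NT_comp(1)[OF t(2) s(3)]
    have "Fa (curried ob ar) (Cmp FunVect t s) = Cmp FunVect (Fa (curried ob ar) t) (Fa (curried ob ar) s)"
    proof (rule NT_eqI[OF curried_NT[OF Y Y'' ts] NT_comp(1)[OF ct cs]])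
      fix H x assume H: "H : Obj" and x: "x : el (vfun_of ob ar Y) H"
      have x': "x : carrier (ob Y H)" using x by simp
      note i = idV_L[OF H]
      show "nt (Fa (curried ob ar) (Cmp FunVect t s)) H x = nt (Cmp FunVect (Fa (curried ob ar) t) (Fa (curried ob ar) s)) H x"
        unfolding NT_comp(2)[OF ct cs H x] nt_curried[OF H]
        using ar_comp[OF Y Y' Y'' s(3) t(2) i i x'] comp_id(1)[OF i] by simp
    qed
    then show ?thesis by simp
  qed
qed

end

context ind_obj
begin

lemma HomX_functor: "is_functor Ind Ind HomX"
  unfolding HomX_def by (rule R.curried_functor[OF _ HomX_Ob]) simp_all

lemma eval_form_presents: "presents (eval_form HomX) rr"
proof (unfold presents_def, intro conjI ballI allI impI)
  have sp: "sp (eval_form HomX) (Y, V) = Rob Y V" for Y V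
    by (simp add: eval_form_def HomX_def R.curried_simps)
  show "coords (sp (eval_form HomX) (Y, V)) (rr Y V) (sh Y V)" if "Y : Ob Ind" "V : Obj" for Y V
    unfolding sp using that by (intro frep_coords Rob_frep) simp_all
  fix Y Y' \<eta> V V' v a
  assume \<eta>: "\<eta> : NT Y Y'" and v: "v : L V V'" and a: "a : carrier (sp (eval_form HomX) (Y, V))"
  note Y = NT_lf[OF \<eta>] and O = L_Ob[OF v]
  note a = a[unfolded sp]
  note i = idV_L[OF O(2)] and I = NT_id(1)[OF Y(1)]
  note r1 = Rar_L[OF I v] and r2 = Rar_L[OF \<eta> i]
  have "act (eval_form HomX) (\<eta>, v) a = fn (Rar \<eta> (idV V') oo Rar (Idn FunVect Y) v) a"
    using O by (simp add: eval_form_def HomX_def R.curried_simps NT_src[OF \<eta>] L_src[OF v])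
  also have "\<dots> = fn (Rar \<eta> v) a"
    unfolding comp_app'[OF r1(1) a]
    using R.ar_comp[OF Y(1) Y(1) Y(2) I \<eta> v i a] comp_id(1)[OF v] R.NT_id_comp(1)[OF \<eta>] by simp
  finally have act: "act (eval_form HomX) (\<eta>, v) a = fn (Rar \<eta> v) a" .
  show "act (eval_form HomX) (\<eta>, v) a : carrier (sp (eval_form HomX) (Y', V'))"
    unfolding act sp by (rule L_app[OF Rar_L(1)[OF \<eta> v] a])
  show "rr Y' V' (act (eval_form HomX) (\<eta>, v) a) (H, x) = fn (twist_map \<eta> v H) (rr Y V a (H, x))"
    if "H : Obj" "x : el X H" for H x unfolding act by (rule Rar_L(2)[OF \<eta> v a that])
qed

end

context small_vect
begin

subsection \<open>Existence of coends, and trilinear maps\<close>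

text \<open>Expresses that \<open>m\<close> is already accounted for at \<open>H0\<close>, before
  any coend is known to exist: all cowedges are consulted instead of a quotient.\<close>

definition reach :: "(('k, 'u) module \<times> ('k, 'u) module, ('k, 'u) lin \<times> ('k, 'u) lin,
      ('k, 'u) module, ('k, 'u) lin) cfunctor => ('k, 'u) module => ('k, 'u) module => 'u => bool" where
  "reach T H0 H m \<longleftrightarrow> (EX m0:el T (H0, H0). ALL e w. is_cowedge Vect Vect T e w --> fn (w H) m = fn (w H0) m0)"

lemma reach_closed:
  assumes O: "Fo T (H0, H0) : Obj" and H0: "H0 : Obj" and H: "H : Obj"
  shows "reach T H0 H (zero (Fo T (H, H)))"
    and "m : el T (H, H) ==> n : el T (H, H) ==> reach T H0 H m ==> reach T H0 H n ==>
      reach T H0 H (add (Fo T (H, H)) m n)"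
    and "c : carrier K ==> m : el T (H, H) ==> reach T H0 H m ==> reach T H0 H (smult (Fo T (H, H)) c m)"
proof -
  note wH = cowedgeD(2)[OF _ H] and w0 = cowedgeD(2)[OF _ H0]
  show "reach T H0 H (zero (Fo T (H, H)))" unfolding reach_def
    by (rule bexI[OF _ V_zero[OF O]]) (use L_zero[OF wH] L_zero[OF w0] in metis)
  assume m: "m : el T (H, H)" and "reach T H0 H m"
  then obtain m0 where m0: "m0 : el T (H0, H0)" "ALL e w. is_cowedge Vect Vect T e w --> fn (w H) m = fn (w H0) m0"
    unfolding reach_def by blast
  show "reach T H0 H (smult (Fo T (H, H)) c m)" if c: "c : carrier K" unfolding reach_def
  proof (rule bexI[OF _ V_smult[OF O c m0(1)]], intro allI impI)
    fix e w assume w: "is_cowedge Vect Vect T e w"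
    then show "fn (w H) (smult (Fo T (H, H)) c m) = fn (w H0) (smult (Fo T (H0, H0)) c m0)"
      using L_smult[OF wH[OF w] c m] L_smult[OF w0[OF w] c m0(1)] m0(2) by simp
  qed
  assume n: "n : el T (H, H)" and "reach T H0 H n"
  then obtain n0 where n0: "n0 : el T (H0, H0)" "ALL e w. is_cowedge Vect Vect T e w --> fn (w H) n = fn (w H0) n0"
    unfolding reach_def by blast
  show "reach T H0 H (add (Fo T (H, H)) m n)" unfolding reach_def
  proof (rule bexI[OF _ V_add[OF O m0(1) n0(1)]], intro allI impI)
    fix e w assume w: "is_cowedge Vect Vect T e w"
    then show "fn (w H) (add (Fo T (H, H)) m n) = fn (w H0) (add (Fo T (H0, H0)) m0 n0)"
      using L_add[OF wH[OF w] m n] L_add[OF w0[OF w] m0(1) n0(1)] m0(2) n0(2) by simp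
  qed
qed

text \<open>Instance of \<open>universal\<close> for the class of all cowedges. The index set
  consists of the vectors of all \<open>T(H, H)\<close> and is large, but by \<open>R\<close> the
  values on \<open>T(H0, H0)\<close> determine everything, and this set is small.\<close>

lemma coend_exists:
  assumes T: "typedT T" and O: "!!H. H : Obj ==> Fo T (H, H) : Obj" and H0: "H0 : Obj"
    and R: "!!H m. H : Obj ==> m : el T (H, H) ==> reach T H0 H m"
  shows "EX e w. is_coend Vect Vect T e w"
proof -
  let ?I = "Sigma Obj (%H. el T (H, H))" and ?G = "Pair H0 ` el T (H0, H0)"
  let ?f = "%w i. fn (w (fst i)) (snd i)"
  define P where "P = {(e, ?f w) | e w. is_cowedge Vect Vect T e w}"
  have PE: "EX w. is_cowedge Vect Vect T (fst p) w & snd p = ?f w" if "p : P" for p using that by (auto simp: P_def)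
  obtain M t k where M: "M : Obj" and t: "!!i. i : ?I ==> t i : carrier M"
    and k: "!!p. p : P ==> k p : L M (fst p)" "!!p i. p : P ==> i : ?I ==> fn (k p) (t i) = snd p i"
    and sep: "!!x y. x : carrier M ==> y : carrier M ==> (!!p. p : P ==> fn (k p) x = fn (k p) y) ==> x = y"
    and sp: "spans M (t ` ?I)"
  proof (rule universal[of P ?I ?G])
    show "fst p : Obj" if "p : P" for p using PE[OF that] cowedgeD(1) by blast
    show "snd p i : carrier (fst p)" if p: "p : P" and i: "i : ?I" for p i
    proof -
      obtain w where w: "is_cowedge Vect Vect T (fst p) w" "snd p = ?f w" using PE[OF p] by blast
      show ?thesis unfolding w(2) using i L_app[OF cowedgeD(2)[OF w(1)]] by auto
    qed
    show "small ?G" by (intro small_image Obj_small O H0)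
    show "?G <= ?I" using H0 by auto
    fix c i assume c: "c : carrier K" and "i : ?I"
    then obtain H m where i: "i = (H, m)" and H: "H : Obj" and m: "m : el T (H, H)" by auto
    \<comment> \<open>The multiple \<open>c m\<close> is again a vector at \<open>H\<close>;
      reaching it from \<open>H0\<close> gives a formal sum with the single term
      \<open>m0\<close>.\<close>
    obtain m0 where m0: "m0 : el T (H0, H0)"
      "ALL e w. is_cowedge Vect Vect T e w --> fn (w H) (smult (Fo T (H, H)) c m) = fn (w H0) m0"
      using R[OF H V_smult[OF O[OF H] c m]] unfolding reach_def by blast
    show "EX l:lists ?G. ALL p:P. smult (fst p) c (snd p i) = lsum (fst p) (snd p) l"
    proof (intro bexI[of _ "[(H0, m0)]"] ballI)
      fix p assume "p : P"
      then obtain w where w: "is_cowedge Vect Vect T (fst p) w" "snd p = ?f w" using PE by blast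
      note wD = cowedgeD[OF w(1)]
      have "fn (w H) (smult (Fo T (H, H)) c m) = fn (w H0) m0" using m0(2) w(1) by blast
      then show "smult (fst p) c (snd p i) = lsum (fst p) (snd p) [(H0, m0)]"
        unfolding w(2) using L_smult[OF wD(2)[OF H] c m] L_app[OF wD(2)[OF H0] m0(1)] wD(1) by (simp add: i)
    qed (use m0 in simp)
  next
    fix M t k
    assume "M : Obj" "!!i. i : ?I ==> t i : carrier M" "!!p. p : P ==> k p : L M (fst p)"
      "!!p i. p : P ==> i : ?I ==> fn (k p) (t i) = snd p i"
      "!!x y. x : carrier M ==> y : carrier M ==> (!!p. p : P ==> fn (k p) x = fn (k p) y) ==> x = y"
      "spans M (t ` ?I)"
    then show thesis by (rule that)
  qed
  have pP: "(e, ?f w) : P" if "is_cowedge Vect Vect T e w" for e w using that by (auto simp: P_def)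
  define W where "W H = mk (Fo T (H, H)) M (%m. t (H, m))" for H
  have W: "W H : L (Fo T (H, H)) M" if H: "H : Obj" for H
    unfolding W_def
  proof (rule mk_L[OF O[OF H] M is_linearI])
    show t': "t (H, m) : carrier M" if "m : el T (H, H)" for m using t H that by simp
    fix m assume m: "m : el T (H, H)"
    show "t (H, add (Fo T (H, H)) m n) = add M (t (H, m)) (t (H, n))" if n: "n : el T (H, H)" for n
    proof (rule sep[OF t'[OF V_add[OF O[OF H] m n]] V_add[OF M t'[OF m] t'[OF n]]])
      fix p assume p: "p : P"
      then obtain w where w: "is_cowedge Vect Vect T (fst p) w" "snd p = ?f w" using PE by blast
      show "fn (k p) (t (H, add (Fo T (H, H)) m n)) = fn (k p) (add M (t (H, m)) (t (H, n)))"
        using L_add[OF k(1)[OF p] t'[OF m] t'[OF n]] k(2)[OF p] H m n V_add[OF O[OF H] m n]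
          L_add[OF cowedgeD(2)[OF w(1) H] m n] by (simp add: w(2))
    qed
    show "t (H, smult (Fo T (H, H)) c m) = smult M c (t (H, m))" if c: "c : carrier K" for c
    proof (rule sep[OF t'[OF V_smult[OF O[OF H] c m]] V_smult[OF M c t'[OF m]]])
      fix p assume p: "p : P"
      then obtain w where w: "is_cowedge Vect Vect T (fst p) w" "snd p = ?f w" using PE by blast
      show "fn (k p) (t (H, smult (Fo T (H, H)) c m)) = fn (k p) (smult M c (t (H, m)))"
        using L_smult[OF k(1)[OF p] c t'[OF m]] k(2)[OF p] H m c V_smult[OF O[OF H] c m]
          L_smult[OF cowedgeD(2)[OF w(1) H] c m] by (simp add: w(2))
    qed
  qed
  have Wm: "fn (W H) m = t (H, m)" if "m : el T (H, H)" for H m unfolding W_def by (rule mk_app[OF that])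
  have kW: "k (e, ?f w) oo W H = w H" if w: "is_cowedge Vect Vect T e w" and H: "H : Obj" for e w H
  proof (rule L_eqI[OF L_comp[OF _ W[OF H]] cowedgeD(2)[OF w H]])
    show "k (e, ?f w) : L M e" using k(1)[OF pP[OF w]] by simp
    fix m assume m: "m : el T (H, H)"
    show "fn (k (e, ?f w) oo W H) m = fn (w H) m"
      unfolding comp_app'[OF W[OF H] m] Wm[OF m] using k(2)[OF pP[OF w]] H m by simp
  qed
  have cW: "is_cowedge Vect Vect T M W"
  proof (rule cowedgeI[OF M W])
    fix A B f assume f: "f : L A B"
    note AB = L_Ob[OF f]
    have Tf: "Fa T (f, idV A) : L (Fo T (B, A)) (Fo T (A, A))" "Fa T (idV B, f) : L (Fo T (B, A)) (Fo T (B, B))"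
      using T f unfolding typedT_def by blast+
    note l = L_comp[OF W[OF AB(1)] Tf(1)] and r = L_comp[OF W[OF AB(2)] Tf(2)]
    show "W A oo Fa T (f, idV A) = W B oo Fa T (idV B, f)"
    proof (rule L_eqI[OF l r])
      fix m assume m: "m : el T (B, A)"
      show "fn (W A oo Fa T (f, idV A)) m = fn (W B oo Fa T (idV B, f)) m"
      proof (rule sep[OF L_app[OF l m] L_app[OF r m]])
        fix p assume p: "p : P"
        then obtain w where w: "is_cowedge Vect Vect T (fst p) w" "snd p = ?f w" using PE by blast
        have pe: "(fst p, ?f w) = p" by (simp add: w(2)[symmetric])
        note kp = k(1)[OF p] and kA = kW[OF w(1) AB(1), unfolded pe] and kB = kW[OF w(1) AB(2), unfolded pe]
        have "k p oo (W A oo Fa T (f, idV A)) = k p oo (W B oo Fa T (idV B, f))"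
          unfolding comp_assoc[OF kp W[OF AB(1)] Tf(1), symmetric] comp_assoc[OF kp W[OF AB(2)] Tf(2), symmetric] kA kB
          by (rule cowedgeD(3)[OF w(1) f])
        then show "fn (k p) (fn (W A oo Fa T (f, idV A)) m) = fn (k p) (fn (W B oo Fa T (idV B, f)) m)"
          using comp_app'[OF l m, of "k p"] comp_app'[OF r m, of "k p"] by simp
      qed
    qed
  qed
  have "is_coend Vect Vect T M W" unfolding is_coend_def
  proof (intro conjI cW allI impI)
    fix e w assume w: "is_cowedge Vect Vect T e w"
    have ke: "k (e, ?f w) : L M e" using k(1)[OF pP[OF w]] by simp
    show "EX! h. h : L M e & (ALL H:Obj. h oo W H = w H)"
    proof (rule ex1I[of _ "k (e, ?f w)"])
      show "k (e, ?f w) : L M e & (ALL H:Obj. k (e, ?f w) oo W H = w H)" using ke kW[OF w] by blast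
      fix h assume h: "h : L M e & (ALL H:Obj. h oo W H = w H)"
      show "h = k (e, ?f w)"
      proof (rule spans_eqI[OF sp _ conjunct1[OF h] ke])
        show "t ` ?I <= carrier M" using t by blast
        fix x assume "x : t ` ?I"
        then obtain H m where x: "x = t (H, m)" and H: "H : Obj" and m: "m : el T (H, H)" by auto
        have "h oo W H = k (e, ?f w) oo W H" using h H kW[OF w H] by simp
        then show "fn h x = fn (k (e, ?f w)) x"
          unfolding x Wm[OF m, symmetric] comp_app'[OF W[OF H] m, symmetric] by (rule arg_cong)
      qed
    qed
  qed
  then show ?thesis by blast
qed

text \<open>The vectors with property \<open>P\<close> form a subspace to which the cowedge
  corestricts. The induced map, followed by the inclusion, fixes all legs and is the identity, so
  the subspace is everything.\<close>

lemma coend_induct: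
  assumes c: "is_coend Vect Vect T e w" and T: "typedT T" and z: "z : carrier e"
    and P: "!!H m. H : Obj ==> m : el T (H, H) ==> P (fn (w H) m)" "P (zero e)"
    "!!x y. x : carrier e ==> y : carrier e ==> P x ==> P y ==> P (add e x y)"
    "!!c x. c : carrier K ==> x : carrier e ==> P x ==> P (smult e c x)"
  shows "P z"
proof -
  let ?U = "{x : carrier e. P x}"
  note wD = cowedgeD[OF coend_cowedge[OF c]]
  have U: "subsp ?U e" using P wD(1) by (intro subspI) auto
  note i = incl_L[OF wD(1) U]
  define v where "v H = mk (Fo T (H, H)) (sub e ?U) (fn (w H))" for H
  have v: "v H : L (Fo T (H, H)) (sub e ?U)" if "H : Obj" for H
    unfolding v_def by (rule corestrict_L[OF wD(2)[OF that] U]) (use L_app[OF wD(2)[OF that]] P(1) that in simp)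
  have vm: "fn (v H) m = fn (w H) m" if "m : el T (H, H)" for H m using that by (simp add: v_def)
  have "is_cowedge Vect Vect T (sub e ?U) v"
  proof (rule cowedgeI[OF L_Ob(1)[OF i] v])
    fix A B f assume f: "f : L A B"
    note AB = L_Ob[OF f]
    have Tf: "Fa T (f, idV A) : L (Fo T (B, A)) (Fo T (A, A))" "Fa T (idV B, f) : L (Fo T (B, A)) (Fo T (B, B))"
      using T f unfolding typedT_def by blast+
    show "v A oo Fa T (f, idV A) = v B oo Fa T (idV B, f)"
    proof (rule L_eqI[OF L_comp[OF v[OF AB(1)] Tf(1)] L_comp[OF v[OF AB(2)] Tf(2)]])
      fix m assume m: "m : el T (B, A)"
      show "fn (v A oo Fa T (f, idV A)) m = fn (v B oo Fa T (idV B, f)) m"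
        unfolding comp_app'[OF Tf(1) m] comp_app'[OF Tf(2) m] vm[OF L_app[OF Tf(1) m]] vm[OF L_app[OF Tf(2) m]]
        using comp_app'[OF Tf(1) m, of "w A"] comp_app'[OF Tf(2) m, of "w B"] wD(3)[OF f] by simp
    qed
  qed
  from coend_lift[OF c this] obtain h where h: "h : L e (sub e ?U)" "!!H. H : Obj ==> h oo w H = v H" by blast
  have "incl e ?U oo h = idV e"
  proof (rule coend_eqI[OF c T L_comp[OF i h(1)] idV_L[OF wD(1)]])
    fix H assume H: "H : Obj"
    note w = wD(2)[OF H]
    have "incl e ?U oo v H = w H"
    proof (rule L_eqI[OF L_comp[OF i v[OF H]] w])
      fix m assume m: "m : el T (H, H)"
      show "fn (incl e ?U oo v H) m = fn (w H) m"
        unfolding comp_app'[OF v[OF H] m] using L_app[OF v[OF H] m] by (simp add: incl_def vm[OF m])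
    qed
    then show "(incl e ?U oo h) oo w H = idV e oo w H"
      using comp_assoc[OF i h(1) w] h(2)[OF H] comp_id(1)[OF w] by simp
  qed
  then have "fn (incl e ?U) (fn h z) = z" using comp_app'[OF h(1) z, of "incl e ?U"] z wD(1) by simp
  moreover have hz: "fn h z : ?U" using L_app[OF h(1) z] by simp
  ultimately have "z : ?U" by (simp add: incl_def)
  then show ?thesis by simp
qed

abbreviation "q3 P Q D V p q h \<equiv> pt (tens P Q) (hom_sp D V) (pt P Q p q) (graph h)"

text \<open>The third variable ranges over arrows and not over their graphs, which keeps the coding
  of linear maps out of later statements; linearity in it is spelled out by \<open>lin_add\<close>
  and \<open>lin_smult\<close>.\<close>

definition trilin :: "('k, 'u) module => ('k, 'u) module => ('k, 'u) module => ('k, 'u) module => ('k, 'u) module =>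
    ('u => 'u => ('k, 'u) lin => 'u) => bool" where
  "trilin P Q D V Z g \<longleftrightarrow> (ALL p:carrier P. ALL q:carrier Q. ALL h:L D V.
     is_linear K P Z (%p. g p q h) & is_linear K Q Z (%q. g p q h) &
     (ALL h':L D V. g p q (lin_add h h') = add Z (g p q h) (g p q h')) &
     (ALL c:carrier K. g p q (lin_smult c h) = smult Z c (g p q h)))"

lemma trilinD:
  assumes "trilin P Q D V Z g" "h : L D V"
  shows "q : carrier Q ==> p : carrier P ==> is_linear K P Z (%p. g p q h)"
    and "p : carrier P ==> q : carrier Q ==> is_linear K Q Z (%q. g p q h)"
    and "p : carrier P ==> q : carrier Q ==> h' : L D V ==> g p q (lin_add h h') = add Z (g p q h) (g p q h')"
    and "p : carrier P ==> q : carrier Q ==> c : carrier K ==> g p q (lin_smult c h) = smult Z c (g p q h)"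
    and "p : carrier P ==> q : carrier Q ==> g p q h : carrier Z"
  using assms unfolding trilin_def is_linear_def by blast+

lemma trilin_comp:
  assumes g: "trilin P Q D V Z g" and k: "k : L Z Z'"
  shows "trilin P Q D V Z' (%p q h. fn k (g p q h))"
  unfolding trilin_def
proof (intro ballI conjI)
  fix p q h assume p: "p : carrier P" and q: "q : carrier Q" and h: "h : L D V"
  note G = trilinD[OF g h]
  note c = L_app[OF k] and s = L_add[OF k] L_smult[OF k]
  note P = is_linearD[OF G(1)[OF q p]] and Q = is_linearD[OF G(2)[OF p q]]
  show "is_linear K P Z' (%p. fn k (g p q h))" using P c s by (intro is_linearI) auto
  show "is_linear K Q Z' (%q. fn k (g p q h))" using Q c s by (intro is_linearI) auto
  show "fn k (g p q (lin_add h h')) = add Z' (fn k (g p q h)) (fn k (g p q h'))" if "h' : L D V" for h'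
    using G(3)[OF p q that] s(1) G(5)[OF p q] trilinD(5)[OF g that p q] by simp
  show "fn k (g p q (lin_smult c h)) = smult Z' c (fn k (g p q h))" if "c : carrier K" for c
    using G(4)[OF p q that] s(2) G(5)[OF p q] that by simp
qed

lemma q3_trilin:
  assumes P: "P : Obj" and Q: "Q : Obj" and D: "D : Obj" and V: "V : Obj"
  shows "trilin P Q D V (tens (tens P Q) (hom_sp D V)) (q3 P Q D V)"
  unfolding trilin_def
proof (intro ballI conjI)
  note T = tens_Obj[OF P Q] and H = hom_Obj[OF D V]
  fix p q h assume p: "p : carrier P" and q: "q : carrier Q" and h: "h : L D V"
  note c = pt_closed[OF P Q] and g = graph_in[OF h]
  show "is_linear K P (tens (tens P Q) (hom_sp D V)) (%p. q3 P Q D V p q h)"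
    by (rule is_linearI) (simp_all add: pt_closed[OF T H _ g] c q pt_add1[OF P Q] pt_smult1[OF P Q] pt_add1[OF T H _ _ g] pt_smult1[OF T H _ _ g])
  show "is_linear K Q (tens (tens P Q) (hom_sp D V)) (%q. q3 P Q D V p q h)"
    by (rule is_linearI) (simp_all add: pt_closed[OF T H _ g] c p pt_add2[OF P Q] pt_smult2[OF P Q] pt_add1[OF T H _ _ g] pt_smult1[OF T H _ _ g])
  note z = c[OF p q]
  show "q3 P Q D V p q (lin_add h h') = add (tens (tens P Q) (hom_sp D V)) (q3 P Q D V p q h) (q3 P Q D V p q h')"
    if "h' : L D V" for h' using pt_add2[OF T H z g graph_in[OF that]] hom_add[OF h that] by simp
  show "q3 P Q D V p q (lin_smult c h) = smult (tens (tens P Q) (hom_sp D V)) c (q3 P Q D V p q h)"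
    if "c : carrier K" for c using pt_smult2[OF T H that z g] hom_smult[OF h] by simp
qed

lemma q3_induct:
  assumes O: "P : Obj" "Q : Obj" "D : Obj" "V : Obj"
    and z: "z : carrier (tens (tens P Q) (hom_sp D V))"
    and R: "!!p q h. p : carrier P ==> q : carrier Q ==> h : L D V ==> R (q3 P Q D V p q h)" "R (zero (tens (tens P Q) (hom_sp D V)))"
    "!!x y. x : carrier (tens (tens P Q) (hom_sp D V)) ==> y : carrier (tens (tens P Q) (hom_sp D V)) ==> R x ==> R y ==> R (add (tens (tens P Q) (hom_sp D V)) x y)"
    "!!c x. c : carrier K ==> x : carrier (tens (tens P Q) (hom_sp D V)) ==> R x ==> R (smult (tens (tens P Q) (hom_sp D V)) c x)"
  shows "R z"
proof (rule tens_induct[OF tens_Obj[OF O(1,2)] hom_Obj[OF O(3,4)] z])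
  note T = tens_Obj[OF O(1,2)] and H = hom_Obj[OF O(3,4)]
  fix v a assume v: "v : carrier (tens P Q)" and a: "a : carrier (hom_sp D V)"
  obtain h where h: "h : L D V" "a = graph h" by (rule hom_cases[OF a])
  note A = pt_add1[OF T H _ _ a] and S = pt_smult1[OF T H _ _ a] and C = pt_closed[OF T H _ a]
  show "R (pt (tens P Q) (hom_sp D V) v a)"
  proof (rule tens_induct[OF O(1,2) v])
    show "R (pt (tens P Q) (hom_sp D V) (pt P Q p q) a)" if "p : carrier P" "q : carrier Q" for p q
      using R(1)[OF that h(1)] h(2) by simp
    show "R (pt (tens P Q) (hom_sp D V) (zero (tens P Q)) a)"
      using is_linear_zero[OF T tens_Obj[OF T H] is_linearI[of "tens P Q" "%v. pt (tens P Q) (hom_sp D V) v a", OF C A S]] R(2)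
      by simp
    fix x y assume x: "x : carrier (tens P Q)" and Rx: "R (pt (tens P Q) (hom_sp D V) x a)"
    show "R (pt (tens P Q) (hom_sp D V) (smult (tens P Q) c x) a)" if "c : carrier K" for c
      unfolding S[OF that x] by (rule R(4)[OF that C[OF x] Rx])
    assume y: "y : carrier (tens P Q)" and Ry: "R (pt (tens P Q) (hom_sp D V) y a)"
    show "R (pt (tens P Q) (hom_sp D V) (add (tens P Q) x y) a)"
      unfolding A[OF x y] by (rule R(3)[OF C[OF x] C[OF y] Rx Ry])
  qed
qed (rule R(2-4); assumption)+

lemma q3_eqI:
  assumes O: "P : Obj" "Q : Obj" "D : Obj" "V : Obj"
    and f: "f : L (tens (tens P Q) (hom_sp D V)) Z" and g: "g : L (tens (tens P Q) (hom_sp D V)) Z"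
    and e: "!!p q h. p : carrier P ==> q : carrier Q ==> h : L D V ==> fn f (q3 P Q D V p q h) = fn g (q3 P Q D V p q h)"
  shows "f = g"
proof (rule L_eqI[OF f g])
  fix z assume "z : carrier (tens (tens P Q) (hom_sp D V))"
  with O show "fn f z = fn g z"
    by (rule q3_induct) (simp_all add: e L_zero[OF f] L_zero[OF g] L_add[OF f] L_add[OF g] L_smult[OF f] L_smult[OF g])
qed

text \<open>For fixed \<open>h\<close> the map factors through the tensor product of
  \<open>P\<close> and \<open>Q\<close>. Uniqueness of the factor makes it linear in
  \<open>h\<close>, and a second use of the universal property finishes.\<close>

lemma q3_lift:
  assumes P: "P : Obj" and Q: "Q : Obj" and D: "D : Obj" and V: "V : Obj" and Z: "Z : Obj"
    and g: "trilin P Q D V Z g"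
  shows "EX k:L (tens (tens P Q) (hom_sp D V)) Z. ALL p:carrier P. ALL q:carrier Q. ALL h:L D V. fn k (q3 P Q D V p q h) = g p q h"
proof -
  note T = tens_Obj[OF P Q] and H = hom_Obj[OF D V]
  have "ALL h:L D V. EX t. t : L (tens P Q) Z & (ALL p:carrier P. ALL q:carrier Q. fn t (pt P Q p q) = g p q h)"
  proof
    fix h assume h: "h : L D V"
    note G = trilinD[OF g h]
    have "is_bilinear K P Q Z (%p q. g p q h)"
      unfolding is_bilinear_def using G(1)[OF _ V_zero[OF P]] G(2)[OF _ V_zero[OF Q]] by blast
    from tens_lift[OF P Q Z this] obtain t where "t : L (tens P Q) Z"
      "!!p q. p : carrier P ==> q : carrier Q ==> fn t (pt P Q p q) = g p q h" by blast
    then show "EX t. t : L (tens P Q) Z & (ALL p:carrier P. ALL q:carrier Q. fn t (pt P Q p q) = g p q h)" by blast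
  qed
  then obtain t where t0: "ALL h:L D V. t h : L (tens P Q) Z & (ALL p:carrier P. ALL q:carrier Q. fn (t h) (pt P Q p q) = g p q h)"
    by (rule exE[OF bchoice])
  have t: "t h : L (tens P Q) Z" and tp: "p : carrier P ==> q : carrier Q ==> fn (t h) (pt P Q p q) = g p q h"
    if "h : L D V" for h p q using bspec[OF t0 that] by blast+
  have ta: "t (lin_add h h') = lin_add (t h) (t h')" if h: "h : L D V" "h' : L D V" for h h'
    by (rule tens_eqI[OF P Q t[OF lin_add_L[OF h]] lin_add_L[OF t[OF h(1)] t[OF h(2)]]])
       (simp add: tp[OF lin_add_L[OF h]] tp[OF h(1)] tp[OF h(2)] lin_add_app[OF t[OF h(1)]] pt_closed[OF P Q] trilinD(3)[OF g h(1) _ _ h(2)])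
  have ts: "t (lin_smult c h) = lin_smult c (t h)" if h: "h : L D V" and c: "c : carrier K" for h c
    by (rule tens_eqI[OF P Q t[OF lin_smult_L[OF h c]] lin_smult_L[OF t[OF h] c]])
       (simp add: tp[OF lin_smult_L[OF h c]] tp[OF h] lin_smult_app[OF t[OF h]] pt_closed[OF P Q] trilinD(4)[OF g h _ _ c])
  let ?b = "%z a. fn (t (ungraph D V a)) z"
  have "is_bilinear K (tens P Q) (hom_sp D V) Z ?b"
  proof (rule bilinearI)
    fix z a assume z: "z : carrier (tens P Q)" and "a : carrier (hom_sp D V)"
    then obtain h where h: "h : L D V" "a = graph h" by (auto elim: hom_cases)
    note th = t[OF h(1)]
    show "?b z a : carrier Z" using L_app[OF th z] h by simp
    show "?b (add (tens P Q) z z') a = add Z (?b z a) (?b z' a)" if "z' : carrier (tens P Q)" for z'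
      using L_add[OF th z that] h by simp
    show "?b (smult (tens P Q) c z) a = smult Z c (?b z a)" if "c : carrier K" for c using L_smult[OF th that z] h by simp
    show "?b z (smult (hom_sp D V) c a) = smult Z c (?b z a)" if c: "c : carrier K" for c
      using ts[OF h(1) c] lin_smult_app[OF th z] h by (simp add: hom_smult[OF h(1)] ungraph_graph[OF lin_smult_L[OF h(1) c]])
    fix a' assume "a' : carrier (hom_sp D V)"
    then obtain h' where h': "h' : L D V" "a' = graph h'" by (rule hom_cases)
    show "?b z (add (hom_sp D V) a a') = add Z (?b z a) (?b z a')"
      using ta[OF h(1) h'(1)] lin_add_app[OF th z] h h' by (simp add: hom_add[OF h(1) h'(1)] ungraph_graph[OF lin_add_L[OF h(1) h'(1)]])
  qed
  from tens_lift[OF T H Z this] obtain k where k: "k : L (tens (tens P Q) (hom_sp D V)) Z"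
    "!!z a. z : carrier (tens P Q) ==> a : carrier (hom_sp D V) ==> fn k (pt (tens P Q) (hom_sp D V) z a) = ?b z a" by blast
  show ?thesis using k tp by (intro bexI[of _ k]) (simp_all add: pt_closed[OF P Q] graph_in)
qed

lemma q3_map:
  assumes a: "a : L P P'" and b: "b : L Q Q'" and d: "d : L D' D" and v: "v : L V V'"
    and p: "p : carrier P" and q: "q : carrier Q" and h: "h : L D V"
  shows "fn (tens_map (tens_map a b) (hom_map d v)) (q3 P Q D V p q h) = q3 P' Q' D' V' (fn a p) (fn b q) (v oo h oo d)"
  unfolding tens_map_pt[OF tens_map_L[OF a b] hom_map_L[OF d v] pt_closed[OF L_Ob(1)[OF a] L_Ob(1)[OF b] p q] graph_in[OF h]]
    tens_map_pt[OF a b p q] hom_map_app[OF d v h] ..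

end

context ind_obj
begin

subsection \<open>The tensor product as a double coend\<close>

abbreviation "TI Y V A B \<equiv> tens_integrand X Y V A B"
abbreviation "iO Y V A B \<equiv> fst (coend_of Vect Vect (TI Y V A B))"
abbreviation "iw Y V A B \<equiv> snd (coend_of Vect Vect (TI Y V A B))"
abbreviation "q5 Y V A B H \<equiv> q3 (Fo X B) (Fo Y H) (tens A H) V"
abbreviation "T5 Y V A B H \<equiv> tens (tens (Fo X B) (Fo Y H)) (hom_sp (tens A H) V)"
abbreviation "i3 Y V A B H x y h \<equiv> fn (iw Y V A B H) (q5 Y V A B H x y h)"

lemma TI_simps[simp]: "Fo (TI Y V A B) (A', B') = tens (tens (Fo X B) (Fo Y B')) (hom_sp (tens A A') V)"
  "Fa (TI Y V A B) (a, b) = tens_map (tens_map (idV (Fo X B)) (Fa Y b)) (hom_map (tens_map (idV A) a) (idV V))"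
  by (simp_all add: tens_integrand_def)

context
  fixes Y V A B
  assumes Y: "lf Y" and V: "V : Obj" and A: "A : Obj" and B: "B : Obj"
begin

lemmas q5O = lf_Ob[OF X B] lf_Ob[OF Y] tens_Obj[OF A] V

lemma typedT_TI: "typedT (TI Y V A B)"
  unfolding typedT_def TI_simps
  by (intro allI impI conjI tens_map_L hom_map_L lf_L[OF Y] idV_L A V lf_Ob[OF X B]; (assumption | erule L_Ob))

lemma TI_Obj: "H : Obj ==> Fo (TI Y V A B) (H, H) : Obj"
  unfolding TI_simps by (intro tens_Obj hom_Obj q5O)

lemma TI_arrow:
  assumes f: "f : L H H'"
  shows "Fa (TI Y V A B) (f, idV H) : L (Fo (TI Y V A B) (H', H)) (Fo (TI Y V A B) (H, H))"
    and "Fa (TI Y V A B) (idV H', f) : L (Fo (TI Y V A B) (H', H)) (Fo (TI Y V A B) (H', H'))"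
    and "x : el X B ==> y : el Y H ==> h : L (tens A H') V ==>
      fn (Fa (TI Y V A B) (f, idV H)) (q3 (Fo X B) (Fo Y H) (tens A H') V x y h) = q5 Y V A B H x y (h oo tens_map (idV A) f)"
    and "x : el X B ==> y : el Y H ==> h : L (tens A H') V ==>
      fn (Fa (TI Y V A B) (idV H', f)) (q3 (Fo X B) (Fo Y H) (tens A H') V x y h) = q5 Y V A B H' x (ap Y f y) h"
proof -
  note H = L_Ob[OF f] and iX = idV_L[OF lf_Ob[OF X B]] and iV = idV_L[OF V] and iA = idV_L[OF A]
  show "Fa (TI Y V A B) (f, idV H) : L (Fo (TI Y V A B) (H', H)) (Fo (TI Y V A B) (H, H))"
    "Fa (TI Y V A B) (idV H', f) : L (Fo (TI Y V A B) (H', H)) (Fo (TI Y V A B) (H', H'))"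
    using typedT_TI f unfolding typedT_def by blast+
  assume x: "x : el X B" and y: "y : el Y H" and h: "h : L (tens A H') V"
  note Af = tens_map_L[OF iA f]
  show "fn (Fa (TI Y V A B) (f, idV H)) (q3 (Fo X B) (Fo Y H) (tens A H') V x y h) = q5 Y V A B H x y (h oo tens_map (idV A) f)"
    unfolding TI_simps q3_map[OF iX lf_L[OF Y idV_L[OF H(1)]] Af iV x y h]
    using x y comp_id(1)[OF L_comp[OF h Af]] ap_id[OF Y H(1)] lf_Ob[OF X B] by simp
  show "fn (Fa (TI Y V A B) (idV H', f)) (q3 (Fo X B) (Fo Y H) (tens A H') V x y h) = q5 Y V A B H' x (ap Y f y) h"
    unfolding TI_simps tens_map_id[OF A H(2)] q3_map[OF iX lf_L[OF Y f] idV_L[OF tens_Obj[OF A H(2)]] iV x y h]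
    using x comp_id[OF h] by simp
qed

lemma TI_cowedgeI:
  assumes e: "e : Obj" and w: "!!H. H : Obj ==> w H : L (T5 Y V A B H) e"
    and d: "!!f H H' x y h. f : L H H' ==> x : el X B ==> y : el Y H ==> h : L (tens A H') V ==>
      fn (w H) (q5 Y V A B H x y (h oo tens_map (idV A) f)) = fn (w H') (q5 Y V A B H' x (ap Y f y) h)"
  shows "is_cowedge Vect Vect (TI Y V A B) e w"
proof (rule cowedgeI[OF e])
  show w': "w H : L (Fo (TI Y V A B) (H, H)) e" if "H : Obj" for H using w[OF that] by simp
  fix H H' f assume f: "f : L H H'"
  note F = TI_arrow[OF f] and H = L_Ob[OF f]
  note F1 = F(1,2)[unfolded TI_simps(1)]
  show "w H oo Fa (TI Y V A B) (f, idV H) = w H' oo Fa (TI Y V A B) (idV H', f)"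
  proof (rule q3_eqI[OF lf_Ob[OF X B] lf_Ob[OF Y H(1)] tens_Obj[OF A H(2)] V L_comp[OF w[OF H(1)] F1(1)] L_comp[OF w[OF H(2)] F1(2)]])
    fix x y h assume x: "x : el X B" and y: "y : el Y H" and h: "h : L (tens A H') V"
    note q = trilinD(5)[OF q3_trilin[OF lf_Ob[OF X B] lf_Ob[OF Y H(1)] tens_Obj[OF A H(2)] V] h x y]
    show "fn (w H oo Fa (TI Y V A B) (f, idV H)) (q3 (Fo X B) (Fo Y H) (tens A H') V x y h) =
      fn (w H' oo Fa (TI Y V A B) (idV H', f)) (q3 (Fo X B) (Fo Y H) (tens A H') V x y h)"
      unfolding comp_app'[OF F1(1) q] comp_app'[OF F1(2) q] F(3)[OF x y h] F(4)[OF x y h] by (rule d[OF f x y h])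
  qed
qed

lemma TI_cowedgeD:
  assumes c: "is_cowedge Vect Vect (TI Y V A B) e w" and f: "f : L H H'"
    and x: "x : el X B" and y: "y : el Y H" and h: "h : L (tens A H') V"
  shows "fn (w H) (q5 Y V A B H x y (h oo tens_map (idV A) f)) = fn (w H') (q5 Y V A B H' x (ap Y f y) h)"
proof -
  note F = TI_arrow[OF f] and H = L_Ob[OF f]
  have q: "q3 (Fo X B) (Fo Y H) (tens A H') V x y h : el (TI Y V A B) (H', H)"
    unfolding TI_simps by (rule trilinD(5)[OF q3_trilin[OF lf_Ob[OF X B] lf_Ob[OF Y H(1)] tens_Obj[OF A H(2)] V] h x y])
  show ?thesis
    unfolding F(3)[OF x y h, symmetric] F(4)[OF x y h, symmetric]
      comp_app'[OF F(1) q, symmetric] comp_app'[OF F(2) q, symmetric] cowedgeD(3)[OF c f] ..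
qed

text \<open>Dinaturality slides an arrow from \<open>y\<close> into \<open>h\<close>. As
  \<open>Y\<close> is generated at \<open>V1\<close>, every vector is reached from
  \<open>H = V1\<close>, so the inner coend exists by \<open>coend_exists\<close>.\<close>

lemma TI_coend:
  assumes g: "gens Y V1"
  shows "is_coend Vect Vect (TI Y V A B) (iO Y V A B) (iw Y V A B)"
proof -
  have V1: "V1 : Obj" using g by (simp add: gens_def)
  have "EX e w. is_coend Vect Vect (TI Y V A B) e w"
  proof (rule coend_exists[OF typedT_TI TI_Obj V1])
    fix H m assume H: "H : Obj" and m: "m : el (TI Y V A B) (H, H)"
    let ?R = "reach (TI Y V A B) V1 H"
    note Rc = reach_closed[OF TI_Obj[OF V1] V1 H, unfolded TI_simps]
    note O = lf_Ob[OF X B] lf_Ob[OF Y H] tens_Obj[OF A H] V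
    show "?R m"
    proof (rule q3_induct[OF O m[unfolded TI_simps]])
      fix x y h assume x: "x : el X B" and y: "y : el Y H" and h: "h : L (tens A H) V"
      note t = trilinD[OF q3_trilin[OF O] h]
      note l = is_linearD[OF t(2)[OF x]]
      show "?R (q5 Y V A B H x y h)"
      proof (rule gens_induct[OF g Y H y])
        fix \<psi> y0 assume \<psi>: "\<psi> : L V1 H" and y0: "y0 : el Y V1"
        show "?R (q5 Y V A B H x (ap Y \<psi> y0) h)" unfolding reach_def
        proof (intro bexI[of _ "q5 Y V A B V1 x y0 (h oo tens_map (idV A) \<psi>)"] allI impI)
          show "fn (w H) (q5 Y V A B H x (ap Y \<psi> y0) h) = fn (w V1) (q5 Y V A B V1 x y0 (h oo tens_map (idV A) \<psi>))"
            if "is_cowedge Vect Vect (TI Y V A B) e w" for e w by (rule TI_cowedgeD[OF that \<psi> x y0 h, symmetric])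
          show "q5 Y V A B V1 x y0 (h oo tens_map (idV A) \<psi>) : el (TI Y V A B) (V1, V1)" unfolding TI_simps
            by (rule trilinD(5)[OF q3_trilin[OF lf_Ob[OF X B] lf_Ob[OF Y V1] tens_Obj[OF A V1] V] L_comp[OF h tens_map_L[OF idV_L[OF A] \<psi>]] x y0])
        qed
      next
        show "?R (q5 Y V A B H x (zero (Fo Y H)) h)"
          unfolding is_linear_zero[OF O(2) tens_Obj[OF tens_Obj[OF O(1,2)] hom_Obj[OF O(3,4)]] t(2)[OF x y]] by (rule Rc(1))
        fix y y' assume y: "y : el Y H" and r: "?R (q5 Y V A B H x y h)"
        show "?R (q5 Y V A B H x (smult (Fo Y H) c y) h)" if "c : carrier K" for c
          unfolding l(3)[OF y that y] by (rule Rc(3)[OF that t(5)[OF x y] r])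
        assume y': "y' : el Y H" and r': "?R (q5 Y V A B H x y' h)"
        show "?R (q5 Y V A B H x (add (Fo Y H) y y') h)"
          unfolding l(2)[OF y y y'] by (rule Rc(2)[OF t(5)[OF x y] t(5)[OF x y'] r r'])
      qed
    qed (rule Rc; assumption)+
  qed
  then obtain e w where "is_coend Vect Vect (TI Y V A B) e w" by blast
  then show ?thesis by (rule coend_is_coend)
qed

context
  fixes V1 assumes g: "gens Y V1"
begin

lemmas TI_chosen = TI_coend[OF g] 
lemmas TI_w = cowedgeD(1)[OF coend_cowedge[OF TI_chosen]]

lemma iw_L: "H : Obj ==> iw Y V A B H : L (T5 Y V A B H) (iO Y V A B)"
  using cowedgeD(2)[OF coend_cowedge[OF TI_chosen]] by simp

lemma i3_trilin: "H : Obj ==> trilin (Fo X B) (Fo Y H) (tens A H) V (iO Y V A B) (i3 Y V A B H)"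
  by (rule trilin_comp[OF q3_trilin iw_L]) (simp_all add: q5O)

lemma i3_din:
  assumes "f : L H H'" "x : el X B" "y : el Y H" "h : L (tens A H') V"
  shows "i3 Y V A B H x y (h oo tens_map (idV A) f) = i3 Y V A B H' x (ap Y f y) h"
  by (rule TI_cowedgeD[OF coend_cowedge[OF TI_chosen] assms])

lemma iO_induct:
  assumes z: "z : carrier (iO Y V A B)"
    and R: "!!H x y h. H : Obj ==> x : el X B ==> y : el Y H ==> h : L (tens A H) V ==> R (i3 Y V A B H x y h)"
    "R (zero (iO Y V A B))"
    "!!x y. x : carrier (iO Y V A B) ==> y : carrier (iO Y V A B) ==> R x ==> R y ==> R (add (iO Y V A B) x y)"
    "!!c x. c : carrier K ==> x : carrier (iO Y V A B) ==> R x ==> R (smult (iO Y V A B) c x)"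
  shows "R z"
proof (rule coend_induct[OF TI_chosen typedT_TI z])
  fix H m assume H: "H : Obj" and m: "m : el (TI Y V A B) (H, H)"
  note l = iw_L[OF H]
  show "R (fn (iw Y V A B H) m)"
  proof (rule q3_induct[OF lf_Ob[OF X B] lf_Ob[OF Y H] tens_Obj[OF A H] V m[unfolded TI_simps]])
    show "R (fn (iw Y V A B H) (zero (T5 Y V A B H)))" unfolding L_zero[OF l] by (rule R(2))
    fix x y assume x: "x : carrier (T5 Y V A B H)" and r: "R (fn (iw Y V A B H) x)"
    show "R (fn (iw Y V A B H) (smult (T5 Y V A B H) c x))" if "c : carrier K" for c
      unfolding L_smult[OF l that x] by (rule R(4)[OF that L_app[OF l x] r])
    assume y: "y : carrier (T5 Y V A B H)" and r': "R (fn (iw Y V A B H) y)"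
    show "R (fn (iw Y V A B H) (add (T5 Y V A B H) x y))"
      unfolding L_add[OF l x y] by (rule R(3)[OF L_app[OF l x] L_app[OF l y] r r'])
  qed (rule R(1)[OF H])
qed (rule R(2-4); assumption)+

lemma iO_eqI:
  assumes f: "f : L (iO Y V A B) M" and f': "f' : L (iO Y V A B) M"
    and e: "!!H x y h. H : Obj ==> x : el X B ==> y : el Y H ==> h : L (tens A H) V ==>
      fn f (i3 Y V A B H x y h) = fn f' (i3 Y V A B H x y h)"
  shows "f = f'"
proof (rule L_eqI[OF f f'])
  fix z assume "z : carrier (iO Y V A B)"
  then show "fn f z = fn f' z"
    by (rule iO_induct) (simp_all add: e L_zero[OF f] L_zero[OF f'] L_add[OF f] L_add[OF f'] L_smult[OF f] L_smult[OF f'])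
qed

lemma iO_lift:
  assumes e: "e : Obj" and t: "!!H. H : Obj ==> trilin (Fo X B) (Fo Y H) (tens A H) V e (k H)"
    and d: "!!f H H' x y h. f : L H H' ==> x : el X B ==> y : el Y H ==> h : L (tens A H') V ==>
      k H x y (h oo tens_map (idV A) f) = k H' x (ap Y f y) h"
  shows "EX l:L (iO Y V A B) e. ALL H:Obj. ALL x:el X B. ALL y:el Y H. ALL h:L (tens A H) V.
    fn l (i3 Y V A B H x y h) = k H x y h"
proof -
  have "ALL H:Obj. EX w. w : L (T5 Y V A B H) e &
    (ALL x:el X B. ALL y:el Y H. ALL h:L (tens A H) V. fn w (q5 Y V A B H x y h) = k H x y h)"
  proof
    fix H assume H: "H : Obj"
    show "EX w. w : L (T5 Y V A B H) e &
      (ALL x:el X B. ALL y:el Y H. ALL h:L (tens A H) V. fn w (q5 Y V A B H x y h) = k H x y h)"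
      using q3_lift[OF lf_Ob[OF X B] lf_Ob[OF Y H] tens_Obj[OF A H] V e t[OF H]] unfolding Bex_def .
  qed
  then obtain w where w0: "ALL H:Obj. w H : L (T5 Y V A B H) e &
    (ALL x:el X B. ALL y:el Y H. ALL h:L (tens A H) V. fn (w H) (q5 Y V A B H x y h) = k H x y h)"
    by (rule exE[OF bchoice])
  have w: "w H : L (T5 Y V A B H) e" if "H : Obj" for H using bspec[OF w0 that] by blast
  have wk: "fn (w H) (q5 Y V A B H x y h) = k H x y h"
    if "H : Obj" "x : el X B" "y : el Y H" "h : L (tens A H) V" for H x y h
    using bspec[OF w0 that(1)] that(2-4) by blast
  have "is_cowedge Vect Vect (TI Y V A B) e w"
  proof (rule TI_cowedgeI[OF e w])
    fix f H H' x y h assume a: "f : L H H'" "x : el X B" "y : el Y H" "h : L (tens A H') V"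
    show "fn (w H) (q5 Y V A B H x y (h oo tens_map (idV A) f)) = fn (w H') (q5 Y V A B H' x (ap Y f y) h)"
      unfolding wk[OF L_Ob(1)[OF a(1)] a(2,3) L_comp[OF a(4) tens_map_L[OF idV_L[OF A] a(1)]]]
        wk[OF L_Ob(2)[OF a(1)] a(2) ap_closed[OF Y a(1,3)] a(4)] by (rule d[OF a])
  qed
  from coend_lift[OF TI_chosen this] obtain l where l: "l : L (iO Y V A B) e" "!!H. H : Obj ==> l oo iw Y V A B H = w H" by blast
  show ?thesis
  proof (intro bexI[OF _ l(1)] ballI)
    fix H x y h assume a: "H : Obj" "x : el X B" "y : el Y H" "h : L (tens A H) V"
    show "fn l (i3 Y V A B H x y h) = k H x y h"
      unfolding wk[OF a, symmetric] l(2)[OF a(1), symmetric]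
      by (rule comp_app'[OF iw_L[OF a(1)] trilinD(5)[OF q3_trilin a(4,2,3)], symmetric]) (simp_all add: q5O a(1))
  qed
qed

end
end


lemma Ind_gens: assumes "Y : Ob Ind" shows "EX V. gens Y V"
  using assms unfolding Ob_Ind by blast

lemma inner_map:
  assumes S: "Y : Ob Ind" "Y' : Ob Ind" and \<eta>: "\<eta> : NT Y Y'" and v: "v : L V V'" and a: "a : L A A'" and b: "b : L B B'"
  shows "tens_inner_map X \<eta> v a b : L (iO Y V A' B) (iO Y' V' A B')"
    and "H : Obj ==> x : el X B ==> y : el Y H ==> h : L (tens A' H) V ==>
      fn (tens_inner_map X \<eta> v a b) (i3 Y V A' B H x y h) =
      i3 Y' V' A B' H (ap X b x) (nt \<eta> H y) (v oo h oo tens_map a (idV H))"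
proof -
  note Y = NT_lf[OF \<eta>] and VO = L_Ob[OF v] and AO = L_Ob[OF a] and BO = L_Ob[OF b]
  obtain V1 V1' where g: "gens Y V1" "gens Y' V1'" using Ind_gens[OF S(1)] Ind_gens[OF S(2)] by blast
  note w = iw_L[OF Y(1) VO(1) AO(2) BO(1) g(1)] and w' = iw_L[OF Y(2) VO(2) AO(1) BO(2) g(2)]
  let ?t = "%H. tens_map (tens_map (Fa X b) (fn \<eta> H)) (hom_map (tens_map a (idV H)) v)"
  have aH: "tens_map a (idV H) : L (tens A H) (tens A' H)" if "H : Obj" for H by (rule tens_map_L[OF a idV_L[OF that]])
  have t: "?t H : L (T5 Y V A' B H) (T5 Y' V' A B' H)" if H: "H : Obj" for H
    by (intro tens_map_L hom_map_L lf_L[OF X b] NT_L[OF \<eta> H] aH[OF H] v)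
  have tq: "fn (iw Y' V' A B' H oo ?t H) (q5 Y V A' B H x y h) =
      i3 Y' V' A B' H (ap X b x) (nt \<eta> H y) (v oo h oo tens_map a (idV H))"
    if H: "H : Obj" and x: "x : el X B" and y: "y : el Y H" and h: "h : L (tens A' H) V" for H x y h
    unfolding comp_app'[OF t[OF H] trilinD(5)[OF q3_trilin[OF lf_Ob[OF X BO(1)] lf_Ob[OF Y(1) H] tens_Obj[OF AO(2) H] VO(1)] h x y]]
      q3_map[OF lf_L[OF X b] NT_L[OF \<eta> H] aH[OF H] v x y h] ..
  have "is_cowedge Vect Vect (TI Y V A' B) (iO Y' V' A B') (%H. iw Y' V' A B' H oo ?t H)"
  proof (rule TI_cowedgeI[OF Y(1) VO(1) AO(2) BO(1) TI_w[OF Y(2) VO(2) AO(1) BO(2) g(2)] L_comp[OF w' t]])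
    fix f H H' x y h
    assume f: "f : L H H'" and x: "x : el X B" and y: "y : el Y H" and h: "h : L (tens A' H') V"
    note H = L_Ob[OF f] and A'f = tens_map_L[OF idV_L[OF AO(2)] f] and Af = tens_map_L[OF idV_L[OF AO(1)] f]
    note vh = L_comp[OF v h]
    have "v oo (h oo tens_map (idV A') f) oo tens_map a (idV H) = (v oo h oo tens_map a (idV H')) oo tens_map (idV A) f"
      using comp_assoc[OF v L_comp[OF h aH[OF H(2)]] Af] comp_assoc[OF h aH[OF H(2)] Af] comp_assoc[OF h A'f aH[OF H(1)]]
        tens_map_comp[OF a idV_L[OF H(1)] idV_L[OF AO(2)] f] tens_map_comp[OF idV_L[OF AO(1)] f a idV_L[OF H(2)]]
        comp_id[OF a] comp_id[OF f] by simp
    then show "fn (iw Y' V' A B' H oo ?t H) (q5 Y V A' B H x y (h oo tens_map (idV A') f)) =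
      fn (iw Y' V' A B' H' oo ?t H') (q5 Y V A' B H' x (ap Y f y) h)"
      unfolding tq[OF H(1) x y L_comp[OF h A'f]] tq[OF H(2) x ap_closed[OF Y(1) f y] h] nt_nat[OF \<eta> f y]
      using i3_din[OF Y(2) VO(2) AO(1) BO(2) g(2) f ap_closed[OF X b x] nt_closed[OF \<eta> H(1) y] L_comp[OF v L_comp[OF h aH[OF H(2)]]]]
      by simp
  qed
  from coend_map_props[OF TI_chosen[OF Y(1) VO(1) AO(2) BO(1) g(1)] this]
  have m: "tens_inner_map X \<eta> v a b : L (iO Y V A' B) (iO Y' V' A B') &
    (ALL H:Obj. tens_inner_map X \<eta> v a b oo iw Y V A' B H = iw Y' V' A B' H oo ?t H)"
    unfolding tens_inner_map_def NT_src[OF \<eta>] L_src[OF v] L_src[OF a] L_src[OF b] .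
  then show "tens_inner_map X \<eta> v a b : L (iO Y V A' B) (iO Y' V' A B')" by (rule conjunct1)
  assume H: "H : Obj" and x: "x : el X B" and y: "y : el Y H" and h: "h : L (tens A' H) V"
  show "fn (tens_inner_map X \<eta> v a b) (i3 Y V A' B H x y h) =
      i3 Y' V' A B' H (ap X b x) (nt \<eta> H y) (v oo h oo tens_map a (idV H))"
    unfolding tq[OF H x y h, symmetric] bspec[OF conjunct2[OF m] H, symmetric]
    by (rule comp_app'[OF w[OF H] trilinD(5)[OF q3_trilin[OF lf_Ob[OF X BO(1)] lf_Ob[OF Y(1) H] tens_Obj[OF AO(2) H] VO(1)] h x y], symmetric])
qed

text \<open>\<open>uu Y V A H x y h\<close> is the class of \<open>(x \<otimes> y) \<otimes> h\<close> in \<open>(X \<otimes> Y)(V)\<close>.\<close>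

abbreviation "TO Y V \<equiv> tens_inner X Y V"
abbreviation "ow Y V \<equiv> snd (coend_of Vect Vect (TO Y V))"
abbreviation "uu Y V A H x y h \<equiv> fn (ow Y V A) (i3 Y V A A H x y h)"

lemma TO_simps[simp]: "Fo (TO Y V) (A, B) = iO Y V A B" "Fa (TO Y V) (a, b) = tens_inner_map X (Idn FunVect Y) (idV V) a b"
  by (simp_all add: tens_inner_def)

context
  fixes Y V
  assumes S: "Y : Ob Ind" and V: "V : Obj"
begin

lemmas Y = Ind_lf[OF S]

lemma TO_Obj: "A : Obj ==> B : Obj ==> iO Y V A B : Obj"
  using Ind_gens[OF S] TI_w[OF Y V] by blast

lemma TO_arrow:
  assumes f: "f : L A B"
  shows "Fa (TO Y V) (f, idV A) : L (iO Y V B A) (iO Y V A A)"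
    and "Fa (TO Y V) (idV B, f) : L (iO Y V B A) (iO Y V B B)"
    and "H : Obj ==> x : el X A ==> y : el Y H ==> h : L (tens B H) V ==>
      fn (Fa (TO Y V) (f, idV A)) (i3 Y V B A H x y h) = i3 Y V A A H x y (h oo tens_map f (idV H))"
    and "H : Obj ==> x : el X A ==> y : el Y H ==> h : L (tens B H) V ==>
      fn (Fa (TO Y V) (idV B, f)) (i3 Y V B A H x y h) = i3 Y V B B H (ap X f x) y h"
proof -
  note AB = L_Ob[OF f] and i = NT_id[OF Y] and iV = idV_L[OF V]
  note m1 = inner_map[OF S S i(1) iV f idV_L[OF AB(1)]] and m2 = inner_map[OF S S i(1) iV idV_L[OF AB(2)] f]
  show "Fa (TO Y V) (f, idV A) : L (iO Y V B A) (iO Y V A A)" unfolding TO_simps by (rule m1(1))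
  show "Fa (TO Y V) (idV B, f) : L (iO Y V B A) (iO Y V B B)" unfolding TO_simps by (rule m2(1))
  assume H: "H : Obj" and x: "x : el X A" and y: "y : el Y H" and h: "h : L (tens B H) V"
  note fH = tens_map_L[OF f idV_L[OF H]]
  show "fn (Fa (TO Y V) (f, idV A)) (i3 Y V B A H x y h) = i3 Y V A A H x y (h oo tens_map f (idV H))"
    unfolding TO_simps m1(2)[OF H x y h] i(2)[OF H y] ap_id[OF X AB(1) x] comp_id(1)[OF L_comp[OF h fH]] ..
  show "fn (Fa (TO Y V) (idV B, f)) (i3 Y V B A H x y h) = i3 Y V B B H (ap X f x) y h"
    unfolding TO_simps m2(2)[OF H x y h] i(2)[OF H y] tens_map_id[OF AB(2) H] comp_id(2)[OF h] comp_id(1)[OF h] ..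
qed

lemma typedT_TO: "typedT (TO Y V)"
  unfolding typedT_def using TO_arrow(1,2) by simp

lemma TO_cowedgeD:
  assumes c: "is_cowedge Vect Vect (TO Y V) e w" and f: "f : L A B" and H: "H : Obj"
    and x: "x : el X A" and y: "y : el Y H" and h: "h : L (tens B H) V"
  shows "fn (w A) (i3 Y V A A H x y (h oo tens_map f (idV H))) = fn (w B) (i3 Y V B B H (ap X f x) y h)"
proof -
  note F = TO_arrow[OF f] and AB = L_Ob[OF f]
  obtain V1 where g: "gens Y V1" using Ind_gens[OF S] by blast
  note z = trilinD(5)[OF i3_trilin[OF Y V AB(2,1) g H] h x y]
  show ?thesis unfolding F(3,4)[OF H x y h, symmetric]
    comp_app'[OF F(1) z, symmetric] comp_app'[OF F(2) z, symmetric] cowedgeD(3)[OF c f] ..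
qed

text \<open>The same sliding in the outer variable: \<open>X\<close> is generated at
  \<open>V0\<close>, and an arrow acting on \<open>x\<close> moves into \<open>h\<close>, so
  everything is reached from \<open>A = V0\<close>.\<close>

lemma TO_coend: "is_coend Vect Vect (TO Y V) (tens_ob X Y V) (ow Y V)"
proof -
  obtain V1 where g: "gens Y V1" using Ind_gens[OF S] by blast
  have "EX e w. is_coend Vect Vect (TO Y V) e w"
  proof (rule coend_exists[OF typedT_TO _ V0])
    show "Fo (TO Y V) (A, A) : Obj" if "A : Obj" for A unfolding TO_simps by (rule TO_Obj[OF that that])
    fix A m assume A: "A : Obj" and m: "m : el (TO Y V) (A, A)"
    let ?R = "reach (TO Y V) V0 A"
    have "Fo (TO Y V) (V0, V0) : Obj" unfolding TO_simps by (rule TO_Obj[OF V0 V0])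
    note Rc = reach_closed[OF this V0 A, unfolded TO_simps]
    show "?R m"
    proof (rule iO_induct[OF Y V A A g m[unfolded TO_simps]])
      fix H x y h assume H: "H : Obj" and x: "x : el X A" and y: "y : el Y H" and h: "h : L (tens A H) V"
      note t = trilinD[OF i3_trilin[OF Y V A A g H] h] 
      note l = is_linearD[OF t(1)[OF y]]
      show "?R (i3 Y V A A H x y h)"
      proof (rule gens_induct[OF gX X A x])
        fix \<phi> x0 assume \<phi>: "\<phi> : L V0 A" and x0: "x0 : el X V0"
        show "?R (i3 Y V A A H (ap X \<phi> x0) y h)" unfolding reach_def
        proof (intro bexI[of _ "i3 Y V V0 V0 H x0 y (h oo tens_map \<phi> (idV H))"] allI impI)
          show "fn (w A) (i3 Y V A A H (ap X \<phi> x0) y h) = fn (w V0) (i3 Y V V0 V0 H x0 y (h oo tens_map \<phi> (idV H)))"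
            if "is_cowedge Vect Vect (TO Y V) e w" for e w by (rule TO_cowedgeD[OF that \<phi> H x0 y h, symmetric])
          show "i3 Y V V0 V0 H x0 y (h oo tens_map \<phi> (idV H)) : el (TO Y V) (V0, V0)" unfolding TO_simps
            by (rule trilinD(5)[OF i3_trilin[OF Y V V0 V0 g H] L_comp[OF h tens_map_L[OF \<phi> idV_L[OF H]]] x0 y])
        qed
      next
        show "?R (i3 Y V A A H (zero (Fo X A)) y h)"
          unfolding is_linear_zero[OF lf_Ob[OF X A] TO_Obj[OF A A] t(1)[OF y x]] by (rule Rc(1))
        fix x x' assume x: "x : el X A" and r: "?R (i3 Y V A A H x y h)"
        show "?R (i3 Y V A A H (smult (Fo X A) c x) y h)" if "c : carrier K" for c
          unfolding l(3)[OF x that x] by (rule Rc(3)[OF that t(5)[OF x y] r])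
        assume x': "x' : el X A" and r': "?R (i3 Y V A A H x' y h)"
        show "?R (i3 Y V A A H (add (Fo X A) x x') y h)"
          unfolding l(2)[OF x x x'] by (rule Rc(2)[OF t(5)[OF x y] t(5)[OF x' y] r r'])
      qed
    qed (rule Rc; assumption)+
  qed
  then obtain e w where "is_coend Vect Vect (TO Y V) e w" by blast
  then show ?thesis unfolding tens_ob_def by (rule coend_is_coend)
qed

lemmas tens_ob_Obj = cowedgeD(1)[OF coend_cowedge[OF TO_coend]]

lemma ow_L: "A : Obj ==> ow Y V A : L (iO Y V A A) (tens_ob X Y V)"
  using cowedgeD(2)[OF coend_cowedge[OF TO_coend]] by simp

lemma u_trilin: "A : Obj ==> H : Obj ==> trilin (Fo X A) (Fo Y H) (tens A H) V (tens_ob X Y V) (uu Y V A H)"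
  using Ind_gens[OF S] trilin_comp[OF i3_trilin[OF Y V] ow_L] by blast

lemma u_closed: "A : Obj ==> H : Obj ==> x : el X A ==> y : el Y H ==> h : L (tens A H) V ==>
    uu Y V A H x y h : carrier (tens_ob X Y V)"
  by (rule trilinD(5)[OF u_trilin])

lemma u_din1:
  assumes A: "A : Obj" and f: "f : L H H'" "x : el X A" "y : el Y H" "h : L (tens A H') V"
  shows "uu Y V A H x y (h oo tens_map (idV A) f) = uu Y V A H' x (ap Y f y) h"
proof -
  obtain V1 where g: "gens Y V1" using Ind_gens[OF S] by blast
  show ?thesis using i3_din[OF Y V A A g f] by simp
qed

lemma u_din2:
  assumes "f : L A A'" "H : Obj" "x : el X A" "y : el Y H" "h : L (tens A' H) V"
  shows "uu Y V A H x y (h oo tens_map f (idV H)) = uu Y V A' H (ap X f x) y h"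
  by (rule TO_cowedgeD[OF coend_cowedge[OF TO_coend] assms])

lemma u_induct:
  assumes z: "z : carrier (tens_ob X Y V)"
    and R: "!!A H x y h. A : Obj ==> H : Obj ==> x : el X A ==> y : el Y H ==> h : L (tens A H) V ==> R (uu Y V A H x y h)"
    "R (zero (tens_ob X Y V))"
    "!!x y. x : carrier (tens_ob X Y V) ==> y : carrier (tens_ob X Y V) ==> R x ==> R y ==> R (add (tens_ob X Y V) x y)"
    "!!c x. c : carrier K ==> x : carrier (tens_ob X Y V) ==> R x ==> R (smult (tens_ob X Y V) c x)"
  shows "R z"
proof (rule coend_induct[OF TO_coend typedT_TO z])
  fix A m assume A: "A : Obj" and m: "m : el (TO Y V) (A, A)"
  obtain V1 where g: "gens Y V1" using Ind_gens[OF S] by blast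
  note l = ow_L[OF A]
  show "R (fn (ow Y V A) m)"
  proof (rule iO_induct[OF Y V A A g m[unfolded TO_simps]])
    show "R (fn (ow Y V A) (zero (iO Y V A A)))" unfolding L_zero[OF l] by (rule R(2))
    fix x y assume x: "x : carrier (iO Y V A A)" and r: "R (fn (ow Y V A) x)"
    show "R (fn (ow Y V A) (smult (iO Y V A A) c x))" if "c : carrier K" for c
      unfolding L_smult[OF l that x] by (rule R(4)[OF that L_app[OF l x] r])
    assume y: "y : carrier (iO Y V A A)" and r': "R (fn (ow Y V A) y)"
    show "R (fn (ow Y V A) (add (iO Y V A A) x y))"
      unfolding L_add[OF l x y] by (rule R(3)[OF L_app[OF l x] L_app[OF l y] r r'])
  qed (rule R(1)[OF A])
qed (rule R(2-4); assumption)+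

lemma u_eqI:
  assumes f: "f : L (tens_ob X Y V) M" and f': "f' : L (tens_ob X Y V) M" and z: "z : carrier (tens_ob X Y V)"
    and e: "!!A H x y h. A : Obj ==> H : Obj ==> x : el X A ==> y : el Y H ==> h : L (tens A H) V ==>
      fn f (uu Y V A H x y h) = fn f' (uu Y V A H x y h)"
  shows "fn f z = fn f' z"
  using z by (rule u_induct) (simp_all add: e L_zero[OF f] L_zero[OF f'] L_add[OF f] L_add[OF f'] L_smult[OF f] L_smult[OF f'])

text \<open>The universal property of the double coend on generators: trilinear maps that are
  dinatural in \<open>A\<close> and in \<open>H\<close> separately. The inner coends are handled
  first, for each \<open>A\<close>.\<close>

lemma u_lift:
  assumes e: "e : Obj" and t: "!!A H. A : Obj ==> H : Obj ==> trilin (Fo X A) (Fo Y H) (tens A H) V e (k A H)"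
    and d1: "!!A f H H' x y h. A : Obj ==> f : L H H' ==> x : el X A ==> y : el Y H ==> h : L (tens A H') V ==>
      k A H x y (h oo tens_map (idV A) f) = k A H' x (ap Y f y) h"
    and d2: "!!H f A A' x y h. H : Obj ==> f : L A A' ==> x : el X A ==> y : el Y H ==> h : L (tens A' H) V ==>
      k A H x y (h oo tens_map f (idV H)) = k A' H (ap X f x) y h"
  shows "EX l:L (tens_ob X Y V) e. ALL A:Obj. ALL H:Obj. ALL x:el X A. ALL y:el Y H. ALL h:L (tens A H) V.
    fn l (uu Y V A H x y h) = k A H x y h"
proof -
  obtain V1 where g: "gens Y V1" using Ind_gens[OF S] by blast
  have "ALL A:Obj. EX w. w : L (iO Y V A A) e & (ALL H:Obj. ALL x:el X A. ALL y:el Y H. ALL h:L (tens A H) V.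
    fn w (i3 Y V A A H x y h) = k A H x y h)"
  proof
    fix A assume A: "A : Obj"
    show "EX w. w : L (iO Y V A A) e & (ALL H:Obj. ALL x:el X A. ALL y:el Y H. ALL h:L (tens A H) V.
      fn w (i3 Y V A A H x y h) = k A H x y h)"
      using iO_lift[where k = "k A", OF Y V A A g e t[OF A] d1[OF A]] unfolding Bex_def .
  qed
  then obtain w where w0: "ALL A:Obj. w A : L (iO Y V A A) e & (ALL H:Obj. ALL x:el X A. ALL y:el Y H. ALL h:L (tens A H) V.
    fn (w A) (i3 Y V A A H x y h) = k A H x y h)"
    by (rule exE[OF bchoice])
  have w: "w A : L (iO Y V A A) e" if "A : Obj" for A using bspec[OF w0 that] by blast
  have wk: "fn (w A) (i3 Y V A A H x y h) = k A H x y h"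
    if "A : Obj" "H : Obj" "x : el X A" "y : el Y H" "h : L (tens A H) V" for A H x y h
    using bspec[OF w0 that(1)] that(2-5) by blast
  have "is_cowedge Vect Vect (TO Y V) e w"
  proof (rule cowedgeI[OF e])
    show "w A : L (Fo (TO Y V) (A, A)) e" if "A : Obj" for A using w[OF that] by simp
    fix A B f assume f: "f : L A B"
    note F = TO_arrow[OF f] and AB = L_Ob[OF f]
    show "w A oo Fa (TO Y V) (f, idV A) = w B oo Fa (TO Y V) (idV B, f)"
    proof (rule iO_eqI[OF Y V AB(2,1) g L_comp[OF w[OF AB(1)] F(1)] L_comp[OF w[OF AB(2)] F(2)]])
      fix H x y h assume H: "H : Obj" and x: "x : el X A" and y: "y : el Y H" and h: "h : L (tens B H) V"
      note z = trilinD(5)[OF i3_trilin[OF Y V AB(2,1) g H] h x y]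
      show "fn (w A oo Fa (TO Y V) (f, idV A)) (i3 Y V B A H x y h) = fn (w B oo Fa (TO Y V) (idV B, f)) (i3 Y V B A H x y h)"
        unfolding comp_app'[OF F(1) z] comp_app'[OF F(2) z] F(3,4)[OF H x y h] wk[OF AB(2) H ap_closed[OF X f x] y h]
          wk[OF AB(1) H x y L_comp[OF h tens_map_L[OF f idV_L[OF H]]]]
        by (rule d2[OF H f x y h])
    qed
  qed
  from coend_lift[OF TO_coend this] obtain l where l: "l : L (tens_ob X Y V) e" "!!A. A : Obj ==> l oo ow Y V A = w A" by blast
  show ?thesis
  proof (intro bexI[OF _ l(1)] ballI)
    fix A H x y h assume a: "A : Obj" "H : Obj" "x : el X A" "y : el Y H" "h : L (tens A H) V"
    show "fn l (uu Y V A H x y h) = k A H x y h"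
      unfolding wk[OF a, symmetric] l(2)[OF a(1), symmetric]
      by (rule comp_app'[OF ow_L[OF a(1)] trilinD(5)[OF i3_trilin[OF Y V a(1,1) g a(2)] a(5,3,4)], symmetric])
  qed
qed

end

lemma u_map:
  assumes S: "Y : Ob Ind" "Y' : Ob Ind" and \<eta>: "\<eta> : NT Y Y'" and v: "v : L V V'"
  shows "tens_ar X \<eta> v : L (tens_ob X Y V) (tens_ob X Y' V')"
    and "A : Obj ==> H : Obj ==> x : el X A ==> y : el Y H ==> h : L (tens A H) V ==>
      fn (tens_ar X \<eta> v) (uu Y V A H x y h) = uu Y' V' A H x (nt \<eta> H y) (v oo h)"
proof -
  note Y = NT_lf[OF \<eta>] and VO = L_Ob[OF v]
  obtain V1 V1' where g: "gens Y V1" "gens Y' V1'" using Ind_gens[OF S(1)] Ind_gens[OF S(2)] by blast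
  let ?t = "%A. tens_inner_map X \<eta> v (idV A) (idV A)"
  have t: "?t A : L (iO Y V A A) (iO Y' V' A A)" if "A : Obj" for A by (rule inner_map(1)[OF S \<eta> v idV_L[OF that] idV_L[OF that]])
  note w = ow_L[OF S(1) VO(1)] and w' = ow_L[OF S(2) VO(2)]
  have tu: "fn (ow Y' V' A oo ?t A) (i3 Y V A A H x y h) = uu Y' V' A H x (nt \<eta> H y) (v oo h)"
    if A: "A : Obj" and H: "H : Obj" and x: "x : el X A" and y: "y : el Y H" and h: "h : L (tens A H) V" for A H x y h
    unfolding comp_app'[OF t[OF A] trilinD(5)[OF i3_trilin[OF Y(1) VO(1) A A g(1) H] h x y]]
      inner_map(2)[OF S \<eta> v idV_L[OF A] idV_L[OF A] H x y h] ap_id[OF X A x] tens_map_id[OF A H] comp_id(2)[OF h] ..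
  have "is_cowedge Vect Vect (TO Y V) (tens_ob X Y' V') (%A. ow Y' V' A oo ?t A)"
  proof (rule cowedgeI[OF tens_ob_Obj[OF S(2) VO(2)]])
    show "ow Y' V' A oo ?t A : L (Fo (TO Y V) (A, A)) (tens_ob X Y' V')" if "A : Obj" for A
      using L_comp[OF w' t] that by simp
    fix A B f assume f: "f : L A B"
    note F = TO_arrow[OF S(1) VO(1) f] and AB = L_Ob[OF f]
    show "(ow Y' V' A oo ?t A) oo Fa (TO Y V) (f, idV A) = (ow Y' V' B oo ?t B) oo Fa (TO Y V) (idV B, f)"
    proof (rule iO_eqI[OF Y(1) VO(1) AB(2,1) g(1) L_comp[OF L_comp[OF w' t] F(1)] L_comp[OF L_comp[OF w' t] F(2)]])
      fix H x y h assume H: "H : Obj" and x: "x : el X A" and y: "y : el Y H" and h: "h : L (tens B H) V"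
      note z = trilinD(5)[OF i3_trilin[OF Y(1) VO(1) AB(2,1) g(1) H] h x y] and fH = tens_map_L[OF f idV_L[OF H]]
      show "fn ((ow Y' V' A oo ?t A) oo Fa (TO Y V) (f, idV A)) (i3 Y V B A H x y h) =
        fn ((ow Y' V' B oo ?t B) oo Fa (TO Y V) (idV B, f)) (i3 Y V B A H x y h)"
        unfolding comp_app'[OF F(1) z] comp_app'[OF F(2) z] F(3,4)[OF H x y h] tu[OF AB(2) H ap_closed[OF X f x] y h]
          tu[OF AB(1) H x y L_comp[OF h fH]] comp_assoc[OF v h fH, symmetric]
        by (rule u_din2[OF S(2) VO(2) f H x nt_closed[OF \<eta> H y] L_comp[OF v h]])
    qed (use AB in simp_all)
  qed
  from coend_map_props[OF TO_coend[OF S(1) VO(1)] this[unfolded tens_ob_def]]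
  have m: "tens_ar X \<eta> v : L (tens_ob X Y V) (tens_ob X Y' V') & (ALL A:Obj. tens_ar X \<eta> v oo ow Y V A = ow Y' V' A oo ?t A)"
    unfolding tens_ar_def tens_ob_def NT_src[OF \<eta>] L_src[OF v] .
  then show "tens_ar X \<eta> v : L (tens_ob X Y V) (tens_ob X Y' V')" by (rule conjunct1)
  assume A: "A : Obj" and H: "H : Obj" and x: "x : el X A" and y: "y : el Y H" and h: "h : L (tens A H) V"
  show "fn (tens_ar X \<eta> v) (uu Y V A H x y h) = uu Y' V' A H x (nt \<eta> H y) (v oo h)"
    unfolding tu[OF A H x y h, symmetric] bspec[OF conjunct2[OF m] A, symmetric]
    by (rule comp_app'[OF w[OF A] trilinD(5)[OF i3_trilin[OF Y(1) VO(1) A A g(1) H] h x y], symmetric])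
qed


lemma u_ap:
  assumes S: "Y : Ob Ind" and f: "f : L V V'" and a: "A : Obj" "H : Obj" "x : el X A" "y : el Y H" "h : L (tens A H) V"
  shows "fn (tens_ar X (Idn FunVect Y) f) (uu Y V A H x y h) = uu Y V' A H x y (f oo h)"
  using u_map(2)[OF S S NT_id(1)[OF Ind_lf[OF S]] f a] NT_id(2)[OF Ind_lf[OF S] a(2,4)] by simp

sublocale U: two_var elts K "%Y. Y : Ob Ind" "tens_ob X" "tens_ar X"
proof (unfold_locales)
  show "lf Y" if "Y : Ob Ind" for Y using that by simp
  show "tens_ob X Y W : Obj" if "Y : Ob Ind" "W : Obj" for Y W by (rule tens_ob_Obj[OF that])
  show "tens_ar X \<eta> w : L (tens_ob X Y W) (tens_ob X Y' W')"
    if "Y : Ob Ind" "Y' : Ob Ind" "\<eta> : NT Y Y'" "w : L W W'" for \<eta> Y Y' w W W' by (rule u_map(1)[OF that])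
next
  fix Y W z assume S: "Y : Ob Ind" and W: "W : Obj" and z: "z : carrier (tens_ob X Y W)"
  note i = NT_id(1)[OF Ind_lf[OF S]]
  have "fn (tens_ar X (Idn FunVect Y) (idV W)) z = fn (idV (tens_ob X Y W)) z"
    by (rule u_eqI[OF S W u_map(1)[OF S S i idV_L[OF W]] idV_L[OF tens_ob_Obj[OF S W]] z])
       (simp add: u_ap[OF S idV_L[OF W]] u_closed[OF S W] tens_ob_Obj[OF S W])
  then show "fn (tens_ar X (Idn FunVect Y) (idV W)) z = z" using z tens_ob_Obj[OF S W] by simp
next
  fix Y Y' Y'' \<eta> \<eta>' W W' W'' w w' z
  assume S: "Y : Ob Ind" "Y' : Ob Ind" "Y'' : Ob Ind" and \<eta>: "\<eta> : NT Y Y'" "\<eta>' : NT Y' Y''" and w: "w : L W W'" "w' : L W' W''"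
    and z: "z : carrier (tens_ob X Y W)"
  note W = L_Ob(1)[OF w(1)]
  note c = NT_comp[OF \<eta>(2,1)] and wc = L_comp[OF w(2,1)]
  note l = u_map[OF S(1,2) \<eta>(1) w(1)] and l' = u_map[OF S(2,3) \<eta>(2) w(2)]
  have "fn (tens_ar X (Cmp FunVect \<eta>' \<eta>) (w' oo w)) z = fn (tens_ar X \<eta>' w' oo tens_ar X \<eta> w) z"
  proof (rule u_eqI[OF S(1) W u_map(1)[OF S(1,3) c(1) wc] L_comp[OF l'(1) l(1)] z])
    fix A H x y h assume a: "A : Obj" "H : Obj" "x : el X A" "y : el Y H" "h : L (tens A H) W"
    show "fn (tens_ar X (Cmp FunVect \<eta>' \<eta>) (w' oo w)) (uu Y W A H x y h) = fn (tens_ar X \<eta>' w' oo tens_ar X \<eta> w) (uu Y W A H x y h)"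
      unfolding comp_app'[OF l(1) u_closed[OF S(1) W a]] l(2)[OF a] u_map(2)[OF S(1,3) c(1) wc a] c(2)[OF a(2,4)]
        l'(2)[OF a(1-3) nt_closed[OF \<eta>(1) a(2,4)] L_comp[OF w(1) a(5)]] comp_assoc[OF w(2,1) a(5)] ..
  qed
  then show "fn (tens_ar X (Cmp FunVect \<eta>' \<eta>) (w' oo w)) z = fn (tens_ar X \<eta>' w') (fn (tens_ar X \<eta> w) z)"
    unfolding comp_app'[OF l(1) z] .
next
  fix Y W W' w w' z assume S: "Y : Ob Ind" and w: "w : L W W'" "w' : L W W'" and z: "z : carrier (tens_ob X Y W)"
  note i = NT_id(1)[OF Ind_lf[OF S]] and O = L_Ob[OF w(1)]
  note l = u_map(1)[OF S S i w(1)] u_map(1)[OF S S i w(2)]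
  have "fn (tens_ar X (Idn FunVect Y) (lin_add w w')) z = fn (lin_add (tens_ar X (Idn FunVect Y) w) (tens_ar X (Idn FunVect Y) w')) z"
  proof (rule u_eqI[OF S O(1) u_map(1)[OF S S i lin_add_L[OF w]] lin_add_L[OF l] z])
    fix A H x y h assume a: "A : Obj" "H : Obj" "x : el X A" "y : el Y H" "h : L (tens A H) W"
    show "fn (tens_ar X (Idn FunVect Y) (lin_add w w')) (uu Y W A H x y h) =
      fn (lin_add (tens_ar X (Idn FunVect Y) w) (tens_ar X (Idn FunVect Y) w')) (uu Y W A H x y h)"
      unfolding lin_add_app[OF l(1) u_closed[OF S O(1) a]] u_ap[OF S w(1) a] u_ap[OF S w(2) a] u_ap[OF S lin_add_L[OF w] a]
        lin_add_comp[OF a(5) w]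
      by (rule trilinD(3)[OF u_trilin[OF S O(2) a(1,2)] L_comp[OF w(1) a(5)] a(3,4) L_comp[OF w(2) a(5)]])
  qed
  then show "fn (tens_ar X (Idn FunVect Y) (lin_add w w')) z =
      add (tens_ob X Y W') (fn (tens_ar X (Idn FunVect Y) w) z) (fn (tens_ar X (Idn FunVect Y) w') z)"
    unfolding lin_add_app[OF l(1) z] .
next
  fix Y W W' w c z assume S: "Y : Ob Ind" and w: "w : L W W'" and c: "c : carrier K" and z: "z : carrier (tens_ob X Y W)"
  note i = NT_id(1)[OF Ind_lf[OF S]] and O = L_Ob[OF w]
  note l = u_map(1)[OF S S i w]
  have "fn (tens_ar X (Idn FunVect Y) (lin_smult c w)) z = fn (lin_smult c (tens_ar X (Idn FunVect Y) w)) z"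
  proof (rule u_eqI[OF S O(1) u_map(1)[OF S S i lin_smult_L[OF w c]] lin_smult_L[OF l c] z])
    fix A H x y h assume a: "A : Obj" "H : Obj" "x : el X A" "y : el Y H" "h : L (tens A H) W"
    show "fn (tens_ar X (Idn FunVect Y) (lin_smult c w)) (uu Y W A H x y h) =
      fn (lin_smult c (tens_ar X (Idn FunVect Y) w)) (uu Y W A H x y h)"
      unfolding lin_smult_app[OF l u_closed[OF S O(1) a]] u_ap[OF S w a] u_ap[OF S lin_smult_L[OF w c] a] lin_smult_comp[OF a(5) w c]
      by (rule trilinD(4)[OF u_trilin[OF S O(2) a(1,2)] L_comp[OF w a(5)] a(3,4) c])
  qed
  then show "fn (tens_ar X (Idn FunVect Y) (lin_smult c w)) z = smult (tens_ob X Y W') c (fn (tens_ar X (Idn FunVect Y) w) z)"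
    unfolding lin_smult_app[OF l z] .
qed

section \<open>Generators of the tensor product\<close>

abbreviation "TX Y \<equiv> vfun_of (tens_ob X) (tens_ar X) Y"
text \<open>The generic elements. By \<open>u_cc\<close> every \<open>uu\<close> is the image of one
  of them, so a morphism out of the tensor product is determined by its values here.\<close>

abbreviation "cc Y A B x y \<equiv> uu Y (tens A B) A B x y (idV (tens A B))"

lemma cc_closed: "Y : Ob Ind ==> A : Obj ==> B : Obj ==> x : el X A ==> y : el Y B ==>
    cc Y A B x y : el (TX Y) (tens A B)"
  using u_closed[of Y "tens A B" A B x y] idV_L[OF tens_Obj, of A B] tens_Obj by simp

lemma u_cc:
  assumes S: "Y : Ob Ind" and a: "A : Obj" "B : Obj" "x : el X A" "y : el Y B" and f: "f : L (tens A B) W"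
  shows "uu Y W A B x y f = ap (TX Y) f (cc Y A B x y)"
  using u_ap[OF S f a idV_L[OF tens_Obj[OF a(1,2)]]] comp_id(2)[OF f] by simp

text \<open>For \<open>x = X(\<phi>) x0\<close> and \<open>y = Y(\<psi>) y0\<close>, dinaturality in
  both variables moves \<open>\<phi>\<close> and \<open>\<psi>\<close> into \<open>h\<close>,
  leaving an image of the generic element of \<open>x0\<close> and \<open>y0\<close>. Linearity in
  \<open>x\<close> and \<open>y\<close> reduces to this case.\<close>

lemma TX_gens:
  assumes S: "Y : Ob Ind" and g: "gens Y V1"
  shows "gens (TX Y) (tens V0 V1)"
  unfolding gens_def
proof (intro conjI ballI)
  have V1: "V1 : Obj" using g by (simp add: gens_def)
  show "tens V0 V1 : Obj" by (rule tens_Obj[OF V0 V1])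
  fix W assume W: "W : Obj"
  show "spans (Fo (TX Y) W) (gset (TX Y) (tens V0 V1) W)" unfolding spans_def
  proof (intro allI impI)
    fix M assume M: "subsp M (Fo (TX Y) W) & gset (TX Y) (tens V0 V1) W <= M"
    let ?T = "tens_ob X Y W"
    have M1: "M <= carrier ?T" "zero ?T : M" "!!x y. x : M ==> y : M ==> add ?T x y : M"
      "!!c x. c : carrier K ==> x : M ==> smult ?T c x : M" using M by (simp_all add: subsp_def)
    have "z : M" if "z : carrier ?T" for z
      using S W that
    proof (rule u_induct)
      fix A H x y h assume A: "A : Obj" and H: "H : Obj" and x: "x : el X A" and y: "y : el Y H" and h: "h : L (tens A H) W"
      note t = trilinD[OF u_trilin[OF S W A H] h] and TO = tens_ob_Obj[OF S W]
      show "uu Y W A H x y h : M"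
      proof (rule gens_induct[OF gX X A x])
        fix \<phi> x0 assume \<phi>: "\<phi> : L V0 A" and x0: "x0 : el X V0"
        show "uu Y W A H (ap X \<phi> x0) y h : M"
        proof (rule gens_induct[OF g Ind_lf[OF S] H y])
          fix \<psi> y0 assume \<psi>: "\<psi> : L V1 H" and y0: "y0 : el Y V1"
          note k = L_comp[OF h tens_map_L[OF \<phi> idV_L[OF H]]] and y1 = ap_closed[OF Ind_lf[OF S] \<psi> y0]
          note k' = L_comp[OF k tens_map_L[OF idV_L[OF V0] \<psi>]]
          have "uu Y W A H (ap X \<phi> x0) (ap Y \<psi> y0) h =
            ap (TX Y) ((h oo tens_map \<phi> (idV H)) oo tens_map (idV V0) \<psi>) (cc Y V0 V1 x0 y0)"
            unfolding u_din2[OF S W \<phi> H x0 y1 h, symmetric] u_din1[OF S W V0 \<psi> x0 y0 k, symmetric]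
            by (rule u_cc[OF S V0 V1 x0 y0 k'])
          then have "uu Y W A H (ap X \<phi> x0) (ap Y \<psi> y0) h : gset (TX Y) (tens V0 V1) W"
            unfolding gset_def using k' cc_closed[OF S V0 V1 x0 y0] by blast
          then show "uu Y W A H (ap X \<phi> x0) (ap Y \<psi> y0) h : M" using M by blast
        qed (simp_all add: is_linear_zero[OF lf_Ob[OF Ind_lf[OF S] H] TO t(2)[OF ap_closed[OF X \<phi> x0] y]]
            is_linearD(2,3)[OF t(2)[OF ap_closed[OF X \<phi> x0] y]] M1)
      qed (simp_all add: is_linear_zero[OF lf_Ob[OF X A] TO t(1)[OF y x]] is_linearD(2,3)[OF t(1)[OF y x]] M1)
    qed (use M1 in auto)
    then show "M = el (TX Y) W" using M1(1) by auto
  qed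
qed

lemma TX_Ob: "Y : Ob Ind ==> TX Y : Ob Ind"
  unfolding Ob_Ind[of "TX Y"] using U.vfun_of_lf TX_gens Ind_gens by blast

lemma tens_left_functor: "is_functor Ind Ind (tens_left X)"
  unfolding tens_left_def by (rule U.curried_functor[OF _ TX_Ob])

subsection \<open>The adjunction\<close>

text \<open>The correspondence as a relation. Each side determines the other on generic elements or
  coordinates, so uniqueness and naturality are checked without an explicit inverse.\<close>

definition adjoint :: "('k, 'u) vfun => ('k, 'u) vfun => ('k, 'u) vnat => ('k, 'u) vnat => bool" where
  "adjoint Y Z s t \<longleftrightarrow> (ALL A:Obj. ALL B:Obj. ALL x:el X A. ALL y:el Y B.
     nt s (tens A B) (cc Y A B x y) = rr Z B (nt t B y) (A, x))"

lemma adjointD: "adjoint Y Z s t ==> A : Obj ==> B : Obj ==> x : el X A ==> y : el Y B ==>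
     nt s (tens A B) (cc Y A B x y) = rr Z B (nt t B y) (A, x)"
  unfolding adjoint_def by blast

abbreviation "RX Z \<equiv> vfun_of Rob Rar Z"

context
  fixes Y Z assumes S: "Y : Ob Ind" and Z: "lf Z"
begin

lemma nt_u:
  assumes s: "s : NT (TX Y) Z" and a: "A : Obj" "B : Obj" "x : el X A" "y : el Y B" and f: "f : L (tens A B) W"
  shows "nt s W (uu Y W A B x y f) = ap Z f (nt s (tens A B) (cc Y A B x y))"
  unfolding u_cc[OF S a f] by (rule nt_nat[OF s f cc_closed[OF S a]])

lemma adjoint_unique1:
  assumes s: "s : NT (TX Y) Z" "s' : NT (TX Y) Z" and a: "adjoint Y Z s t" "adjoint Y Z s' t"
  shows "s = s'"
proof (rule NT_eqI[OF s])
  fix W z assume W: "W : Obj" and "z : el (TX Y) W"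
  then have z: "z : carrier (tens_ob X Y W)" by simp
  show "nt s W z = nt s' W z"
  proof (rule u_eqI[OF S W NT_L[OF s(1) W, unfolded U.vfun_of_simps] NT_L[OF s(2) W, unfolded U.vfun_of_simps] z])
    fix A H x y h assume c: "A : Obj" "H : Obj" "x : el X A" "y : el Y H" and h: "h : L (tens A H) W"
    show "nt s W (uu Y W A H x y h) = nt s' W (uu Y W A H x y h)"
      unfolding nt_u[OF s(1) c h] nt_u[OF s(2) c h] adjointD[OF a(1) c] adjointD[OF a(2) c] ..
  qed
qed

lemma adjoint_unique2:
  assumes t: "t : NT Y (RX Z)" "t' : NT Y (RX Z)" and a: "adjoint Y Z s t" "adjoint Y Z s t'"
  shows "t = t'"
proof (rule NT_eqI[OF t])
  fix B y assume B: "B : Obj" and y: "y : el Y B"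
  note c = nt_closed[OF t(1) B y, unfolded R.vfun_of_simps] nt_closed[OF t(2) B y, unfolded R.vfun_of_simps]
  show "nt t B y = nt t' B y"
    by (rule rr_eqI[OF Z B c]) (simp add: adjointD[OF a(1) _ B _ y, symmetric] adjointD[OF a(2) _ B _ y, symmetric])
qed

text \<open>For fixed \<open>y\<close> the values of \<open>s\<close> on generic elements are
  natural in \<open>A\<close> by \<open>u_din2\<close>, hence are the coordinates of a vector of the
  internal hom. Its naturality in \<open>B\<close> is \<open>u_din1\<close>.\<close>

lemma adjoint_ex1:
  assumes s: "s : NT (TX Y) Z"
  shows "EX t:NT Y (RX Z). adjoint Y Z s t"
proof -
  let ?g = "%B y A x. nt s (tens A B) (cc Y A B x y)"
  have fam: "mkfam X (?g B y) : fam X (sh Z B)" if B: "B : Obj" and y: "y : el Y B" for B y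
  proof (rule mkfam_fam[OF X])
    show "?g B y A x : el (sh Z B) A" if "A : Obj" "x : el X A" for A x
      unfolding sh_simps by (rule nt_closed[OF s tens_Obj[OF that(1) B] cc_closed[OF S that(1) B that(2) y]])
    fix f A A' x assume f: "f : L A A'" and x: "x : el X A"
    note A = L_Ob[OF f] and fB = tens_map_L[OF f idV_L[OF B]]
    show "?g B y A' (ap X f x) = ap (sh Z B) f (?g B y A x)"
      unfolding sh_simps nt_u[OF s A(1) B x y fB, symmetric]
        u_din2[OF S tens_Obj[OF A(2) B] f B x y idV_L[OF tens_Obj[OF A(2) B]], symmetric] comp_id(1)[OF fB] ..
  qed
  define r where "r B y = (SOME n. n : carrier (Rob Z B) & rr Z B n = mkfam X (?g B y))" for B y
  have r: "r B y : carrier (Rob Z B) & rr Z B (r B y) = mkfam X (?g B y)" if "B : Obj" "y : el Y B" for B y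
    unfolding r_def by (rule someI_ex) (use representsD(6)[OF Rob_frep[OF Z that(1)] fam[OF that]] in blast)
  have r1: "r B y : carrier (Rob Z B)" and r2: "rr Z B (r B y) = mkfam X (?g B y)"
    if "B : Obj" "y : el Y B" for B y using r[OF that] by blast+
  have t: "mkN Y (RX Z) r : NT Y (RX Z)"
  proof (rule mkN_NT[OF Ind_lf[OF S] R.vfun_of_lf[OF Z]])
    show "r B y : el (RX Z) B" if "B : Obj" "y : el Y B" for B y using r1[OF that] by simp
    fix b B B' y assume b: "b : L B B'" and y: "y : el Y B"
    note B = L_Ob[OF b] and by' = ap_closed[OF Ind_lf[OF S] b y]
    note m = L_app[OF Rar_L(1)[OF NT_id(1)[OF Z] b] r1[OF B(1) y]]
    show "r B' (ap Y b y) = ap (RX Z) b (r B y)" unfolding R.vfun_of_simps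
    proof (rule rr_eqI[OF Z B(2) r1[OF B(2) by'] m])
      fix A x assume A: "A : Obj" and x: "x : el X A"
      note Ab = tens_map_L[OF idV_L[OF A] b]
      show "rr Z B' (r B' (ap Y b y)) (A, x) = rr Z B' (fn (Rar (Idn FunVect Z) b) (r B y)) (A, x)"
        unfolding rr_Rar_id[OF Z b r1[OF B(1) y] A x] r2[OF B(2) by'] r2[OF B(1) y] mkfam_app[OF A x]
          nt_u[OF s A B(1) x y Ab, symmetric]
          u_din1[OF S tens_Obj[OF A B(2)] A b x y idV_L[OF tens_Obj[OF A B(2)]], symmetric] comp_id(1)[OF Ab] ..
    qed
  qed
  have "adjoint Y Z s (mkN Y (RX Z) r)" unfolding adjoint_def by (simp add: r2)
  with t show ?thesis by blast
qed

lemma adjoint_ex2: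
  assumes t: "t : NT Y (RX Z)"
  shows "EX s:NT (TX Y) Z. adjoint Y Z s t"
proof -
  \<comment> \<open>The only possible formula, by \<open>u_cc\<close> and naturality of
    \<open>s\<close>. It is dinatural in \<open>A\<close> because coordinates are natural families,
    and in \<open>H\<close> because \<open>t\<close> is natural.\<close>
  let ?k = "%A H x y h. ap Z h (rr Z H (nt t H y) (A, x))"
  have tc: "nt t H y : carrier (Rob Z H)" if "H : Obj" "y : el Y H" for H y
    using nt_closed[OF t that] by simp
  have "ALL W:Obj. EX l. l : L (tens_ob X Y W) (Fo Z W) & (ALL A:Obj. ALL H:Obj. ALL x:el X A. ALL y:el Y H. ALL h:L (tens A H) W.
    fn l (uu Y W A H x y h) = ?k A H x y h)"
  proof
    fix W assume W: "W : Obj"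
    show "EX l. l : L (tens_ob X Y W) (Fo Z W) & (ALL A:Obj. ALL H:Obj. ALL x:el X A. ALL y:el Y H. ALL h:L (tens A H) W.
      fn l (uu Y W A H x y h) = ?k A H x y h)"
      unfolding Bex_def[symmetric]
    proof (rule u_lift[where k = ?k, OF S W lf_Ob[OF Z W]])
      fix A H assume A: "A : Obj" and H: "H : Obj"
      show "trilin (Fo X A) (Fo Y H) (tens A H) W (Fo Z W) (?k A H)" unfolding trilin_def
      proof (intro ballI conjI)
        fix x y h assume x: "x : el X A" and y: "y : el Y H" and h: "h : L (tens A H) W"
        note c = rr_closed[OF Z H tc[OF H] A]
        note l = fam_linear[OF X lf_sh[OF Z H] rr_fam[OF Z H tc[OF H y]] A, unfolded sh_simps]
        note tl = NT_L[OF t H, unfolded R.vfun_of_simps]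
        show "is_linear K (Fo X A) (Fo Z W) (%x. ?k A H x y h)"
          by (rule is_linearI) (simp_all add: is_linearD(2,3)[OF l] ap_add[OF Z h] ap_smult[OF Z h] ap_closed[OF Z h] c y)
        show "is_linear K (Fo Y H) (Fo Z W) (%y. ?k A H x y h)"
          by (rule is_linearI) (simp_all add: L_add[OF tl] L_smult[OF tl] is_linearD(2,3)[OF rr_linear[OF Z H A x]] tc[OF H]
            ap_add[OF Z h] ap_smult[OF Z h] ap_closed[OF Z h] c x)
        show "?k A H x y (lin_add h h') = add (Fo Z W) (?k A H x y h) (?k A H x y h')" if "h' : L (tens A H) W" for h'
          by (rule ap_lin_add[OF Z h that c[OF y x]])
        show "?k A H x y (lin_smult b h) = smult (Fo Z W) b (?k A H x y h)" if "b : carrier K" for b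
          by (rule ap_lin_smult[OF Z h that c[OF y x]])
      qed
    next
      fix A f H H' x y h
      assume A: "A : Obj" and f: "f : L H H'" and x: "x : el X A" and y: "y : el Y H" and h: "h : L (tens A H') W"
      note H = L_Ob[OF f]
      show "?k A H x y (h oo tens_map (idV A) f) = ?k A H' x (ap Y f y) h"
        unfolding nt_nat[OF t f y] R.vfun_of_simps rr_Rar_id[OF Z f tc[OF H(1) y] A x]
        by (rule ap_comp[OF Z h tens_map_L[OF idV_L[OF A] f] rr_closed[OF Z H(1) tc[OF H(1) y] A x]])
    next
      fix H f A A' x y h
      assume H: "H : Obj" and f: "f : L A A'" and x: "x : el X A" and y: "y : el Y H" and h: "h : L (tens A' H) W"
      show "?k A H x y (h oo tens_map f (idV H)) = ?k A' H (ap X f x) y h"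
        unfolding fam_nat[OF rr_fam[OF Z H tc[OF H y]] f x] sh_simps
        by (rule ap_comp[OF Z h tens_map_L[OF f idV_L[OF H]] rr_closed[OF Z H tc[OF H y] L_Ob(1)[OF f] x]])
    qed
  qed
  then obtain l where l0: "ALL W:Obj. l W : L (tens_ob X Y W) (Fo Z W) & (ALL A:Obj. ALL H:Obj. ALL x:el X A. ALL y:el Y H. ALL h:L (tens A H) W.
    fn (l W) (uu Y W A H x y h) = ?k A H x y h)" by (rule exE[OF bchoice])
  have l: "l W : L (tens_ob X Y W) (Fo Z W)" if "W : Obj" for W using bspec[OF l0 that] by blast
  have lu: "fn (l W) (uu Y W A H x y h) = ?k A H x y h"
    if "A : Obj" "H : Obj" "x : el X A" "y : el Y H" "h : L (tens A H) W" for W A H x y h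
    using bspec[OF l0 L_Ob(2)[OF that(5)]] that by blast
  let ?s = "mkN (TX Y) Z (%W. fn (l W))"
  have "?s : NT (TX Y) Z"
  proof (rule mkN_NT[OF U.vfun_of_lf[OF S] Z])
    show "fn (l W) z : el Z W" if "W : Obj" "z : el (TX Y) W" for W z
      using L_app[OF l[OF that(1)]] that(2) by simp
    fix f V W z assume f: "f : L V W" and z: "z : el (TX Y) V"
    note O = L_Ob[OF f] and z = z[unfolded U.vfun_of_simps]
    note a = u_map(1)[OF S S NT_id(1)[OF Ind_lf[OF S]] f] and b = lf_L[OF Z f]
    have "fn (l W oo tens_ar X (Idn FunVect Y) f) z = fn (Fa Z f oo l V) z"
    proof (rule u_eqI[OF S O(1) L_comp[OF l[OF O(2)] a] L_comp[OF b l[OF O(1)]] z])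
      fix A H x y h assume c: "A : Obj" "H : Obj" "x : el X A" "y : el Y H" and h: "h : L (tens A H) V"
      note u = u_closed[OF S O(1) c h]
      show "fn (l W oo tens_ar X (Idn FunVect Y) f) (uu Y V A H x y h) = fn (Fa Z f oo l V) (uu Y V A H x y h)"
        unfolding comp_app'[OF a u] comp_app'[OF l[OF O(1)] u] u_ap[OF S f c h] lu[OF c h] lu[OF c L_comp[OF f h]]
        by (rule ap_comp[OF Z f h rr_closed[OF Z c(2) tc[OF c(2,4)] c(1,3)]])
    qed
    then show "fn (l W) (ap (TX Y) f z) = ap Z f (fn (l V) z)"
      unfolding comp_app'[OF a z] comp_app'[OF l[OF O(1)] z] by simp
  qed
  moreover have "adjoint Y Z ?s t" unfolding adjoint_def
  proof (intro ballI)
    fix A B x y assume c: "A : Obj" "B : Obj" "x : el X A" "y : el Y B"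
    note T = tens_Obj[OF c(1,2)]
    show "nt ?s (tens A B) (cc Y A B x y) = rr Z B (nt t B y) (A, x)"
      unfolding nt_mkN[OF T cc_closed[OF S c]] lu[OF c idV_L[OF T]]
      by (rule ap_id[OF Z T rr_closed[OF Z c(2) tc[OF c(2,4)] c(1,3)]])
  qed
  ultimately show ?thesis by blast
qed

end


definition transpose :: "('k, 'u) vfun => ('k, 'u) vfun => ('k, 'u) vnat => ('k, 'u) vnat" where
  "transpose Y Z s = (SOME t. t : NT Y (RX Z) & adjoint Y Z s t)"

context
  fixes Y Z assumes S: "Y : Ob Ind" and Z: "lf Z"
begin

lemma transpose:
  assumes "s : NT (TX Y) Z"
  shows "transpose Y Z s : NT Y (RX Z)" "adjoint Y Z s (transpose Y Z s)"
proof -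
  have "transpose Y Z s : NT Y (RX Z) & adjoint Y Z s (transpose Y Z s)"
    unfolding transpose_def by (rule someI_ex) (use adjoint_ex1[OF S Z assms] in blast)
  then show "transpose Y Z s : NT Y (RX Z)" "adjoint Y Z s (transpose Y Z s)" by blast+
qed

lemma transpose_eq: "s : NT (TX Y) Z ==> t : NT Y (RX Z) ==> adjoint Y Z s t ==> transpose Y Z s = t"
  by (rule adjoint_unique2[OF S Z transpose(1) _ transpose(2)])

lemma transpose_bij: "bij_betw (transpose Y Z) (NT (TX Y) Z) (NT Y (RX Z))"
proof (rule bij_betwI')
  fix s s' assume s: "s : NT (TX Y) Z" and s': "s' : NT (TX Y) Z"
  show "transpose Y Z s = transpose Y Z s' \<longleftrightarrow> s = s'"
    using adjoint_unique1[OF S Z s s' transpose(2)[OF s]] transpose(2)[OF s'] by auto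
next
  show "transpose Y Z s : NT Y (RX Z)" if "s : NT (TX Y) Z" for s by (rule transpose(1)[OF that])
  fix t assume t: "t : NT Y (RX Z)"
  obtain s where s: "s : NT (TX Y) Z" "adjoint Y Z s t" using adjoint_ex2[OF S Z t] by blast
  then show "EX s:NT (TX Y) Z. t = transpose Y Z s" using transpose_eq[OF s(1) t s(2)] by blast
qed

end

lemma adjoint_natural:
  assumes S: "Y : Ob Ind" "Y' : Ob Ind" and Z: "lf Z" "lf Z'" and f: "f : NT Y' Y" and g: "g : NT Z Z'"
    and s: "s : NT (TX Y) Z" and t: "t : NT Y (RX Z)" and a: "adjoint Y Z s t"
  shows "adjoint Y' Z' (Cmp FunVect g (Cmp FunVect s (Fa (tens_left X) f))) (Cmp FunVect (Fa HomX g) (Cmp FunVect t f))"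
  unfolding adjoint_def
proof (intro ballI)
  fix A B x y assume A: "A : Obj" and B: "B : Obj" and x: "x : el X A" and y: "y : el Y' B"
  note AB = tens_Obj[OF A B]
  note Tf = U.curried_NT[OF S(2,1) f, folded tens_left_def] and Rg = R.curried_NT[OF Z g, folded HomX_def]
  note fy = nt_closed[OF f B y] and c = cc_closed[OF S(2) A B x y] and i = idV_L[OF AB] and iB = idV_L[OF B]
  note n = nt_closed[OF t B fy, unfolded R.vfun_of_simps]
  note z = rr_closed[OF Z(1) B n A x]
  have "nt (Fa (tens_left X) f) (tens A B) (cc Y' A B x y) = cc Y A B x (nt f B y)"
    unfolding tens_left_def U.nt_curried[OF AB] using u_map(2)[OF S(2,1) f i A B x y i] comp_id(1)[OF i] by simp
  then have "nt (Cmp FunVect g (Cmp FunVect s (Fa (tens_left X) f))) (tens A B) (cc Y' A B x y) =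
      nt g (tens A B) (rr Z B (nt t B (nt f B y)) (A, x))"
    unfolding NT_comp(2)[OF g NT_comp(1)[OF s Tf] AB c] NT_comp(2)[OF s Tf AB c] using adjointD[OF a A B x fy] by simp
  also have "\<dots> = rr Z' B (nt (Fa HomX g) B (nt t B (nt f B y))) (A, x)"
    unfolding HomX_def R.nt_curried[OF B] Rar_L(2)[OF g iB n A x] twist_L(2)[OF g iB A z] tens_map_id[OF A B] ap_id[OF Z(1) AB z] ..
  finally show "nt (Cmp FunVect g (Cmp FunVect s (Fa (tens_left X) f))) (tens A B) (cc Y' A B x y) =
      rr Z' B (nt (Cmp FunVect (Fa HomX g) (Cmp FunVect t f)) B y) (A, x)"
    unfolding NT_comp(2)[OF Rg NT_comp(1)[OF t f] B y] NT_comp(2)[OF t f B y] .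
qed

lemma tens_hom_adjunction: "is_adjunction Ind Ind (tens_left X) HomX"
  unfolding is_adjunction_def
proof (intro conjI tens_left_functor HomX_functor exI[of _ transpose] ballI)
  have L: "Fo (tens_left X) Y = TX Y" and R: "Fo HomX Y = RX Y" for Y
    by (simp_all add: tens_left_def HomX_def U.curried_simps R.curried_simps)
  show "bij_betw (transpose Y Z) (Mor Ind (Fo (tens_left X) Y) Z) (Mor Ind Y (Fo HomX Z))" if Y: "Y : Ob Ind" and Z: "Z : Ob Ind" for Y Z
    unfolding L R Mor_Ind[OF TX_Ob[OF Y] Z] Mor_Ind[OF Y HomX_Ob[OF Z]] by (rule transpose_bij[OF Y Ind_lf[OF Z]])
  fix f g h assume "f : Ar Ind" "g : Ar Ind" and h: "h : Mor Ind (Fo (tens_left X) (Cod Ind f)) (Dom Ind g)"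
  then have f: "src f : Ob Ind" "tgt f : Ob Ind" "f : NT (src f) (tgt f)" and g: "src g : Ob Ind" "tgt g : Ob Ind" "g : NT (src g) (tgt g)"
    unfolding Ar_Ind by blast+
  have h: "h : NT (TX (tgt f)) (src g)" using h Mor_Ind[OF TX_Ob[OF f(2)] g(1)] by (simp add: L)
  note Z = Ind_lf[OF g(1)] Ind_lf[OF g(2)]
  note t = transpose[OF f(2) Z(1) h]
  have "transpose (src f) (tgt g) (Cmp FunVect g (Cmp FunVect h (Fa (tens_left X) f))) =
    Cmp FunVect (Fa HomX g) (Cmp FunVect (transpose (tgt f) (src g) h) f)"
  proof (rule transpose_eq[OF f(1) Z(2)])
    show "Cmp FunVect g (Cmp FunVect h (Fa (tens_left X) f)) : NT (TX (src f)) (tgt g)"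
      by (rule NT_comp(1)[OF g(3) NT_comp(1)[OF h U.curried_NT[OF f(1,2,3), folded tens_left_def]]])
    show "Cmp FunVect (Fa HomX g) (Cmp FunVect (transpose (tgt f) (src g) h) f) : NT (src f) (RX (tgt g))"
      by (rule NT_comp(1)[OF R.curried_NT[OF Z g(3), folded HomX_def] NT_comp(1)[OF t(1) f(3)]])
  qed (rule adjoint_natural[OF f(2,1) Z f(3) g(3) h t])
  then show "transpose (Dom Ind f) (Cod Ind g) (Cmp Ind g (Cmp Ind h (Fa (tens_left X) f))) =
    Cmp Ind (Fa HomX g) (Cmp Ind (transpose (Cod Ind f) (Dom Ind g) h) f)" by simp
qed

subsection \<open>Morphisms out of \<open>X \<otimes> yo V\<close>\<close>

text \<open>A representable is strongly generated by its identity element.\<close>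

lemma yo_Ind: assumes V: "V : Obj" shows "yo V : Ob Ind"
proof -
  have "a : gset (yo V) V W" if W: "W : Obj" and "a : carrier (hom_sp V W)" for W a
  proof -
    obtain h where h: "h : L V W" "a = graph h" using hom_cases[OF \<open>a \<in> carrier (hom_sp V W)\<close>] by blast
    then have "a = ap (yo V) h (graph (idV V))" using ap_yo[OF h(1) idV_L[OF V]] comp_id(2)[OF h(1)] by simp
    then show ?thesis unfolding gset_def using h(1) graph_in[OF idV_L[OF V]] by auto
  qed
  then have "sgen (yo V) V" unfolding sgen_def using V by auto
  then show ?thesis unfolding Ob_Ind using lf_yo[OF V] sgen_gens by blast
qed

abbreviation "gid V \<equiv> graph (idV V)"

lemma gid: "V : Obj ==> gid V : el (yo V) V" using graph_in[OF idV_L] by simp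

text \<open>The image under the adjunction and the Yoneda lemma, made explicit: evaluate at the
  generic element formed from \<open>x\<close> and the identity of \<open>V\<close>.\<close>

definition \<iota>x :: "('k, 'u) vfun => ('k, 'u) module => ('k, 'u) vnat => ('k, 'u) module \<times> 'u => 'u" where
  "\<iota>x Y V s = mkfam X (%A x. nt s (tens A V) (cc (yo V) A V x (gid V)))"

lemma \<iota>x_transpose:
  assumes Y: "lf Y" and V: "V : Obj" and s: "s : NT (TX (yo V)) Y"
  shows "\<iota>x Y V s = rr Y V (yev V (transpose (yo V) Y s))" "yev V (transpose (yo V) Y s) : carrier (Rob Y V)"
proof -
  note t = transpose[OF yo_Ind[OF V] Y s]
  show n: "yev V (transpose (yo V) Y s) : carrier (Rob Y V)" using yev_closed[OF t(1) V] by simp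
  note f = rr_fam[OF Y V n]
  show "\<iota>x Y V s = rr Y V (yev V (transpose (yo V) Y s))"
  proof
    fix j show "\<iota>x Y V s j = rr Y V (yev V (transpose (yo V) Y s)) j"
    proof (cases "j : idx X")
      case True
      then obtain A x where j: "j = (A, x)" and A: "A : Obj" and x: "x : el X A" by (rule idxE)
      show ?thesis unfolding j \<iota>x_def mkfam_app[OF A x] yev_def by (rule adjointD[OF t(2) A V x gid[OF V]])
    next
      case False
      have "rr Y V (yev V (transpose (yo V) Y s)) : PiE (idx X) (%j. el (sh Y V) (fst j))"
        using f unfolding fam_def by simp
      from PiE_arb[OF this False] show ?thesis using False by (simp add: \<iota>x_def mkfam_def)
    qed
  qed
qed

text \<open>A composite of three bijections: transposition, the Yoneda lemma for the internal hom,
  and its coordinates.\<close>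

lemma \<iota>x_bij:
  assumes Y: "lf Y" and V: "V : Obj"
  shows "bij_betw (\<iota>x Y V) (NT (TX (yo V)) Y) (fam X (sh Y V))"
proof -
  note R = R.vfun_of_lf[OF Y]
  have "bij_betw (yev V) (NT (yo V) (RX Y)) (carrier (Rob Y V))"
  proof (rule bij_betw_byWitness[of _ "yoN (RX Y) V"])
    show "ALL t:NT (yo V) (RX Y). yoN (RX Y) V (yev V t) = t" using yoN_yev V by blast
    show "ALL x:carrier (Rob Y V). yev V (yoN (RX Y) V x) = x" using yev_yoN[OF R V] by simp
    show "yev V ` NT (yo V) (RX Y) <= carrier (Rob Y V)" using yev_closed[OF _ V] by fastforce
    show "yoN (RX Y) V ` carrier (Rob Y V) <= NT (yo V) (RX Y)" using yoN_NT[OF R V] by auto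
  qed
  moreover have "bij_betw (rr Y V) (carrier (Rob Y V)) (fam X (sh Y V))"
    using Rob_frep[OF Y V] unfolding represents_def by blast
  ultimately have "bij_betw (rr Y V \<circ> (yev V \<circ> transpose (yo V) Y)) (NT (TX (yo V)) Y) (fam X (sh Y V))"
    by (intro bij_betw_trans[OF bij_betw_trans[OF transpose_bij[OF yo_Ind[OF V] Y]]])
  then show ?thesis by (rule bij_betw_cong[THEN iffD1, rotated]) (simp add: \<iota>x_transpose[OF Y V])
qed

lemma nat_sp_ops:
  assumes F: "F : Ob Ind" and G: "G : Ob Ind" and s: "s : NT F G"
  shows "t : NT F G ==> add (nat_sp F G) s t : NT F G"
    and "H : Obj ==> z : el F H ==> nt (add (nat_sp F G) s t) H z = add (Fo G H) (nt s H z) (nt t H z)"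
    and "c : carrier K ==> smult (nat_sp F G) c s : NT F G"
    and "H : Obj ==> z : el F H ==> nt (smult (nat_sp F G) c s) H z = smult (Fo G H) c (nt s H z)"
proof -
  have nat: "fn t W oo Fa F f = Fa G f oo fn t V" if "t : NT F G" "f : L V W" for t f V W
    using that(1) L_Ar[OF that(2)] L_src[OF that(2)] unfolding NT_iff by auto
  note l = Ind_lf[OF F] Ind_lf[OF G]
  show "add (nat_sp F G) s t : NT F G" if t: "t : NT F G"
    unfolding NT_iff
  proof (intro conjI l ballI)
    show "fn (add (nat_sp F G) s t) H : L (Fo F H) (Fo G H)" if "H : Obj" for H
      using lin_add_L[OF NT_L[OF s that] NT_L[OF t that]] that by (simp add: nat_sp_def)
    fix f assume "f : Ar Vect"
    then obtain V W where f: "f : L V W" by (auto simp: Ar_L)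
    note O = L_Ob[OF f]
    have "lin_add (fn s W) (fn t W) oo Fa F f = Fa G f oo lin_add (fn s V) (fn t V)"
      unfolding lin_add_comp[OF lf_L[OF l(1) f] NT_L[OF s O(2)] NT_L[OF t O(2)]]
        comp_lin_add[OF lf_L[OF l(2) f] NT_L[OF s O(1)] NT_L[OF t O(1)]] nat[OF s f] nat[OF t f] ..
    then show "fn (add (nat_sp F G) s t) (tgt f) oo Fa F f = Fa G f oo fn (add (nat_sp F G) s t) (src f)"
      using O L_src[OF f] by (simp add: nat_sp_def)
  qed (simp_all add: nat_sp_def)
  show "smult (nat_sp F G) c s : NT F G" if c: "c : carrier K"
    unfolding NT_iff
  proof (intro conjI l ballI)
    show "fn (smult (nat_sp F G) c s) H : L (Fo F H) (Fo G H)" if "H : Obj" for H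
      using lin_smult_L[OF NT_L[OF s that] c] that by (simp add: nat_sp_def)
    fix f assume "f : Ar Vect"
    then obtain V W where f: "f : L V W" by (auto simp: Ar_L)
    note O = L_Ob[OF f]
    have "lin_smult c (fn s W) oo Fa F f = Fa G f oo lin_smult c (fn s V)"
      unfolding lin_smult_comp[OF lf_L[OF l(1) f] NT_L[OF s O(2)] c] comp_lin_smult[OF lf_L[OF l(2) f] NT_L[OF s O(1)] c] nat[OF s f] ..
    then show "fn (smult (nat_sp F G) c s) (tgt f) oo Fa F f = Fa G f oo fn (smult (nat_sp F G) c s) (src f)"
      using O L_src[OF f] by (simp add: nat_sp_def)
  qed (simp_all add: nat_sp_def)
  show "nt (add (nat_sp F G) s t) H z = add (Fo G H) (nt s H z) (nt t H z)" if "H : Obj" "z : el F H"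
    using lin_add_app[OF NT_L[OF s that(1)] that(2)] that(1) by (simp add: nat_sp_def)
  show "nt (smult (nat_sp F G) c s) H z = smult (Fo G H) c (nt s H z)" if "H : Obj" "z : el F H"
    using lin_smult_app[OF NT_L[OF s that(1)] that(2)] that(1) by (simp add: nat_sp_def)
qed

lemma ind_hom_form_presents: "presents (ind_hom_form X) \<iota>x"
proof (unfold presents_def, intro conjI ballI allI impI)
  have sp: "sp (ind_hom_form X) (Y, V) = nat_sp (TX (yo V)) Y" for Y V
    by (simp add: ind_hom_form_def tens_left_def U.curried_simps)
  have car: "carrier (nat_sp (TX (yo V)) Y) = NT (TX (yo V)) Y" if "Y : Ob Ind" "V : Obj" for Y V
    using Mor_Ind[OF TX_Ob[OF yo_Ind[OF that(2)]] that(1)] by (simp add: nat_sp_def)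
  fix Y V assume S: "Y : Ob Ind" and V: "V : Obj"
  note yV = yo_Ind[OF V]
  note o = nat_sp_ops[OF TX_Ob[OF yV] S]
  note c = cc_closed[OF yV _ V _ gid[OF V]]
  show "coords (sp (ind_hom_form X) (Y, V)) (\<iota>x Y V) (sh Y V)" unfolding coords_def sp car[OF S V]
  proof (intro conjI ballI o \<iota>x_bij[OF Ind_lf[OF S] V])
    fix j assume "j : idx X"
    then obtain A x where j: "j = (A, x)" and A: "A : Obj" and x: "x : el X A" by (rule idxE)
    note AV = tens_Obj[OF A V]
    define z where "z = cc (yo V) A V x (gid V)"
    have ca: "z : el (TX (yo V)) (tens A V)" unfolding z_def by (rule c[OF A x])
    have \<iota>: "\<iota>x Y V s j = nt s (tens A V) z" for s unfolding j \<iota>x_def mkfam_app[OF A x] z_def ..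
    show "is_linear K (nat_sp (TX (yo V)) Y) (Fo (sh Y V) (fst j)) (%s. \<iota>x Y V s j)"
      by (rule is_linearI)
         (simp_all add: \<iota>[unfolded j] j car[OF S V] o(2)[OF _ AV ca] o(4)[OF _ AV ca] nt_closed[OF _ AV ca])
  qed
next
  have sp: "sp (ind_hom_form X) (Y, V) = nat_sp (TX (yo V)) Y" for Y V
    by (simp add: ind_hom_form_def tens_left_def U.curried_simps)
  have car: "carrier (nat_sp (TX (yo V)) Y) = NT (TX (yo V)) Y" if "Y : Ob Ind" "V : Obj" for Y V
    using Mor_Ind[OF TX_Ob[OF yo_Ind[OF that(2)]] that(1)] by (simp add: nat_sp_def)
  fix Y Y' \<eta> V V' v s
  assume S: "Y : Ob Ind" "Y' : Ob Ind" and \<eta>: "\<eta> : NT Y Y'" and v: "v : L V V'"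
    and s: "s : carrier (sp (ind_hom_form X) (Y, V))"
  note O = L_Ob[OF v] and yV = yo_Ind[OF L_Ob(1)[OF v]] and yV' = yo_Ind[OF L_Ob(2)[OF v]]
  have s: "s : NT (TX (yo V)) Y" using s unfolding sp car[OF S(1) O(1)] .
  note f = Yoneda_NT[OF v] and Tf = U.curried_NT[OF yV' yV Yoneda_NT[OF v], folded tens_left_def]
  have act: "act (ind_hom_form X) (\<eta>, v) s = Cmp FunVect \<eta> (Cmp FunVect s (Fa (tens_left X) (Fa Yoneda v)))"
    by (simp add: ind_hom_form_def)
  note sT = NT_comp[OF s Tf]
  note m = NT_comp[OF \<eta> sT(1)]
  show "act (ind_hom_form X) (\<eta>, v) s : carrier (sp (ind_hom_form X) (Y', V'))"
    unfolding act sp car[OF S(2) O(2)] by (rule m(1))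
  fix A x assume A: "A : Obj" and x: "x : el X A"
  note AV = tens_Obj[OF A O(1)] and AV' = tens_Obj[OF A O(2)] and g = gid[OF O(1)] and g' = gid[OF O(2)]
  note i = idV_L[OF AV'] and Av = tens_map_L[OF idV_L[OF A] v] and c' = cc_closed[OF yV' A O(2) x g']
  \<comment> \<open>The Yoneda arrow of \<open>v\<close> takes the identity element of
    \<open>V'\<close> to \<open>v\<close>, which is also the image under \<open>v\<close> of the
    identity element of \<open>V\<close>. Dinaturality then moves \<open>v\<close> into the third
    argument, where it acts as in \<open>twist_map\<close>.\<close>
  have "nt (Fa Yoneda v) V' (gid V') = graph v"
    unfolding Yoneda_yoN[OF v] nt_yoN[OF idV_L[OF O(2)]] ap_yo[OF idV_L[OF O(2)] v] comp_id(1)[OF v] ..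
  also have "\<dots> = ap (yo V) v (gid V)" unfolding ap_yo[OF v idV_L[OF O(1)]] comp_id(2)[OF v] ..
  finally have "nt (Fa (tens_left X) (Fa Yoneda v)) (tens A V') (cc (yo V') A V' x (gid V')) =
    uu (yo V) (tens A V') A V' x (ap (yo V) v (gid V)) (idV (tens A V'))"
    unfolding tens_left_def U.nt_curried[OF AV'] using u_map(2)[OF yV' yV f i A O(2) x g' i] comp_id(1)[OF i] by simp
  also have "\<dots> = uu (yo V) (tens A V') A V x (gid V) (tens_map (idV A) v)"
    unfolding u_din1[OF yV AV' A v x g i, symmetric] comp_id(1)[OF Av] ..
  finally have "nt (act (ind_hom_form X) (\<eta>, v) s) (tens A V') (cc (yo V') A V' x (gid V')) =
    nt \<eta> (tens A V') (ap Y (tens_map (idV A) v) (nt s (tens A V) (cc (yo V) A V x (gid V))))"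
    unfolding act m(2)[OF AV' c'] sT(2)[OF AV' c'] using nt_u[OF yV Ind_lf[OF S(1)] s A O(1) x g Av] by simp
  then show "\<iota>x Y' V' (act (ind_hom_form X) (\<eta>, v) s) (A, x) = fn (twist_map \<eta> v A) (\<iota>x Y V s (A, x))"
    unfolding \<iota>x_def mkfam_app[OF A x]
      twist_L(2)[OF \<eta> v A nt_closed[OF s AV cc_closed[OF yV A O(1) x g]]] .
qed

end

theorem proposition6p9:
  fixes elts :: "'u \<Rightarrow> 'u set" and K :: "'k ring" and X :: "('k, 'u) vfun"
  assumes "grothendieck_universe elts" and "field K"
    and "X \<in> Ob (small_vect.Ind elts K)"
  shows "\<exists>Hom_X.
    is_adjunction (small_vect.Ind elts K) (small_vect.Ind elts K)
      (small_vect.tens_left elts K X) Hom_X \<and>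
    nat_lin_iso K (prod_cat (small_vect.Ind elts K) (small_vect.Vect elts K))
      (small_vect.eval_form elts K Hom_X)
      (small_vect.ind_hom_form elts K X) \<and>
    nat_lin_iso K (prod_cat (small_vect.Ind elts K) (small_vect.Vect elts K))
      (small_vect.ind_hom_form elts K X)
      (small_vect.lim_form elts K X (small_vect.colim_functor elts K)) \<and>
    nat_lin_iso K (prod_cat (small_vect.Ind elts K) (small_vect.Vect elts K))
      (small_vect.lim_form elts K X (small_vect.colim_functor elts K))
      (small_vect.end_form elts K X small_vect.id_functor) \<and>
    nat_lin_iso K (prod_cat (small_vect.Ind elts K) (small_vect.Vect elts K))
      (small_vect.end_form elts K X small_vect.id_functor)
      (small_vect.end_form elts K X (small_vect.coend_functor elts K))"
proof -
  interpret small_vect elts K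
    using assms(1,2) by (simp add: small_vect_def)
  obtain V0 where "lf X" "gens X V0" using assms(3) unfolding Ob_Ind by blast
  then interpret ind_obj elts K X V0 by unfold_locales
  obtain \<theta>\<^sub>1 where "nearid colim_functor \<theta>\<^sub>1" using nearid_colim by blast
  then obtain \<rho>\<^sub>1 where l: "presents (lim_form X colim_functor) \<rho>\<^sub>1" using lim_form_presents by blast
  obtain \<rho>\<^sub>2 where e: "presents (end_form X id_functor) \<rho>\<^sub>2" using end_form_presents[OF nearid_id] by blast
  obtain \<theta>\<^sub>3 where "nearid coend_functor \<theta>\<^sub>3" using nearid_coend by blast
  then obtain \<rho>\<^sub>3 where c: "presents (end_form X coend_functor) \<rho>\<^sub>3" using end_form_presents by blast
  show ?thesis
    by (intro exI[of _ HomX] conjI tens_hom_adjunction presents_iso[OF eval_form_presents ind_hom_form_presents]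
      presents_iso[OF ind_hom_form_presents l] presents_iso[OF l e] presents_iso[OF e c])
qed

end
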